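(* Let $\mathfrak q\in\mathbb C^\times$ with $m=\mathfrak q+\mathfrak q^{-1}\ne0$. Let $M_1,M_2$ be objects of the direct-limit category $\widehat{\mathsf C}_\infty$ with representatives $M_1[N_1],M_1[N_1+2n]$ and $M_2[N_2],M_2[N_2+2k]$, for integers $n$ and $k$. Then the modules $M_1[N_1]\,\widehat\times_f\,M_2[N_2]$ and $M_1[N_1+2n]\,\widehat\times_f\,M_2[N_2+2k]$ over the corresponding affine Temperley–Lieb algebras are in the same equivalence class in the direct limit $\widehat{\mathsf C}_\infty$. If $k=-n$, the two $\mathsf T^a_{N_1+N_2}$-modules are identical in $\widehat{\mathsf C}_{N_1+N_2}$.
   Context: **Affine Temperley–Lieb algebras.** For $N\ge1$, $\mathsf T^a_N=\mathsf T^a_N(m)$ is the $\mathbb C$-algebra spanned by affine diagrams: isotopy classes (boundary points fixed) of non-crossing pairings, drawn in an annulus, of $N$ points on the inner and $N$ on the outer boundary, possibly with non-contractible loops when there are no through-lines. The product $ab$ joins the inner boundary of $a$ to the outer boundary of $b$; contractible loops are replaced by $m$. Generators: $e_j$, $j\in\mathbb Z/N\mathbb Z$ (joining neighbours $j,j+1$ on each boundary, other points going straight; $e_0=e_N$), and the translation $u^{\pm1}$ ($u$ joins outer point $i+1$ to inner point $i$ for all $i$ mod $N$). For $N=1$, $\mathsf T^a_1=\mathbb C[u,u^{-1}]$. $\widehat{\mathsf C}_N$ is the category of finite-dimensional left $\mathsf T^a_N$-modules. **Fusion.** Fix $\mathfrak q^{1/2}$; $g_i^{\pm1}=\pm\mathrm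 i(\mathfrak q^{\pm1/2}\mathbf 1-\mathfrak q^{\mp1/2}e_i)$. With $N=N_1+N_2$, let $\varepsilon_{N_1,N_2}:\mathsf T^a_{N_1}\otimes\mathsf T^a_{N_2}\to\mathsf T^a_N$ be the algebra map sending $e^{(1)}_j\mapsto e_j$ ($1\le j\le N_1-1$), $e^{(2)}_k\mapsto e_{N_1+k}$ ($1\le k\le N_2-1$), $u^{(1)}\mapsto u\,g_{N-1}^{-1}\cdots g_{N_1}^{-1}$, $u^{(2)}\mapsto g_{N_1}\cdots g_1u$, $e_0^{(1)}\mapsto g_{N_1}\cdots g_{N-1}e_0g_{N-1}^{-1}\cdots g_{N_1}^{-1}$, $e_0^{(2)}\mapsto g_0^{-1}\cdots g_{N_1-1}^{-1}e_{N_1}g_{N_1-1}\cdots g_0$ (superscripts label the tensor factor). For $M_i\in\widehat{\mathsf C}_{N_i}$, $M_1\,\widehat\times_f\,M_2=\mathsf T^a_N\otimes_{\mathsf T^a_{N_1}\otimes\mathsf T^a_{N_2}}(M_1\otimes M_2)$, via $\varepsilon_{N_1,N_2}$. **Direct limit.** Let $\mathsf e_{(N)}=\frac1me_{N+1}\in\mathsf T^a_{N+2}$. One has an isomorphism $\mathsf T^a_N\cong\mathsf e_{(N)}\mathsf T^a_{N+2}\mathsf e_{(N)}$, $u^{\pm1}\mapsto m\,\mathsf e_{(N)}u^{\pm1}\mathsf e_{(N)}$, $e_j\mapsto\mathsf e_{(N)}e_j$ ($1\le j\le N-1$), $e_N\mapsto m\,\mathsf e_{(N)}e_Ne_{N+2}\mathsf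 e_{(N)}$. The globalization functor is $\widehat{\mathcal G}_N:\widehat{\mathsf C}_N\to\widehat{\mathsf C}_{N+2}$, $M\mapsto\mathsf T^a_{N+2}\mathsf e_{(N)}\otimes_{\mathsf T^a_N}M$. $\widehat{\mathsf C}_\infty$ is the direct sum of the direct limits of $\widehat{\mathsf C}_1\to\widehat{\mathsf C}_3\to\cdots$ and $\widehat{\mathsf C}_2\to\widehat{\mathsf C}_4\to\cdots$ along the $\widehat{\mathcal G}_N$: two modules are in the same equivalence class iff their images under compositions of the globalization functors agree at some common level. For an object $M$ of $\widehat{\mathsf C}_\infty$, $M[N]$ denotes its representative in $\widehat{\mathsf C}_N$; representatives satisfy $M[N+2]=\widehat{\mathcal G}_N(M[N])$. Equality of modules built from (iterated) balanced tensor products is understood via the canonical identifications of such tensor products. *)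

theory Defs
  imports Complex_Main "HOL-Algebra.Module" "HOL-Algebra.Generated_Groups"
    "HOL-Algebra.Free_Abelian_Groups"
begin

section \<open>Affine diagrams\<close>

text \<open>
  A non-crossing pairing in the annulus is encoded by its lift to the universal cover, the
  strip whose two boundary lines carry marked points indexed by the integers.  The lifts of the
  boundary point \<open>i\<close> of the annulus are the integers congruent to \<open>i\<close> modulo \<open>N\<close>.
  An isotopy class (boundary fixed) is determined by the lifted pairing together with the number
  of non-contractible loops.
\<close>

datatype bpoint = Outer int | Inner int

fun shift :: "int \<Rightarrow> bpoint \<Rightarrow> bpoint" where
  "shift k (Outer i) = Outer (i + k)"
| "shift k (Inner i) = Inner (i + k)"

type_synonym pairing = "bpoint \<Rightarrow> bpoint"

type_synonym diagram = "pairing \<times> nat"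

definition periodic_pairing :: "nat \<Rightarrow> pairing \<Rightarrow> bool" where
  "periodic_pairing N \<sigma> \<longleftrightarrow>
     (\<forall>p. \<sigma> p \<noteq> p \<and> \<sigma> (\<sigma> p) = p \<and> \<sigma> (shift (int N) p) = shift (int N) (\<sigma> p))"

definition noncrossing :: "pairing \<Rightarrow> bool" where
  "noncrossing \<sigma> \<longleftrightarrow>
     (\<forall>i j k. \<sigma> (Outer i) = Outer j \<and> i < k \<and> k < j \<longrightarrow> (\<exists>l. i < l \<and> l < j \<and> \<sigma> (Outer k) = Outer l)) \<and>
     (\<forall>i j k. \<sigma> (Inner i) = Inner j \<and> i < k \<and> k < j \<longrightarrow> (\<exists>l. i < l \<and> l < j \<and> \<sigma> (Inner k) = Inner l)) \<and>
     (\<forall>i j i' j'. \<sigma> (Outer i) = Inner j \<and> \<sigma> (Outer i') = Inner j' \<and> i < i' \<longrightarrow> j < j')"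

definition has_through_line :: "pairing \<Rightarrow> bool" where
  "has_through_line \<sigma> \<longleftrightarrow> (\<exists>i j. \<sigma> (Outer i) = Inner j)"

definition affine_diagrams :: "nat \<Rightarrow> diagram set" where
  "affine_diagrams N =
     {(\<sigma>, l). periodic_pairing N \<sigma> \<and> noncrossing \<sigma> \<and> (has_through_line \<sigma> \<longrightarrow> l = 0)}"


section \<open>Composition of diagrams\<close>

text \<open>
  In the product \<open>ab\<close> the inner boundary of \<open>a\<close> is glued to the outer boundary of \<open>b\<close>.
  The points of the glued picture are those on the outer boundary of \<open>a\<close> (\<open>Top\<close>), the
  glued ones (\<open>Mid\<close>), and those on the inner boundary of \<open>b\<close> (\<open>Bot\<close>).
\<close>

datatype gpoint = Top int | Mid int | Bot int

fun glue_upper :: "bpoint \<Rightarrow> gpoint" where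
  "glue_upper (Outer i) = Top i"
| "glue_upper (Inner i) = Mid i"

fun glue_lower :: "bpoint \<Rightarrow> gpoint" where
  "glue_lower (Outer i) = Mid i"
| "glue_lower (Inner i) = Bot i"

fun endpoint :: "bpoint \<Rightarrow> gpoint" where
  "endpoint (Outer i) = Top i"
| "endpoint (Inner i) = Bot i"

definition connected_in :: "pairing \<Rightarrow> pairing \<Rightarrow> (gpoint \<times> gpoint) set" where
  "connected_in \<sigma> \<tau> = (range (\<lambda>p. (glue_upper p, glue_upper (\<sigma> p))) \<union>
     range (\<lambda>p. (glue_lower p, glue_lower (\<tau> p))))\<^sup>*"

definition comp_pairing :: "pairing \<Rightarrow> pairing \<Rightarrow> pairing" where
  "comp_pairing \<sigma> \<tau> p = (THE p'. p' \<noteq> p \<and> (endpoint p, endpoint p') \<in> connected_in \<sigma> \<tau>)"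

text \<open>
  A closed loop of the glued annulus lifts to an orbit, under translation by multiples of
  \<open>N\<close>, of connected components of the glued strip that contain no end point.  The loop is
  contractible iff these components are closed curves (finite), and non-contractible iff they are
  lines (infinite).
\<close>

definition closed_components :: "pairing \<Rightarrow> pairing \<Rightarrow> int set set" where
  "closed_components \<sigma> \<tau> =
     {{j. (Mid i, Mid j) \<in> connected_in \<sigma> \<tau>} | i. \<forall>p. (Mid i, endpoint p) \<notin> connected_in \<sigma> \<tau>}"

definition translates :: "nat \<Rightarrow> int set \<Rightarrow> int set set" where
  "translates N C = range (\<lambda>k::int. (\<lambda>i. i + k * int N) ` C)"

definition contractible_loops :: "nat \<Rightarrow> pairing \<Rightarrow> pairing \<Rightarrow> nat" where
  "contractible_loops N \<sigma> \<tau> = card (translates N ` {C \<in> closed_components \<sigma> \<tau>. finite C})"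

definition noncontractible_loops :: "nat \<Rightarrow> pairing \<Rightarrow> pairing \<Rightarrow> nat" where
  "noncontractible_loops N \<sigma> \<tau> = card (translates N ` {C \<in> closed_components \<sigma> \<tau>. infinite C})"

definition comp_diagram :: "nat \<Rightarrow> diagram \<Rightarrow> diagram \<Rightarrow> diagram" where
  "comp_diagram N a b =
     (comp_pairing (fst a) (fst b), snd a + snd b + noncontractible_loops N (fst a) (fst b))"

definition loop_weight :: "nat \<Rightarrow> complex \<Rightarrow> diagram \<Rightarrow> diagram \<Rightarrow> complex" where
  "loop_weight N m a b = m ^ contractible_loops N (fst a) (fst b)"

definition id_diagram :: diagram where
  "id_diagram = (\<lambda>p. case p of Outer i \<Rightarrow> Inner i | Inner i \<Rightarrow> Outer i, 0)"

definition e_diagram :: "nat \<Rightarrow> int \<Rightarrow> diagram" where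
  "e_diagram N j =
     (\<lambda>p. case p of
        Outer i \<Rightarrow> (if (i - j) mod int N = 0 then Outer (i + 1)
                    else if (i - j) mod int N = 1 then Outer (i - 1) else Inner i)
      | Inner i \<Rightarrow> (if (i - j) mod int N = 0 then Inner (i + 1)
                    else if (i - j) mod int N = 1 then Inner (i - 1) else Outer i), 0)"

definition u_diagram :: diagram where
  "u_diagram = (\<lambda>p. case p of Outer i \<Rightarrow> Inner (i - 1) | Inner i \<Rightarrow> Outer (i + 1), 0)"

definition u_inv_diagram :: diagram where
  "u_inv_diagram = (\<lambda>p. case p of Outer i \<Rightarrow> Inner (i + 1) | Inner i \<Rightarrow> Outer (i - 1), 0)"


section \<open>The algebras\<close>

text \<open>
  The algebra with basis \<open>D\<close> and product of basis elements
  \<open>a \<cdot> b = w a b (op a b)\<close>.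
\<close>

definition diagram_algebra ::
  "'d set \<Rightarrow> ('d \<Rightarrow> 'd \<Rightarrow> complex) \<Rightarrow> ('d \<Rightarrow> 'd \<Rightarrow> 'd) \<Rightarrow> 'd \<Rightarrow> (complex, 'd \<Rightarrow>\<^sub>0 complex) module" where
  "diagram_algebra D w op d1 =
     \<lparr>carrier = {x. Poly_Mapping.keys x \<subseteq> D},
      monoid.mult = (\<lambda>x y. \<Sum>a\<in>Poly_Mapping.keys x. \<Sum>b\<in>Poly_Mapping.keys y.
         Poly_Mapping.single (op a b) (w a b * Poly_Mapping.lookup x a * Poly_Mapping.lookup y b)),
      monoid.one = Poly_Mapping.single d1 1,
      ring.zero = 0,
      ring.add = (+),
      module.smult = (\<lambda>c. Poly_Mapping.map ((*) c))\<rparr>"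

type_synonym tl_elem = "diagram \<Rightarrow>\<^sub>0 complex"

definition TL :: "complex \<Rightarrow> nat \<Rightarrow> (complex, tl_elem) module" where
  "TL m N = diagram_algebra (affine_diagrams N) (loop_weight N m) (comp_diagram N) id_diagram"

text \<open>The tensor product algebra, with basis the pure tensors \<open>a \<otimes> b\<close> of diagrams.\<close>

type_synonym tl2_elem = "(diagram \<times> diagram) \<Rightarrow>\<^sub>0 complex"

definition TL2 :: "complex \<Rightarrow> nat \<Rightarrow> nat \<Rightarrow> (complex, tl2_elem) module" where
  "TL2 m N1 N2 =
     diagram_algebra (affine_diagrams N1 \<times> affine_diagrams N2)
       (\<lambda>a b. loop_weight N1 m (fst a) (fst b) * loop_weight N2 m (snd a) (snd b))
       (\<lambda>a b. (comp_diagram N1 (fst a) (fst b), comp_diagram N2 (snd a) (snd b)))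
       (id_diagram, id_diagram)"

definition e_gen :: "nat \<Rightarrow> int \<Rightarrow> tl_elem" where
  "e_gen N j = Poly_Mapping.single (e_diagram N j) 1"

definition u_gen :: tl_elem where
  "u_gen = Poly_Mapping.single u_diagram 1"

definition u_inv_gen :: tl_elem where
  "u_inv_gen = Poly_Mapping.single u_inv_diagram 1"

definition alg_hom :: "(complex, 'a) module \<Rightarrow> (complex, 'b) module \<Rightarrow> ('a \<Rightarrow> 'b) \<Rightarrow> bool" where
  "alg_hom A B f \<longleftrightarrow>
     f \<in> ring_hom A B \<and> (\<forall>c. \<forall>x\<in>carrier A. f (c \<odot>\<^bsub>A\<^esub> x) = c \<odot>\<^bsub>B\<^esub> f x)"

definition alg_iso :: "(complex, 'a) module \<Rightarrow> (complex, 'b) module \<Rightarrow> ('a \<Rightarrow> 'b) \<Rightarrow> bool" where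
  "alg_iso A B f \<longleftrightarrow> alg_hom A B f \<and> bij_betw f (carrier A) (carrier B)"


section \<open>Modules over a non-commutative algebra\<close>

text \<open>The library's locale \<open>module\<close> assumes a commutative ring of scalars.\<close>

locale left_module = R?: ring R + M?: abelian_group M
  for R :: "('r, 'p) ring_scheme" (structure) and M :: "('r, 'v, 'q) module_scheme" (structure) +
  assumes smult_closed:
      "\<lbrakk>a \<in> carrier R; x \<in> carrier M\<rbrakk> \<Longrightarrow> a \<odot>\<^bsub>M\<^esub> x \<in> carrier M"
    and smult_l_distr:
      "\<lbrakk>a \<in> carrier R; b \<in> carrier R; x \<in> carrier M\<rbrakk> \<Longrightarrow>
         (a \<oplus> b) \<odot>\<^bsub>M\<^esub> x = a \<odot>\<^bsub>M\<^esub> x \<oplus>\<^bsub>M\<^esub> b \<odot>\<^bsub>M\<^esub> x"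
    and smult_r_distr:
      "\<lbrakk>a \<in> carrier R; x \<in> carrier M; y \<in> carrier M\<rbrakk> \<Longrightarrow>
         a \<odot>\<^bsub>M\<^esub> (x \<oplus>\<^bsub>M\<^esub> y) = a \<odot>\<^bsub>M\<^esub> x \<oplus>\<^bsub>M\<^esub> a \<odot>\<^bsub>M\<^esub> y"
    and smult_assoc:
      "\<lbrakk>a \<in> carrier R; b \<in> carrier R; x \<in> carrier M\<rbrakk> \<Longrightarrow>
         (a \<otimes> b) \<odot>\<^bsub>M\<^esub> x = a \<odot>\<^bsub>M\<^esub> (b \<odot>\<^bsub>M\<^esub> x)"
    and smult_one: "x \<in> carrier M \<Longrightarrow> \<one> \<odot>\<^bsub>M\<^esub> x = x"

definition scale :: "(complex, 'a) module \<Rightarrow> ('a, 'v) module \<Rightarrow> complex \<Rightarrow> 'v \<Rightarrow> 'v" where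
  "scale A M c v = (c \<odot>\<^bsub>A\<^esub> \<one>\<^bsub>A\<^esub>) \<odot>\<^bsub>M\<^esub> v"

definition fin_dim :: "(complex, 'a) module \<Rightarrow> ('a, 'v) module \<Rightarrow> bool" where
  "fin_dim A M \<longleftrightarrow>
     (\<exists>S. finite S \<and> S \<subseteq> carrier M \<and>
        (\<forall>v\<in>carrier M. \<exists>c. v = (\<Oplus>\<^bsub>M\<^esub>s\<in>S. scale A M (c s) s)))"

definition module_iso :: "(complex, 'a) module \<Rightarrow> ('a, 'v) module \<Rightarrow> ('a, 'w) module \<Rightarrow> bool" where
  "module_iso A M M' \<longleftrightarrow>
     (\<exists>f. bij_betw f (carrier M) (carrier M') \<and>
        (\<forall>v\<in>carrier M. \<forall>w\<in>carrier M. f (v \<oplus>\<^bsub>M\<^esub> w) = f v \<oplus>\<^bsub>M'\<^esub> f w) \<and>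
        (\<forall>a\<in>carrier A. \<forall>v\<in>carrier M. f (a \<odot>\<^bsub>M\<^esub> v) = a \<odot>\<^bsub>M'\<^esub> f v))"

definition TL_Mod :: "complex \<Rightarrow> nat \<Rightarrow> (tl_elem, 'v) module set" where
  "TL_Mod m N = {M. left_module (TL m N) M \<and> fin_dim (TL m N) M}"


section \<open>Balanced tensor products\<close>

text \<open>
  The tensor product of \<open>X\<close> and \<open>Y\<close> balanced over \<open>R\<close> (acting by \<open>ra\<close> on the
  right of \<open>X\<close> and by \<open>la\<close> on the left of \<open>Y\<close>): the free abelian group on
  \<open>X \<times> Y\<close> modulo the usual relators.
\<close>

definition tensor_relators ::
  "('x, 'p) ring_scheme \<Rightarrow> ('y, 'q) ring_scheme \<Rightarrow> 'r set \<Rightarrow> ('x \<Rightarrow> 'r \<Rightarrow> 'x) \<Rightarrow> ('r \<Rightarrow> 'y \<Rightarrow> 'y)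
    \<Rightarrow> ('x \<times> 'y \<Rightarrow>\<^sub>0 int) set" where
  "tensor_relators X Y R ra la =
     {frag_of (x \<oplus>\<^bsub>X\<^esub> x', y) - frag_of (x, y) - frag_of (x', y) | x x' y.
        x \<in> carrier X \<and> x' \<in> carrier X \<and> y \<in> carrier Y} \<union>
     {frag_of (x, y \<oplus>\<^bsub>Y\<^esub> y') - frag_of (x, y) - frag_of (x, y') | x y y'.
        x \<in> carrier X \<and> y \<in> carrier Y \<and> y' \<in> carrier Y} \<union>
     {frag_of (ra x r, y) - frag_of (x, la r y) | x r y.
        x \<in> carrier X \<and> r \<in> R \<and> y \<in> carrier Y}"

text \<open>
  In addition, \<open>act a\<close> prescribes the action of a scalar \<open>a\<close> on generators \<open>x \<otimes> y\<close>.
  The fields \<open>mult\<close> and \<open>one\<close> of a module record are irrelevant.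
\<close>

definition tensor_module ::
  "('x, 'p) ring_scheme \<Rightarrow> ('y, 'q) ring_scheme \<Rightarrow> 'r set \<Rightarrow> ('x \<Rightarrow> 'r \<Rightarrow> 'x) \<Rightarrow> ('r \<Rightarrow> 'y \<Rightarrow> 'y)
    \<Rightarrow> ('a \<Rightarrow> 'x \<times> 'y \<Rightarrow> ('x \<times> 'y \<Rightarrow>\<^sub>0 int)) \<Rightarrow> ('a, ('x \<times> 'y \<Rightarrow>\<^sub>0 int) set) module" where
  "tensor_module X Y R ra la act =
     (let F = free_Abelian_group (carrier X \<times> carrier Y);
          K = generate F (tensor_relators X Y R ra la)
      in \<lparr>carrier = carrier (F Mod K),
          monoid.mult = undefined,
          monoid.one = undefined,
          ring.zero = \<one>\<^bsub>F Mod K\<^esub>,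
          ring.add = monoid.mult (F Mod K),
          module.smult = (\<lambda>a C. K <#>\<^bsub>F\<^esub> (frag_extend (act a) ` C))\<rparr>)"

text \<open>
  \<open>X \<otimes>\<^sub>B V\<close> for a left ideal \<open>X\<close> of \<open>A\<close>, on whose right \<open>B\<close> acts through
  \<open>f : B \<rightarrow> A\<close>.
\<close>

definition induced_module ::
  "(complex, 'a) module \<Rightarrow> 'a set \<Rightarrow> (complex, 'b) module \<Rightarrow> ('b \<Rightarrow> 'a) \<Rightarrow> ('b, 'v) module
    \<Rightarrow> ('a, ('a \<times> 'v \<Rightarrow>\<^sub>0 int) set) module" where
  "induced_module A X B f V =
     tensor_module (A\<lparr>carrier := X\<rparr>) V (carrier B) (\<lambda>x b. x \<otimes>\<^bsub>A\<^esub> f b) (module.smult V)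
       (\<lambda>a (x, v). frag_of (a \<otimes>\<^bsub>A\<^esub> x, v))"

text \<open>
  \<open>M1 \<otimes> M2\<close> over the complex numbers, as a module over the tensor product algebra:
  \<open>c (a \<otimes> b)\<close> sends \<open>v \<otimes> w\<close> to \<open>(c a) v \<otimes> b w\<close>.
\<close>

definition outer_tensor ::
  "complex \<Rightarrow> nat \<Rightarrow> nat \<Rightarrow> (tl_elem, 'v) module \<Rightarrow> (tl_elem, 'w) module
    \<Rightarrow> (tl2_elem, ('v \<times> 'w \<Rightarrow>\<^sub>0 int) set) module" where
  "outer_tensor m N1 N2 M1 M2 =
     tensor_module M1 M2 (UNIV :: complex set)
       (\<lambda>v c. scale (TL m N1) M1 c v) (scale (TL m N2) M2)
       (\<lambda>t (v, w). \<Sum>(a, b)\<in>Poly_Mapping.keys t.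
          frag_of (Poly_Mapping.single a (Poly_Mapping.lookup t (a, b)) \<odot>\<^bsub>M1\<^esub> v,
                   Poly_Mapping.single b 1 \<odot>\<^bsub>M2\<^esub> w))"


section \<open>Fusion\<close>

definition alg_prod :: "(complex, 'a) module \<Rightarrow> 'a list \<Rightarrow> 'a" where
  "alg_prod A xs = foldr (\<otimes>\<^bsub>A\<^esub>) xs \<one>\<^bsub>A\<^esub>"

text \<open>Here \<open>s\<close> is the chosen square root of the parameter \<open>q\<close>.\<close>

definition g_elem :: "complex \<Rightarrow> complex \<Rightarrow> nat \<Rightarrow> nat \<Rightarrow> tl_elem" where
  "g_elem m s N i =
     \<i> \<odot>\<^bsub>TL m N\<^esub> (s \<odot>\<^bsub>TL m N\<^esub> \<one>\<^bsub>TL m N\<^esub> \<ominus>\<^bsub>TL m N\<^esub> inverse s \<odot>\<^bsub>TL m N\<^esub> e_gen N (int i))"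

definition g_inv_elem :: "complex \<Rightarrow> complex \<Rightarrow> nat \<Rightarrow> nat \<Rightarrow> tl_elem" where
  "g_inv_elem m s N i =
     (- \<i>) \<odot>\<^bsub>TL m N\<^esub> (inverse s \<odot>\<^bsub>TL m N\<^esub> \<one>\<^bsub>TL m N\<^esub> \<ominus>\<^bsub>TL m N\<^esub> s \<odot>\<^bsub>TL m N\<^esub> e_gen N (int i))"

definition in_fst :: "diagram \<Rightarrow> tl2_elem" where
  "in_fst d = Poly_Mapping.single (d, id_diagram) 1"

definition in_snd :: "diagram \<Rightarrow> tl2_elem" where
  "in_snd d = Poly_Mapping.single (id_diagram, d) 1"

text \<open>
  For \<open>N1 = 1\<close> (resp. \<open>N2 = 1\<close>) the first (resp. second) factor is the algebra of Laurent
  polynomials in \<open>u\<close> and has no generators \<open>e\<close>.  As the listed elements and the inverses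
  of the two copies of \<open>u\<close> generate, there is only one such \<open>f\<close>.
\<close>

definition fusion_map ::
  "complex \<Rightarrow> complex \<Rightarrow> nat \<Rightarrow> nat \<Rightarrow> (tl2_elem \<Rightarrow> tl_elem) \<Rightarrow> bool" where
  "fusion_map m s N1 N2 f \<longleftrightarrow>
     (let N = N1 + N2; A = TL m N; g = g_elem m s N; g' = g_inv_elem m s N in
        alg_hom (TL2 m N1 N2) A f \<and>
        (\<forall>j\<in>{1..<N1}. f (in_fst (e_diagram N1 (int j))) = e_gen N (int j)) \<and>
        (\<forall>k\<in>{1..<N2}. f (in_snd (e_diagram N2 (int k))) = e_gen N (int (N1 + k))) \<and>
        f (in_fst u_diagram) = u_gen \<otimes>\<^bsub>A\<^esub> alg_prod A (map g' (rev [N1..<N])) \<and>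
        f (in_snd u_diagram) = alg_prod A (map g (rev [1..<N1 + 1])) \<otimes>\<^bsub>A\<^esub> u_gen \<and>
        (N1 \<ge> 2 \<longrightarrow> f (in_fst (e_diagram N1 0)) =
           alg_prod A (map g [N1..<N]) \<otimes>\<^bsub>A\<^esub> e_gen N 0 \<otimes>\<^bsub>A\<^esub> alg_prod A (map g' (rev [N1..<N]))) \<and>
        (N2 \<ge> 2 \<longrightarrow> f (in_snd (e_diagram N2 0)) =
           alg_prod A (map g' [0..<N1]) \<otimes>\<^bsub>A\<^esub> e_gen N (int N1) \<otimes>\<^bsub>A\<^esub>
           alg_prod A (map g (rev [0..<N1]))))"

definition fusion ::
  "complex \<Rightarrow> (nat \<Rightarrow> nat \<Rightarrow> tl2_elem \<Rightarrow> tl_elem) \<Rightarrow> nat \<Rightarrow> (tl_elem, 'v) module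
    \<Rightarrow> nat \<Rightarrow> (tl_elem, 'w) module
    \<Rightarrow> (tl_elem, (tl_elem \<times> ('v \<times> 'w \<Rightarrow>\<^sub>0 int) set \<Rightarrow>\<^sub>0 int) set) module" where
  "fusion m \<epsilon> N1 M1 N2 M2 =
     induced_module (TL m (N1 + N2)) (carrier (TL m (N1 + N2))) (TL2 m N1 N2) (\<epsilon> N1 N2)
       (outer_tensor m N1 N2 M1 M2)"


section \<open>Globalization and the direct limit\<close>

definition corner_idem :: "complex \<Rightarrow> nat \<Rightarrow> tl_elem" where
  "corner_idem m N = inverse m \<odot>\<^bsub>TL m (N + 2)\<^esub> e_gen (N + 2) (int N + 1)"

definition corner_algebra :: "complex \<Rightarrow> nat \<Rightarrow> (complex, tl_elem) module" where
  "corner_algebra m N =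
     (let A = TL m (N + 2); c = corner_idem m N
      in A\<lparr>carrier := {c \<otimes>\<^bsub>A\<^esub> x \<otimes>\<^bsub>A\<^esub> c | x. x \<in> carrier A}, monoid.one := c\<rparr>)"

definition corner_iso :: "complex \<Rightarrow> nat \<Rightarrow> (tl_elem \<Rightarrow> tl_elem) \<Rightarrow> bool" where
  "corner_iso m N f \<longleftrightarrow>
     (let A = TL m (N + 2); c = corner_idem m N in
        alg_iso (TL m N) (corner_algebra m N) f \<and>
        f u_gen = m \<odot>\<^bsub>A\<^esub> (c \<otimes>\<^bsub>A\<^esub> u_gen \<otimes>\<^bsub>A\<^esub> c) \<and>
        f u_inv_gen = m \<odot>\<^bsub>A\<^esub> (c \<otimes>\<^bsub>A\<^esub> u_inv_gen \<otimes>\<^bsub>A\<^esub> c) \<and>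
        (\<forall>j\<in>{1..<N}. f (e_gen N (int j)) = c \<otimes>\<^bsub>A\<^esub> e_gen (N + 2) (int j)) \<and>
        (N \<ge> 2 \<longrightarrow> f (e_gen N (int N)) =
           m \<odot>\<^bsub>A\<^esub> (c \<otimes>\<^bsub>A\<^esub> e_gen (N + 2) (int N) \<otimes>\<^bsub>A\<^esub> e_gen (N + 2) (int N + 2) \<otimes>\<^bsub>A\<^esub> c)))"

definition globalize ::
  "complex \<Rightarrow> (nat \<Rightarrow> tl_elem \<Rightarrow> tl_elem) \<Rightarrow> nat \<Rightarrow> (tl_elem, 'v) module
    \<Rightarrow> (tl_elem, (tl_elem \<times> 'v \<Rightarrow>\<^sub>0 int) set) module" where
  "globalize m \<phi> N M =
     induced_module (TL m (N + 2))
       {x \<otimes>\<^bsub>TL m (N + 2)\<^esub> corner_idem m N | x. x \<in> carrier (TL m (N + 2))} (TL m N) (\<phi> N) M"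

text \<open>
  The carrier type of \<open>globalize m \<phi> N M\<close> differs from that of \<open>M\<close>.  To iterate the functor,
  and to speak of the collection of all objects, modules are taken up to isomorphism in the fixed
  universe \<open>std_vec\<close>, which contains a copy of every finite-dimensional complex vector space.
\<close>

type_synonym std_vec = "nat \<Rightarrow> complex"

type_synonym level_module = "nat \<times> (tl_elem, std_vec) module"

text \<open>
  \<open>iterated_glob m \<phi> N M L P\<close>: \<open>P\<close> is (isomorphic to) the image of \<open>M\<close>, a module at level
  \<open>N\<close>, under the composition of the globalization functors from level \<open>N\<close> to level \<open>L\<close>.
\<close>

inductive iterated_glob ::
  "complex \<Rightarrow> (nat \<Rightarrow> tl_elem \<Rightarrow> tl_elem) \<Rightarrow> nat \<Rightarrow> (tl_elem, std_vec) module
    \<Rightarrow> nat \<Rightarrow> (tl_elem, std_vec) module \<Rightarrow> bool"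
  for m \<phi> N M where
  base: "P \<in> TL_Mod m N \<Longrightarrow> module_iso (TL m N) M P \<Longrightarrow> iterated_glob m \<phi> N M N P"
| step: "iterated_glob m \<phi> N M L P \<Longrightarrow> Q \<in> TL_Mod m (L + 2) \<Longrightarrow>
         module_iso (TL m (L + 2)) (globalize m \<phi> L P) Q \<Longrightarrow> iterated_glob m \<phi> N M (L + 2) Q"

definition level_modules :: "complex \<Rightarrow> level_module set" where
  "level_modules m = {(N, M). N \<ge> 1 \<and> M \<in> TL_Mod m N}"

definition limit_rel ::
  "complex \<Rightarrow> (nat \<Rightarrow> tl_elem \<Rightarrow> tl_elem) \<Rightarrow> (level_module \<times> level_module) set" where
  "limit_rel m \<phi> =
     {((N, M), (N', M')). (N, M) \<in> level_modules m \<and> (N', M') \<in> level_modules m \<and>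
        (\<exists>L P. iterated_glob m \<phi> N M L P \<and> iterated_glob m \<phi> N' M' L P)}"

definition odd_limit :: "complex \<Rightarrow> (nat \<Rightarrow> tl_elem \<Rightarrow> tl_elem) \<Rightarrow> level_module set set" where
  "odd_limit m \<phi> = {(N, M) \<in> level_modules m. odd N} // limit_rel m \<phi>"

definition even_limit :: "complex \<Rightarrow> (nat \<Rightarrow> tl_elem \<Rightarrow> tl_elem) \<Rightarrow> level_module set set" where
  "even_limit m \<phi> = {(N, M) \<in> level_modules m. even N} // limit_rel m \<phi>"

text \<open>Objects of the direct sum of the two direct limits are pairs of objects.\<close>

definition C_infinity ::
  "complex \<Rightarrow> (nat \<Rightarrow> tl_elem \<Rightarrow> tl_elem) \<Rightarrow> (level_module set \<times> level_module set) set" where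
  "C_infinity m \<phi> = odd_limit m \<phi> \<times> even_limit m \<phi>"

text \<open>\<open>M\<close> is a representative \<open>X[N]\<close> of the object \<open>X\<close> at level \<open>N\<close>.\<close>

definition represents ::
  "complex \<Rightarrow> level_module set \<times> level_module set \<Rightarrow> nat \<Rightarrow> (tl_elem, 'v) module \<Rightarrow> bool" where
  "represents m X N M \<longleftrightarrow>
     M \<in> TL_Mod m N \<and>
     (\<exists>P. (N, P) \<in> (if odd N then fst X else snd X) \<and> module_iso (TL m N) P M)"

end

theory Submission
 imports Defs
begin

text \<open>
 Fusion commutes with globalization in either argument: the fusions of \<open>(G M1, M2)\<close> and of \<open>(M1, G M2)\<close> are
 both isomorphic to \<open>G\<close> applied to the fusion of \<open>(M1, M2)\<close>.  For the second argument the corner idempotents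
 of the two sides coincide.  For the first one the idempotent sits between the two bundles of strands and is
 carried to the end of the second bundle by \<open>X = (1/m) e\<^sub>a\<^sub>+\<^sub>1 ... e\<^sub>N\<^sub>-\<^sub>1\<close>, where \<open>a\<close> is the size of the first
 bundle; \<open>X\<close> intertwines the two embeddings of the small algebras, which is checked on generators by sliding
 the cup through the braids.  The isomorphisms then come from the universal properties of the tensor products.
 Since \<open>M\<close> is recovered from \<open>G M\<close> as the image of the corner idempotent, \<open>G\<close> reflects isomorphisms, which
 gives the statement on the same level.

 Two facts have to be supplied: composition of diagrams is associative, by contracting the middle layer of a
 gluing and counting its components up to translation, and fusion preserves finite dimension, because the
 affine algebra is finitely generated as a right module over the image of the fusion map.
\<close>

text \<open>The product of diagrams is a definite description, and only the maps \<phi> and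
  \<epsilon> are given, so even the ring structure has to be earned. Planarity of a product is
  checked only for products with a generator; all other products follow once every affine diagram is
  a polynomial in \<open>u\<close>, its inverse and \<open>e_1\<close>. That generation result in
  turn rests on the corner isomorphisms, by induction on the number of points. Associativity must
  therefore be available before closure is known: it is proved on all periodic pairings, and the
  affine algebra is cut out of that larger one.

  Finite dimension is the other obstacle. The affine algebra is infinite dimensional because of the
  powers of \<open>u\<close>; modified translations \<open>Y i\<close>, which wind a single strand
  around the annulus, can be moved to the right into the image of the fusion map, and only the
  finite-dimensional algebra of \<open>e_1, ..., e_(N-1)\<close> stays on the left.

  Each application of a functor changes the carrier type. Universal properties are therefore stated
  for one given target at a time, and a module returns to the fixed universe \<open>std_vec\<close>
  only up to isomorphism.\<close>

abbreviation "per \<equiv> periodic_pairing"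
abbreviation "AD \<equiv> affine_diagrams"

section \<open>Orbits of two involutions that commute with a free translation action\<close>

text \<open>The gluing of two pairings seen as a dihedral group action: \<alpha> follows the arcs of
  the upper pairing and \<beta> those of the lower one, and a point on no arc of one of them is
  fixed by it, which marks the end points. \<open>T\<close> is the deck translation;
  \<open>res\<close> leaves finitely many points up to translation. By \<open>disj\<close> every
  point lies on some arc.\<close>

locale dihedral =
 fixes \<alpha> \<beta> :: "'v => 'v" and T :: "int => 'v => 'v" and res :: "'v => 'r"
 assumes aa: "\<alpha> (\<alpha> x) = x" and bb: "\<beta> (\<beta> x) = x"
  and Ta: "\<alpha> (T k x) = T k (\<alpha> x)" and Tb: "\<beta> (T k x) = T k (\<beta> x)"
  and T0: "T 0 x = x" and Tadd: "T k (T l x) = T (k + l) x" and Tfree: "T k x = x ==> k = 0"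
  and fin: "finite (range res)" and res: "res x = res y ==> \<exists>k. y = T k x"
  and disj: "\<alpha> x = x ==> \<beta> x ~= x"
begin

definition rh where "rh x = \<alpha> (\<beta> x)"
definition orb where "orb = (range (\<lambda>x. (x, \<alpha> x)) \<union> range (\<lambda>x. (x, \<beta> x)))^*"

lemma inj_rho: "inj rh"
 by (rule inj_on_inverseI[where g = "\<lambda>x. \<beta> (\<alpha> x)"]) (simp add: rh_def aa bb)

lemma inj_pow: "(rh ^^ k) x = (rh ^^ k) y ==> x = y"
 using inj_rho inj_fn by (metis injD)

lemma rho_T: "(rh ^^ k) (T j x) = T j ((rh ^^ k) x)"
 by (induction k) (auto simp: rh_def Ta Tb)

text \<open>The reflection \<beta> inverts the rotation \<open>rh\<close>. The dihedral relation is
  written without inverse powers because \<open>^^\<close> has natural exponents;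
  \<open>pow_alpha\<close> is the same relation for \<alpha>.\<close>

lemma pow_beta: "(rh ^^ k) (\<beta> ((rh ^^ k) x)) = \<beta> x"
 by (induction k arbitrary: x) (simp_all add: funpow_swap1 rh_def aa bb)

lemma pow_alpha: "(rh ^^ k) (\<alpha> ((rh ^^ k) x)) = \<alpha> x"
proof (induction k arbitrary: x)
 case (Suc k)
 have "rh (\<alpha> (rh y)) = \<alpha> y" for y by (simp add: rh_def aa bb)
 with Suc show ?case by (simp add: funpow_swap1)
qed simp

text \<open>A reflected point of the orbit of a fixed end is the inverse power, so a nontrivial translation
 along the orbit would equal its own inverse.\<close>

lemma period_exists:
 assumes v: "\<beta> v = v"
 shows "\<exists>d>0. (rh ^^ d) v = v"
proof -
 have "\<not> inj (\<lambda>n::nat. res ((rh ^^ n) v))"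
  using fin by (metis finite_imageD finite_subset image_image infinite_UNIV_nat rangeI subsetI
    image_subset_iff)
 then obtain a b where ab: "a < b" "res ((rh ^^ a) v) = res ((rh ^^ b) v)"
  unfolding inj_def by (metis linorder_neqE_nat)
 obtain k where k: "(rh ^^ b) v = T k ((rh ^^ a) v)" using res[OF ab(2)] by blast
 define d where "d = b - a"
 have "(rh ^^ a) ((rh ^^ d) v) = (rh ^^ a) (T k v)"
  using k ab(1) by (simp add: d_def rho_T flip: funpow_add[THEN fun_cong, unfolded o_def])
 hence d: "(rh ^^ d) v = T k v" by (rule inj_pow)
 have "(rh ^^ d) (T k v) = v" using pow_beta[of d v] by (simp add: d Tb v)
 hence "T (k + k) v = v" by (simp add: rho_T d Tadd)
 hence "k = 0" using Tfree by fastforce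
 thus ?thesis using d ab(1) T0 by (auto simp: d_def intro!: exI[of _ "b - a"])
qed

text \<open>As \<beta> fixes \<open>v\<close>, the orbit of \<open>v\<close> is a single cycle of
  length \<open>d\<close> under \<open>rh\<close>. On its k-th point \<beta> acts by k to -k and
  \<alpha> by k to 1 - k modulo \<open>d\<close>, so ends are the solutions of 2k = 0 or 2k = 1
  modulo \<open>d\<close>. Besides k = 0 there is exactly one, \<open>(d + 1) div 2\<close>, for
  either parity of \<open>d\<close>.\<close>

lemma unique_end:
 assumes v: "\<beta> v = v"
 shows "\<exists>!w. w ~= v \<and> (v, w) \<in> orb \<and> (\<alpha> w = w \<or> \<beta> w = w)"
proof -
 define d where "d = (LEAST d. d > 0 \<and> (rh ^^ d) v = v)"
 have d: "d > 0" "(rh ^^ d) v = v" and dmin: "!!k. 0 < k ==> (rh ^^ k) v = v ==> d <= k"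
  using LeastI_ex[OF period_exists[OF v]] Least_le[of "\<lambda>d. d > 0 \<and> (rh ^^ d) v = v"]
  unfolding d_def by auto
 have av: "\<alpha> v ~= v" using disj v by blast
 have mult: "(rh ^^ (j * d)) v = v" for j
  by (induction j) (simp_all add: funpow_add d)
 have pmod: "(rh ^^ k) v = (rh ^^ (k mod d)) v" for k
 proof -
  have "(rh ^^ k) v = (rh ^^ (k mod d + (k div d) * d)) v" by simp
  also have "\<dots> = (rh ^^ (k mod d)) v" by (simp only: funpow_add o_def mult)
  finally show ?thesis .
 qed
 have dvd: "(rh ^^ k) v = v \<longleftrightarrow> d dvd k" for k
  using dmin[of "k mod d"] pmod[of k] d(1) mod_less_divisor[of d k]
  by (metis dvd_imp_mod_0 funpow_0 leD mod_0_imp_dvd neq0_conv)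
 have orb1: "\<exists>k. w = (rh ^^ k) v" if "(v, w) \<in> orb" for w
  using that unfolding orb_def
 proof (induction rule: rtrancl_induct)
  case base
  show ?case by (intro exI[of _ 0]) simp
 next
  case (step y z)
  \<comment> \<open>The witness \<open>k * d - k\<close> is the exponent -k modulo
    \<open>d\<close>.\<close>
  have beta: "\<exists>i. \<beta> ((rh ^^ k) v) = (rh ^^ i) v" for k
  proof -
   have "(rh ^^ k) ((rh ^^ (k * d - k)) v) = (rh ^^ (k * d)) v"
    using d(1) by (simp flip: funpow_add[THEN fun_cong, unfolded o_def])
   also have "\<dots> = (rh ^^ k) (\<beta> ((rh ^^ k) v))" by (simp add: mult pow_beta v)
   finally show ?thesis using inj_pow by metis
  qed
  obtain k where k: "y = (rh ^^ k) v" using step by blast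
  from step(2) consider "z = \<alpha> y" | "z = \<beta> y" by auto
  thus ?case
  proof cases
   case 1
   show ?thesis
   proof (cases k)
    case 0
    thus ?thesis using 1 k v by (intro exI[of _ 1]) (simp add: rh_def)
   next
    case (Suc j)
    hence "z = \<beta> ((rh ^^ j) v)" using 1 k by (simp add: rh_def aa)
    thus ?thesis using beta by metis
   qed
  next
   case 2
   thus ?thesis using beta k by metis
  qed
 qed
 have orb2: "(v, (rh ^^ k) v) \<in> orb" for k
 proof (induction k)
  case (Suc k)
  have "(x, rh x) \<in> orb" for x
   unfolding orb_def rh_def
   by (rule rtrancl_trans[of _ "\<beta> x"]) (auto intro: r_into_rtrancl)
  with Suc show ?case unfolding orb_def by (auto intro: rtrancl_trans)
 qed (simp add: orb_def)
 have bfix: "\<beta> ((rh ^^ k) v) = (rh ^^ k) v \<longleftrightarrow> d dvd 2 * k" for k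
 proof -
  have "\<beta> ((rh ^^ k) v) = (rh ^^ k) v \<longleftrightarrow> (rh ^^ k) (\<beta> ((rh ^^ k) v)) = (rh ^^ k) ((rh ^^ k) v)"
   using inj_pow by metis
  also have "\<dots> \<longleftrightarrow> (rh ^^ (2 * k)) v = v"
   by (auto simp: pow_beta v mult_2 funpow_add)
  finally show ?thesis by (simp add: dvd)
 qed
 have afix: "\<alpha> ((rh ^^ k) v) = (rh ^^ k) v \<longleftrightarrow> d dvd 2 * k - 1" if "k > 0" for k
 proof -
  have "\<alpha> ((rh ^^ k) v) = (rh ^^ k) v \<longleftrightarrow> (rh ^^ k) (\<alpha> ((rh ^^ k) v)) = (rh ^^ k) ((rh ^^ k) v)"
   using inj_pow by metis
  also have "\<dots> \<longleftrightarrow> (rh ^^ (2 * k)) v = rh v"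
   by (auto simp: pow_alpha v mult_2 funpow_add rh_def)
  also have "\<dots> \<longleftrightarrow> rh ((rh ^^ (2 * k - 1)) v) = rh v"
   using that by (cases "2 * k") simp_all
  finally show ?thesis using inj_rho by (simp add: dvd inj_eq)
 qed
 have d1: "d ~= 1"
  using d av v by (auto simp: rh_def)
 define h where "h = (d + 1) div 2"
 have h: "0 < h" "h < d" using d(1) d1 by (auto simp: h_def)
 have "(rh ^^ h) v ~= v" using h by (auto simp: dvd dest: dvd_imp_le)
 moreover have "\<alpha> ((rh ^^ h) v) = (rh ^^ h) v \<or> \<beta> ((rh ^^ h) v) = (rh ^^ h) v"
 proof (cases "even d")
  case True
  hence "2 * h = d" by (auto simp: h_def)
  thus ?thesis by (simp add: bfix)
 next
  case False
  hence "2 * h - 1 = d" by (auto simp: h_def elim: oddE)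
  thus ?thesis by (simp add: afix h)
 qed
 moreover have "w = (rh ^^ h) v" if w: "w ~= v" "(v, w) \<in> orb" "\<alpha> w = w \<or> \<beta> w = w" for w
 proof -
  obtain k0 where "w = (rh ^^ k0) v" using orb1 w by blast
  then obtain k where k: "w = (rh ^^ k) v" "k < d"
   using pmod d(1) by (metis mod_less_divisor)
  hence k0: "k > 0" using w(1) by (cases k) auto
  have *: "n = d" if "d dvd n" "0 < n" "n < 2 * d" for n
  proof -
   obtain j where j: "n = d * j" using \<open>d dvd n\<close> by (elim dvdE)
   hence "j < 2" "j ~= 0" using that by auto
   thus ?thesis using j by (simp add: less_2_cases_iff)
  qed
  have "2 * k = d \<or> 2 * k - 1 = d"
  proof (cases "\<beta> w = w")
   case True
   hence "d dvd 2 * k" using bfix k by simp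
   hence "2 * k = d" using * k k0 by auto
   thus ?thesis ..
  next
   case False
   hence "d dvd 2 * k - 1" using w(3) afix[OF k0] k by simp
   moreover have "0 < 2 * k - 1" "2 * k - 1 < 2 * d" using k k0 by linarith+
   ultimately have "2 * k - 1 = d" by (rule *)
   thus ?thesis ..
  qed
  hence "k = h" by (auto simp: h_def)
  thus ?thesis using k by simp
 qed
 ultimately show ?thesis using orb2 by blast
qed

end

section \<open>The gluing graph of two pairings and the composite pairing\<close>

fun glue_alpha :: "pairing => gpoint => gpoint" where
 "glue_alpha sg (Top i) = glue_upper (sg (Outer i))"
| "glue_alpha sg (Mid i) = glue_upper (sg (Inner i))"
| "glue_alpha sg (Bot i) = Bot i"

fun glue_beta :: "pairing => gpoint => gpoint" where
 "glue_beta ta (Top i) = Top i"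
| "glue_beta ta (Mid i) = glue_lower (ta (Outer i))"
| "glue_beta ta (Bot i) = glue_lower (ta (Inner i))"

fun gshift :: "int => gpoint => gpoint" where
 "gshift k (Top i) = Top (i + k)"
| "gshift k (Mid i) = Mid (i + k)"
| "gshift k (Bot i) = Bot (i + k)"

fun gres :: "nat => gpoint => nat \<times> int" where
 "gres N (Top i) = (0, i mod int N)"
| "gres N (Mid i) = (1, i mod int N)"
| "gres N (Bot i) = (2, i mod int N)"

lemma shift_0 [simp]: "shift 0 p = p" by (cases p) auto
lemma shift_shift [simp]: "shift k (shift l p) = shift (k + l) p" by (cases p) auto

lemma glue_alpha_upper [simp]: "glue_alpha sg (glue_upper p) = glue_upper (sg p)"
 by (cases p) auto
lemma glue_beta_lower [simp]: "glue_beta sg (glue_lower p) = glue_lower (sg p)"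
 by (cases p) auto
lemma gshift_upper: "gshift k (glue_upper p) = glue_upper (shift k p)" by (cases p) auto
lemma gshift_lower: "gshift k (glue_lower p) = glue_lower (shift k p)" by (cases p) auto

lemma glue_upper_inj [simp]: "glue_upper p = glue_upper p' \<longleftrightarrow> p = p'"
 by (cases p; cases p') auto
lemma glue_lower_inj [simp]: "glue_lower p = glue_lower p' \<longleftrightarrow> p = p'"
 by (cases p; cases p') auto
lemma endpoint_inj [simp]: "endpoint p = endpoint p' \<longleftrightarrow> p = p'"
 by (cases p; cases p') auto
lemma endpoint_not_Mid [simp]: "endpoint p ~= Mid i" "Mid i ~= endpoint p"
 by (cases p; auto)+

lemma pairing_shift:
 assumes "per N sg"
 shows "sg (shift (k * int N) p) = shift (k * int N) (sg p)"
proof -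
 have nat: "sg (shift (int n * int N) p) = shift (int n * int N) (sg p)" for n p
 proof (induction n arbitrary: p)
  case (Suc n)
  have "sg (shift (int (Suc n) * int N) p) = sg (shift (int N) (shift (int n * int N) p))"
   by (simp add: algebra_simps)
  also have "\<dots> = shift (int N) (sg (shift (int n * int N) p))"
   using assms unfolding periodic_pairing_def by blast
  also have "\<dots> = shift (int (Suc n) * int N) (sg p)"
   by (simp add: Suc distrib_right)
  finally show ?case .
 qed simp
 show ?thesis
 proof (cases "k >= 0")
  case True
  thus ?thesis using nat[of "nat k"] by simp
 next
  case False
  define q where "q = shift (k * int N) p"
  have "shift (int (nat (- k)) * int N) q = p" using False by (simp add: q_def)
  hence "sg p = shift (- k * int N) (sg q)" using nat[of "nat (- k)" q] False by simp
  thus ?thesis by (simp add: q_def)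
 qed
qed

lemma pairing_invol: "per N sg ==> sg (sg p) = p"
 and pairing_neq: "per N sg ==> sg p ~= p"
 by (auto simp: periodic_pairing_def)

lemma dihedral_glue:
 assumes "N >= 1" "per N sg" "per N ta"
 shows "dihedral (glue_alpha sg) (glue_beta ta) (\<lambda>k. gshift (k * int N)) (gres N)"
proof
 have ga: "glue_alpha sg (gshift (k * int N) x) = gshift (k * int N) (glue_alpha sg x)" for k x
  using pairing_shift[OF assms(2), of k] by (cases x) (auto simp: gshift_upper shift.simps[symmetric] simp del: shift.simps)
 have gb: "glue_beta ta (gshift (k * int N) x) = gshift (k * int N) (glue_beta ta x)" for k x
  using pairing_shift[OF assms(3), of k] by (cases x) (auto simp: gshift_lower shift.simps[symmetric] simp del: shift.simps)
 fix x y k l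
 show "glue_alpha sg (glue_alpha sg x) = x"
  using pairing_invol[OF assms(2)] by (cases x) auto
 show "glue_beta ta (glue_beta ta x) = x"
  using pairing_invol[OF assms(3)] by (cases x) auto
 show "glue_alpha sg (gshift (k * int N) x) = gshift (k * int N) (glue_alpha sg x)" by (rule ga)
 show "glue_beta ta (gshift (k * int N) x) = gshift (k * int N) (glue_beta ta x)" by (rule gb)
 show "gshift (0 * int N) x = x" by (cases x) auto
 show "gshift (k * int N) (gshift (l * int N) x) = gshift ((k + l) * int N) x"
  by (cases x) (auto simp: algebra_simps)
 show "gshift (k * int N) x = x ==> k = 0" using assms(1) by (cases x) auto
 have "gres N x \<in> {0,1,2} \<times> {0..<int N}" for x
  using assms(1) by (cases x) auto
 hence "range (gres N) \<subseteq> {0,1,2} \<times> {0..<int N}" by (rule image_subsetI)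
 thus "finite (range (gres N))" by (rule finite_subset) auto
 have m: "\<exists>k. j = i + k * int N" if "i mod int N = j mod int N" for i j
  using that by (metis mod_eqE add.commute mult.commute add_diff_cancel_left' diff_add_cancel)
 show "gres N x = gres N y ==> \<exists>k. y = gshift (k * int N) x"
  by (cases x; cases y) (auto dest: m)
 show "glue_alpha sg x = x ==> glue_beta ta x ~= x"
  using pairing_neq[OF assms(2)] pairing_neq[OF assms(3)]
  by (cases x) (metis glue_upper.simps glue_alpha_upper glue_upper_inj,
   metis glue_upper.simps glue_alpha_upper glue_upper_inj,
   metis glue_lower.simps glue_beta_lower glue_lower_inj)
qed

text \<open>The two edge sets differ only by loops at the end points fixed by an involution, hence
  the comparison of their reflexive closures.\<close>

lemma connected_in_orb:
 assumes "dihedral (glue_alpha sg) (glue_beta ta) T r"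
 shows "connected_in sg ta = dihedral.orb (glue_alpha sg) (glue_beta ta)"
proof -
 have eq: "(range (\<lambda>p. (glue_upper p, glue_upper (sg p))) \<union> range (\<lambda>p. (glue_lower p, glue_lower (ta p))))\<^sup>=
  = (range (\<lambda>x. (x, glue_alpha sg x)) \<union> range (\<lambda>x. (x, glue_beta ta x)))\<^sup>=" (is "?A = ?B")
 proof
  have "(glue_upper p, glue_upper (sg p)) \<in> ?B" "(glue_lower p, glue_lower (ta p)) \<in> ?B" for p
   using glue_alpha_upper[of sg p] glue_beta_lower[of ta p] by (metis UnI1 UnI2 rangeI)+
  thus "?A \<subseteq> ?B" by auto
  have "(x, glue_alpha sg x) \<in> ?A" "(x, glue_beta ta x) \<in> ?A" for x
   by (cases x; force intro: image_eqI[where x = "Outer _"] image_eqI[where x = "Inner _"])+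
  thus "?B \<subseteq> ?A" by auto
 qed
 show ?thesis
  unfolding connected_in_def dihedral.orb_def[OF assms]
  using eq by (metis rtrancl_reflcl)
qed

lemma connected_in_refl [simp]: "(x, x) \<in> connected_in sg ta"
 by (simp add: connected_in_def)

lemma connected_in_trans:
 "(x, y) \<in> connected_in sg ta ==> (y, z) \<in> connected_in sg ta ==> (x, z) \<in> connected_in sg ta"
 by (auto simp: connected_in_def)

text \<open>This makes the definite description in \<open>comp_pairing\<close> meaningful.
  \<open>unique_end\<close> speaks of ends fixed by \<beta>, which are the \<open>Top\<close>
  points; for \<open>Bot\<close> points it is applied with \<alpha> and \<beta> exchanged.\<close>

lemma ex1_partner:
 assumes "N >= 1" "per N sg" "per N ta"
 shows "\<exists>!p'. p' ~= p \<and> (endpoint p, endpoint p') \<in> connected_in sg ta"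
proof -
 note D = dihedral_glue[OF assms]
 have D': "dihedral (glue_beta ta) (glue_alpha sg) (\<lambda>k. gshift (k * int N)) (gres N)"
  using D unfolding dihedral_def by blast
 have sw: "dihedral.orb (glue_beta ta) (glue_alpha sg) = dihedral.orb (glue_alpha sg) (glue_beta ta)"
  by (simp add: dihedral.orb_def[OF D] dihedral.orb_def[OF D'] Un_commute)
 have fixp: "glue_alpha sg w = w \<or> glue_beta ta w = w \<longleftrightarrow> (\<exists>p. w = endpoint p)" for w
 proof (cases w)
  case (Mid i)
  have "glue_alpha sg (Mid i) ~= Mid i" "glue_beta ta (Mid i) ~= Mid i"
   using pairing_neq[OF assms(2)] pairing_neq[OF assms(3)]
   by (metis glue_upper.simps glue_alpha_upper glue_upper_inj,
     metis glue_lower.simps glue_beta_lower glue_lower_inj)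
  thus ?thesis using Mid by simp
 next
  case (Top i)
  thus ?thesis by (auto intro: exI[of _ "Outer i"])
 next
  case (Bot i)
  thus ?thesis by (auto intro: exI[of _ "Inner i"])
 qed
 have "\<exists>!w. w ~= endpoint p \<and> (endpoint p, w) \<in> connected_in sg ta \<and> (\<exists>p. w = endpoint p)"
 proof (cases p)
  case (Outer i)
  thus ?thesis using dihedral.unique_end[OF D, of "endpoint p"]
   by (simp add: fixp connected_in_orb[OF D])
 next
  case (Inner i)
  thus ?thesis using dihedral.unique_end[OF D', of "endpoint p"]
   by (simp add: fixp disj_commute[of "glue_beta ta _ = _"] connected_in_orb[OF D] sw)
 qed
 thus ?thesis by (metis endpoint_inj)
qed

lemma comp_pairing_eqI:
 assumes "N >= 1" "per N sg" "per N ta"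
  and "p' ~= p" "(endpoint p, endpoint p') \<in> connected_in sg ta"
 shows "comp_pairing sg ta p = p'"
 unfolding comp_pairing_def
 by (rule the1_equality) (use assms ex1_partner[OF assms(1-3)] in auto)

lemma comp_pairing_connected:
 assumes "N >= 1" "per N sg" "per N ta"
 shows "comp_pairing sg ta p ~= p" "(endpoint p, endpoint (comp_pairing sg ta p)) \<in> connected_in sg ta"
 using theI'[OF ex1_partner[OF assms, of p]] unfolding comp_pairing_def by auto

lemma sym_glue_edges:
 assumes "per N sg" "per N ta"
 shows "sym (range (\<lambda>p. (glue_upper p, glue_upper (sg p))) \<union> range (\<lambda>p. (glue_lower p, glue_lower (ta p))))"
 using rangeI[of "\<lambda>p. (glue_upper p, glue_upper (sg p))" "sg _"] pairing_invol[OF assms(1)]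
  rangeI[of "\<lambda>p. (glue_lower p, glue_lower (ta p))" "ta _"] pairing_invol[OF assms(2)]
 by (auto intro!: sym_Un symI)

lemma connected_in_sym:
 assumes "per N sg" "per N ta" "(x, y) \<in> connected_in sg ta"
 shows "(y, x) \<in> connected_in sg ta"
 using sym_rtrancl[OF sym_glue_edges[OF assms(1,2)]] assms(3)
 unfolding connected_in_def by (meson symD)

lemma connected_in_shift:
 assumes "per N sg" "per N ta" "(x, y) \<in> connected_in sg ta"
 shows "(gshift (k * int N) x, gshift (k * int N) y) \<in> connected_in sg ta"
 using assms(3) unfolding connected_in_def
proof (induction rule: rtrancl_induct)
 case (step y z)
 have "(gshift (k * int N) y, gshift (k * int N) z) \<in>
  range (\<lambda>p. (glue_upper p, glue_upper (sg p))) \<union> range (\<lambda>p. (glue_lower p, glue_lower (ta p)))"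
  using step(2) pairing_shift[OF assms(1)] pairing_shift[OF assms(2)]
  by (auto simp: gshift_upper gshift_lower simp flip: pairing_shift[OF assms(1)] pairing_shift[OF assms(2)])
 thus ?case using step(3) by (rule rtrancl_into_rtrancl[rotated])
qed simp

lemma gshift_endpoint: "gshift k (endpoint p) = endpoint (shift k p)" by (cases p) auto

lemma shift_inj [simp]: "shift k p = shift k q \<longleftrightarrow> p = q"
 by (cases p; cases q) auto

lemma periodic_comp:
 assumes "N >= 1" "per N sg" "per N ta"
 shows "per N (comp_pairing sg ta)"
 unfolding periodic_pairing_def
proof (intro allI conjI)
 fix p
 note C = comp_pairing_connected[OF assms]
 show "comp_pairing sg ta p ~= p" by (rule C)
 show "comp_pairing sg ta (comp_pairing sg ta p) = p"
  by (rule comp_pairing_eqI[OF assms]) (use C[of p] connected_in_sym[OF assms(2,3)] in auto)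
 show "comp_pairing sg ta (shift (int N) p) = shift (int N) (comp_pairing sg ta p)"
  by (rule comp_pairing_eqI[OF assms])
   (use C[of p] connected_in_shift[OF assms(2,3) C(2), of 1 p] in \<open>auto simp: gshift_endpoint\<close>)
qed

text \<open>Gluings of several layers live on vertices \<open>(level, position)\<close>.\<close>

fun lv :: "nat => nat => bpoint => nat \<times> int" where
 "lv a b (Outer i) = (a, i)"
| "lv a b (Inner i) = (b, i)"

fun emb :: "nat => nat => nat => gpoint => nat \<times> int" where
 "emb a b c (Top i) = (a, i)"
| "emb a b c (Mid i) = (b, i)"
| "emb a b c (Bot i) = (c, i)"

definition edges :: "nat => nat => pairing => ((nat \<times> int) \<times> (nat \<times> int)) set" where
 "edges a b sg = range (\<lambda>p. (lv a b p, lv a b (sg p)))"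

lemma lv_level: "fst (lv a b p) = a \<or> fst (lv a b p) = b" by (cases p) auto

lemma edges_level:
 assumes "(x, y) \<in> edges a b sg"
 shows "(fst x = a \<or> fst x = b) \<and> (fst y = a \<or> fst y = b)"
 using assms lv_level by (auto simp: edges_def)

definition vshift :: "int => nat \<times> int => nat \<times> int" where
 "vshift k v = (fst v, snd v + k)"

lemma vshift_simps [simp]: "fst (vshift k v) = fst v" "vshift k (a, i) = (a, i + k)"
  "vshift 0 v = v" "vshift k (vshift l v) = vshift (k + l) v"
 by (auto simp: vshift_def)

lemma lv_shift: "lv a b (shift k p) = vshift k (lv a b p)" by (cases p) auto
lemma emb_upper [simp]: "emb a b c (glue_upper p) = lv a b p" by (cases p) auto
lemma emb_lower [simp]: "emb a b c (glue_lower p) = lv b c p" by (cases p) auto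
lemma emb_endpoint [simp]: "emb a b c (endpoint p) = lv a c p" by (cases p) auto

lemma rtrancl_inj_image:
 assumes "inj f" "R = map_prod f f ` S"
 shows "(f x, y) \<in> R^* \<longleftrightarrow> (\<exists>y'. y = f y' \<and> (x, y') \<in> S^*)"
proof
 assume "(f x, y) \<in> R^*"
 thus "\<exists>y'. y = f y' \<and> (x, y') \<in> S^*"
 proof (induction rule: rtrancl_induct)
  case (step y z)
  thus ?case using assms by (auto simp: inj_eq intro: rtrancl_into_rtrancl)
 qed auto
next
 have "(f x, f y') \<in> R^*" if "(x, y') \<in> S^*" for y'
  using that by (induction rule: rtrancl_induct) (auto simp: assms(2) intro: rtrancl_into_rtrancl)
 thus "\<exists>y'. y = f y' \<and> (x, y') \<in> S^* ==> (f x, y) \<in> R^*" by auto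
qed

lemma inj_emb: "distinct [a, b, c] ==> inj (emb a b c)"
 by (rule injI) (auto elim!: emb.elims)

lemma edges_image:
 "edges a b sg \<union> edges b c ta = map_prod (emb a b c) (emb a b c) `
  (range (\<lambda>p. (glue_upper p, glue_upper (sg p))) \<union> range (\<lambda>p. (glue_lower p, glue_lower (ta p))))"
 by (simp add: edges_def image_Un image_image)

lemma connected_in_emb:
 assumes "distinct [a, b, c]"
 shows "(emb a b c x, y) \<in> (edges a b sg \<union> edges b c ta)^* \<longleftrightarrow>
  (\<exists>y'. y = emb a b c y' \<and> (x, y') \<in> connected_in sg ta)"
 unfolding connected_in_def
 by (rule rtrancl_inj_image[OF inj_emb[OF assms] edges_image])

lemma connected_in_emb':
 assumes "distinct [a, b, c]"
 shows "(emb a b c x, emb a b c y) \<in> (edges a b sg \<union> edges b c ta)^* \<longleftrightarrow> (x, y) \<in> connected_in sg ta"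
 using connected_in_emb[OF assms, of x "emb a b c y"] inj_emb[OF assms] by (auto simp: inj_eq)

section \<open>Contracting a layer\<close>

text \<open>A path is cut at its \<open>E2\<close>-edges. These never touch \<open>I\<close>, so
  each \<open>E1\<close>-stretch between them starts and ends outside \<open>I\<close> and is a
  single edge of the contracted relation.\<close>

lemma contract_outside:
 assumes E2: "E2 \<inter> (I \<times> UNIV \<union> UNIV \<times> I) = {}" and x: "x \<notin> I" and y: "y \<notin> I"
 shows "(x, y) \<in> (E1 \<union> E2)^* \<longleftrightarrow> (x, y) \<in> ((E1^* \<inter> (- I) \<times> (- I)) \<union> E2)^*" (is "?l \<longleftrightarrow> (x, y) \<in> ?R^*")
proof
 assume ?l
 hence "\<exists>p. p \<notin> I \<and> (x, p) \<in> ?R^* \<and> (p, y) \<in> E1^*"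
 proof (induction rule: rtrancl_induct)
  case base
  thus ?case using x by blast
 next
  case (step y z)
  then obtain p where p: "p \<notin> I" "(x, p) \<in> ?R^*" "(p, y) \<in> E1^*" by blast
  show ?case
  proof (cases "(y, z) \<in> E1")
   case True
   thus ?thesis using p by (blast intro: rtrancl_into_rtrancl)
  next
   case False
   hence yz: "(y, z) \<in> E2" using step by blast
   hence "y \<notin> I" "z \<notin> I" using E2 by blast+
   hence "(p, y) \<in> ?R" using p by blast
   hence "(x, z) \<in> ?R^*" using p yz by (meson UnI2 rtrancl.rtrancl_into_rtrancl)
   thus ?thesis using \<open>z \<notin> I\<close> by blast
  qed
 qed
 then obtain p where p: "p \<notin> I" "(x, p) \<in> ?R^*" "(p, y) \<in> E1^*" by blast
 hence "(p, y) \<in> ?R" using y by blast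
 thus "(x, y) \<in> ?R^*" using p by (meson rtrancl.rtrancl_into_rtrancl)
next
 have "?R \<subseteq> (E1 \<union> E2)^*" by (auto intro: in_rtrancl_UnI)
 hence "?R^* \<subseteq> (E1 \<union> E2)^*" by (metis rtrancl_idemp rtrancl_mono)
 thus "(x, y) \<in> ?R^* ==> ?l" by blast
qed

lemma contract_inside:
 assumes E2: "E2 \<inter> (I \<times> UNIV \<union> UNIV \<times> I) = {}" and x: "!!y. (x, y) \<in> E1^* ==> y \<in> I"
 shows "(x, y) \<in> (E1 \<union> E2)^* \<longleftrightarrow> (x, y) \<in> E1^*"
proof
 show "(x, y) \<in> (E1 \<union> E2)^* ==> (x, y) \<in> E1^*"
 proof (induction rule: rtrancl_induct)
  case (step y z)
  hence "(y, z) \<in> E1" using E2 x by blast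
  thus ?case using step by (auto intro: rtrancl_into_rtrancl)
 qed simp
qed (auto intro: in_rtrancl_UnI)

text \<open>Outside the middle level, the components of the two glued layers are the pairs of end
  points joined by the composite pairing. As every point is also connected to itself, the relations
  agree only up to reflexive closure, which suffices under \<open>^*\<close>.\<close>

lemma contract_edges:
 assumes N: "N >= 1" "per N sg" "per N ta"
  and d: "distinct [a, b, c]"
  and E2: "!!x y. (x, y) \<in> E2 ==> fst x ~= b \<and> fst y ~= b"
  and x: "fst x ~= b" and y: "fst y ~= b"
 shows "(x, y) \<in> (edges a b sg \<union> edges b c ta \<union> E2)^* \<longleftrightarrow>
  (x, y) \<in> (edges a c (comp_pairing sg ta) \<union> E2)^*"
proof -
 define E1 where "E1 = edges a b sg \<union> edges b c ta"
 define I where "I = {v::nat \<times> int. fst v = b}"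
 have "(x, y) \<in> (E1 \<union> E2)^* \<longleftrightarrow> (x, y) \<in> ((E1^* \<inter> (- I) \<times> (- I)) \<union> E2)^*"
  by (rule contract_outside) (use assms in \<open>auto simp: I_def\<close>)
 also have "((E1^* \<inter> (- I) \<times> (- I)) \<union> E2)\<^sup>= = (edges a c (comp_pairing sg ta) \<union> E2)\<^sup>="
 proof -
  have "(lv a c p, lv a c (comp_pairing sg ta p)) \<in> E1^*" for p
   using comp_pairing_connected(2)[OF N, of p] connected_in_emb'[OF d, of "endpoint p" "endpoint (comp_pairing sg ta p)"]
   unfolding E1_def by simp
  moreover have "lv a c p \<notin> I" for p using d by (cases p) (auto simp: I_def)
  ultimately have 1: "edges a c (comp_pairing sg ta) \<subseteq> E1^* \<inter> (- I) \<times> (- I)"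
   by (auto simp: edges_def)
  have 2: "(v, w) \<in> (edges a c (comp_pairing sg ta))\<^sup>=" if vw: "(v, w) \<in> E1^*" "v \<notin> I" "w \<notin> I" for v w
  proof (cases "\<exists>p. v = lv a c p")
   case True
   then obtain p where p: "v = emb a b c (endpoint p)" by auto
   then obtain w' where w': "w = emb a b c w'" "(endpoint p, w') \<in> connected_in sg ta"
    using vw(1) connected_in_emb[OF d] unfolding E1_def by blast
   then obtain p' where p': "w' = endpoint p'"
    using vw(3) by (cases w') (auto simp: I_def intro: that[of "Outer _"] that[of "Inner _"])
   show ?thesis
   proof (cases "p' = p")
    case False
    hence "comp_pairing sg ta p = p'" using comp_pairing_eqI[OF N] w' p' by blast
    thus ?thesis using p p' w' by (auto simp: edges_def)
   qed (use p w' p' in auto)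
  next
   case False
   hence "fst v ~= a" "fst v ~= c"
    by (metis lv.simps prod.collapse)+
   hence "(v, z) \<notin> E1" for z using vw(2)
    by (auto simp: E1_def I_def dest: edges_level)
   hence "w = v" using vw(1) by (metis converse_rtranclE)
   thus ?thesis by simp
  qed
  show ?thesis using 1 2 by blast
 qed
 hence "((E1^* \<inter> (- I) \<times> (- I)) \<union> E2)^* = (edges a c (comp_pairing sg ta) \<union> E2)^*"
  by (metis rtrancl_reflcl)
 finally show ?thesis by (simp add: E1_def)
qed

text \<open>Both sides describe how end points are connected in the gluing of all three layers, on
  levels 0 to 3: contracting level 1 gives the left side, contracting level 2 the right
  side.\<close>

lemma comp_pairing_assoc:
 assumes N: "N >= 1" "per N sg" "per N ta" "per N up"
 shows "comp_pairing (comp_pairing sg ta) up = comp_pairing sg (comp_pairing ta up)"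
proof -
 have l: "(endpoint p, endpoint p') \<in> connected_in (comp_pairing sg ta) up \<longleftrightarrow>
  (lv 0 3 p, lv 0 3 p') \<in> (edges 0 1 sg \<union> edges 1 2 ta \<union> edges 2 3 up)^*" for p p'
 proof -
  have "(lv 0 3 p, lv 0 3 p') \<in> (edges 0 1 sg \<union> edges 1 2 ta \<union> edges 2 3 up)^* \<longleftrightarrow>
   (lv 0 3 p, lv 0 3 p') \<in> (edges 0 2 (comp_pairing sg ta) \<union> edges 2 3 up)^*"
   by (rule contract_edges[OF N(1-3)])
    (use lv_level[of 0 3 p] lv_level[of 0 3 p'] in \<open>auto dest: edges_level\<close>)
  thus ?thesis using connected_in_emb'[of 0 2 3 "endpoint p" "endpoint p'"] by simp
 qed
 have r: "(endpoint p, endpoint p') \<in> connected_in sg (comp_pairing ta up) \<longleftrightarrow>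
  (lv 0 3 p, lv 0 3 p') \<in> (edges 0 1 sg \<union> edges 1 2 ta \<union> edges 2 3 up)^*" for p p'
 proof -
  have "(lv 0 3 p, lv 0 3 p') \<in> (edges 1 2 ta \<union> edges 2 3 up \<union> edges 0 1 sg)^* \<longleftrightarrow>
   (lv 0 3 p, lv 0 3 p') \<in> (edges 1 3 (comp_pairing ta up) \<union> edges 0 1 sg)^*"
   by (rule contract_edges[OF N(1,3,4)])
    (use lv_level[of 0 3 p] lv_level[of 0 3 p'] in \<open>auto dest: edges_level\<close>)
  thus ?thesis using connected_in_emb'[of 0 1 3 "endpoint p" "endpoint p'"] by (simp add: Un_ac)
 qed
 show ?thesis by (rule ext) (simp add: comp_pairing_def[of "comp_pairing sg ta" up] comp_pairing_def[of sg "comp_pairing ta up"] l r)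
qed

section \<open>Counting loops\<close>

definition closed_at :: "((nat \<times> int) \<times> (nat \<times> int)) set => nat set => nat \<times> int => bool" where
 "closed_at E Q v \<longleftrightarrow> (\<forall>w. (v, w) \<in> E^* --> fst w \<notin> Q)"

definition winds :: "nat => ((nat \<times> int) \<times> (nat \<times> int)) set => nat \<times> int => bool" where
 "winds N E v \<longleftrightarrow> (\<exists>k. k ~= 0 \<and> (v, vshift (k * int N) v) \<in> E^*)"

definition loop_class :: "nat => ((nat \<times> int) \<times> (nat \<times> int)) set => nat \<times> int => (nat \<times> int) set" where
 "loop_class N E v = {w. \<exists>k. (v, vshift (k * int N) w) \<in> E^*}"

text \<open>Loops are counted in the annulus, as components up to translation. \<open>V\<close> is
  the set of interior levels in which they are looked for, \<open>Q\<close> the set of boundary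
  levels they must avoid, and \<open>t\<close> selects the non-contractible ones. Keeping
  \<open>V\<close> and \<open>Q\<close> variable lets one notion serve gluings of two and of three
  layers.\<close>

definition loop_count where
 "loop_count N E V Q t = card (loop_class N E ` {v. fst v \<in> V \<and> closed_at E Q v \<and> winds N E v = t})"

locale periodic_graph =
 fixes N :: nat and E :: "((nat \<times> int) \<times> (nat \<times> int)) set"
 assumes N1: "N >= 1" and symE: "sym E"
  and shE: "(v, w) \<in> E ==> (vshift (k * int N) v, vshift (k * int N) w) \<in> E"
begin

lemma conn_sym: "(v, w) \<in> E^* ==> (w, v) \<in> E^*"
 using sym_rtrancl[OF symE] by (meson symD)

lemma conn_shift: "(v, w) \<in> E^* ==> (vshift (k * int N) v, vshift (k * int N) w) \<in> E^*"
 by (induction rule: rtrancl_induct) (auto intro: rtrancl_into_rtrancl shE)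

lemma conn_unshift: "(v, vshift (k * int N) w) \<in> E^* \<longleftrightarrow> (vshift (- k * int N) v, w) \<in> E^*"
 using conn_shift[of v "vshift (k * int N) w" "- k"] conn_shift[of "vshift (- k * int N) v" w k] by auto

lemma loop_class_eq: "loop_class N E v = loop_class N E w \<longleftrightarrow> (\<exists>k. (v, vshift (k * int N) w) \<in> E^*)"
proof
 assume "loop_class N E v = loop_class N E w"
 moreover have "w \<in> loop_class N E w" by (auto simp: loop_class_def intro: exI[of _ 0])
 ultimately show "\<exists>k. (v, vshift (k * int N) w) \<in> E^*" by (auto simp: loop_class_def)
next
 have sub: "loop_class N E w \<subseteq> loop_class N E v" if "(v, vshift (k * int N) w) \<in> E^*" for v w k
 proof
  fix z assume "z \<in> loop_class N E w"
  then obtain l where "(w, vshift (l * int N) z) \<in> E^*" by (auto simp: loop_class_def)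
  from conn_shift[OF this, of k] that have "(v, vshift ((k + l) * int N) z) \<in> E^*"
   by (auto simp: distrib_right)
  thus "z \<in> loop_class N E v" by (auto simp: loop_class_def)
 qed
 assume "\<exists>k. (v, vshift (k * int N) w) \<in> E^*"
 then obtain k where k: "(v, vshift (k * int N) w) \<in> E^*" by blast
 hence "(w, vshift (- k * int N) v) \<in> E^*"
  using conn_unshift[of v k w] conn_sym by blast
 thus "loop_class N E v = loop_class N E w" using sub k by blast
qed

lemma finite_loop_classes:
 assumes "finite V" shows "finite (loop_class N E ` {v. fst v \<in> V \<and> P v})"
proof (rule finite_subset)
 show "loop_class N E ` {v. fst v \<in> V \<and> P v} \<subseteq> loop_class N E ` (V \<times> {0..<int N})"
 proof (intro subsetI, elim imageE)
  fix c v assume v: "c = loop_class N E v" "v \<in> {v. fst v \<in> V \<and> P v}"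
  define w where "w = (fst v, snd v mod int N)"
  have "v = vshift ((snd v div int N) * int N) w"
   by (simp add: w_def prod_eq_iff vshift_def)
  hence "(v, vshift ((snd v div int N) * int N) w) \<in> E^*" by simp
  hence "loop_class N E v = loop_class N E w" using loop_class_eq by blast
  moreover have "w \<in> V \<times> {0..<int N}" using v N1 by (auto simp: w_def)
  ultimately show "c \<in> loop_class N E ` (V \<times> {0..<int N})" using v by blast
 qed
 show "finite (loop_class N E ` (V \<times> {0..<int N}))" using assms by auto
qed

lemma closed_at_conn: "(v, w) \<in> E^* ==> closed_at E Q v \<longleftrightarrow> closed_at E Q w"
 unfolding closed_at_def by (meson conn_sym rtrancl_trans)

lemma closed_at_shift: "closed_at E Q (vshift (k * int N) v) \<longleftrightarrow> closed_at E Q v"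
proof -
 have "closed_at E Q v ==> closed_at E Q (vshift (k * int N) v)" for k v
  unfolding closed_at_def
 proof (intro allI impI)
  fix w assume a: "\<forall>w. (v, w) \<in> E^* --> fst w \<notin> Q" and "(vshift (k * int N) v, w) \<in> E^*"
  hence "(v, vshift (- k * int N) w) \<in> E^*" using conn_shift[of "vshift (k * int N) v" w "- k"] by simp
  thus "fst w \<notin> Q" using a by (metis vshift_simps(1))
 qed
 from this[of v k] this[of "vshift (k * int N) v" "- k"] show ?thesis by auto
qed

lemma winds_conn: assumes "(v, w) \<in> E^*" shows "winds N E v \<longleftrightarrow> winds N E w"
proof -
 have "winds N E w" if vw: "winds N E v" "(v, w) \<in> E^*" for v w
 proof -
  obtain k where "k ~= 0" "(v, vshift (k * int N) v) \<in> E^*" using vw by (auto simp: winds_def)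
  moreover have "(w, v) \<in> E^*" "(vshift (k * int N) v, vshift (k * int N) w) \<in> E^*"
   using vw conn_sym conn_shift by auto
  ultimately show ?thesis unfolding winds_def by (meson rtrancl_trans)
 qed
 thus ?thesis using assms conn_sym by blast
qed

lemma winds_shift: "winds N E (vshift (k * int N) v) \<longleftrightarrow> winds N E v"
proof -
 have *: "winds N E (vshift (k * int N) v)" if w: "winds N E v" for k v
 proof -
  obtain l where "l ~= 0" "(v, vshift (l * int N) v) \<in> E^*" using w by (auto simp: winds_def)
  thus ?thesis using conn_shift[of v "vshift (l * int N) v" k]
   by (auto simp: winds_def add.commute)
 qed
 from *[of v k] *[of "vshift (k * int N) v" "- k"] show ?thesis by auto
qed

lemma loop_class_closed:
 assumes "loop_class N E v = loop_class N E w"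
 shows "closed_at E Q v \<longleftrightarrow> closed_at E Q w" "winds N E v \<longleftrightarrow> winds N E w"
proof -
 obtain k where k: "(v, vshift (k * int N) w) \<in> E^*" using assms loop_class_eq by blast
 show "closed_at E Q v \<longleftrightarrow> closed_at E Q w" using closed_at_conn[OF k] closed_at_shift by simp
 show "winds N E v \<longleftrightarrow> winds N E w" using winds_conn[OF k] winds_shift by simp
qed

end

text \<open>Used to compare numbers of loop classes formed in two different graphs: \<open>f\<close>
  and \<open>g\<close> after \<open>h\<close> have the same fibres on \<open>S\<close>.\<close>

lemma card_image_eq:
 assumes "h ` S = S'" "!!x y. x \<in> S ==> y \<in> S ==> f x = f y \<longleftrightarrow> g (h x) = g (h y)"
 shows "card (f ` S) = card (g ` S')"
proof -
 have "\<forall>c\<in>f ` S. \<exists>x. x \<in> S \<and> f x = c" by blast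
 then obtain r where r: "!!c. c \<in> f ` S ==> r c \<in> S" "!!c. c \<in> f ` S ==> f (r c) = c"
  by (metis bchoice)
 have "bij_betw (\<lambda>c. g (h (r c))) (f ` S) (g ` S')"
 proof (rule bij_betwI')
  fix c d assume cd: "c \<in> f ` S" "d \<in> f ` S"
  show "(g (h (r c)) = g (h (r d))) = (c = d)"
   using assms(2)[OF r(1)[OF cd(1)] r(1)[OF cd(2)]] r(2)[OF cd(1)] r(2)[OF cd(2)] by simp
 next
  fix c assume "c \<in> f ` S"
  thus "g (h (r c)) \<in> g ` S'" using r(1) assms(1) by blast
 next
  fix b assume "b \<in> g ` S'"
  then obtain x where x: "x \<in> S" "b = g (h x)" using assms(1) by blast
  have "f x \<in> f ` S" using x by blast
  thus "\<exists>c\<in>f ` S. b = g (h (r c))"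
   using assms(2)[OF x(1) r(1)] r(2) x(2) by (intro bexI[of _ "f x"]) auto
 qed
 thus ?thesis by (rule bij_betw_same_card)
qed

lemma sym_edges: "per N sg ==> sym (edges a b sg)"
 unfolding edges_def
 using rangeI[of "\<lambda>p. (lv a b p, lv a b (sg p))" "sg _"] pairing_invol[of N sg]
 by (auto intro!: symI)

lemma shift_edges:
 assumes "per N sg" "(v, w) \<in> edges a b sg"
 shows "(vshift (k * int N) v, vshift (k * int N) w) \<in> edges a b sg"
proof -
 obtain p where "v = lv a b p" "w = lv a b (sg p)" using assms(2) by (auto simp: edges_def)
 hence "(vshift (k * int N) v, vshift (k * int N) w) =
   (lv a b (shift (k * int N) p), lv a b (sg (shift (k * int N) p)))"
  by (simp add: lv_shift pairing_shift[OF assms(1)])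
 thus ?thesis by (auto simp: edges_def)
qed

lemma periodic_graph_edges: "N >= 1 ==> per N sg ==> periodic_graph N (edges a b sg)"
 by unfold_locales (auto intro: sym_edges shift_edges)

lemma periodic_graph_Un: "periodic_graph N E ==> periodic_graph N E' ==> periodic_graph N (E \<union> E')"
 unfolding periodic_graph_def by (auto intro: sym_Un)


context periodic_graph begin

text \<open>There are only \<open>N\<close> residues. A component without a nontrivial translate of
  its point meets each residue at most once on the level; one that contains such a translate
  contains all its multiples. So the finiteness used to define contractible loops is the absence of
  winding.\<close>

lemma finite_level: "finite {j. ((b, i), (b, j)) \<in> E^*} \<longleftrightarrow> \<not> winds N E (b, i)"
proof
 assume f: "finite {j. ((b, i), (b, j)) \<in> E^*}"
 show "\<not> winds N E (b, i)"
 proof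
  assume "winds N E (b, i)"
  then obtain k where k: "k ~= 0" "((b, i), (b, i + k * int N)) \<in> E^*" by (auto simp: winds_def)
  have "((b, i), (b, i + int n * (k * int N))) \<in> E^*" for n
  proof (induction n)
   case (Suc n)
   have "((b, i + int n * (k * int N)), (b, i + k * int N + int n * (k * int N))) \<in> E^*"
    using conn_shift[OF k(2), of "int n * k"] by (simp add: mult.assoc)
   with Suc show ?case by (auto simp: algebra_simps intro: rtrancl_trans)
  qed simp
  hence "range (\<lambda>n::nat. i + int n * (k * int N)) \<subseteq> {j. ((b, i), (b, j)) \<in> E^*}" by auto
  hence "finite (range (\<lambda>n::nat. i + int n * (k * int N)))" using f finite_subset by blast
  moreover have "inj (\<lambda>n::nat. i + int n * (k * int N))" using k N1 by (auto simp: inj_def)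
  ultimately show False using finite_imageD infinite_UNIV_nat by blast
 qed
next
 assume w: "\<not> winds N E (b, i)"
 have "inj_on (\<lambda>j. j mod int N) {j. ((b, i), (b, j)) \<in> E^*}"
 proof (rule inj_onI, rule ccontr)
  fix x y assume xy: "x \<in> {j. ((b, i), (b, j)) \<in> E^*}" "y \<in> {j. ((b, i), (b, j)) \<in> E^*}"
   "x mod int N = y mod int N" "x ~= y"
  then obtain k where k: "y = x + k * int N"
   by (metis mod_eqE add.commute mult.commute add_diff_cancel_left' diff_add_cancel)
  have "((b, x), (b, i)) \<in> E^*" "((b, i), (b, y)) \<in> E^*" using xy conn_sym by auto
  hence "((b, x), (b, y)) \<in> E^*" by (rule rtrancl_trans)
  hence "winds N E (b, x)" using k xy(4) by (auto simp: winds_def)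
  thus False using w winds_conn xy(1) by blast
 qed
 moreover have "finite ((\<lambda>j. j mod int N) ` {j. ((b, i), (b, j)) \<in> E^*})"
  by (rule finite_subset[of _ "{0..<int N}"]) (use N1 in auto)
 ultimately show "finite {j. ((b, i), (b, j)) \<in> E^*}" using finite_imageD by blast
qed

lemma translates_level: "translates N {j. ((b, i), (b, j)) \<in> E^*} = translates N {j. ((b, i'), (b, j)) \<in> E^*}
 \<longleftrightarrow> loop_class N E (b, i) = loop_class N E (b, i')" (is "translates N (?C i) = _ \<longleftrightarrow> _")
proof
 assume eq: "translates N (?C i) = translates N (?C i')"
 have "?C i = (\<lambda>j. j + 0 * int N) ` ?C i" by simp
 hence "?C i \<in> translates N (?C i)" unfolding translates_def by (rule range_eqI)
 then obtain k where k: "?C i = (\<lambda>j. j + k * int N) ` ?C i'" using eq by (auto simp: translates_def)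
 have "i' + k * int N \<in> ?C i" unfolding k by auto
 thus "loop_class N E (b, i) = loop_class N E (b, i')" by (auto simp: loop_class_eq)
next
 assume "loop_class N E (b, i) = loop_class N E (b, i')"
 then obtain k where k: "((b, i), (b, i' + k * int N)) \<in> E^*" by (auto simp: loop_class_eq)
 have "?C i = ?C (i' + k * int N)" using k conn_sym[OF k] by (auto elim: rtrancl_trans)
 also have "\<dots> = (\<lambda>j. j + k * int N) ` ?C i'"
 proof (intro subset_antisym subsetI)
  fix x assume "x \<in> ?C (i' + k * int N)"
  hence "x - k * int N \<in> ?C i'"
   using conn_shift[of "(b, i' + k * int N)" "(b, x)" "- k"] by simp
  thus "x \<in> (\<lambda>j. j + k * int N) ` ?C i'" by (intro image_eqI[of _ _ "x - k * int N"]) simp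
 qed (use conn_shift[of "(b, i')" _ k] in auto)
 finally have C: "?C i = (\<lambda>j. j + k * int N) ` ?C i'" .
 show "translates N (?C i) = translates N (?C i')"
  unfolding translates_def C image_image
 proof (intro subset_antisym subsetI; elim imageE)
  fix x l assume "x = (\<lambda>j. j + k * int N + l * int N) ` ?C i'"
  hence "x = (\<lambda>j. j + (k + l) * int N) ` ?C i'" by (simp add: algebra_simps)
  thus "x \<in> range (\<lambda>l. (\<lambda>j. j + l * int N) ` ?C i')" by blast
 next
  fix x l assume "x = (\<lambda>j. j + l * int N) ` ?C i'"
  hence "x = (\<lambda>j. j + k * int N + (l - k) * int N) ` ?C i'" by (simp add: algebra_simps)
  thus "x \<in> range (\<lambda>l. (\<lambda>j. j + k * int N + l * int N) ` ?C i')" by blast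
 qed
qed

end

lemma loops_loop_count:
 assumes N: "N >= 1" "per N sg" "per N ta" and d: "distinct [a, b, c]"
 shows "contractible_loops N sg ta = loop_count N (edges a b sg \<union> edges b c ta) {b} {a, c} False"
  and "noncontractible_loops N sg ta = loop_count N (edges a b sg \<union> edges b c ta) {b} {a, c} True"
proof -
 define E where "E = edges a b sg \<union> edges b c ta"
 interpret periodic_graph N E
  unfolding E_def by (intro periodic_graph_Un periodic_graph_edges N)
 have mid: "(Mid i, Mid j) \<in> connected_in sg ta \<longleftrightarrow> ((b, i), (b, j)) \<in> E^*" for i j
  using connected_in_emb'[OF d, of "Mid i" "Mid j" sg ta] by (simp add: E_def)
 have cl: "(\<forall>p. (Mid i, endpoint p) \<notin> connected_in sg ta) \<longleftrightarrow> closed_at E {a, c} (b, i)" for i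
 proof -
  have "(Mid i, endpoint p) \<in> connected_in sg ta \<longleftrightarrow> ((b, i), lv a c p) \<in> E^*" for p
   using connected_in_emb'[OF d, of "Mid i" "endpoint p" sg ta] by (simp add: E_def)
  moreover have "(\<forall>p. ((b, i), lv a c p) \<notin> E^*) \<longleftrightarrow> closed_at E {a, c} (b, i)"
   unfolding closed_at_def by (metis insert_iff empty_iff lv.simps lv_level prod.collapse)
  ultimately show ?thesis by simp
 qed
 define comp where "comp i = {j. ((b, i), (b, j)) \<in> E^*}" for i
 have closed: "closed_components sg ta = comp ` {i. closed_at E {a, c} (b, i)}"
  by (auto simp: closed_components_def mid cl comp_def)
 have "card (translates N ` {C \<in> closed_components sg ta. finite C = f}) = loop_count N E {b} {a, c} (\<not> f)" for f
 proof -
  have "translates N ` {C \<in> closed_components sg ta. finite C = f} =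
    (\<lambda>i. translates N (comp i)) ` {i. closed_at E {a, c} (b, i) \<and> winds N E (b, i) = (\<not> f)}"
   unfolding closed by (auto simp: comp_def finite_level)
  moreover have "card ((\<lambda>i. translates N (comp i)) ` {i. closed_at E {a, c} (b, i) \<and> winds N E (b, i) = (\<not> f)})
   = card (loop_class N E ` {v. fst v \<in> {b} \<and> closed_at E {a, c} v \<and> winds N E v = (\<not> f)})"
   by (rule card_image_eq[where h = "\<lambda>i. (b, i)"]) (auto simp: comp_def translates_level)
  ultimately show ?thesis by (simp add: loop_count_def)
 qed
 from this[of True] this[of False]
 show "contractible_loops N sg ta = loop_count N (edges a b sg \<union> edges b c ta) {b} {a, c} False"
  and "noncontractible_loops N sg ta = loop_count N (edges a b sg \<union> edges b c ta) {b} {a, c} True"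
  by (simp_all add: contractible_loops_def noncontractible_loops_def E_def)
qed

text \<open>Here \<open>m\<close> is whichever of \<open>a\<close> and \<open>c\<close> is interior
  to the larger gluing. A loop through the interior levels either stays on level \<open>b\<close>,
  and then is already a loop of the two glued layers, or it meets level \<open>m\<close>, and then
  survives the contraction of level \<open>b\<close>.\<close>

lemma contract_loop_count:
 assumes N: "N >= 1" "per N sg" "per N ta" and d: "distinct [a, b, c]"
  and g2: "periodic_graph N E2"
  and E2: "!!x y. (x, y) \<in> E2 ==> fst x ~= b \<and> fst y ~= b"
  and Q: "b \<notin> Q" "m \<notin> Q" "m = a \<or> m = c" "{a, c} \<subseteq> insert m Q"
 shows "loop_count N (edges a b sg \<union> edges b c ta \<union> E2) {b, m} Q t =
  loop_count N (edges a b sg \<union> edges b c ta) {b} {a, c} t +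
  loop_count N (edges a c (comp_pairing sg ta) \<union> E2) {m} Q t"
proof -
 define E1 where "E1 = edges a b sg \<union> edges b c ta"
 define G where "G = E1 \<union> E2"
 define R where "R = edges a c (comp_pairing sg ta) \<union> E2"
 interpret E1: periodic_graph N E1
  unfolding E1_def by (intro periodic_graph_Un periodic_graph_edges N)
 interpret R: periodic_graph N R
  unfolding R_def by (intro periodic_graph_Un periodic_graph_edges periodic_comp N g2)
 interpret G: periodic_graph N G
  unfolding G_def by (intro periodic_graph_Un g2) unfold_locales
 have GR: "(x, y) \<in> G^* \<longleftrightarrow> (x, y) \<in> R^*" if "fst x ~= b" "fst y ~= b" for x y
  unfolding G_def E1_def R_def by (rule contract_edges[OF N d E2 that]) auto
 have mb: "m ~= b" using Q d by auto
 define S where "S V = {v. fst v \<in> V \<and> closed_at G Q v \<and> winds N G v = t}" for V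
 define S' where "S' = {v \<in> S {b}. \<forall>w. (v, w) \<in> G^* --> fst w ~= m}"
 have E1_level: "fst w \<in> {a, b, c}" if "(v, w) \<in> E1^*" "fst v = b" for v w
  using that by (induction rule: rtrancl_induct) (auto simp: E1_def dest: edges_level)
 have E1_sub: "E1^* \<subseteq> G^*" by (simp add: G_def rtrancl_mono)
 have ins: "(v, w) \<in> G^* \<longleftrightarrow> (v, w) \<in> E1^*" if "fst v = b" "closed_at E1 {a, c} v" for v w
  unfolding G_def
 proof (rule contract_inside[where I = "{w. fst w = b}"])
  show "E2 \<inter> ({w. fst w = b} \<times> UNIV \<union> UNIV \<times> {w. fst w = b}) = {}" using E2 by fastforce
  fix y assume "(v, y) \<in> E1^*"
  thus "y \<in> {w. fst w = b}" using that E1_level[of v y] unfolding closed_at_def by blast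
 qed
 \<comment> \<open>The set \<open>S'\<close> collects the points of the first kind, whose component
   never reaches level \<open>m\<close>. No edge of \<open>E2\<close> can enter such a
   component.\<close>
 have S'_eq: "S' = {v. fst v \<in> {b} \<and> closed_at E1 {a, c} v \<and> winds N E1 v = t}"
 proof (intro subset_antisym subsetI)
  fix v assume v: "v \<in> S'"
  have "closed_at E1 {a, c} v"
   unfolding closed_at_def
  proof (intro allI impI)
   fix w assume "(v, w) \<in> E1^*"
   hence "(v, w) \<in> G^*" using E1_sub by blast
   hence "fst w \<notin> insert m Q" using v unfolding S'_def S_def closed_at_def by blast
   thus "fst w \<notin> {a, c}" using Q(4) by blast
  qed
  thus "v \<in> {v. fst v \<in> {b} \<and> closed_at E1 {a, c} v \<and> winds N E1 v = t}"
   using v ins[of v] by (auto simp: S'_def S_def winds_def)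
 next
  fix v assume v: "v \<in> {v. fst v \<in> {b} \<and> closed_at E1 {a, c} v \<and> winds N E1 v = t}"
  hence fb: "fst w = b" if "(v, w) \<in> G^*" for w
   using that ins[of v w] E1_level[of v w] unfolding closed_at_def mem_Collect_eq by blast
  thus "v \<in> S'" using v ins[of v] mb Q(1) by (auto simp: S'_def S_def winds_def closed_at_def)
 qed
 have "loop_class N G ` S {b, m} = loop_class N G ` S' \<union> loop_class N G ` S {m}"
 proof
  show "loop_class N G ` S {b, m} \<subseteq> loop_class N G ` S' \<union> loop_class N G ` S {m}"
  proof (intro subsetI, elim imageE)
   fix z v assume v: "z = loop_class N G v" "v \<in> S {b, m}"
   show "z \<in> loop_class N G ` S' \<union> loop_class N G ` S {m}"
   proof (cases "v \<in> S' \<or> fst v = m")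
    case True
    thus ?thesis using v by (auto simp: S_def)
   next
    case False
    hence "v \<in> S {b}" "v \<notin> S'" using v by (auto simp: S_def)
    then obtain w where w: "(v, w) \<in> G^*" "fst w = m" by (auto simp: S'_def)
    hence eq: "loop_class N G v = loop_class N G w"
     unfolding G.loop_class_eq by (intro exI[of _ 0]) simp
    hence "w \<in> S {m}" using v w G.loop_class_closed[OF eq] by (auto simp: S_def)
    thus ?thesis using eq v by blast
   qed
  qed
 qed (auto simp: S_def S'_def)
 moreover have "loop_class N G ` S' \<inter> loop_class N G ` S {m} = {}"
 proof (rule ccontr)
  assume "\<not> ?thesis"
  then obtain v w where vw: "v \<in> S'" "w \<in> S {m}" "loop_class N G v = loop_class N G w" by blast
  then obtain k where "(v, vshift (k * int N) w) \<in> G^*" using G.loop_class_eq by blast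
  hence "fst (vshift (k * int N) w) ~= m" using vw(1) unfolding S'_def by blast
  thus False using vw(2) by (simp add: S_def)
 qed
 moreover have "finite (loop_class N G ` S')" "finite (loop_class N G ` S {m})"
  using G.finite_loop_classes[of "{b}" "\<lambda>v. closed_at G Q v \<and> winds N G v = t"]
   G.finite_loop_classes[of "{m}" "\<lambda>v. closed_at G Q v \<and> winds N G v = t"]
  by (auto simp: S_def S'_def elim!: finite_subset[rotated])
 ultimately have "card (loop_class N G ` S {b, m}) = card (loop_class N G ` S') + card (loop_class N G ` S {m})"
  by (simp add: card_Un_disjoint)
 moreover have "card (loop_class N G ` S') = loop_count N E1 {b} {a, c} t"
  unfolding loop_count_def S'_eq[symmetric]
 proof (rule card_image_eq[where h = "\<lambda>v. v"])
  fix v w assume "v \<in> S'" "w \<in> S'"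
  thus "loop_class N G v = loop_class N G w \<longleftrightarrow> loop_class N E1 v = loop_class N E1 w"
   using ins[of v] by (simp add: G.loop_class_eq E1.loop_class_eq S'_eq)
 qed simp
 moreover have "card (loop_class N G ` S {m}) = loop_count N R {m} Q t"
  unfolding loop_count_def
 proof (rule card_image_eq[where h = "\<lambda>v. v"])
  have "closed_at G Q v \<longleftrightarrow> closed_at R Q v" "winds N G v \<longleftrightarrow> winds N R v" if "fst v = m" for v
  proof -
   show "closed_at G Q v \<longleftrightarrow> closed_at R Q v" unfolding closed_at_def
    using GR[of v] that mb Q(1) by metis
   show "winds N G v \<longleftrightarrow> winds N R v" unfolding winds_def
    using GR[of v] that mb by simp
  qed
  thus "(\<lambda>v. v) ` S {m} = {v. fst v \<in> {m} \<and> closed_at R Q v \<and> winds N R v = t}"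
   by (auto simp: S_def)
 next
  fix v w assume "v \<in> S {m}" "w \<in> S {m}"
  thus "loop_class N G v = loop_class N G w \<longleftrightarrow> loop_class N R v = loop_class N R w"
   using GR[of v "vshift _ w"] mb by (simp add: G.loop_class_eq R.loop_class_eq S_def)
 qed
 ultimately show ?thesis
  by (simp add: loop_count_def S_def G_def E1_def R_def)
qed

text \<open>Both sums count the loops of the three-layer gluing, split once by contracting level 1
  and once by contracting level 2.\<close>

lemma loops_assoc:
 assumes N: "N >= 1" "per N sg" "per N ta" "per N up"
 shows "contractible_loops N sg ta + contractible_loops N (comp_pairing sg ta) up =
   contractible_loops N ta up + contractible_loops N sg (comp_pairing ta up)"
  and "noncontractible_loops N sg ta + noncontractible_loops N (comp_pairing sg ta) up =
   noncontractible_loops N ta up + noncontractible_loops N sg (comp_pairing ta up)"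
proof -
 have l: "loop_count N (edges 0 1 sg \<union> edges 1 2 ta \<union> edges 2 3 up) {1, 2} {0, 3} t =
  loop_count N (edges 0 1 sg \<union> edges 1 2 ta) {1} {0, 2} t +
  loop_count N (edges 0 2 (comp_pairing sg ta) \<union> edges 2 3 up) {2} {0, 3} t" for t
  by (rule contract_loop_count[OF N(1-3)]) (auto dest: edges_level intro!: periodic_graph_edges N)
 have r: "loop_count N (edges 1 2 ta \<union> edges 2 3 up \<union> edges 0 1 sg) {2, 1} {0, 3} t =
  loop_count N (edges 1 2 ta \<union> edges 2 3 up) {2} {1, 3} t +
  loop_count N (edges 1 3 (comp_pairing ta up) \<union> edges 0 1 sg) {1} {0, 3} t" for t
  by (rule contract_loop_count[OF N(1,3,4)]) (auto dest: edges_level intro!: periodic_graph_edges N)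
 have "loop_count N (edges 0 1 sg \<union> edges 1 2 ta) {1} {0, 2} t +
  loop_count N (edges 0 2 (comp_pairing sg ta) \<union> edges 2 3 up) {2} {0, 3} t =
  loop_count N (edges 1 2 ta \<union> edges 2 3 up) {2} {1, 3} t +
  loop_count N (edges 0 1 sg \<union> edges 1 3 (comp_pairing ta up)) {1} {0, 3} t" for t
  using l[of t] r[of t] by (simp add: Un_ac insert_commute)
 thus
  "contractible_loops N sg ta + contractible_loops N (comp_pairing sg ta) up =
   contractible_loops N ta up + contractible_loops N sg (comp_pairing ta up)"
  "noncontractible_loops N sg ta + noncontractible_loops N (comp_pairing sg ta) up =
   noncontractible_loops N ta up + noncontractible_loops N sg (comp_pairing ta up)"
  using N periodic_comp[OF N(1-3)] periodic_comp[OF N(1,3,4)]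
  by (simp_all add: loops_loop_count[of N sg ta 0 1 2] loops_loop_count[of N "comp_pairing sg ta" up 0 2 3]
    loops_loop_count[of N ta up 1 2 3] loops_loop_count[of N sg "comp_pairing ta up" 0 1 3])
qed

section \<open>Composition with the generators\<close>

text \<open>The diagram of \<open>u\<close> to the power -k: by the convention that \<open>u\<close>
  joins outer i + 1 to inner i, \<open>u\<close> itself is k = -1.\<close>

definition tr_pairing :: "int => pairing" where
 "tr_pairing k p = (case p of Outer i => Inner (i + k) | Inner i => Outer (i - k))"

lemma tr_pairing_simps [simp]:
 "tr_pairing k (Outer i) = Inner (i + k)" "tr_pairing k (Inner i) = Outer (i - k)"
 by (simp_all add: tr_pairing_def)

lemma diagrams_trans:
 "id_diagram = (tr_pairing 0, 0)" "u_diagram = (tr_pairing (- 1), 0)"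
 "u_inv_diagram = (tr_pairing 1, 0)"
 by (auto simp: id_diagram_def u_diagram_def u_inv_diagram_def fun_eq_iff split: bpoint.splits)

fun oshift :: "int => bpoint => bpoint" where
 "oshift k (Outer i) = Outer (i + k)"
| "oshift k (Inner i) = Inner i"

fun ishift :: "int => bpoint => bpoint" where
 "ishift k (Outer i) = Outer i"
| "ishift k (Inner i) = Inner (i + k)"

lemma oshift_simps [simp]: "oshift 0 p = p" "oshift k (oshift l p) = oshift (k + l) p"
 "oshift k p = oshift k q \<longleftrightarrow> p = q"
 by (cases p; cases q; auto)+
lemma ishift_simps [simp]: "ishift 0 p = p" "ishift k (ishift l p) = ishift (k + l) p"
 "ishift k p = ishift k q \<longleftrightarrow> p = q"
 by (cases p; cases q; auto)+

lemma periodic_trans [simp]: "per N (tr_pairing k)"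
 unfolding periodic_pairing_def
proof
 fix p show "tr_pairing k p ~= p \<and> tr_pairing k (tr_pairing k p) = p \<and>
   tr_pairing k (shift (int N) p) = shift (int N) (tr_pairing k p)"
  by (cases p) auto
qed

lemma upper_edge: "(glue_upper p, glue_upper (sg p)) \<in> connected_in sg ta"
 and lower_edge: "(glue_lower p, glue_lower (ta p)) \<in> connected_in sg ta"
 by (auto simp: connected_in_def)

lemma comp_trans_left:
 assumes N: "N >= 1" and sg: "per N sg"
 shows "comp_pairing (tr_pairing k) sg = (\<lambda>p. oshift (- k) (sg (oshift k p)))"
proof
 fix p
 have 1: "(endpoint p, glue_lower (oshift k p)) \<in> connected_in (tr_pairing k) sg" for p
  using upper_edge[of p "tr_pairing k" sg] by (cases p) auto
 have "(glue_lower (sg (oshift k p)), endpoint (oshift (- k) (sg (oshift k p)))) \<in> connected_in (tr_pairing k) sg"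
  using connected_in_sym[OF periodic_trans sg 1[of "oshift (- k) (sg (oshift k p))"]] by simp
 hence "(endpoint p, endpoint (oshift (- k) (sg (oshift k p)))) \<in> connected_in (tr_pairing k) sg"
  using connected_in_trans[OF connected_in_trans[OF 1[of p] lower_edge]] by blast
 moreover have "oshift (- k) (sg (oshift k p)) ~= p"
  using pairing_neq[OF sg, of "oshift k p"] by (metis oshift_simps add.right_inverse)
 ultimately show "comp_pairing (tr_pairing k) sg p = oshift (- k) (sg (oshift k p))"
  using comp_pairing_eqI[OF N periodic_trans sg] by blast
qed

lemma comp_trans_right:
 assumes N: "N >= 1" and sg: "per N sg"
 shows "comp_pairing sg (tr_pairing k) = (\<lambda>p. ishift k (sg (ishift (- k) p)))"
proof
 fix p
 have 1: "(endpoint p, glue_upper (ishift (- k) p)) \<in> connected_in sg (tr_pairing k)" for p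
  using lower_edge[of p "tr_pairing k" sg] by (cases p) auto
 have "(glue_upper (sg (ishift (- k) p)), endpoint (ishift k (sg (ishift (- k) p)))) \<in> connected_in sg (tr_pairing k)"
  using connected_in_sym[OF sg periodic_trans 1[of "ishift k (sg (ishift (- k) p))"]] by simp
 hence "(endpoint p, endpoint (ishift k (sg (ishift (- k) p)))) \<in> connected_in sg (tr_pairing k)"
  using connected_in_trans[OF connected_in_trans[OF 1[of p] upper_edge]] by blast
 moreover have "ishift k (sg (ishift (- k) p)) ~= p"
  using pairing_neq[OF sg, of "ishift (- k) p"] by (metis ishift_simps add.right_inverse add.left_inverse)
 ultimately show "comp_pairing sg (tr_pairing k) p = ishift k (sg (ishift (- k) p))"
  using comp_pairing_eqI[OF N sg periodic_trans] by blast
qed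

lemma no_loops:
 assumes "!!i. \<exists>p. (Mid i, endpoint p) \<in> connected_in sg ta"
 shows "contractible_loops N sg ta = 0" "noncontractible_loops N sg ta = 0"
proof -
 have "closed_components sg ta = {}" unfolding closed_components_def using assms by blast
 thus "contractible_loops N sg ta = 0" "noncontractible_loops N sg ta = 0"
  by (simp_all add: contractible_loops_def noncontractible_loops_def)
qed

lemma loops_trans [simp]:
 "contractible_loops N (tr_pairing k) sg = 0" "noncontractible_loops N (tr_pairing k) sg = 0"
 "contractible_loops N sg (tr_pairing k) = 0" "noncontractible_loops N sg (tr_pairing k) = 0"
proof -
 have "\<exists>p. (Mid i, endpoint p) \<in> connected_in (tr_pairing k) sg" for i
  using upper_edge[of "Inner i" "tr_pairing k" sg] by (intro exI[of _ "Outer (i - k)"]) simp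
 thus "contractible_loops N (tr_pairing k) sg = 0" "noncontractible_loops N (tr_pairing k) sg = 0"
  by (rule no_loops)+
 have "\<exists>p. (Mid i, endpoint p) \<in> connected_in sg (tr_pairing k)" for i
  using lower_edge[of "Outer i" "tr_pairing k" sg] by (intro exI[of _ "Inner (i + k)"]) simp
 thus "contractible_loops N sg (tr_pairing k) = 0" "noncontractible_loops N sg (tr_pairing k) = 0"
  by (rule no_loops)+
qed

definition strip :: "nat => int => int => bool" where
 "strip N j i \<longleftrightarrow> (i - j) mod int N = 0 \<or> (i - j) mod int N = 1"

definition swap :: "nat => int => int => int" where
 "swap N j i = (if (i - j) mod int N = 0 then i + 1 else if (i - j) mod int N = 1 then i - 1 else i)"

definition e_pairing :: "nat => int => pairing" where
 "e_pairing N j p = (case p of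
  Outer i => if strip N j i then Outer (swap N j i) else Inner i
 | Inner i => if strip N j i then Inner (swap N j i) else Outer i)"

lemma e_diagram_pairing: "e_diagram N j = (e_pairing N j, 0)"
 by (auto simp: e_diagram_def e_pairing_def strip_def swap_def fun_eq_iff split: bpoint.splits)

lemma e_pairing_simps [simp]:
 "e_pairing N j (Outer i) = (if strip N j i then Outer (swap N j i) else Inner i)"
 "e_pairing N j (Inner i) = (if strip N j i then Inner (swap N j i) else Outer i)"
 by (simp_all add: e_pairing_def)

lemma mod_shift1: "(i + k * int N - j) mod int N = (i - j) mod int N"
proof -
 have "i + k * int N - j = (i - j) + k * int N" by simp
 thus ?thesis by (simp only: mod_mult_self1)
qed

lemma strip_shift [simp]: "strip N j (i + k * int N) = strip N j i"
 "swap N j (i + k * int N) = swap N j i + k * int N"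
 by (simp_all add: strip_def swap_def mod_shift1)

lemma mod_succ: "x mod n = c ==> c + 1 < n ==> n > 0 ==> (x + 1) mod n = c + 1" for x n c :: int
proof -
 assume a: "x mod n = c" "c + 1 < n"
 assume n: "n > 0"
 show ?thesis
 proof -
  have "(x + 1) mod n = (x mod n + 1) mod n" by (simp add: mod_simps)
  also have "\<dots> = c + 1" using a n pos_mod_sign[of n x] by simp
  finally show ?thesis .
 qed
qed

lemma mod_pred: "x mod n = c ==> c >= 1 ==> n > 0 ==> (x - 1) mod n = c - 1" for x n c :: int
proof -
 assume a: "x mod n = c" "c >= 1" "n > 0"
 have "(x - 1) mod n = (x mod n - 1) mod n" by (simp add: mod_simps)
 also have "\<dots> = c - 1" using a pos_mod_bound[of n x] by simp
 finally show ?thesis .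
qed

lemma strip_swap:
 assumes "N >= 2" "strip N j i"
 shows "strip N j (swap N j i)" "swap N j (swap N j i) = i" "swap N j i ~= i"
proof -
 have s: "(i + 1 - j) mod int N = 1" if "(i - j) mod int N = 0"
  using mod_succ[OF that] assms(1) by (simp add: algebra_simps)
 have p: "(i - 1 - j) mod int N = 0" if "(i - j) mod int N = 1"
  using mod_pred[OF that] assms(1) by (simp add: algebra_simps)
 show "strip N j (swap N j i)" "swap N j (swap N j i) = i" "swap N j i ~= i"
  using assms(2) s p by (auto simp: strip_def swap_def)
qed

lemma strip_two:
 assumes "strip N j a" "strip N j c"
 shows "\<exists>l. c = a + l * int N \<or> c = swap N j a + l * int N"
proof -
 have m: "\<exists>l. y = x + l * int N" if "(x - j) mod int N = (y - j) mod int N" for x y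
 proof -
  have "int N dvd (y - j) - (x - j)" using that by (metis mod_eq_dvd_iff)
  then obtain l where "(y - j) - (x - j) = int N * l" by blast
  thus ?thesis by (intro exI[of _ l]) (simp add: algebra_simps)
 qed
 have m1: "\<exists>l. y = x + 1 + l * int N" if "(x - j) mod int N = 0" "(y - j) mod int N = 1" for x y
 proof -
  have "N ~= 1" using that by auto
  hence "(x + 1 - j) mod int N = (y - j) mod int N"
   using that by (cases "N = 0") (auto simp: mod_succ[OF that(1), THEN trans[rotated]] algebra_simps dest: mod_succ[OF that(1)])
  thus ?thesis using m by blast
 qed
 have m2: "\<exists>l. y = x - 1 + l * int N" if "(x - j) mod int N = 1" "(y - j) mod int N = 0" for x y
  using m1[OF that(2,1)] by (elim exE) (rule_tac x = "- l" in exI, simp)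
 show ?thesis
  using assms m[of a c] m1[of a c] m2[of a c] by (auto simp: strip_def swap_def)
qed

lemma periodic_e [simp]: "N >= 2 ==> per N (e_pairing N j)"
 unfolding periodic_pairing_def
proof
 fix p assume N: "N >= 2"
 have "strip N j (i + int N) = strip N j i" "swap N j (i + int N) = swap N j i + int N" for i
  using strip_shift[of N j i 1] by auto
 thus "e_pairing N j p ~= p \<and> e_pairing N j (e_pairing N j p) = p \<and>
   e_pairing N j (shift (int N) p) = shift (int N) (e_pairing N j p)"
  using strip_swap[OF N, of j] by (cases p) auto
qed

fun ostrip :: "nat => int => bpoint => bool" where
 "ostrip N j (Outer i) = strip N j i"
| "ostrip N j (Inner i) = False"

fun oswap :: "nat => int => bpoint => bpoint" where
 "oswap N j (Outer i) = Outer (swap N j i)"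
| "oswap N j (Inner i) = Inner i"

lemma oswap_strip:
 assumes "N >= 2" "ostrip N j p"
 shows "ostrip N j (oswap N j p)" "oswap N j (oswap N j p) = p" "oswap N j p ~= p"
 using assms strip_swap by (cases p; simp)+

text \<open>Closed form of a product with \<open>e_j\<close> on the left. A path starting in the
  strip turns back along the arc of \<open>e_j\<close>; a path that enters the strip through
  \<open>sg\<close> takes one arc of \<open>e_j\<close> and leaves through \<open>sg\<close> again.
  One such detour is enough by \<open>e_left_escape\<close>.\<close>

definition e_left :: "nat => int => pairing => pairing" where
 "e_left N j sg p = (if ostrip N j p then oswap N j p
  else if ostrip N j (sg p) then sg (oswap N j (sg p)) else sg p)"

lemma pairing_shift_Outer:
 assumes "per N sg"
 shows "sg (Outer (i + k * int N)) = shift (k * int N) (sg (Outer i))"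
 using pairing_shift[OF assms, of k "Outer i"] by simp

text \<open>An arc from \<open>a\<close> to its own translate by \<open>l * N\<close> would, by
  periodicity, also lead from there to the translate by \<open>2 * l * N\<close>; as
  \<open>sg\<close> is an involution, \<open>l = 0\<close>, and the arc would be a fixed
  point.\<close>

lemma strip_partner:
 assumes N: "N >= 2" and sg: "per N sg" and a: "strip N j a" "strip N j c" "sg (Outer a) = Outer c"
 shows "\<exists>l. c = swap N j a + l * int N"
proof -
 have "c ~= a + l * int N" for l
 proof
  assume c: "c = a + l * int N"
  hence "sg (Outer c) = Outer (c + l * int N)"
   using a(3) pairing_shift_Outer[OF sg, of a l] by simp
  hence "Outer a = Outer (c + l * int N)" using pairing_invol[OF sg, of "Outer a"] a(3) by simp
  hence "l = 0" using c N by (simp add: algebra_simps)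
  thus False using c a(3) pairing_neq[OF sg, of "Outer a"] by simp
 qed
 thus ?thesis using strip_two[OF a(1,2)] by blast
qed

text \<open>If the path met the strip again, \<open>sg\<close> would join the two points of the
  strip up to a translation. Translating that arc back shows that the start \<open>p\<close> is
  itself a point of the strip.\<close>

lemma e_left_escape:
 assumes N: "N >= 2" and sg: "per N sg" and p: "\<not> ostrip N j p" "ostrip N j (sg p)"
 shows "\<not> ostrip N j (sg (oswap N j (sg p)))"
proof
 assume s: "ostrip N j (sg (oswap N j (sg p)))"
 obtain a where a: "sg p = Outer a" "strip N j a" using p(2) by (cases "sg p") auto
 define b where "b = swap N j a"
 have b: "strip N j b" "swap N j b = a" using strip_swap[OF N a(2)] by (auto simp: b_def)
 obtain c where c: "sg (Outer b) = Outer c" "strip N j c"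
  using s a by (cases "sg (Outer b)") (auto simp: b_def)
 obtain l where "c = a + l * int N" using strip_partner[OF N sg b(1) c(2,1)] b by auto
 hence "Outer b = shift (l * int N) (sg (Outer a))"
  using pairing_invol[OF sg, of "Outer b"] c pairing_shift_Outer[OF sg, of a l] by simp
 also have "sg (Outer a) = p" using a pairing_invol[OF sg, of p] by simp
 finally have "p = Outer (b + (- l) * int N)" by (cases p) auto
 thus False using p(1) b(1) strip_shift(1)[of N j b "- l"] by simp
qed

lemma comp_e_left:
 assumes N: "N >= 2" and sg: "per N sg"
 shows "comp_pairing (e_pairing N j) sg = e_left N j sg"
proof
 fix p
 have N1: "N >= 1" using N by simp
 let ?C = "connected_in (e_pairing N j) sg"
 have 1: "(endpoint p, glue_lower p) \<in> ?C" if "\<not> ostrip N j p" for p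
  using upper_edge[of p "e_pairing N j" sg] that by (cases p) auto
 note rev1 = connected_in_sym[OF periodic_e[OF N] sg 1]
 have 2: "(glue_lower p, glue_lower (oswap N j p)) \<in> ?C" if "ostrip N j p" for p
  using upper_edge[of "tr_pairing 0 p" "e_pairing N j" sg] that by (cases p) auto
 note eqI = comp_pairing_eqI[OF N1 periodic_e[OF N] sg]
 show "comp_pairing (e_pairing N j) sg p = e_left N j sg p"
 proof (cases "ostrip N j p")
  case True
  have "comp_pairing (e_pairing N j) sg p = oswap N j p"
   by (rule eqI) (use True oswap_strip[OF N True] upper_edge[of p "e_pairing N j" sg] in \<open>cases p; auto\<close>)+
  thus ?thesis using True by (simp add: e_left_def)
 next
  case False note np = this
  show ?thesis
  proof (cases "ostrip N j (sg p)")
   case True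
   define r where "r = oswap N j (sg p)"
   have r: "\<not> ostrip N j (sg r)" using e_left_escape[OF N sg np True] by (simp add: r_def)
   have "(endpoint p, glue_lower r) \<in> ?C"
    unfolding r_def
    by (rule connected_in_trans[OF 1[OF np] connected_in_trans[OF lower_edge 2[OF True]]])
   hence "(endpoint p, endpoint (sg r)) \<in> ?C"
    by (rule connected_in_trans[OF _ connected_in_trans[OF lower_edge rev1[OF r]]])
   moreover have "sg r ~= p"
    using oswap_strip[OF N True] pairing_invol[OF sg, of r] by (auto simp: r_def)
   ultimately show ?thesis using np True eqI by (simp add: e_left_def r_def)
  next
   case False
   have "(endpoint p, endpoint (sg p)) \<in> ?C"
    by (rule connected_in_trans[OF 1[OF np] connected_in_trans[OF lower_edge rev1[OF False]]])
   thus ?thesis using np False eqI pairing_neq[OF sg] by (simp add: e_left_def)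
  qed
 qed
qed

text \<open>A closed component must stay in the strip, because any other middle point continues
  straight to the outer boundary. So it uses only the arc of \<open>e_j\<close> and an arc of
  \<open>sg\<close> from \<open>j\<close> to \<open>j + 1 + k * N\<close>. All points of the strip
  then form one class, whence the count is 0 or 1, and the loop winds exactly if \<open>k\<close> is
  nonzero.\<close>

lemma loops_e_left:
 assumes N: "N >= 2" and sg: "per N sg"
 shows "contractible_loops N (e_pairing N j) sg = (if sg (Outer j) = Outer (j + 1) then 1 else 0)"
  and "noncontractible_loops N (e_pairing N j) sg =
   (if \<exists>k. k ~= 0 \<and> sg (Outer j) = Outer (j + 1 + k * int N) then 1 else 0)"
proof -
 have N1: "N >= 1" using N by simp
 define E where "E = edges 0 1 (e_pairing N j) \<union> edges 1 2 sg"
 interpret periodic_graph N E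
  unfolding E_def by (intro periodic_graph_Un periodic_graph_edges N1 periodic_e N sg)
 have sj: "strip N j j" "strip N j (j + 1)" "swap N j j = j + 1" "swap N j (j + 1) = j"
  using N by (auto simp: strip_def swap_def)
 have ee: "((0, i), lv 0 1 (e_pairing N j (Outer i))) \<in> E" "((1, i), lv 0 1 (e_pairing N j (Inner i))) \<in> E"
  and es: "((1, i), lv 1 2 (sg (Outer i))) \<in> E" for i
  using rangeI[of "\<lambda>p. (lv 0 1 p, lv 0 1 (e_pairing N j p))" "Outer i"]
   rangeI[of "\<lambda>p. (lv 0 1 p, lv 0 1 (e_pairing N j p))" "Inner i"]
   rangeI[of "\<lambda>p. (lv 1 2 p, lv 1 2 (sg p))" "Outer i"]
  unfolding E_def edges_def by (simp_all only: lv.simps UnI1 UnI2)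
 let ?cl = "closed_at E {0, 2}"
 let ?S = "\<lambda>t. {v. fst v \<in> {1} \<and> ?cl v \<and> winds N E v = t}"
 have cl: "strip N j i \<and> (\<exists>k. sg (Outer i) = Outer (swap N j i + k * int N))" if "?cl (1, i)" for i
 proof -
  have s: "strip N j x" if x: "((1, i), (1, x)) \<in> E^*" for x
  proof (rule ccontr)
   assume "\<not> strip N j x"
   hence "((1, x), (0, x)) \<in> E" using ee(2)[of x] by simp
   hence "((1, i), (0, x)) \<in> E^*" using x by (rule rtrancl_into_rtrancl[rotated])
   thus False using \<open>?cl (1, i)\<close> by (auto simp: closed_at_def)
  qed
  have "\<exists>x. sg (Outer i) = Outer x \<and> strip N j x"
  proof (cases "sg (Outer i)")
   case (Outer x)
   hence "((1, i), (1, x)) \<in> E^*" using es[of i] by auto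
   thus ?thesis using Outer s by blast
  next
   case (Inner x)
   hence "((1, i), (2, x)) \<in> E^*" using es[of i] by auto
   thus ?thesis using that by (auto simp: closed_at_def)
  qed
  thus ?thesis using s[of i] strip_partner[OF N sg, of j i] by blast
 qed
 have js: "\<exists>k. sg (Outer j) = Outer (j + 1 + k * int N)" if "?cl (1, i)" for i
 proof -
  obtain k where k: "strip N j i" "sg (Outer i) = Outer (swap N j i + k * int N)" using cl[OF \<open>?cl (1, i)\<close>] by blast
  obtain l where l: "i = j + l * int N \<or> i = j + 1 + l * int N" using strip_two[OF sj(1) k(1)] sj(3) by auto
  thus ?thesis
  proof
   assume i: "i = j + l * int N"
   hence "shift (l * int N) (sg (Outer j)) = Outer (j + 1 + (l + k) * int N)"
    using k(2) pairing_shift_Outer[OF sg, of j l] sj(3) by (simp add: algebra_simps)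
   hence "sg (Outer j) = Outer (j + 1 + k * int N)"
    by (cases "sg (Outer j)") (auto simp: algebra_simps)
   thus ?thesis by blast
  next
   assume i: "i = j + 1 + l * int N"
   hence "swap N j i = j + l * int N" using strip_shift(2)[of N j "j + 1" l] sj(4) by simp
   hence "shift (l * int N) (sg (Outer (j + 1))) = Outer (j + (l + k) * int N)"
    using i k(2) pairing_shift_Outer[OF sg, of "j + 1" l] sj(4) by (simp add: algebra_simps)
   hence "sg (Outer (j + 1)) = Outer (j + k * int N)"
    by (cases "sg (Outer (j + 1))") (auto simp: algebra_simps)
   hence "Outer (j + 1) = shift (k * int N) (sg (Outer j))"
    using pairing_invol[OF sg, of "Outer (j + 1)"] pairing_shift_Outer[OF sg, of j k] by simp
   hence "sg (Outer j) = Outer (j + 1 + (- k) * int N)" by (cases "sg (Outer j)") auto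
   thus ?thesis by blast
  qed
 qed
 have count: "loop_count N E {1} {0, 2} t = (if (\<exists>k. (k ~= 0) = t \<and> sg (Outer j) = Outer (j + 1 + k * int N)) then 1 else 0)" for t
 proof (cases "\<exists>k. sg (Outer j) = Outer (j + 1 + k * int N)")
  case False
  have "\<not> ?cl v" if "fst v = 1" for v using js[of "snd v"] that False by (cases v) auto
  hence S: "?S t = {}" by blast
  show ?thesis unfolding loop_count_def S using False by auto
 next
  case True
  then obtain k where k: "sg (Outer j) = Outer (j + 1 + k * int N)" by blast
  have "Outer j = shift (k * int N) (sg (Outer (j + 1)))"
   using k pairing_invol[OF sg, of "Outer j"] pairing_shift_Outer[OF sg, of "j + 1" k] by simp
  hence k': "sg (Outer (j + 1)) = Outer (j + (- k) * int N)" by (cases "sg (Outer (j + 1))") auto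
  have ss: "\<exists>y. sg (Outer x) = Outer y \<and> strip N j y" if "strip N j x" for x
  proof -
   obtain l where l: "x = j + l * int N \<or> x = j + 1 + l * int N" using strip_two[OF sj(1) \<open>strip N j x\<close>] sj(3) by auto
   have "strip N j (j + 1 + k * int N + l * int N)" "strip N j (j + (- k) * int N + l * int N)"
    by (simp_all only: strip_shift sj)
   thus ?thesis using l k k' pairing_shift_Outer[OF sg, of _ l] by auto
  qed
  have reach: "fst w = 1 \<and> strip N j (snd w)" if "(v, w) \<in> E^*" "fst v = 1" "strip N j (snd v)" for v w
   using that
  proof (induction rule: rtrancl_induct)
   case (step y z)
   obtain x where x: "y = (1, x)" "strip N j x" using step by (cases y) auto
   from step(2) consider p where "y = lv 0 1 p" "z = lv 0 1 (e_pairing N j p)"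
    | p where "y = lv 1 2 p" "z = lv 1 2 (sg p)" by (auto simp: E_def edges_def)
   thus ?case
   proof cases
    case 1
    thus ?thesis using x strip_swap(1)[OF N x(2)] by (cases p) auto
   next
    case 2
    thus ?thesis using x ss[OF x(2)] by (cases p) auto
   qed
  qed auto
  have jj: "((1, j), (1, j + 1)) \<in> E" using ee(2)[of j] sj by simp
  have cls: "loop_class N E (1, x) = loop_class N E (1, j)" if "strip N j x" for x
  proof -
   obtain l where l: "x = j + l * int N \<or> x = j + 1 + l * int N" using strip_two[OF sj(1) \<open>strip N j x\<close>] sj(3) by auto
   have "((1, x), (1, j + l * int N)) \<in> E^*"
    using l conn_sym[OF r_into_rtrancl[OF shE[OF jj, of l]]] by auto
   thus ?thesis unfolding loop_class_eq by (intro exI[of _ l]) simp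
  qed
  have clj: "?cl (1, x)" if "strip N j x" for x
   using reach[of "(1, x)"] that by (auto simp: closed_at_def)
  have w: "winds N E (1, j) \<longleftrightarrow> k ~= 0"
  proof
   assume "k ~= 0"
   moreover have "((1, j), (1, j + (- k) * int N)) \<in> E^*"
    using jj es[of "j + 1"] k' by (auto intro: rtrancl_into_rtrancl)
   ultimately show "winds N E (1, j)" unfolding winds_def by (intro exI[of _ "- k"]) simp
  next
   assume "winds N E (1, j)"
   then obtain l where l: "l ~= 0" "((1, j), (1, j + l * int N)) \<in> E^*" by (auto simp: winds_def)
   show "k ~= 0"
   proof
    assume k0: "k = 0"
    have "w = (1, j) \<or> w = (1, j + 1)" if "((1, j), w) \<in> E^*" for w
     using that
    proof (induction rule: rtrancl_induct)
     case (step y z)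
     from step(2) consider p where "y = lv 0 1 p" "z = lv 0 1 (e_pairing N j p)"
      | p where "y = lv 1 2 p" "z = lv 1 2 (sg p)" by (auto simp: E_def edges_def)
     thus ?case
     proof cases
      case 1
      thus ?thesis using step(3) sj by (cases p) auto
     next
      case 2
      thus ?thesis using step(3) k k' k0 by (cases p) auto
     qed
    qed simp
    from this[OF l(2)] have "l * int N = 0 \<or> l * int N = 1" by auto
    thus False using l(1) N by (auto simp: zmult_eq_1_iff)
   qed
  qed
  have S: "?S t = (if (k ~= 0) = t then {v. fst v = 1 \<and> strip N j (snd v)} else {})"
  proof -
   have "?cl v \<longleftrightarrow> strip N j (snd v)" "strip N j (snd v) ==> winds N E v \<longleftrightarrow> k ~= 0" if "fst v = 1" for v
    using that clj[of "snd v"] cl[of "snd v"] loop_class_closed(2)[OF cls[of "snd v"]] w by (cases v; auto)+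
   thus ?thesis by auto
  qed
  define S0 where "S0 = {v::nat \<times> int. fst v = 1 \<and> strip N j (snd v)}"
  have "loop_class N E v = loop_class N E (1, j)" if "v \<in> S0" for v
   using cls[of "snd v"] that by (cases v) (auto simp: S0_def)
  hence "loop_class N E ` S0 = (\<lambda>_. loop_class N E (1, j)) ` S0" by (rule image_cong[OF refl])
  moreover have "(1, j) \<in> S0" using sj by (simp add: S0_def)
  ultimately have "loop_class N E ` S0 = {loop_class N E (1, j)}" by (auto simp: image_constant_conv)
  hence "loop_class N E ` {v. fst v = 1 \<and> strip N j (snd v)} = {loop_class N E (1, j)}"
   by (simp add: S0_def)
  moreover have "(\<exists>l. (l ~= 0) = t \<and> sg (Outer j) = Outer (j + 1 + l * int N)) \<longleftrightarrow> (k ~= 0) = t"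
   using k N by auto
  ultimately show ?thesis unfolding loop_count_def S by simp
 qed
 have d: "distinct [0::nat, 1, 2]" by simp
 show "contractible_loops N (e_pairing N j) sg = (if sg (Outer j) = Outer (j + 1) then 1 else 0)"
  using loops_loop_count(1)[OF N1 periodic_e[OF N] sg d] count[of False] by (simp add: E_def)
 show "noncontractible_loops N (e_pairing N j) sg =
   (if \<exists>k. k ~= 0 \<and> sg (Outer j) = Outer (j + 1 + k * int N) then 1 else 0)"
  using loops_loop_count(2)[OF N1 periodic_e[OF N] sg d] count[of True] by (simp add: E_def)
qed

section \<open>Reflection\<close>

fun mirror :: "bpoint => bpoint" where
 "mirror (Outer i) = Inner i"
| "mirror (Inner i) = Outer i"

fun gmirror :: "gpoint => gpoint" where
 "gmirror (Top i) = Bot i"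
| "gmirror (Mid i) = Mid i"
| "gmirror (Bot i) = Top i"

text \<open>Reflection in the core of the annulus exchanges the boundaries and reverses products, so
  facts about multiplication by \<open>e_j\<close> on the left carry over to the right.\<close>

definition mirror_pairing :: "pairing => pairing" where
 "mirror_pairing sg p = mirror (sg (mirror p))"

lemma mirror_mirror [simp]: "mirror (mirror p) = p" by (cases p) auto
lemma mirror_eq [simp]: "mirror p = mirror q \<longleftrightarrow> p = q" by (metis mirror_mirror)
lemma gmirror_gmirror [simp]: "gmirror (gmirror p) = p" by (cases p) auto
lemma gmirror_glue [simp]: "gmirror (glue_upper p) = glue_lower (mirror p)"
  "gmirror (glue_lower p) = glue_upper (mirror p)" "gmirror (endpoint p) = endpoint (mirror p)"
 by (cases p; simp)+
lemma mirror_pairing_mirror [simp]: "mirror_pairing (mirror_pairing sg) = sg"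
 by (simp add: mirror_pairing_def fun_eq_iff)
lemma mirror_shift: "mirror (shift k p) = shift k (mirror p)" by (cases p) auto

lemma periodic_mirror:
 assumes "per N sg" shows "per N (mirror_pairing sg)"
 using assms unfolding periodic_pairing_def mirror_pairing_def
 by (metis mirror_mirror mirror_shift)

lemma connected_in_mirror1:
 assumes "(x, y) \<in> connected_in sg ta"
 shows "(gmirror x, gmirror y) \<in> connected_in (mirror_pairing ta) (mirror_pairing sg)"
 using assms unfolding connected_in_def
proof (induction rule: rtrancl_induct)
 case (step y z)
 have e: "mirror (sg p) = mirror_pairing sg (mirror p)" for sg p by (simp add: mirror_pairing_def)
 have "(gmirror y, gmirror z) \<in> range (\<lambda>p. (glue_upper p, glue_upper (mirror_pairing ta p))) \<union>
  range (\<lambda>p. (glue_lower p, glue_lower (mirror_pairing sg p)))"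
  using step(2) by (auto simp: e)
 with step(3) show ?case by (rule rtrancl_into_rtrancl)
qed simp

lemma connected_in_mirror:
 "(gmirror x, gmirror y) \<in> connected_in (mirror_pairing ta) (mirror_pairing sg) \<longleftrightarrow> (x, y) \<in> connected_in sg ta"
 using connected_in_mirror1[of x y sg ta]
  connected_in_mirror1[of "gmirror x" "gmirror y" "mirror_pairing ta" "mirror_pairing sg"] by auto

lemma closed_components_mirror:
 "closed_components (mirror_pairing ta) (mirror_pairing sg) = closed_components sg ta"
proof -
 have m: "(Mid i, Mid j) \<in> connected_in (mirror_pairing ta) (mirror_pairing sg) \<longleftrightarrow> (Mid i, Mid j) \<in> connected_in sg ta" for i j
  using connected_in_mirror[of "Mid i" "Mid j"] by simp
 have e: "(Mid i, endpoint p) \<in> connected_in (mirror_pairing ta) (mirror_pairing sg) \<longleftrightarrow> (Mid i, endpoint (mirror p)) \<in> connected_in sg ta" for i p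
  using connected_in_mirror[of "Mid i" "endpoint (mirror p)"] by simp
 have "(\<forall>p. (Mid i, endpoint (mirror p)) \<notin> connected_in sg ta) \<longleftrightarrow> (\<forall>p. (Mid i, endpoint p) \<notin> connected_in sg ta)" for i
  by (metis mirror_mirror)
 thus ?thesis by (simp add: closed_components_def m e)
qed

lemma comp_pairing_mirror:
 assumes N: "N >= 1" "per N sg" "per N ta"
 shows "comp_pairing (mirror_pairing ta) (mirror_pairing sg) = mirror_pairing (comp_pairing sg ta)"
proof
 fix p
 have "comp_pairing sg ta (mirror p) ~= mirror p"
  "(endpoint (mirror p), endpoint (comp_pairing sg ta (mirror p))) \<in> connected_in sg ta"
  using comp_pairing_connected[OF N] by auto
 thus "comp_pairing (mirror_pairing ta) (mirror_pairing sg) p = mirror_pairing (comp_pairing sg ta) p"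
  using connected_in_mirror1[of "endpoint (mirror p)" "endpoint (comp_pairing sg ta (mirror p))" sg ta]
  by (intro comp_pairing_eqI[OF N(1) periodic_mirror[OF N(3)] periodic_mirror[OF N(2)]])
   (auto simp: mirror_pairing_def, metis mirror_mirror)
qed

lemma mirror_e: "mirror_pairing (e_pairing N j) = e_pairing N j"
 unfolding fun_eq_iff mirror_pairing_def
proof
 fix p show "mirror (e_pairing N j (mirror p)) = e_pairing N j p" by (cases p) auto
qed

lemma e_left_absorb:
 assumes N: "N >= 2" and sg: "per N sg" and j: "sg (Outer j) = Outer (j + 1)"
 shows "e_left N j sg = sg"
proof
 fix p
 have sj: "strip N j j" "swap N j j = j + 1" "strip N j (j + 1)" "swap N j (j + 1) = j"
  using N by (auto simp: strip_def swap_def)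
 have j': "sg (Outer (j + 1)) = Outer j" using pairing_invol[OF sg, of "Outer j"] j by simp
 have s: "sg (Outer i) = Outer (swap N j i)" if si: "strip N j i" for i
 proof -
  obtain l where "i = j + l * int N \<or> i = j + 1 + l * int N" using strip_two[OF sj(1) si] sj(2) by auto
  thus ?thesis using j j' pairing_shift_Outer[OF sg, of j l] pairing_shift_Outer[OF sg, of "j + 1" l]
   strip_shift(2)[of N j "j + 1" l] sj by auto
 qed
 have o: "sg q = oswap N j q" if "ostrip N j q" for q using s that by (cases q) auto
 hence "\<not> ostrip N j (sg p)" if "\<not> ostrip N j p"
  using that oswap_strip(1)[OF N, of j "sg p"] pairing_invol[OF sg, of p] by metis
 thus "e_left N j sg p = sg p" using o by (auto simp: e_left_def)
qed

lemma comp_e_absorb_left: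
 assumes N: "N >= 2" and sg: "per N sg" and j: "sg (Outer j) = Outer (j + 1)"
 shows "comp_pairing (e_pairing N j) sg = sg" "contractible_loops N (e_pairing N j) sg = 1"
  "noncontractible_loops N (e_pairing N j) sg = 0"
 using e_left_absorb[OF assms] j N by (simp_all add: comp_e_left[OF N sg] loops_e_left[OF N sg])

lemma comp_e_absorb_right:
 assumes N: "N >= 2" and sg: "per N sg" and j: "sg (Inner j) = Inner (j + 1)"
 shows "comp_pairing sg (e_pairing N j) = sg" "contractible_loops N sg (e_pairing N j) = 1"
  "noncontractible_loops N sg (e_pairing N j) = 0"
proof -
 have "mirror_pairing sg (Outer j) = Outer (j + 1)" by (simp add: mirror_pairing_def j)
 note ab = comp_e_absorb_left[OF N periodic_mirror[OF sg] this]
 have "mirror_pairing (comp_pairing sg (e_pairing N j)) = mirror_pairing sg"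
  using ab(1) comp_pairing_mirror[OF _ sg periodic_e[OF N]] N by (simp add: mirror_e)
 thus "comp_pairing sg (e_pairing N j) = sg" by (metis mirror_pairing_mirror)
 show "contractible_loops N sg (e_pairing N j) = 1" "noncontractible_loops N sg (e_pairing N j) = 0"
  using ab(2,3) closed_components_mirror[of "e_pairing N j" sg]
  by (simp_all add: contractible_loops_def noncontractible_loops_def mirror_e)
qed

section \<open>Planarity\<close>

text \<open>The boundary of the strip traversed once: the outer line from left to right, then the
  inner line from right to left. With this linear order the three clauses of
  \<open>noncrossing\<close> become one condition on pairs of chords.\<close>

fun before :: "bpoint => bpoint => bool" where
 "before (Outer i) (Outer k) = (i < k)"
| "before (Outer i) (Inner k) = True"
| "before (Inner i) (Outer k) = False"
| "before (Inner i) (Inner k) = (k < i)"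

text \<open>The chord from \<open>a\<close> to \<open>b\<close> separates \<open>x\<close> from \<open>y\<close> in the strip, whose boundary is ordered by
 \<open>before\<close>.\<close>

definition sep :: "bpoint => bpoint => bpoint => bpoint => bool" where
 "sep a b x y = ((before a x ~= before b x) ~= (before a y ~= before b y))"

definition planar :: "pairing => bool" where
 "planar sg \<longleftrightarrow> (\<forall>p r. r ~= p --> r ~= sg p --> \<not> sep p (sg p) r (sg r))"

lemma before_flip: "a ~= b ==> before a b = (\<not> before b a)"
 by (cases a; cases b) auto

lemma sep_flip: "x \<notin> {a, b} ==> y \<notin> {a, b} ==> sep a b x y = sep x y a b"
 using before_flip[of a x] before_flip[of a y] before_flip[of b x] before_flip[of b y]
 unfolding sep_def by auto

text \<open>For a fixed chord, separation is a parity and adds up along a chain of points. This is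
  what makes it possible to follow an arc of a product through its pieces.\<close>

lemma sep_trans: "sep a b x z = (sep a b x y ~= sep a b y z)"
 unfolding sep_def by auto

lemma sep_adjacent:
 assumes "ostrip N j p" "a \<notin> {p, oswap N j p}" "b \<notin> {p, oswap N j p}"
 shows "\<not> sep a b p (oswap N j p)"
proof -
 obtain i where i: "p = Outer i" using assms(1) by (cases p) auto
 have s: "swap N j i = i + 1 \<or> swap N j i = i - 1" using assms(1) i by (auto simp: swap_def strip_def)
 have "before c p = before c (oswap N j p)" if "c \<notin> {p, oswap N j p}" for c
  using that i s by (cases c) auto
 thus ?thesis using assms(2,3) unfolding sep_def by auto
qed

lemma noncrossing_iff_planar:
 assumes inv: "!!p. sg (sg p) = p"
 shows "noncrossing sg \<longleftrightarrow> planar sg"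
proof
 assume p: "planar sg"
 have P: "\<not> sep p (sg p) r (sg r)" "sg r ~= p" "sg r ~= sg p" if "r ~= p" "r ~= sg p" for p r
  using p that inv by (auto simp: planar_def) (metis inv)+
 show "noncrossing sg"
  unfolding noncrossing_def
 proof (intro conjI allI impI; elim conjE)
  fix i j k assume a: "sg (Outer i) = Outer j" "i < k" "k < j"
  thus "\<exists>l>i. l < j \<and> sg (Outer k) = Outer l"
   using P[of "Outer k" "Outer i"] by (cases "sg (Outer k)") (auto simp: sep_def)
 next
  fix i j k assume a: "sg (Inner i) = Inner j" "i < k" "k < j"
  thus "\<exists>l>i. l < j \<and> sg (Inner k) = Inner l"
   using P[of "Inner k" "Inner i"] by (cases "sg (Inner k)") (auto simp: sep_def)
 next
  fix i j i' j' assume a: "sg (Outer i) = Inner j" "sg (Outer i') = Inner j'" "i < i'"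
  thus "j < j'"
   using P[of "Outer i'" "Outer i"] by (auto simp: sep_def)
 qed
next
 assume nc: "noncrossing sg"
 have o: "\<exists>l. i < l \<and> l < j \<and> sg (Outer k) = Outer l" if "sg (Outer i) = Outer j" "i < k" "k < j" for i j k
  using nc that unfolding noncrossing_def by blast
 have i: "\<exists>l. i < l \<and> l < j \<and> sg (Inner k) = Inner l" if "sg (Inner i) = Inner j" "i < k" "k < j" for i j k
  using nc that unfolding noncrossing_def by blast
 have t: "j < j'" if "sg (Outer i) = Inner j" "sg (Outer i') = Inner j'" "i < i'" for i j i' j'
  using nc that unfolding noncrossing_def by blast
 show "planar sg"
  unfolding planar_def
 proof (intro allI impI)
  fix p r assume ne: "r ~= p" "r ~= sg p"
  define p' r' where "p' = sg p" and "r' = sg r"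
  have inv': "sg p' = p" "sg r' = r" by (simp_all add: p'_def r'_def inv)
  have ne': "r' ~= p" "r' ~= p'" using ne inv' by (auto simp: p'_def r'_def)
  \<comment> \<open>One half of planarity: if \<open>r\<close> lies between the ends of the chord,
    so does its partner. Exchanging \<open>r\<close> and its partner gives the other half.\<close>
  have half: "before p r = before p' r \<or> before p r' ~= before p' r'"
   if "sg p = p'" "sg p' = p" "sg r = r'" "sg r' = r" "r ~= p" "r ~= p'" "r' ~= p" "r' ~= p'" for p p' r r'
  proof -
   \<comment> \<open>The chord is a through line here; all three clauses of
     \<open>noncrossing\<close> occur, depending on the sides of \<open>r\<close> and its
     partner.\<close>
   have OI: "before p r = before p' r \<or> before p r' ~= before p' r'"
    if p: "p = Outer x" "p' = Inner x'" and eq: "sg p = p'" "sg p' = p" "sg r = r'" "sg r' = r"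
     "r ~= p" "r ~= p'" "r' ~= p" "r' ~= p'" for p p' r r' x x'
   proof (cases r)
    case r: (Outer y)
    show ?thesis
    proof (cases r')
     case (Outer y')
     thus ?thesis using o[of y' y x] p r eq by (cases "y' < x") auto
    next
     case (Inner y')
     thus ?thesis using t[of x x' y y'] p r eq by auto
    qed
   next
    case r: (Inner y)
    show ?thesis
    proof (cases r')
     case (Outer y')
     thus ?thesis using t[of y' y x x'] p r eq by (cases "y' < x") auto
    next
     case (Inner y')
     thus ?thesis using i[of y' y x'] p r eq by (cases "x' < y") auto
    qed
   qed
   show ?thesis
   proof (cases p)
    case p: (Outer x)
    show ?thesis
    proof (cases p')
     case (Outer x')
     note q = this
     show ?thesis
     proof (cases r)
      case (Outer y)
      thus ?thesis using o[of x x' y] o[of x' x y] p q that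
       by (cases "x < y"; cases "x' < y") (auto simp: not_less)
     qed (use p q in auto)
    next
     case (Inner x')
     show ?thesis by (rule OI[OF p Inner]) (use that in auto)
    qed
   next
    case p: (Inner x)
    show ?thesis
    proof (cases p')
     case (Inner x')
     note q = this
     show ?thesis
     proof (cases r)
      case (Inner y)
      thus ?thesis using i[of x x' y] i[of x' x y] p q that
       by (cases "x < y"; cases "x' < y") (auto simp: not_less)
     qed (use p q in auto)
    next
     case (Outer x')
     have "before p' r = before p r \<or> before p' r' ~= before p r'"
      by (rule OI[OF Outer p]) (use that in auto)
     thus ?thesis by blast
    qed
   qed
  qed
  have eqs: "sg p = p'" "sg r = r'" by (simp_all add: p'_def r'_def)
  have "\<not> sep p p' r r'"
   using half[OF eqs(1) inv'(1) eqs(2) inv'(2) ne(1) _ ne'] half[OF eqs(1) inv'(1) inv'(2) eqs(2) ne' ne(1)] ne(2) eqs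
   unfolding sep_def by auto
  thus "\<not> sep p (sg p) r (sg r)" by (simp add: p'_def r'_def)
 qed
qed

text \<open>A rerouted arc of the product is a chain of two arcs of \<open>sg\<close> and one arc of
  \<open>e_j\<close> between neighbours. A chord separates the ends of none of the three pieces,
  hence by \<open>sep_trans\<close> not the ends of the chain.\<close>

lemma planar_e_left:
 assumes N: "N >= 2" and sg: "per N sg" and pl: "planar sg"
 shows "planar (e_left N j sg)"
proof -
 define ta where "ta = e_left N j sg"
 have per: "per N ta"
  using periodic_comp[OF _ periodic_e[OF N] sg] comp_e_left[OF N sg] N by (simp add: ta_def)
 note ti = pairing_invol[OF per] and si = pairing_invol[OF sg]
 have P: "\<not> sep x (sg x) y (sg y)" if "y ~= x" "y ~= sg x" for x y
  using pl that by (auto simp: planar_def)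
 have ts: "ta p = oswap N j p" if "ostrip N j p" for p using that by (simp add: ta_def e_left_def)
 have tn: "ta p = (if ostrip N j (sg p) then sg (oswap N j (sg p)) else sg p)" if "\<not> ostrip N j p" for p
  using that by (simp add: ta_def e_left_def)
 have tns: "\<not> ostrip N j (ta p)" if "\<not> ostrip N j p" for p
  using that tn[OF that] e_left_escape[OF N sg that] by simp
 \<comment> \<open>Mixed statement: a chord of the old pairing against an arc of the new one. When
   both arcs are rerouted, it is applied to the pieces of one of them, with \<open>sep_flip\<close>
   exchanging chord and ends.\<close>
 have old: "\<not> sep x (sg x) p (ta p)"
  if p: "\<not> ostrip N j p" and x: "x ~= p" "x ~= ta p" "x ~= sg p" "ostrip N j (sg p) ==> x ~= oswap N j (sg p)" for p x
 proof (cases "ostrip N j (sg p)")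
  case True
  define a b where "a = sg p" and "b = oswap N j a"
  have tp: "ta p = sg b" using tn[OF p] True by (simp add: a_def b_def)
  have xs: "x ~= a" "x ~= b" "x ~= sg b" "x ~= p" using x True tp by (auto simp: a_def b_def)
  have pa: "p = sg a" by (simp add: a_def si)
  have xs': "sg x ~= a" "sg x ~= b" using xs si pa by metis+
  have 1: "\<not> sep x (sg x) p a" using P[of p x] xs xs' pa si by (metis a_def)
  have 2: "\<not> sep x (sg x) a b"
   unfolding b_def by (rule sep_adjacent) (use True xs xs' in \<open>auto simp: a_def b_def\<close>)
  have 3: "\<not> sep x (sg x) b (sg b)" using P[of b x] xs xs' by auto
  show ?thesis unfolding tp
   using 1 2 3 sep_trans[of x "sg x" p "sg b" a] sep_trans[of x "sg x" a "sg b" b] by simp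
 next
  case False
  hence "ta p = sg p" using tn[OF p] by simp
  thus ?thesis using P[of p x] x si by metis
 qed
 show ?thesis
  unfolding planar_def ta_def[symmetric]
 proof (intro allI impI)
  fix p r assume ne: "r ~= p" "r ~= ta p"
  have ne': "ta r ~= p" "ta r ~= ta p" using ne ti by metis+
  show "\<not> sep p (ta p) r (ta r)"
  proof (cases "ostrip N j p \<or> ostrip N j r")
   case True
   thus ?thesis
   proof
    assume s: "ostrip N j p"
    have "\<not> sep r (ta r) p (oswap N j p)" by (rule sep_adjacent[OF s]) (use ne ne' ts[OF s] in auto)
    thus ?thesis using sep_flip[of r p "ta p" "ta r"] ne ne' ts[OF s] by auto
   next
    assume s: "ostrip N j r"
    have "\<not> sep p (ta p) r (oswap N j r)" by (rule sep_adjacent[OF s]) (use ne ne' ts[OF s] in auto)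
    thus ?thesis using ts[OF s] by simp
   qed
  next
   case False
   hence np: "\<not> ostrip N j p" and nr: "\<not> ostrip N j r" by auto
   have rp: "r ~= sg p"
    using ne(2) tn[OF np] nr by (auto split: if_splits)
   have ro: "ostrip N j (sg p) ==> r ~= oswap N j (sg p)"
    using oswap_strip(1)[OF N] nr by auto
   have A: "\<not> sep r (sg r) p (ta p)" by (rule old[OF np ne rp ro])
   show ?thesis
   proof (cases "ostrip N j (sg r)")
    case False
    hence "ta r = sg r" using tn[OF nr] by simp
    thus ?thesis using A sep_flip[of r p "ta p" "ta r"] ne ne' by auto
   next
    case True
    define c d where "c = sg r" and "d = oswap N j c"
    have tr: "ta r = sg d" using tn[OF nr] True by (simp add: c_def d_def)
    have cs: "ostrip N j c" "ostrip N j d" "oswap N j d = c"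
     using True oswap_strip[OF N] by (auto simp: c_def d_def)
    have pc: "p ~= c" "p ~= d" "ta p ~= c" "ta p ~= d" using np tns[OF np] cs by auto
    have s1: "\<not> sep p (ta p) r c"
     using A sep_flip[of r p "ta p" c] ne pc by (auto simp: c_def)
    have s2: "\<not> sep p (ta p) c d"
     unfolding d_def by (rule sep_adjacent[OF cs(1)]) (use pc in \<open>auto simp: d_def\<close>)
    have da: "d ~= sg p" using cs(3) ne(2) tn[OF np] cs(2) si c_def by (metis)
    have db: "d ~= oswap N j (sg p)" if "ostrip N j (sg p)"
     using that cs oswap_strip(2)[OF N] si ne(1) c_def by metis
    have "\<not> sep d (sg d) p (ta p)" by (rule old[OF np]) (use pc da db in auto)
    hence s3: "\<not> sep p (ta p) d (sg d)"
     using sep_flip[of d p "ta p" "sg d"] pc ne' tr by auto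
    show ?thesis unfolding tr
     using s1 s2 s3 sep_trans[of p "ta p" r "sg d" c] sep_trans[of p "ta p" c "sg d" d] by simp
   qed
  qed
 qed
qed

section \<open>Affine diagrams\<close>

lemma affine_diagrams_iff:
 "(sg, l) \<in> AD N \<longleftrightarrow> per N sg \<and> planar sg \<and> (has_through_line sg --> l = 0)"
 using noncrossing_iff_planar[of sg] pairing_invol[of N sg] by (auto simp: affine_diagrams_def)

lemma comp_diagram_trans_left:
 assumes "N >= 1" "per N sg"
 shows "comp_diagram N (tr_pairing k, 0) (sg, l) = (\<lambda>p. oshift (- k) (sg (oshift k p)), l)"
 using comp_trans_left[OF assms] by (simp add: comp_diagram_def)

lemma comp_diagram_trans_right:
 assumes "N >= 1" "per N sg"
 shows "comp_diagram N (sg, l) (tr_pairing k, 0) = (\<lambda>p. ishift k (sg (ishift (- k) p)), l)"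
 using comp_trans_right[OF assms] by (simp add: comp_diagram_def)

lemma before_oshift [simp]: "before (oshift k p) (oshift k q) = before p q"
 and before_ishift [simp]: "before (ishift k p) (ishift k q) = before p q"
 by (cases p; cases q; simp)+

lemma planar_oshift: "planar sg ==> planar (\<lambda>p. oshift (- k) (sg (oshift k p)))"
 unfolding planar_def
proof (intro allI impI)
 fix p r assume a: "\<forall>p r. r ~= p --> r ~= sg p --> \<not> sep p (sg p) r (sg r)"
  and r: "r ~= p" "r ~= oshift (- k) (sg (oshift k p))"
 have s: "sep (oshift k a) (oshift k b) (oshift k c) (oshift k d) = sep a b c d" for a b c d
  by (simp add: sep_def)
 have "oshift k r ~= sg (oshift k p)" using r(2) by (metis oshift_simps(1,2) add.left_inverse)
 hence "\<not> sep (oshift k p) (sg (oshift k p)) (oshift k r) (sg (oshift k r))" using a r(1) by simp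
 thus "\<not> sep p (oshift (- k) (sg (oshift k p))) r (oshift (- k) (sg (oshift k r)))"
  using s[of p "oshift (- k) (sg (oshift k p))" r "oshift (- k) (sg (oshift k r))"] by simp
qed

lemma planar_ishift: "planar sg ==> planar (\<lambda>p. ishift k (sg (ishift (- k) p)))"
 unfolding planar_def
proof (intro allI impI)
 fix p r assume a: "\<forall>p r. r ~= p --> r ~= sg p --> \<not> sep p (sg p) r (sg r)"
  and r: "r ~= p" "r ~= ishift k (sg (ishift (- k) p))"
 have s: "sep (ishift (- k) a) (ishift (- k) b) (ishift (- k) c) (ishift (- k) d) = sep a b c d" for a b c d
  by (simp add: sep_def)
 have "ishift (- k) r ~= sg (ishift (- k) p)" using r(2) by (metis ishift_simps(1,2) add.right_inverse)
 hence "\<not> sep (ishift (- k) p) (sg (ishift (- k) p)) (ishift (- k) r) (sg (ishift (- k) r))" using a r(1) by simp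
 thus "\<not> sep p (ishift k (sg (ishift (- k) p))) r (ishift k (sg (ishift (- k) r)))"
  using s[of p "ishift k (sg (ishift (- k) p))" r "ishift k (sg (ishift (- k) r))"] by simp
qed

lemma affine_trans: assumes "N >= 1" shows "(tr_pairing k, 0) \<in> AD N"
proof -
 have "noncrossing (tr_pairing k)" by (auto simp: noncrossing_def)
 thus ?thesis by (simp add: affine_diagrams_def)
qed

lemma affine_comp_trans_left:
 assumes N: "N >= 1" and d: "d \<in> AD N"
 shows "comp_diagram N (tr_pairing k, 0) d \<in> AD N"
proof -
 obtain sg l where d': "d = (sg, l)" by (cases d)
 have sg: "per N sg" "planar sg" "has_through_line sg --> l = 0"
  using d unfolding d' affine_diagrams_iff by auto
 let ?ta = "\<lambda>p. oshift (- k) (sg (oshift k p))"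
 have "per N ?ta" using periodic_comp[OF N periodic_trans sg(1)] comp_trans_left[OF N sg(1)] by metis
 moreover have "has_through_line ?ta ==> has_through_line sg"
  unfolding has_through_line_def by (elim exE) (metis bpoint.exhaust bpoint.simps(4) oshift.simps)
 ultimately show ?thesis
  using sg planar_oshift[of sg k] unfolding d' comp_diagram_trans_left[OF N sg(1)] affine_diagrams_iff by blast
qed

lemma affine_comp_trans_right:
 assumes N: "N >= 1" and d: "d \<in> AD N"
 shows "comp_diagram N d (tr_pairing k, 0) \<in> AD N"
proof -
 obtain sg l where d': "d = (sg, l)" by (cases d)
 have sg: "per N sg" "planar sg" "has_through_line sg --> l = 0"
  using d unfolding d' affine_diagrams_iff by auto
 let ?ta = "\<lambda>p. ishift k (sg (ishift (- k) p))"
 have "per N ?ta" using periodic_comp[OF N sg(1) periodic_trans] comp_trans_right[OF N sg(1)] by metis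
 moreover have "has_through_line ?ta ==> has_through_line sg"
  unfolding has_through_line_def by (elim exE) (metis bpoint.exhaust bpoint.simps(4) ishift.simps)
 ultimately show ?thesis
  using sg planar_ishift[of sg k] unfolding d' comp_diagram_trans_right[OF N sg(1)] affine_diagrams_iff by blast
qed

text \<open>Besides planarity, the condition on non-contractible loops has to be kept: the product
  must not create one while a through line is present.\<close>

lemma affine_comp_e_left:
 assumes N: "N >= 2" and d: "d \<in> AD N"
 shows "comp_diagram N (e_diagram N j) d \<in> AD N"
proof -
 obtain sg l where d': "d = (sg, l)" by (cases d)
 have sg: "per N sg" "planar sg" "has_through_line sg --> l = 0" and nc: "noncrossing sg"
  using d unfolding d' affine_diagrams_iff by (auto simp: noncrossing_iff_planar pairing_invol)
 have o: "\<exists>l. i < l \<and> l < j \<and> sg (Outer k) = Outer l" if "sg (Outer i) = Outer j" "i < k" "k < j" for i j k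
  using nc that unfolding noncrossing_def by blast
 have through: "has_through_line sg" if "has_through_line (e_left N j sg)"
 proof (rule ccontr)
  assume "\<not> has_through_line sg"
  hence "\<exists>x. sg (Outer i) = Outer x" for i
   unfolding has_through_line_def by (metis bpoint.exhaust)
  hence "\<exists>x. e_left N j sg (Outer i) = Outer x" for i
   unfolding e_left_def by (metis oswap.simps(1))
  thus False using that unfolding has_through_line_def by (metis bpoint.distinct(1))
 qed
 \<comment> \<open>A winding loop needs an arc of \<open>sg\<close> spanning at least a full period.
   Some translate of the through line would start below that arc, against the first clause of
   \<open>noncrossing\<close>.\<close>
 have nc0: "noncontractible_loops N (e_pairing N j) sg = 0" if t: "has_through_line sg"
 proof -
  have False if k: "k ~= 0" "sg (Outer j) = Outer (j + 1 + k * int N)" for k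
  proof -
   obtain x y where xy: "sg (Outer x) = Inner y" using t by (auto simp: has_through_line_def)
   have xi: "\<exists>y. sg (Outer (x + l * int N)) = Inner y" for l
    using pairing_shift_Outer[OF sg(1), of x l] xy by auto
   have k': "sg (Outer (j + 1 + k * int N)) = Outer j" using k pairing_invol[OF sg(1), of "Outer j"] by simp
   have win: "\<exists>l. b <= x + l * int N \<and> x + l * int N < b + int N" for b
   proof (intro exI[of _ "- ((x - b) div int N)"])
    have "x + - ((x - b) div int N) * int N = b + (x - b) mod int N"
     by (simp add: minus_mult_div_eq_mod[symmetric] algebra_simps)
    thus "b <= x + - ((x - b) div int N) * int N \<and> x + - ((x - b) div int N) * int N < b + int N"
     using N by simp
   qed
   show False
   proof (cases "k > 0")
    case True
    obtain l where l: "j <= x + l * int N" "x + l * int N < j + int N" using win by blast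
    define M z where "M = k * int N" and "z = x + l * int N"
    have "int N <= M" using True mult_right_mono[of 1 k "int N"] by (simp add: M_def)
    thus False using xi[of l] o[OF k(2), of "x + l * int N"] k(2) l
     unfolding M_def[symmetric] z_def[symmetric]
     by (cases "z = j") auto
   next
    case False
    obtain l where l: "j + 1 - int N <= x + l * int N" "x + l * int N < j + 1 - int N + int N" using win by blast
    define M z where "M = k * int N" and "z = x + l * int N"
    have "M <= - int N" using False k(1) mult_right_mono[of k "-1" "int N"] by (simp add: M_def)
    thus False using xi[of l] o[OF k', of "x + l * int N"] k(2) k' l
     unfolding M_def[symmetric] z_def[symmetric]
     by (cases "z = j \<or> z = j + 1 + M") auto
   qed
  qed
  thus ?thesis using loops_e_left(2)[OF N sg(1), of j] by auto
 qed
 have "per N (e_left N j sg)"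
  using periodic_comp[OF _ periodic_e[OF N] sg(1)] comp_e_left[OF N sg(1)] N by simp
 thus ?thesis
  using planar_e_left[OF N sg(1,2)] through nc0 sg(3)
  unfolding d' comp_diagram_def e_diagram_pairing fst_conv snd_conv comp_e_left[OF N sg(1)] affine_diagrams_iff
  by auto
qed

lemma comp_diagram_id_right:
 assumes "N >= 1" "per N (fst d)" shows "comp_diagram N d id_diagram = d"
 using comp_diagram_trans_right[OF assms, of "snd d" 0] by (simp add: diagrams_trans)

lemma comp_diagram_id_left:
 assumes "N >= 1" "per N (fst d)" shows "comp_diagram N id_diagram d = d"
 using comp_diagram_trans_left[OF assms, of 0 "snd d"] by (simp add: diagrams_trans)

lemma affine_e: assumes "N >= 2" shows "e_diagram N j \<in> AD N"
 using affine_comp_e_left[OF assms, of id_diagram j] affine_trans[of N 0] assms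
 by (simp add: comp_diagram_id_right e_diagram_pairing diagrams_trans(1)[symmetric])

text \<open>Descent on the length of an arc: if \<open>j\<close> is not \<open>i + 1\<close>, the
  partner of \<open>i + 1\<close> lies strictly inside, which gives a shorter arc.\<close>

lemma adjacent_arc:
 fixes P :: "int => int => bool"
 assumes sym: "!!i j. P i j ==> P j i" and irr: "!!i. \<not> P i i"
  and nest: "!!i j k. P i j ==> i < k ==> k < j ==> \<exists>l. i < l \<and> l < j \<and> P k l"
  and "P i j"
 shows "\<exists>a. P a (a + 1)"
 using \<open>P i j\<close>
proof (induction "nat \<bar>i - j\<bar>" arbitrary: i j rule: less_induct)
 case less
 have *: ?case if ij: "i < j" "P i j" "nat \<bar>i - j\<bar> <= nat \<bar>i0 - j0\<bar>" and IH: "!!a b. nat \<bar>a - b\<bar> < nat \<bar>i0 - j0\<bar> ==> P a b ==> \<exists>a. P a (a + 1)" for i j i0 j0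
 proof (cases "j = i + 1")
  case False
  then obtain l where "i < l" "l < j" "P (i + 1) l" using nest[OF ij(2), of "i + 1"] ij(1) by auto
  moreover have "nat \<bar>i + 1 - l\<bar> < nat \<bar>i0 - j0\<bar>" using calculation(1,2) ij(1,3) by linarith
  ultimately show ?thesis using IH[of "i + 1" l] by blast
 qed (use ij in auto)
 have "i ~= j" using less irr by auto
 thus ?case
  using *[of i j i j] *[of j i i j] less sym by (cases "i < j") auto
qed

text \<open>A strictly increasing integer map gains at least 1 per step; gaining exactly
  \<open>N\<close> over \<open>N\<close> steps leaves exactly 1 for each.\<close>

lemma translation_if_increasing:
 fixes f :: "int => int"
 assumes N: "N >= 1" and inc: "!!i j. i < j ==> f i < f j" and per: "!!i. f (i + int N) = f i + int N"
 shows "f i = i + f 0"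
proof -
 have ge: "f (i + int n) >= f i + int n" for i n
 proof (induction n)
  case (Suc n)
  have "f (i + int n) < f (i + int (Suc n))" by (rule inc) simp
  thus ?case using Suc by simp
 qed simp
 have "f (i + 1) = f i + 1" for i
  using ge[of "i + 1" "N - 1"] inc[of i "i + 1"] per[of i] N by (simp add: of_nat_diff algebra_simps)
 hence step: "f (i + 1) = f i + 1" for i .
 have up: "f (i + int n) = f i + int n" for i n
 proof (induction n)
  case (Suc n)
  thus ?case using step[of "i + int n"] by (simp add: algebra_simps)
 qed simp
 show ?thesis
 proof (cases "i >= 0")
  case True
  thus ?thesis using up[of 0 "nat i"] by simp
 next
  case False
  thus ?thesis using up[of i "nat (- i)"] by simp
 qed
qed

text \<open>If one boundary carries no arc, its through lines define an increasing periodic map,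
  hence a translation, which exhausts the other boundary too. So arcs occur on both boundaries or on
  neither, and then innermost arcs join neighbours.\<close>

lemma diagram_cases:
 assumes N: "N >= 1" and d: "(sg, l) \<in> AD N"
 obtains (trans) k where "sg = tr_pairing k" "l = 0"
 | (arcs) a b where "sg (Outer a) = Outer (a + 1)" "sg (Inner b) = Inner (b + 1)"
proof -
 have sg: "per N sg" "noncrossing sg" "has_through_line sg --> l = 0"
  using d by (auto simp: affine_diagrams_def)
 note inv = pairing_invol[OF sg(1)]
 have fin: "l = 0" if "sg = tr_pairing k" for k
  using sg(3) that by (auto simp: has_through_line_def)
 show thesis
 proof (cases "\<exists>i j. sg (Outer i) = Outer j")
  case False
  hence "\<forall>i. \<exists>j. sg (Outer i) = Inner j" by (metis bpoint.exhaust)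
  then obtain f where f: "!!i. sg (Outer i) = Inner (f i)" by metis
  have "f i < f j" if "i < j" for i j using sg(2) f that unfolding noncrossing_def by blast
  moreover have "f (i + int N) = f i + int N" for i
   using pairing_shift_Outer[OF sg(1), of i 1] by (simp add: f)
  ultimately have "f i = i + f 0" for i by (rule translation_if_increasing[OF N])
  hence fo: "sg (Outer i) = Inner (i + f 0)" for i using f by metis
  have "sg (Inner i) = Outer (i - f 0)" for i using inv[of "Outer (i - f 0)"] by (simp add: fo)
  hence "sg = tr_pairing (f 0)" using fo by (auto simp: fun_eq_iff tr_pairing_def split: bpoint.splits)
  thus thesis using fin trans by blast
 next
  case o: True
  show thesis
  proof (cases "\<exists>i j. sg (Inner i) = Inner j")
   case False
   hence "\<forall>i. \<exists>j. sg (Inner i) = Outer j" by (metis bpoint.exhaust)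
   then obtain f where f: "!!i. sg (Inner i) = Outer (f i)" by metis
   have fi: "sg (Outer (f i)) = Inner i" for i using inv[of "Inner i"] f by simp
   have "f i < f j" if "i < j" for i j
   proof (rule ccontr)
    assume "\<not> f i < f j"
    moreover have "f i ~= f j" using fi that by (metis bpoint.inject(2) less_irrefl)
    ultimately have "f j < f i" by simp
    hence "j < i" using sg(2) fi unfolding noncrossing_def by blast
    thus False using that by simp
   qed
   moreover have "f (i + int N) = f i + int N" for i
    using pairing_shift[OF sg(1), of 1 "Inner i"] by (simp add: f)
   ultimately have "f i = i + f 0" for i by (rule translation_if_increasing[OF N])
   hence fo: "sg (Inner i) = Outer (i + f 0)" for i using f by metis
   have "sg (Outer i) = Inner (i - f 0)" for i using inv[of "Inner (i - f 0)"] by (simp add: fo)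
   thus thesis using o by simp
  next
   case i: True
   have irr: "sg p ~= p" for p using pairing_neq[OF sg(1)] .
   have "\<exists>a. sg (Outer a) = Outer (a + 1)"
    using o by (elim exE) (erule adjacent_arc[rotated 3], insert sg(2) irr inv, unfold noncrossing_def, metis+)
   moreover have "\<exists>a. sg (Inner a) = Inner (a + 1)"
    using i by (elim exE) (erule adjacent_arc[rotated 3], insert sg(2) irr inv, unfold noncrossing_def, metis+)
   ultimately show thesis using arcs by blast
  qed
 qed
qed

section \<open>Relations between the generators\<close>

lemma trans_comp: "N >= 1 ==> comp_diagram N (tr_pairing k, 0) (tr_pairing l, 0) = (tr_pairing (k + l), 0)"
 by (subst comp_diagram_trans_left) (auto simp: fun_eq_iff tr_pairing_def split: bpoint.splits)

lemma trans_e: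
 assumes "N >= 2"
 shows "comp_diagram N (tr_pairing k, 0) (e_diagram N j) = comp_diagram N (e_diagram N (j - k)) (tr_pairing k, 0)"
proof -
 have m: "i + k - j = i - (j - k)" for i by simp
 have s: "strip N j (i + k) = strip N (j - k) i" "swap N j (i + k) = swap N (j - k) i + k" for i
  unfolding strip_def swap_def m by simp_all
 have s': "strip N (j - k) (i - k) = strip N j i" "swap N (j - k) (i - k) = swap N j i - k" for i
  using s[of "i - k"] by simp_all
 have "oshift (- k) (e_pairing N j (oshift k p)) = ishift k (e_pairing N (j - k) (ishift (- k) p))" for p
  by (cases p) (auto simp: s s')
 thus ?thesis
  using assms unfolding e_diagram_pairing
  by (subst comp_diagram_trans_left, simp, simp, subst comp_diagram_trans_right, simp, simp) simp
qed

context
 fixes N :: nat and j :: int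
 assumes N: "N >= 3"
begin

text \<open>Computations with \<open>e_j\<close> and \<open>e_(j+1)\<close> depend only on whether
  \<open>i - j\<close> is 0, 1, 2 or something else modulo \<open>N\<close>. The bound
  \<open>N >= 3\<close> keeps these residues apart, and residue 0 becomes \<open>N - 1\<close>
  relative to \<open>j + 1\<close>, outside the second strip.\<close>

lemma strip_residues:
 "strip N j i \<longleftrightarrow> (i - j) mod int N \<in> {0, 1}" "strip N (j + 1) i \<longleftrightarrow> (i - j) mod int N \<in> {1, 2}"
 "(i - j) mod int N = 0 ==> swap N j i = i + 1" "(i - j) mod int N = 1 ==> swap N j i = i - 1"
 "(i - j) mod int N = 1 ==> swap N (j + 1) i = i + 1" "(i - j) mod int N = 2 ==> swap N (j + 1) i = i - 1"
proof -
 define r where "r = (i - j) mod int N"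
 have r: "0 <= r" "r < int N" using N by (auto simp: r_def)
 have "(i - (j + 1)) mod int N = (if r = 0 then int N - 1 else r - 1)"
 proof (cases "r = 0")
  case True
  have "(i - (j + 1)) mod int N = (r - 1) mod int N" by (simp add: r_def mod_simps diff_diff_eq)
  also have "\<dots> = int N - 1" using True N zmod_minus1[of "int N"] by simp
  finally show ?thesis using True by simp
 next
  case False
  hence "r >= 1" using r by simp
  thus ?thesis using False mod_pred[of "i - j" "int N" r] N by (simp add: r_def diff_diff_eq)
 qed
 thus "strip N j i \<longleftrightarrow> (i - j) mod int N \<in> {0, 1}" "strip N (j + 1) i \<longleftrightarrow> (i - j) mod int N \<in> {1, 2}"
  "(i - j) mod int N = 0 ==> swap N j i = i + 1" "(i - j) mod int N = 1 ==> swap N j i = i - 1"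
  "(i - j) mod int N = 1 ==> swap N (j + 1) i = i + 1" "(i - j) mod int N = 2 ==> swap N (j + 1) i = i - 1"
  using N r by (auto simp: strip_def swap_def r_def[symmetric])
qed

lemma residues_step:
 "(i - j) mod int N = 0 ==> (i + 1 - j) mod int N = 1" "(i - j) mod int N = 1 ==> (i + 1 - j) mod int N = 2"
 "(i - j) mod int N = 1 ==> (i - 1 - j) mod int N = 0" "(i - j) mod int N = 2 ==> (i - 1 - j) mod int N = 1"
 "(i - j) mod int N = 0 ==> (i + 2 - j) mod int N = 2" "(i - j) mod int N = 2 ==> (i - 2 - j) mod int N = 0"
proof -
 have a: "(i + 1 - j) mod int N = c + 1" if "(i - j) mod int N = c" "c + 1 < int N" for c i
  using mod_succ[OF that] N by (simp add: algebra_simps)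
 have b: "(i - 1 - j) mod int N = c - 1" if "(i - j) mod int N = c" "c >= 1" for c i
  using mod_pred[OF that] N by (simp add: algebra_simps)
 show "(i - j) mod int N = 0 ==> (i + 1 - j) mod int N = 1" "(i - j) mod int N = 1 ==> (i + 1 - j) mod int N = 2"
  "(i - j) mod int N = 1 ==> (i - 1 - j) mod int N = 0" "(i - j) mod int N = 2 ==> (i - 1 - j) mod int N = 1"
  using a[of i] b[of i] N by auto
 show "(i - j) mod int N = 0 ==> (i + 2 - j) mod int N = 2"
  using a[of i 0] a[of "i + 1" 1] N by (auto simp: algebra_simps)
 show "(i - j) mod int N = 2 ==> (i - 2 - j) mod int N = 0"
  using b[of i 2] b[of "i - 1" 1] N by (auto simp: algebra_simps)
qed

lemma e_braid_pairings:
 "e_left N j (e_left N (j + 1) (e_pairing N j)) = e_pairing N j"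
 "e_left N (j + 1) (e_left N j (e_pairing N (j + 1))) = e_pairing N (j + 1)"
proof -
 have c: "(i - j) mod int N = 0 \<or> (i - j) mod int N = 1 \<or> (i - j) mod int N = 2 \<or>
  ((i - j) mod int N ~= 0 \<and> (i - j) mod int N ~= 1 \<and> (i - j) mod int N ~= 2)" for i by blast
 note S = strip_residues residues_step
 have S': "(i - j) mod int N = 0 ==> (1 + i - j) mod int N = 1" "(i - j) mod int N = 1 ==> (1 + i - j) mod int N = 2"
  "(i - j) mod int N = 0 ==> (2 + i - j) mod int N = 2" for i
  using residues_step[of i] by (simp_all add: add.commute)
 note S = S S'
 show "e_left N j (e_left N (j + 1) (e_pairing N j)) = e_pairing N j"
 proof
  fix p show "e_left N j (e_left N (j + 1) (e_pairing N j)) p = e_pairing N j p"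
  proof (cases p)
   case (Outer i)
   thus ?thesis using c[of i] by (elim disjE) (simp_all add: e_left_def S)
  next
   case (Inner i)
   thus ?thesis using c[of i] by (elim disjE) (simp_all add: e_left_def S)
  qed
 qed
 show "e_left N (j + 1) (e_left N j (e_pairing N (j + 1))) = e_pairing N (j + 1)"
 proof
  fix p show "e_left N (j + 1) (e_left N j (e_pairing N (j + 1))) p = e_pairing N (j + 1) p"
  proof (cases p)
   case (Outer i)
   thus ?thesis using c[of i] by (elim disjE) (simp_all add: e_left_def S)
  next
   case (Inner i)
   thus ?thesis using c[of i] by (elim disjE) (simp_all add: e_left_def S)
  qed
 qed
qed

lemma e_braid_loops:
 "contractible_loops N (e_pairing N (j + 1)) (e_pairing N j) = 0"
 "noncontractible_loops N (e_pairing N (j + 1)) (e_pairing N j) = 0"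
 "contractible_loops N (e_pairing N j) (e_pairing N (j + 1)) = 0"
 "noncontractible_loops N (e_pairing N j) (e_pairing N (j + 1)) = 0"
 "contractible_loops N (e_pairing N j) (e_left N (j + 1) (e_pairing N j)) = 0"
 "noncontractible_loops N (e_pairing N j) (e_left N (j + 1) (e_pairing N j)) = 0"
 "contractible_loops N (e_pairing N (j + 1)) (e_left N j (e_pairing N (j + 1))) = 0"
 "noncontractible_loops N (e_pairing N (j + 1)) (e_left N j (e_pairing N (j + 1))) = 0"
proof -
 have N2: "N >= 2" "N >= 1" using N by auto
 note S = strip_residues residues_step
 have r: "(j - j) mod int N = 0" "(j + 1 - j) mod int N = 1" "(j + 2 - j) mod int N = 2" using N by auto
 have per: "per N (e_left N a (e_pairing N b))" for a b
  using periodic_comp[OF N2(2) periodic_e[OF N2(1)] periodic_e[OF N2(1)]] comp_e_left[OF N2(1) periodic_e[OF N2(1)]] by simp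
 have r2: "(2 + j - j) mod int N = 2" "(1 + j - j) mod int N = 1" using N by auto
 have 1: "e_pairing N j (Outer (j + 1)) = Outer j" using S[of "j + 1"] r by simp
 have 2: "e_pairing N (j + 1) (Outer j) = Inner j" using S[of j] r by simp
 have 3: "e_left N (j + 1) (e_pairing N j) (Outer j) = Inner (j + 2)"
  using S[of j] S[of "j + 1"] S[of "j + 2"] S[of "2 + j"] r r2 by (simp add: e_left_def)
 have 4: "e_left N j (e_pairing N (j + 1)) (Outer (j + 1)) = Outer j"
  using S[of j] S[of "j + 1"] r by (simp add: e_left_def)
 have no: "j ~= j + 2 + k * int N" for k
 proof
  assume "j = j + 2 + k * int N"
  hence "int N dvd 2" by (metis add.commute add_cancel_right_right dvd_minus_iff dvd_triv_right minus_unique add.assoc)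
  thus False using N zdvd_imp_le by fastforce
 qed
 have no': "j ~= j + 1 + 1 + k * int N" for k using no[of k] by simp
 show "contractible_loops N (e_pairing N (j + 1)) (e_pairing N j) = 0"
  "noncontractible_loops N (e_pairing N (j + 1)) (e_pairing N j) = 0"
  "contractible_loops N (e_pairing N j) (e_pairing N (j + 1)) = 0"
  "noncontractible_loops N (e_pairing N j) (e_pairing N (j + 1)) = 0"
  "contractible_loops N (e_pairing N j) (e_left N (j + 1) (e_pairing N j)) = 0"
  "noncontractible_loops N (e_pairing N j) (e_left N (j + 1) (e_pairing N j)) = 0"
  "contractible_loops N (e_pairing N (j + 1)) (e_left N j (e_pairing N (j + 1))) = 0"
  "noncontractible_loops N (e_pairing N (j + 1)) (e_left N j (e_pairing N (j + 1))) = 0"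
  using no' by (simp_all only: loops_e_left[OF N2(1) periodic_e[OF N2(1)]] loops_e_left[OF N2(1) per] 1 2 3 4
    bpoint.inject bpoint.distinct if_False refl simp_thms ex_simps) auto
qed

end

lemma e_commute:
 assumes N: "N >= 2" and dis: "!!i. strip N j i ==> \<not> strip N k i"
 shows "comp_diagram N (e_diagram N j) (e_diagram N k) = comp_diagram N (e_diagram N k) (e_diagram N j)"
  "contractible_loops N (e_pairing N j) (e_pairing N k) = 0"
proof -
 have dis': "strip N k i ==> \<not> strip N j i" for i using dis by blast
 have sn: "\<not> strip N j i ==> swap N j i = i" "\<not> strip N k i ==> swap N k i = i" for i
  by (auto simp: swap_def strip_def)
 have s2: "strip N j i ==> \<not> strip N k (swap N j i)" "strip N k i ==> \<not> strip N j (swap N k i)" for i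
  using dis[of "swap N j i"] dis'[of "swap N k i"] strip_swap(1)[OF N] by blast+
 have "swap N k (swap N j i) = swap N j (swap N k i)" for i
  by (cases "strip N j i"; cases "strip N k i") (simp_all add: sn s2 dis dis')
 note s = this s2
 have e: "e_left N j (e_pairing N k) = e_left N k (e_pairing N j)"
 proof
  fix p show "e_left N j (e_pairing N k) p = e_left N k (e_pairing N j) p"
   by (cases p) (auto simp: e_left_def s sn dest: dis dis')
 qed
 have jk: "strip N j j" "strip N k k" using N by (auto simp: strip_def)
 have l: "e_pairing N k (Outer j) = Inner j" "e_pairing N j (Outer k) = Inner k"
  using dis[OF jk(1)] dis'[OF jk(2)] by simp_all
 show "comp_diagram N (e_diagram N j) (e_diagram N k) = comp_diagram N (e_diagram N k) (e_diagram N j)"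
  "contractible_loops N (e_pairing N j) (e_pairing N k) = 0"
  by (simp_all only: comp_diagram_def e_diagram_pairing fst_conv snd_conv comp_e_left[OF N periodic_e[OF N]]
   loops_e_left[OF N periodic_e[OF N]] l e) simp_all
qed

text \<open>The bounds place both strips in one period: the second ends at
  \<open>k + 1 <= N\<close>, below the first translate of the first.\<close>

lemma strips_disjoint:
 assumes "1 <= j" "j + 2 <= k" "k <= int N - 1" "strip N j i" shows "\<not> strip N k i"
proof
 assume "strip N k i"
 have N: "N >= 2" using assms by simp
 obtain l where l: "k = j + l * int N \<or> k = j + 1 + l * int N \<or> k + 1 = j + l * int N \<or> k + 1 = j + 1 + l * int N"
 proof -
  have jj: "strip N j j" "swap N j j = j + 1" and kk: "strip N k k" "swap N k k = k + 1" using N by (auto simp: strip_def swap_def)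
  obtain a where a: "i = j + a * int N \<or> i = j + 1 + a * int N" using strip_two[OF jj(1) assms(4)] jj by auto
  obtain b where b: "i = k + b * int N \<or> i = k + 1 + b * int N" using strip_two[OF kk(1) \<open>strip N k i\<close>] kk by auto
  show thesis using a b by (intro that[of "a - b"]) (auto simp: algebra_simps)
 qed
 hence "1 <= l * int N \<and> l * int N <= int N - 1" using assms(1-3) by (elim disjE) linarith+
 hence "\<exists>x. x = l * int N \<and> 1 <= x \<and> x <= int N - 1" by blast
 thus False
 proof (elim exE conjE)
  fix x assume x: "x = l * int N" "1 <= x" "x <= int N - 1"
  hence "0 < l" by (metis mult_le_0_iff not_le of_nat_0_le_iff zero_less_one order.strict_trans2 order_trans)
  hence "int N <= x" using mult_right_mono[of 1 l "int N"] x(1) by simp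
  thus False using x(3) by simp
 qed
qed

section \<open>Algebras with a basis of diagrams\<close>

abbreviation smult_in ("(_/ *[_] _)" [70, 0, 71] 70) where "a *[M] v \<equiv> a \<odot>\<^bsub>M\<^esub> v"
abbreviation add_in ("(_/ +[_] _)" [65, 0, 66] 65) where "v +[M] w \<equiv> v \<oplus>\<^bsub>M\<^esub> w"
abbreviation mult_in ("(_/ **[_] _)" [70, 0, 71] 70) where "a **[R] b \<equiv> a \<otimes>\<^bsub>R\<^esub> b"

abbreviation "single \<equiv> Poly_Mapping.single"
abbreviation "keys \<equiv> Poly_Mapping.keys"
abbreviation "lookup \<equiv> Poly_Mapping.lookup"

abbreviation sc :: "complex => ('d \<Rightarrow>\<^sub>0 complex) => ('d \<Rightarrow>\<^sub>0 complex)" where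
 "sc c \<equiv> Poly_Mapping.map ((*) c)"

lemma lookup_sc [simp]: "lookup (sc c x) a = c * lookup x a"
 by (simp add: Poly_Mapping.map.rep_eq when_def)

lemma sc_simps [simp]:
 "sc c (x + y) = sc c x + sc c y" "sc (c + d) x = sc c x + sc d x" "sc c (sc d x) = sc (c * d) x"
 "sc 1 x = x" "sc 0 x = 0" "sc c 0 = 0" "sc c (- x) = - sc c x" "sc c (x - y) = sc c x - sc c y"
 by (auto intro!: poly_mapping_eqI simp: lookup_add lookup_minus algebra_simps)

lemma sc_single [simp]: "sc c (single a d) = single a (c * d)"
 by (auto intro!: poly_mapping_eqI simp: lookup_single when_def)

lemma keys_sc: "keys (sc c x) \<subseteq> keys x"
 by (auto simp: in_keys_iff)

lemma sum_single_lookup: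
 assumes "finite S" "keys x \<subseteq> S"
 shows "(\<Sum>a\<in>S. single a (lookup x a)) = x"
proof (rule poly_mapping_eqI)
 fix k
 show "lookup (\<Sum>a\<in>S. single a (lookup x a)) k = lookup x k"
  using assms by (cases "k \<in> S") (auto simp: lookup_sum lookup_single when_def in_keys_iff)
qed

lemma single_induct [consumes 1, case_names zero add]:
 fixes x :: "'d \<Rightarrow>\<^sub>0 'c::comm_monoid_add"
 assumes "keys x \<subseteq> D" and "P 0"
  and step: "!!x a c. keys x \<subseteq> D ==> P x ==> a \<in> D ==> P (x + single a c)"
 shows "P x"
proof -
 have "keys (\<Sum>a\<in>S. single a (f a)) \<subseteq> D \<and> P (\<Sum>a\<in>S. single a (f a))"
  if "finite S" "S \<subseteq> D" for S and f :: "'d => 'c"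
  using that
 proof (induction S rule: finite_induct)
  case (insert a S)
  hence "keys (\<Sum>a\<in>S. single a (f a)) \<subseteq> D" "P (\<Sum>a\<in>S. single a (f a))" by auto
  from step[OF this, of a "f a"] insert this show ?case
   using keys_add[of "\<Sum>a\<in>S. single a (f a)" "single a (f a)"]
   by (auto simp: add.commute split: if_splits)
 qed (use assms in auto)
 from this[OF finite_keys assms(1), of "lookup x"] sum_single_lookup[of "keys x" x]
 show ?thesis by simp
qed

definition conv :: "('d => 'd => complex) => ('d => 'd => 'd) => ('d \<Rightarrow>\<^sub>0 complex) => ('d \<Rightarrow>\<^sub>0 complex) => ('d \<Rightarrow>\<^sub>0 complex)" where
 "conv w op x y = (\<Sum>a\<in>keys x. \<Sum>b\<in>keys y.
  single (op a b) (w a b * lookup x a * lookup y b))"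

lemma conv_superset:
 assumes "finite A" "keys x \<subseteq> A" "finite B" "keys y \<subseteq> B"
 shows "conv w op x y = (\<Sum>a\<in>A. \<Sum>b\<in>B.
  single (op a b) (w a b * lookup x a * lookup y b))"
proof -
 have "conv w op x y = (\<Sum>a\<in>A. \<Sum>b\<in>keys y.
  single (op a b) (w a b * lookup x a * lookup y b))"
  unfolding conv_def by (rule sum.mono_neutral_left) (use assms in \<open>auto simp: in_keys_iff\<close>)
 also have "\<dots> = (\<Sum>a\<in>A. \<Sum>b\<in>B.
  single (op a b) (w a b * lookup x a * lookup y b))"
  by (intro sum.cong refl sum.mono_neutral_left) (use assms in \<open>auto simp: in_keys_iff\<close>)
 finally show ?thesis .
qed

lemma conv_add_left [simp]: "conv w op (x + x') y = conv w op x y + conv w op x' y"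
proof -
 let ?A = "keys x \<union> keys x' \<union> keys (x + x')"
 have "conv w op z y = (\<Sum>a\<in>?A. \<Sum>b\<in>keys y.
  single (op a b) (w a b * lookup z a * lookup y b))"
  if "z \<in> {x, x', x + x'}" for z
  by (rule conv_superset) (use that in auto)
 thus ?thesis
  by (simp add: lookup_add distrib_left distrib_right single_add sum.distrib)
qed

lemma conv_add_right [simp]: "conv w op x (y + y') = conv w op x y + conv w op x y'"
proof -
 let ?B = "keys y \<union> keys y' \<union> keys (y + y')"
 have "conv w op x z = (\<Sum>a\<in>keys x. \<Sum>b\<in>?B.
  single (op a b) (w a b * lookup x a * lookup z b))"
  if "z \<in> {y, y', y + y'}" for z
  by (rule conv_superset) (use that in auto)
 thus ?thesis
  by (simp add: lookup_add distrib_left distrib_right single_add sum.distrib)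
qed

lemma sc_sum: "sc c (\<Sum>a\<in>A. f a) = (\<Sum>a\<in>A. sc c (f a))"
 by (induction A rule: infinite_finite_induct) auto

lemma conv_sc [simp]: "conv w op (sc c x) y = sc c (conv w op x y)" "conv w op x (sc c y) = sc c (conv w op x y)"
proof -
 have "conv w op (sc c x) y = (\<Sum>a\<in>keys x. \<Sum>b\<in>keys y.
  single (op a b) (w a b * lookup (sc c x) a * lookup y b))"
  by (rule conv_superset) (auto simp: keys_sc[THEN subsetD])
 thus "conv w op (sc c x) y = sc c (conv w op x y)"
  by (simp add: conv_def sc_sum mult_ac)
 have "conv w op x (sc c y) = (\<Sum>a\<in>keys x. \<Sum>b\<in>keys y.
  single (op a b) (w a b * lookup x a * lookup (sc c y) b))"
  by (rule conv_superset) (auto simp: keys_sc[THEN subsetD])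
 thus "conv w op x (sc c y) = sc c (conv w op x y)"
  by (simp add: conv_def sc_sum mult_ac)
qed

lemma conv_zero [simp]: "conv w op 0 y = 0" "conv w op x 0 = 0"
 by (simp_all add: conv_def)

lemma conv_uminus [simp]: "conv w op (- x) y = - conv w op x y" "conv w op x (- y) = - conv w op x y"
 using conv_add_left[of w op x "- x" y] conv_add_right[of w op x y "- y"]
 by (simp_all add: eq_neg_iff_add_eq_0 add.commute)

lemma conv_diff [simp]: "conv w op (x - x') y = conv w op x y - conv w op x' y"
 "conv w op x (y - y') = conv w op x y - conv w op x y'"
 using conv_add_left[of w op x "- x'" y] conv_add_right[of w op x y "- y'"] by simp_all

lemma conv_single [simp]:
 "conv w op (single a c) (single b d) = single (op a b) (w a b * c * d)"
 by (subst conv_superset[where A = "{a}" and B = "{b}"]) auto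

lemma keys_conv:
 assumes "keys x \<subseteq> D" "keys y \<subseteq> D'" and "!!a b. a \<in> D ==> b \<in> D' ==> op a b \<in> D''"
 shows "keys (conv w op x y) \<subseteq> D''"
 unfolding conv_def
 by (intro order.trans[OF keys_sum] UN_least) (use assms in \<open>auto split: if_splits\<close>)

lemma conv_assoc:
 assumes D: "keys x \<subseteq> D" "keys y \<subseteq> D" "keys z \<subseteq> D"
  and op: "!!a b c. a \<in> D ==> b \<in> D ==> c \<in> D ==> op (op a b) c = op a (op b c)"
  and w: "!!a b c. a \<in> D ==> b \<in> D ==> c \<in> D ==> w a b * w (op a b) c = w b c * w a (op b c)"
 shows "conv w op (conv w op x y) z = conv w op x (conv w op y z)"
 using D(1)
proof (induction x rule: single_induct)
 case (add x a p)
 have "conv w op (conv w op (single a p) y) z = conv w op (single a p) (conv w op y z)"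
  using D(2)
 proof (induction y rule: single_induct)
  case (add y b q)
  have "conv w op (conv w op (single a p) (single b q)) z =
    conv w op (single a p) (conv w op (single b q) z)"
   using D(3)
  proof (induction z rule: single_induct)
   case (add z c r)
   thus ?case
    using op[OF \<open>a \<in> D\<close> \<open>b \<in> D\<close> \<open>c \<in> D\<close>] w[OF \<open>a \<in> D\<close> \<open>b \<in> D\<close> \<open>c \<in> D\<close>] by (simp add: mult_ac)
  qed simp
  thus ?case using add by simp
 qed simp
 thus ?case using add by simp
qed simp

lemma diagram_algebra_simps [simp]:
 "carrier (diagram_algebra D w op d1) = {x. keys x \<subseteq> D}"
 "monoid.mult (diagram_algebra D w op d1) = conv w op"
 "monoid.one (diagram_algebra D w op d1) = single d1 1"
 "ring.zero (diagram_algebra D w op d1) = 0"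
 "ring.add (diagram_algebra D w op d1) = (+)"
 "module.smult (diagram_algebra D w op d1) = sc"
 by (auto simp: diagram_algebra_def conv_def fun_eq_iff)

text \<open>A monoid of diagrams with a weight satisfying the cocycle identity
  \<open>w_assoc\<close>, which is what the bilinear product requires to be associative.\<close>

locale diagram_basis =
 fixes D :: "'d set" and w :: "'d => 'd => complex" and op :: "'d => 'd => 'd" and d1 :: 'd
 assumes op_closed: "!!a b. a \<in> D ==> b \<in> D ==> op a b \<in> D"
  and op_assoc: "!!a b c. a \<in> D ==> b \<in> D ==> c \<in> D ==> op (op a b) c = op a (op b c)"
  and w_assoc: "!!a b c. a \<in> D ==> b \<in> D ==> c \<in> D ==> w a b * w (op a b) c = w b c * w a (op b c)"
  and d1: "d1 \<in> D"
  and op_unit: "!!a. a \<in> D ==> op d1 a = a" "!!a. a \<in> D ==> op a d1 = a"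
  and w_unit: "!!a. a \<in> D ==> w d1 a = 1" "!!a. a \<in> D ==> w a d1 = 1"
begin

abbreviation "DA \<equiv> diagram_algebra D w op d1"

lemma conv_unit:
 assumes "keys x \<subseteq> D"
 shows "conv w op (single d1 1) x = x" "conv w op x (single d1 1) = x"
 using assms by (induction x rule: single_induct; simp add: op_unit w_unit)+

lemma ring_diagram_algebra: "ring (DA)"
proof (rule ringI)
 show "abelian_group (DA)"
 proof (rule abelian_groupI)
  fix x assume "x \<in> carrier (DA)"
  thus "\<exists>y\<in>carrier (DA). y +[DA] x = \<zero>\<^bsub>DA\<^esub>"
   by (intro bexI[of _ "- x"]) simp_all
 next
  fix x y assume "x \<in> carrier (DA)" "y \<in> carrier (DA)"
  thus "x +[DA] y \<in> carrier (DA)"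
   using keys_add[of x y] by auto
 qed (simp_all add: add_ac)
 show "monoid (DA)"
 proof (rule monoidI)
  fix x y assume "x \<in> carrier (DA)" "y \<in> carrier (DA)"
  thus "x **[DA] y \<in> carrier (DA)"
   using keys_conv[where x = x and y = y and D = D and D' = D and D'' = D, OF _ _ op_closed] by simp
 next
  fix x y z assume "x \<in> carrier (DA)" "y \<in> carrier (DA)"
   "z \<in> carrier (DA)"
  thus "x **[DA] y **[DA] z =
    x **[DA] (y **[DA] z)"
   using conv_assoc[where x = x and y = y and z = z and D = D and op = op and w = w, OF _ _ _ op_assoc w_assoc] by simp
 qed (simp_all add: d1 conv_unit)
qed simp_all

end

subsection \<open>The algebra of all periodic pairings\<close>

text \<open>The larger basis on which the algebra exists from the start: its closure under
  composition is \<open>periodic_comp\<close>, whereas closure of the affine diagrams is so far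
  known only for products with a generator.\<close>

definition periodic_diagrams :: "nat => diagram set" where
 "periodic_diagrams N = {d. per N (fst d)}"

lemma affine_periodic: "AD N \<subseteq> periodic_diagrams N"
 by (auto simp: affine_diagrams_def periodic_diagrams_def)

lemma diagram_basis_periodic:
 assumes N: "N >= 1"
 shows "diagram_basis (periodic_diagrams N) (loop_weight N m) (comp_diagram N) id_diagram"
proof
 fix a b c assume a: "a \<in> periodic_diagrams N" and b: "b \<in> periodic_diagrams N" and c: "c \<in> periodic_diagrams N"
 note P = a[unfolded periodic_diagrams_def, simplified] b[unfolded periodic_diagrams_def, simplified]
  c[unfolded periodic_diagrams_def, simplified]
 show "comp_diagram N a b \<in> periodic_diagrams N"
  using periodic_comp[OF N P(1,2)] by (simp add: comp_diagram_def periodic_diagrams_def)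
 show "comp_diagram N (comp_diagram N a b) c = comp_diagram N a (comp_diagram N b c)"
  using comp_pairing_assoc[OF N P] loops_assoc(2)[OF N P] by (simp add: comp_diagram_def)
 show "loop_weight N m a b * loop_weight N m (comp_diagram N a b) c = loop_weight N m b c * loop_weight N m a (comp_diagram N b c)"
  using loops_assoc(1)[OF N P] by (simp add: loop_weight_def comp_diagram_def flip: power_add)
 show "comp_diagram N id_diagram a = a" "comp_diagram N a id_diagram = a"
  using P(1) by (simp_all add: comp_diagram_id_left[OF N] comp_diagram_id_right[OF N])
 show "loop_weight N m id_diagram a = 1" "loop_weight N m a id_diagram = 1"
  by (simp_all add: loop_weight_def diagrams_trans(1))
next
 show "id_diagram \<in> periodic_diagrams N" by (simp add: periodic_diagrams_def diagrams_trans(1))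
qed

abbreviation tl_mult :: "complex => nat => tl_elem => tl_elem => tl_elem" where
 "tl_mult m N \<equiv> conv (loop_weight N m) (comp_diagram N)"

lemma TL_simps [simp]:
 "monoid.mult (TL m N) = tl_mult m N"
 "monoid.one (TL m N) = single id_diagram 1"
 "ring.zero (TL m N) = 0" "ring.add (TL m N) = (+)" "module.smult (TL m N) = sc"
 by (simp_all add: TL_def)

lemma carrier_TL: "carrier (TL m N) = {x. keys x \<subseteq> AD N}"
 by (simp add: TL_def)

section \<open>The subalgebra generated by the translations and one cup-cap element\<close>

text \<open>Only \<open>e_1\<close> is taken among the generators \<open>e_j\<close>, since the
  others are its conjugates under \<open>u\<close>. Inductions over this set then have few
  cases.\<close>

inductive_set gen_alg :: "complex => nat => tl_elem set" for m N where
 one: "single id_diagram 1 \<in> gen_alg m N"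
| u: "u_gen \<in> gen_alg m N"
| u_inv: "u_inv_gen \<in> gen_alg m N"
| e: "N >= 2 ==> e_gen N 1 \<in> gen_alg m N"
| add: "x \<in> gen_alg m N ==> y \<in> gen_alg m N ==> x + y \<in> gen_alg m N"
| scale: "x \<in> gen_alg m N ==> sc c x \<in> gen_alg m N"
| mult: "x \<in> gen_alg m N ==> y \<in> gen_alg m N ==> tl_mult m N x y \<in> gen_alg m N"

abbreviation tdiag :: "int => diagram" where "tdiag k \<equiv> (tr_pairing k, 0)"

context
 fixes m :: complex and N :: nat
 assumes N: "N >= 1"
begin

interpretation B: diagram_basis "periodic_diagrams N" "loop_weight N m" "comp_diagram N" id_diagram
 by (rule diagram_basis_periodic[OF N])

lemma tdiag_periodic: "tdiag k \<in> periodic_diagrams N" by (simp add: periodic_diagrams_def)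
lemma e_periodic: "N >= 2 ==> e_diagram N j \<in> periodic_diagrams N"
 by (simp add: periodic_diagrams_def e_diagram_pairing)

lemma loop_weight_tdiag [simp]: "loop_weight N m (tdiag k) d = 1" "loop_weight N m d (tdiag k) = 1"
 by (simp_all add: loop_weight_def)

lemma conv_periodic:
 "keys x \<subseteq> periodic_diagrams N ==> keys y \<subseteq> periodic_diagrams N ==>
  keys (tl_mult m N x y) \<subseteq> periodic_diagrams N"
 by (rule keys_conv[OF _ _ B.op_closed])

lemma conv_periodic_assoc:
 "keys x \<subseteq> periodic_diagrams N ==> keys y \<subseteq> periodic_diagrams N ==>
  keys z \<subseteq> periodic_diagrams N ==>
  tl_mult m N (tl_mult m N x y) z = tl_mult m N x (tl_mult m N y z)"
 by (rule conv_assoc[OF _ _ _ B.op_assoc B.w_assoc])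

lemma gen_alg_periodic: "x \<in> gen_alg m N ==> keys x \<subseteq> periodic_diagrams N"
proof (induction rule: gen_alg.induct)
 case (add x y)
 thus ?case using keys_add[of x y] by blast
next
 case (scale x c)
 thus ?case using keys_sc[of c x] by blast
next
 case (mult x y)
 show ?case by (rule conv_periodic[OF mult.IH])
qed (auto simp: u_gen_def u_inv_gen_def e_gen_def e_periodic tdiag_periodic diagrams_trans)

text \<open>The statement about all affine \<open>y\<close> is what passes through the induction:
  for a product of generated elements, associativity in the larger algebra lets the factors act on
  \<open>y\<close> one after the other.\<close>

lemma gen_alg_mult_affine:
 assumes "x \<in> gen_alg m N"
 shows "keys y \<subseteq> AD N ==> keys (tl_mult m N x y) \<subseteq> AD N"
 using assms
proof (induction arbitrary: y rule: gen_alg.induct)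
 case one
 thus ?case using B.conv_unit(1)[of y] affine_periodic[of N] by auto
next
 case u
 thus ?case unfolding u_gen_def diagrams_trans
  by (intro keys_conv[where D = "{tdiag (- 1)}"]) (auto simp: affine_comp_trans_left[OF N])
next
 case u_inv
 thus ?case unfolding u_inv_gen_def diagrams_trans
  by (intro keys_conv[where D = "{tdiag 1}"]) (auto simp: affine_comp_trans_left[OF N])
next
 case e
 thus ?case unfolding e_gen_def
  by (intro keys_conv[where D = "{e_diagram N 1}"]) (auto simp: affine_comp_e_left)
next
 case (add x x')
 hence "keys (tl_mult m N x y) \<union> keys (tl_mult m N x' y) \<subseteq> AD N" by simp
 from order_trans[OF keys_add this] show ?case by simp
next
 case (scale x c)
 thus ?case using order_trans[OF keys_sc scale.IH] by simp
next
 case (mult x x')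
 have "tl_mult m N (tl_mult m N x x') y = tl_mult m N x (tl_mult m N x' y)"
  using mult gen_alg_periodic affine_periodic[of N] by (intro conv_periodic_assoc) auto
 thus ?case using mult by simp
qed

lemma id_affine: "id_diagram \<in> AD N"
 using affine_trans[OF N] by (simp add: diagrams_trans)

lemma gen_alg_affine:
 assumes "x \<in> gen_alg m N" shows "keys x \<subseteq> AD N"
 using gen_alg_mult_affine[OF assms, of "single id_diagram 1"] id_affine
  B.conv_unit(2)[OF gen_alg_periodic[OF assms]] by simp

lemma gen_alg_trans: "single (tdiag k) c \<in> gen_alg m N"
proof -
 have "single (tdiag (s * int n)) 1 \<in> gen_alg m N" if "single (tdiag s) 1 \<in> gen_alg m N" for n s
 proof (induction n)
  case 0
  thus ?case using gen_alg.one[of m N] by (simp add: diagrams_trans)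
 next
  case (Suc n)
  from gen_alg.mult[OF that this] show ?case by (simp add: trans_comp[OF N] algebra_simps)
 qed
 from this[of 1 "nat k"] this[of "- 1" "nat (- k)"] gen_alg.u[of m N] gen_alg.u_inv[of m N]
 have "single (tdiag k) 1 \<in> gen_alg m N"
  by (cases "k >= 0") (auto simp: u_gen_def u_inv_gen_def diagrams_trans)
 from gen_alg.scale[OF this, of c] show ?thesis by simp
qed

lemma gen_alg_conj:
 assumes d: "d \<in> periodic_diagrams N"
  and "single (comp_diagram N (tdiag k) (comp_diagram N d (tdiag l))) 1 \<in> gen_alg m N"
 shows "single d 1 \<in> gen_alg m N"
proof -
 let ?d' = "comp_diagram N (tdiag k) (comp_diagram N d (tdiag l))"
 have dl: "comp_diagram N d (tdiag l) \<in> periodic_diagrams N" using B.op_closed d tdiag_periodic by blast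
 have "comp_diagram N (tdiag (- k)) (comp_diagram N ?d' (tdiag (- l))) = comp_diagram N (comp_diagram N (tdiag (- k)) ?d') (tdiag (- l))"
  using B.op_assoc B.op_closed d dl tdiag_periodic by metis
 also have "comp_diagram N (tdiag (- k)) ?d' = comp_diagram N (comp_diagram N (tdiag (- k)) (tdiag k)) (comp_diagram N d (tdiag l))"
  using B.op_assoc dl tdiag_periodic by metis
 also have "\<dots> = comp_diagram N d (tdiag l)"
  using B.op_unit(1)[OF dl] by (simp add: trans_comp[OF N] diagrams_trans)
 also have "comp_diagram N (comp_diagram N d (tdiag l)) (tdiag (- l)) = comp_diagram N d (comp_diagram N (tdiag l) (tdiag (- l)))"
  using B.op_assoc d tdiag_periodic by metis
 also have "\<dots> = d" using B.op_unit(2)[OF d] by (simp add: trans_comp[OF N] diagrams_trans)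
 finally have "comp_diagram N (tdiag (- k)) (comp_diagram N ?d' (tdiag (- l))) = d" .
 hence "tl_mult m N (single (tdiag (- k)) 1) (tl_mult m N (single ?d' 1)
  (single (tdiag (- l)) 1)) = single d 1"
  by simp
 thus ?thesis
  using gen_alg.mult[OF gen_alg_trans gen_alg.mult[OF assms(2) gen_alg_trans]] by metis
qed

lemma gen_alg_e:
 assumes "N >= 2" shows "e_gen N j \<in> gen_alg m N"
proof -
 have "comp_diagram N (tdiag (j - 1)) (comp_diagram N (e_diagram N j) (tdiag (1 - j))) =
  comp_diagram N (comp_diagram N (tdiag (j - 1)) (e_diagram N j)) (tdiag (1 - j))"
  using B.op_assoc e_periodic[OF assms] tdiag_periodic by metis
 also have "\<dots> = comp_diagram N (comp_diagram N (e_diagram N 1) (tdiag (j - 1))) (tdiag (1 - j))"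
  by (simp add: trans_e[OF assms])
 also have "\<dots> = comp_diagram N (e_diagram N 1) (comp_diagram N (tdiag (j - 1)) (tdiag (1 - j)))"
  using B.op_assoc e_periodic[OF assms] tdiag_periodic by metis
 also have "\<dots> = e_diagram N 1"
  using B.op_unit(2)[OF e_periodic[OF assms]] by (simp add: trans_comp[OF N] diagrams_trans)
 finally show ?thesis
  using gen_alg_conj[OF e_periodic[OF assms], of "j - 1" j "1 - j"] gen_alg.e[OF assms] by (simp add: e_gen_def)
qed

lemma gen_alg_sum:
 assumes "!!d. d \<in> D ==> single d 1 \<in> gen_alg m N" and "keys x \<subseteq> D"
 shows "x \<in> gen_alg m N"
 using assms(2)
proof (induction x rule: single_induct)
 case zero
 show ?case using gen_alg.scale[OF gen_alg.one, of 0] by simp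
next
 case (add x a c)
 have "single a c \<in> gen_alg m N" using gen_alg.scale[OF assms(1)[OF \<open>a \<in> D\<close>], of c] by simp
 thus ?case using add gen_alg.add by blast
qed

end

lemma alg_hom_simps:
 assumes "alg_hom A B f" and "x \<in> carrier A" "y \<in> carrier A"
 shows "f (x **[A] y) = f x **[B] f y" "f (x +[A] y) = f x +[B] f y"
  "f (c *[A] x) = c *[B] f x" "f \<one>\<^bsub>A\<^esub> = \<one>\<^bsub>B\<^esub>" "f x \<in> carrier B"
 using assms by (auto simp: alg_hom_def ring_hom_def)

lemma corner_simps [simp]:
 "monoid.mult (corner_algebra m N) = tl_mult m (N + 2)" "monoid.one (corner_algebra m N) = corner_idem m N"
 "ring.add (corner_algebra m N) = (+)" "module.smult (corner_algebra m N) = sc" "ring.zero (corner_algebra m N) = 0"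
 by (simp_all add: corner_algebra_def Let_def)

lemma corner_idem_eq: "corner_idem m N = single (e_diagram (N + 2) (int N + 1)) (inverse m)"
 by (simp add: corner_idem_def e_gen_def)

text \<open>\<open>corner_iso\<close> prescribes the images of the generators as visible products of
  generators two points higher, and these prescriptions extend along the construction of
  \<open>gen_alg\<close>.\<close>

lemma corner_iso_image_gen_alg:
 assumes K: "K >= 1" and f: "corner_iso m K f" and x: "x \<in> gen_alg m K"
 shows "f x \<in> gen_alg m (K + 2)"
proof -
 have hom: "alg_hom (TL m K) (corner_algebra m K) f" using f by (simp add: corner_iso_def Let_def alg_iso_def)
 have car: "y \<in> gen_alg m K ==> y \<in> carrier (TL m K)" for y using gen_alg_affine[OF K] by (auto simp: carrier_TL)
 have c: "corner_idem m K \<in> gen_alg m (K + 2)"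
  unfolding corner_idem_def using gen_alg.scale[OF gen_alg_e[of "K + 2"]] by simp
 note H = alg_hom_simps[OF hom car car, simplified]
 show ?thesis using x
 proof (induction rule: gen_alg.induct)
  case one
  thus ?case using H(4)[OF gen_alg.one gen_alg.one] c by simp
 next
  case u
  thus ?case using f c gen_alg.u[of m "K + 2"] by (auto simp: corner_iso_def Let_def intro!: gen_alg.intros)
 next
  case u_inv
  thus ?case using f c gen_alg.u_inv[of m "K + 2"] by (auto simp: corner_iso_def Let_def intro!: gen_alg.intros)
 next
  case e
  have "\<forall>j\<in>{1..<K}. f (e_gen K (int j)) = tl_mult m (K + 2) (corner_idem m K) (e_gen (K + 2) (int j))"
   using f by (simp add: corner_iso_def Let_def)
  from bspec[OF this, of 1] e have "f (e_gen K 1) = tl_mult m (K + 2) (corner_idem m K) (e_gen (K + 2) 1)" by simp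
  thus ?case using c gen_alg_e[of "K + 2" 1 m] by (auto intro: gen_alg.mult)
 next
  case (add x y)
  thus ?case using H(2)[of x y] gen_alg.add by auto
 next
  case (scale x c)
  thus ?case using H(3)[of x x c] gen_alg.scale by auto
 next
  case (mult x y)
  thus ?case using H(1)[of x y] gen_alg.mult by auto
 qed
qed

text \<open>A diagram with an arc on each boundary lies, up to rotations, in the corner at \<open>corner_idem\<close>, that is
 in the image of the algebra with two points less.\<close>

lemma affine_gen_alg:
 assumes m: "m ~= 0" and \<phi>: "!!K. K >= 1 ==> corner_iso m K (\<phi> K)" and N: "N >= 1" and d: "d \<in> AD N"
 shows "single d 1 \<in> gen_alg m N"
 using N d
proof (induction N arbitrary: d rule: less_induct)
 case (less N)
 note N = less.prems(1)
 obtain sg l where d: "d = (sg, l)" by (cases d)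
 have aff: "(sg, l) \<in> AD N" using less.prems d by simp
 hence per: "per N sg" by (simp add: affine_diagrams_def)
 from N aff show ?case
 proof (cases rule: diagram_cases)
  case (trans k)
  thus ?thesis using gen_alg_trans[OF N] d by simp
 next
  case (arcs a b)
  have N2: "N >= 2"
  proof (rule ccontr)
   assume "\<not> N >= 2"
   hence "N = 1" using N by simp
   hence "sg (Outer (a + 1)) = Outer (a + 1 + 1)" using arcs(1) pairing_shift_Outer[OF per, of a 1] by simp
   moreover have "sg (Outer (a + 1)) = Outer a" using arcs(1) pairing_invol[OF per] by metis
   ultimately show False by simp
  qed
  \<comment> \<open>Rotations bring both arcs to position \<open>N - 1\<close>, where the corner
    idempotent of level \<open>N - 2\<close> has its arcs.\<close>
  define j where "j = int N - 1"
  define d' where "d' = comp_diagram N (tdiag (a - j)) (comp_diagram N d (tdiag (j - b)))"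
  define ta where "ta = (\<lambda>p. oshift (- (a - j)) (ishift (j - b) (sg (ishift (- (j - b)) (oshift (a - j) p)))))"
  have perd: "per N (\<lambda>p. ishift (j - b) (sg (ishift (- (j - b)) p)))"
   using periodic_comp[OF N per periodic_trans] comp_trans_right[OF N per] by metis
  have d'_eq: "d' = (ta, l)"
   using comp_diagram_trans_right[OF N per, of l "j - b"] comp_diagram_trans_left[OF N perd, of "a - j" l]
   by (simp add: d'_def d ta_def)
  have d'_aff: "d' \<in> AD N"
   unfolding d'_def d by (intro affine_comp_trans_left affine_comp_trans_right N aff)
  hence per': "per N ta" unfolding d'_eq by (simp add: affine_diagrams_def)
  have arcs': "ta (Outer j) = Outer (j + 1)" "ta (Inner j) = Inner (j + 1)"
   using arcs by (simp_all add: ta_def)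
  note ab = comp_e_absorb_left[OF N2 per' arcs'(1)] comp_e_absorb_right[OF N2 per' arcs'(2)]
  have "single d' 1 \<in> gen_alg m N"
  proof (cases "N = 2")
   \<comment> \<open>With two points there is no smaller level to descend to. The diagram is
     \<open>e_j\<close> together with some winding loops, and these are built one at a time.\<close>
   case True
   have st: "strip 2 j i" for i
    by (simp add: strip_def) (metis even_iff_mod_2_eq_zero odd_iff_mod_2_eq_one even_diff)
   have "ta (Outer i) = e_pairing 2 j (Outer i)" for i
    using e_left_absorb[OF N2 per' arcs'(1)] st True by (simp add: e_left_def fun_eq_iff) (metis oswap.simps(1) ostrip.simps(1))
   moreover have "ta (Inner i) = e_pairing 2 j (Inner i)" for i
   proof -
    have "mirror_pairing ta (Outer j) = Outer (j + 1)" using arcs' by (simp add: mirror_pairing_def)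
    from e_left_absorb[OF N2 periodic_mirror[OF per'] this]
    have "mirror_pairing ta (Outer i) = Outer (swap 2 j i)" using st True
     by (metis e_left_def oswap.simps(1) ostrip.simps(1))
    thus ?thesis using st by (simp add: mirror_pairing_def) (metis mirror.simps mirror_mirror)
   qed
   ultimately have ta: "ta = e_pairing 2 j" by (metis bpoint.exhaust ext)
   have "single (e_pairing 2 j, l) 1 \<in> gen_alg m 2"
   proof (induction l)
    case 0
    thus ?case using gen_alg_e[of 2 j m] by (simp add: e_gen_def e_diagram_pairing)
   next
    \<comment> \<open>A rotation between two copies of \<open>e_j\<close> on two points closes up
      one more winding loop, and no contractible one.\<close>
    case (Suc l)
    let ?up = "\<lambda>p. oshift (- 1) (e_pairing 2 j (oshift 1 p))"
    have pu: "periodic_pairing 2 ?up"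
     using periodic_comp[of 2 "tr_pairing 1" "e_pairing 2 j"] comp_trans_left[of 2 "e_pairing 2 j" 1] by simp
    have sj: "swap 2 j j = j + 1" "swap 2 j (j + 1) = j" by (auto simp: swap_def)
    have uj: "?up (Outer j) = Outer (j + 1 + (- 1) * int 2)" using st sj by simp
    have "e_left 2 j ?up = e_pairing 2 j"
    proof
     fix p show "e_left 2 j ?up p = e_pairing 2 j p" using st by (cases p) (auto simp: e_left_def)
    qed
    moreover have "\<exists>k. k ~= 0 \<and> ?up (Outer j) = Outer (j + 1 + k * int 2)"
     using uj by (intro exI[of _ "- 1"]) simp
    hence "noncontractible_loops 2 (e_pairing 2 j) ?up = 1" "contractible_loops 2 (e_pairing 2 j) ?up = 0"
     using loops_e_left[OF _ pu, of j] uj by auto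
    ultimately have "comp_diagram 2 (e_diagram 2 j) (comp_diagram 2 (tdiag 1) (e_pairing 2 j, l)) = (e_pairing 2 j, Suc l)"
     "loop_weight 2 m (e_diagram 2 j) (comp_diagram 2 (tdiag 1) (e_pairing 2 j, l)) = 1"
     using comp_diagram_trans_left[of 2 "e_pairing 2 j" 1 l] comp_e_left[OF _ pu, of j]
     by (simp_all add: comp_diagram_def e_diagram_pairing loop_weight_def)
    hence "single (e_pairing 2 j, Suc l) 1 =
     tl_mult m 2 (e_gen 2 j) (tl_mult m 2 (single (tdiag 1) 1) (single (e_pairing 2 j, l) 1))"
     by (simp add: e_gen_def)
    thus ?case using gen_alg.mult[OF gen_alg_e[of 2 j m] gen_alg.mult[OF gen_alg_trans[of 2 1 1 m] Suc]] by simp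
   qed
   thus ?thesis using True ta d'_eq by simp
  next
   case False
   define K where "K = N - 2"
   have K: "K >= 1" "N = K + 2" "K < N" "j = int K + 1" using False N2 by (auto simp: K_def j_def)
   have "tl_mult m N (tl_mult m N (corner_idem m K) (single d' 1)) (corner_idem m K) = single d' 1"
    using ab m unfolding d'_eq corner_idem_eq K(2)[symmetric] K(4)[symmetric] e_diagram_pairing
    by (simp add: comp_diagram_def loop_weight_def)
   moreover have "single d' 1 \<in> carrier (TL m N)" using d'_aff by (simp add: carrier_TL)
   ultimately have "single d' 1 \<in> carrier (corner_algebra m K)"
    unfolding corner_algebra_def Let_def K(2)[symmetric] by simp metis
   moreover have bij: "bij_betw (\<phi> K) (carrier (TL m K)) (carrier (corner_algebra m K))"
    using \<phi>[OF K(1)] unfolding corner_iso_def Let_def alg_iso_def by blast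
   ultimately have "single d' 1 \<in> \<phi> K ` carrier (TL m K)" unfolding bij_betw_def by simp
   then obtain x where x: "x \<in> carrier (TL m K)" "\<phi> K x = single d' 1" by (metis imageE)
   have "x \<in> gen_alg m K"
    by (rule gen_alg_sum[OF K(1) less.IH[OF K(3,1)]]) (use x in \<open>auto simp: carrier_TL\<close>)
   thus ?thesis using corner_iso_image_gen_alg[OF K(1) \<phi>[OF K(1)]] x(2) K(2) by metis
  qed
  thus ?thesis
   using gen_alg_conj[OF N] aff affine_periodic[of N] d unfolding d'_def by blast
 qed
qed


section \<open>The Temperley-Lieb algebras as rings\<close>

locale tl_corners =
 fixes m :: complex and \<phi> :: "nat => tl_elem => tl_elem"
 assumes m0: "m ~= 0" and \<phi>: "!!K. K >= 1 ==> corner_iso m K (\<phi> K)"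
begin

abbreviation "CT K \<equiv> carrier (TL m K)"
abbreviation "lmod K \<equiv> left_module (TL m K)"
abbreviation "miso K \<equiv> module_iso (TL m K)"

lemma TL_gen_alg:
 assumes N: "N >= 1" shows "carrier (TL m N) = gen_alg m N"
proof (intro subset_antisym subsetI)
 fix x assume "x \<in> carrier (TL m N)"
 thus "x \<in> gen_alg m N"
  by (intro gen_alg_sum[OF N affine_gen_alg[OF m0 \<phi> N]]) (auto simp: carrier_TL)
next
 fix x assume "x \<in> gen_alg m N"
 thus "x \<in> carrier (TL m N)" using gen_alg_affine[OF N] by (simp add: carrier_TL)
qed

lemma loop_weight_nonzero: "loop_weight N m a b ~= 0"
 using m0 by (simp add: loop_weight_def)

text \<open>As \<open>m\<close> is nonzero, the product of two basis elements is a nonzero multiple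
  of the composite diagram, so the support of the product reveals that diagram.\<close>

lemma affine_closed:
 assumes N: "N >= 1" and a: "a \<in> AD N" and b: "b \<in> AD N"
 shows "comp_diagram N a b \<in> AD N"
proof -
 have "keys (tl_mult m N (single a 1) (single b 1)) \<subseteq> AD N"
  by (rule gen_alg_mult_affine[OF N affine_gen_alg[OF m0 \<phi> N a]]) (use b in auto)
 thus ?thesis by (simp add: loop_weight_nonzero)
qed

lemma diagram_basis_TL:
 assumes N: "N >= 1"
 shows "diagram_basis (AD N) (loop_weight N m) (comp_diagram N) id_diagram"
proof -
 interpret B: diagram_basis "periodic_diagrams N" "loop_weight N m" "comp_diagram N" id_diagram
  by (rule diagram_basis_periodic[OF N])
 note s = subsetD[OF affine_periodic[of N]]
 show ?thesis
  by unfold_locales (auto simp: affine_closed[OF N] id_affine[OF N] B.op_unit B.w_unit s intro!: B.op_assoc B.w_assoc s)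
qed

lemma diagram_basis_TL2:
 assumes "N1 >= 1" "N2 >= 1"
 shows "diagram_basis (AD N1 \<times> AD N2)
   (\<lambda>a b. loop_weight N1 m (fst a) (fst b) * loop_weight N2 m (snd a) (snd b))
   (\<lambda>a b. (comp_diagram N1 (fst a) (fst b), comp_diagram N2 (snd a) (snd b)))
   (id_diagram, id_diagram)"
proof -
 interpret A: diagram_basis "AD N1" "loop_weight N1 m" "comp_diagram N1" id_diagram
  by (rule diagram_basis_TL[OF assms(1)])
 interpret B: diagram_basis "AD N2" "loop_weight N2 m" "comp_diagram N2" id_diagram
  by (rule diagram_basis_TL[OF assms(2)])
 have sw: "a * b * (c * d) = (a * c) * (b * d)" for a b c d :: complex by (simp add: mult_ac)
 show ?thesis
 proof
  fix a b c assume "a \<in> AD N1 \<times> AD N2"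
   "b \<in> AD N1 \<times> AD N2" "c \<in> AD N1 \<times> AD N2"
  hence P: "fst a \<in> AD N1" "snd a \<in> AD N2" "fst b \<in> AD N1"
   "snd b \<in> AD N2" "fst c \<in> AD N1" "snd c \<in> AD N2" by auto
  show "loop_weight N1 m (fst a) (fst b) * loop_weight N2 m (snd a) (snd b) *
   (loop_weight N1 m (fst (comp_diagram N1 (fst a) (fst b), comp_diagram N2 (snd a) (snd b))) (fst c) *
    loop_weight N2 m (snd (comp_diagram N1 (fst a) (fst b), comp_diagram N2 (snd a) (snd b))) (snd c)) =
   loop_weight N1 m (fst b) (fst c) * loop_weight N2 m (snd b) (snd c) *
   (loop_weight N1 m (fst a) (fst (comp_diagram N1 (fst b) (fst c), comp_diagram N2 (snd b) (snd c))) *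
    loop_weight N2 m (snd a) (snd (comp_diagram N1 (fst b) (fst c), comp_diagram N2 (snd b) (snd c))))"
   using A.w_assoc[OF P(1,3,5)] B.w_assoc[OF P(2,4,6)]
   by - (rule trans[OF sw trans[OF _ sw[symmetric]]], simp)
 qed (auto simp: A.op_closed B.op_closed A.op_assoc B.op_assoc A.d1 B.d1 A.op_unit B.op_unit A.w_unit B.w_unit)
qed

lemma ring_TL: "N >= 1 ==> ring (TL m N)"
 unfolding TL_def by (rule diagram_basis.ring_diagram_algebra[OF diagram_basis_TL])

lemma ring_TL2: "N1 >= 1 ==> N2 >= 1 ==> ring (TL2 m N1 N2)"
 unfolding TL2_def by (rule diagram_basis.ring_diagram_algebra[OF diagram_basis_TL2])

end

section \<open>Computations with words in the generators\<close>

lemmas sc_simps(2) [simp del]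

locale tl_alg = tl_corners m \<phi> for m and \<phi> +
 fixes N :: nat and s :: complex
 assumes N: "N >= 2" and s0: "s ~= 0" and ms: "m = s\<^sup>2 + inverse (s\<^sup>2)"
begin

definition mul (infixr "**" 70) where "x ** y = tl_mult m N x y"
abbreviation C where "C \<equiv> carrier (TL m N)"
definition \<I> :: tl_elem where "\<I> = single id_diagram 1"
definition E :: "nat => tl_elem" where "E j = e_gen N (int j)"
abbreviation prd :: "tl_elem list => tl_elem" where "prd \<equiv> alg_prod (TL m N)"

lemma mul_linear [simp]:
 "(x + x') ** y = x ** y + x' ** y" "x ** (y + y') = x ** y + x ** y'"
 "(x - x') ** y = x ** y - x' ** y" "x ** (y - y') = x ** y - x ** y'"
 "(- x) ** y = - (x ** y)" "x ** (- y) = - (x ** y)" "0 ** y = 0" "x ** 0 = 0"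
 "sc c x ** y = sc c (x ** y)" "x ** sc c y = sc c (x ** y)"
 by (simp_all add: mul_def)

lemma mult_TL: "monoid.mult (TL m N) = mul"
 by (simp add: mul_def fun_eq_iff)

lemma N1: "N >= 1" using N by simp

sublocale diagram_basis "AD N" "loop_weight N m" "comp_diagram N" id_diagram
 by (rule diagram_basis_TL[OF N1])

lemma C_closed [simp, intro]:
 "x \<in> C ==> y \<in> C ==> x ** y \<in> C" "x \<in> C ==> y \<in> C ==> x + y \<in> C" "x \<in> C ==> y \<in> C ==> x - y \<in> C"
 "x \<in> C ==> - x \<in> C" "x \<in> C ==> sc c x \<in> C" "0 \<in> C" "\<I> \<in> C" "E j \<in> C" "u_gen \<in> C" "u_inv_gen \<in> C"
proof -
 show "x \<in> C ==> y \<in> C ==> x ** y \<in> C" using ring.ring_simprules(5)[OF ring_TL[OF N1], of x y] by (simp add: mul_def)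
 show "x \<in> C ==> y \<in> C ==> x + y \<in> C" using ring.ring_simprules(1)[OF ring_TL[OF N1], of x y] by (simp add: mul_def)
 show "x \<in> C ==> y \<in> C ==> x - y \<in> C" using keys_diff[of x y] by (auto simp: carrier_TL)
 show "x \<in> C ==> - x \<in> C" by (simp add: carrier_TL)
 show "x \<in> C ==> sc c x \<in> C" using keys_sc[of c x] by (auto simp: carrier_TL)
 show "0 \<in> C" "\<I> \<in> C" by (auto simp: carrier_TL id_affine[OF N1] \<I>_def)
 show "E j \<in> C" by (auto simp: carrier_TL E_def e_gen_def affine_e[OF N])
 show "u_gen \<in> C" "u_inv_gen \<in> C" by (auto simp: carrier_TL u_gen_def u_inv_gen_def diagrams_trans affine_trans[OF N1])
qed

lemma assoc [simp]: "x \<in> C ==> y \<in> C ==> z \<in> C ==> (x ** y) ** z = x ** (y ** z)"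
 using ring.ring_simprules(11)[OF ring_TL[OF N1], of x y z] by (simp add: mul_def)

lemma unit [simp]: "x \<in> C ==> \<I> ** x = x" "x \<in> C ==> x ** \<I> = x"
 using conv_unit by (auto simp: carrier_TL \<I>_def mul_def)

lemma a_minus_TL: "x \<in> C ==> y \<in> C ==> x \<ominus>\<^bsub>TL m N\<^esub> y = x - y"
proof -
 assume xy: "x \<in> C" "y \<in> C"
 interpret R: ring "TL m N" by (rule ring_TL[OF N1])
 have "\<ominus>\<^bsub>TL m N\<^esub> y = - y" using R.minus_equality[of "- y" y] xy by simp
 thus ?thesis by (simp add: a_minus_def)
qed

definition g :: "nat => tl_elem" where "g j = sc \<i> (sc s \<I> - sc (inverse s) (E j))"
definition g' :: "nat => tl_elem" where "g' j = sc (- \<i>) (sc (inverse s) \<I> - sc s (E j))"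

lemma g_elem_eq: "g_elem m s N j = g j" "g_inv_elem m s N j = g' j"
 unfolding g_elem_def g_inv_elem_def g_def g'_def TL_simps \<I>_def[symmetric] E_def[symmetric] by (simp_all only: a_minus_TL C_closed)

lemma g_closed [simp, intro]: "g j \<in> C" "g' j \<in> C"
 unfolding g_def g'_def by (simp_all only: C_closed)

lemma g_mult:
 "x \<in> C ==> g j ** x = sc (\<i> * s) x - sc (\<i> / s) (E j ** x)"
 "x \<in> C ==> g' j ** x = sc (\<i> * s) (E j ** x) - sc (\<i> / s) x"
 "x \<in> C ==> x ** g j = sc (\<i> * s) x - sc (\<i> / s) (x ** E j)"
 "x \<in> C ==> x ** g' j = sc (\<i> * s) (x ** E j) - sc (\<i> / s) x"
 unfolding g_def g'_def
 by (auto intro!: poly_mapping_eqI simp: lookup_minus lookup_add field_simps)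

lemma ee: "E j ** E j = sc m (E j)"
proof -
 have "e_pairing N (int j) (Outer (int j)) = Outer (int j + 1)" by (simp add: strip_def swap_def)
 from comp_e_absorb_left[OF N periodic_e[OF N] this]
 show ?thesis by (simp add: mul_def E_def e_gen_def e_diagram_pairing comp_diagram_def loop_weight_def)
qed

lemma eee:
 assumes "N >= 3"
 shows "E j ** E (Suc j) ** E j = E j" "E (Suc j) ** E j ** E (Suc j) = E (Suc j)"
proof -
 note B = e_braid_pairings[OF assms, of "int j"] e_braid_loops[OF assms, of "int j"]
 note c = comp_e_left[OF N periodic_e[OF N]]
 have per: "per N (e_left N a (e_pairing N b))" for a b
  using periodic_comp[OF N1 periodic_e[OF N] periodic_e[OF N]] c by simp
 note c' = comp_e_left[OF N per]
 show "E j ** E (Suc j) ** E j = E j" "E (Suc j) ** E j ** E (Suc j) = E (Suc j)"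
  using B by (simp_all add: mul_def E_def e_gen_def e_diagram_pairing comp_diagram_def loop_weight_def c c' add.commute[of 1])
qed

lemma ecomm:
 assumes "1 <= j" "j + 2 <= k" "k + 1 <= N"
 shows "E j ** E k = E k ** E j"
proof -
 have d: "strip N (int j) i ==> \<not> strip N (int k) i" for i
  using strips_disjoint[of "int j" "int k" N i] assms by simp
 hence d': "strip N (int k) i ==> \<not> strip N (int j) i" for i by blast
 show ?thesis
  using e_commute[OF N d] e_commute(2)[OF N d'] by (simp add: mul_def E_def e_gen_def loop_weight_def e_diagram_pairing)
qed

lemma ue: "u_gen ** E j = E (Suc j) ** u_gen"
 using trans_e[OF N, of "- 1" "int j"]
 by (simp add: mul_def E_def e_gen_def u_gen_def diagrams_trans loop_weight_tdiag[OF N1] add.commute)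

lemma uui: "u_gen ** u_inv_gen = \<I>" "u_inv_gen ** u_gen = \<I>"
 by (simp_all add: mul_def \<I>_def u_gen_def u_inv_gen_def diagrams_trans loop_weight_tdiag[OF N1] trans_comp[OF N1])

text \<open>Products are normalised by nesting to the right, so every relation is also provided with
  a trailing factor.\<close>

lemma tails:
 assumes "x \<in> C"
 shows "E j ** E j ** x = sc m (E j ** x)" "u_gen ** E j ** x = E (Suc j) ** u_gen ** x"
  "u_gen ** u_inv_gen ** x = x" "u_inv_gen ** u_gen ** x = x"
  "N >= 3 ==> E j ** E (Suc j) ** E j ** x = E j ** x"
  "N >= 3 ==> E (Suc j) ** E j ** E (Suc j) ** x = E (Suc j) ** x"
proof -
 have *: "a ** x = b ** x" if "a = b" for a b using that by simp
 show "E j ** E j ** x = sc m (E j ** x)" "u_gen ** E j ** x = E (Suc j) ** u_gen ** x"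
  "u_gen ** u_inv_gen ** x = x" "u_inv_gen ** u_gen ** x = x"
  using *[OF ee[of j]] *[OF ue[of j]] *[OF uui(1)] *[OF uui(2)] assms by simp_all
 show "N >= 3 ==> E j ** E (Suc j) ** E j ** x = E j ** x"
  "N >= 3 ==> E (Suc j) ** E j ** E (Suc j) ** x = E (Suc j) ** x"
  using *[OF eee(1)[of j]] *[OF eee(2)[of j]] assms by simp_all
qed

text \<open>The loop weight is written out in terms of \<open>s\<close> here, since rewriting \<open>m\<close> itself would also change
 the product.\<close>

lemma ees: "E j ** E j = sc (s\<^sup>2 + inverse (s\<^sup>2)) (E j)"
 "x \<in> C ==> E j ** E j ** x = sc (s\<^sup>2 + inverse (s\<^sup>2)) (E j ** x)"
 using ee tails(1)[of x j] ms by simp_all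

lemmas expand_g = g_mult ees lookup_minus lookup_add

lemma gg: "g j ** g' j = \<I>" "g' j ** g j = \<I>"
proof -
 have E: "E j ** g' j = sc (\<i> * s * (s\<^sup>2 + inverse (s\<^sup>2)) - \<i> / s) (E j)"
  "E j ** g j = sc (\<i> * s - \<i> / s * (s\<^sup>2 + inverse (s\<^sup>2))) (E j)"
  by (auto intro!: poly_mapping_eqI simp: g_mult ees lookup_minus lookup_add left_diff_distrib right_diff_distrib distrib_left distrib_right mult.assoc)
 have "g j ** g' j = sc (\<i> * s) (g' j) - sc (\<i> / s) (E j ** g' j)" by (rule g_mult(1)) simp
 also have "\<dots> = \<I>" unfolding E
  by (rule poly_mapping_eqI) (simp add: g'_def lookup_minus lookup_add s0 field_simps power2_eq_square)
 finally show "g j ** g' j = \<I>" .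
 have "g' j ** g j = sc (\<i> * s) (E j ** g j) - sc (\<i> / s) (g j)" by (rule g_mult(2)) simp
 also have "\<dots> = \<I>" unfolding E
  by (rule poly_mapping_eqI) (simp add: g_def lookup_minus lookup_add s0 field_simps power2_eq_square)
 finally show "g' j ** g j = \<I>" .
qed

text \<open>An arc slides off a strand that crosses both of its ends. The factors
  \<open>\<i>\<close> and \<open>s\<close> in the crossings are normalised so that no scalar
  appears.\<close>

lemma braid_left:
 assumes "N >= 3"
 shows "g (Suc j) ** g j ** E (Suc j) = E j ** E (Suc j)" "g j ** g (Suc j) ** E j = E (Suc j) ** E j"
  "g' (Suc j) ** g' j ** E (Suc j) = E j ** E (Suc j)" "g' j ** g' (Suc j) ** E j = E (Suc j) ** E j"
 using s0
 by (auto intro!: poly_mapping_eqI simp: expand_g eee[OF assms] field_simps power2_eq_square)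

lemma braid_right:
 assumes "N >= 3"
 shows "E j ** g (Suc j) ** g j = E j ** E (Suc j)" "E (Suc j) ** g j ** g (Suc j) = E (Suc j) ** E j"
  "E j ** g' (Suc j) ** g' j = E j ** E (Suc j)" "E (Suc j) ** g' j ** g' (Suc j) = E (Suc j) ** E j"
proof -
 have "E a ** g b ** g a = (E a ** g b) ** g a" "E a ** g' b ** g' a = (E a ** g' b) ** g' a" for a b by simp_all
 thus "E j ** g (Suc j) ** g j = E j ** E (Suc j)" "E (Suc j) ** g j ** g (Suc j) = E (Suc j) ** E j"
  "E j ** g' (Suc j) ** g' j = E j ** E (Suc j)" "E (Suc j) ** g' j ** g' (Suc j) = E (Suc j) ** E j"
  using s0
  by (auto intro!: poly_mapping_eqI simp: expand_g eee[OF assms] field_simps power2_eq_square)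
qed

text \<open>The sliding relations with one crossing moved to the other side by
  \<open>gg\<close>.\<close>

lemma cross_left:
 assumes "N >= 3"
 shows "g' (Suc j) ** E j ** E (Suc j) = g j ** E (Suc j)" "E j ** E (Suc j) ** g' j = E j ** g (Suc j)"
proof -
 have "g' (Suc j) ** (g (Suc j) ** g j ** E (Suc j)) = (g' (Suc j) ** g (Suc j)) ** g j ** E (Suc j)" by simp
 thus "g' (Suc j) ** E j ** E (Suc j) = g j ** E (Suc j)" by (simp add: braid_left(1)[OF assms] gg)
 have "(E j ** g (Suc j) ** g j) ** g' j = E j ** g (Suc j) ** (g j ** g' j)" by simp
 thus "E j ** E (Suc j) ** g' j = E j ** g (Suc j)" unfolding braid_right(1)[OF assms] by (simp add: gg)
qed


section \<open>Words in the cup-cap elements and the crossings\<close>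

definition W :: "(nat => tl_elem) => nat list => tl_elem" where "W f js = prd (map f js)"

lemma W_simps [simp]: "W f [] = \<I>" "W f (j # js) = f j ** W f js"
 by (simp_all add: W_def alg_prod_def \<I>_def mul_def)

text \<open>The two kinds of crossings are linear in \<open>E j\<close>, so whatever commutes with
  \<open>E j\<close> commutes with them. One set of letters lets a single lemma serve all three
  families.\<close>

definition letters :: "(nat => tl_elem) set" where "letters = {E, g, g'}"

lemma letters [simp]: "E \<in> letters" "g \<in> letters" "g' \<in> letters" by (auto simp: letters_def)

lemma letter_closed [simp]: "f \<in> letters ==> f j \<in> C" by (auto simp: letters_def)

lemma W_closed [simp]: "f \<in> letters ==> W f js \<in> C"
 by (induction js) auto

lemma W_append: "f \<in> letters ==> W f (js @ ks) = W f js ** W f ks"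
 by (induction js) auto

lemma letter_comm:
 assumes "x \<in> C" "E j ** x = x ** E j" "f \<in> letters" shows "f j ** x = x ** f j"
 using assms by (auto simp: letters_def g_mult)

lemma W_comm:
 assumes f: "f \<in> letters" and x: "x \<in> C" and "!!j. j \<in> set js ==> E j ** x = x ** E j"
 shows "W f js ** x = x ** W f js"
 using assms(3)
proof (induction js)
 case (Cons j js)
 have "f j ** x = x ** f j" by (rule letter_comm[OF x _ f]) (use Cons in auto)
 hence "x ** f j ** W f js = f j ** x ** W f js"
  using f x by (metis assoc letter_closed W_closed)
 thus ?case using Cons f x by simp
qed (use x in simp)

lemma E_far: "1 <= j ==> 1 <= k ==> j < N ==> k < N ==> j + 2 <= k \<or> k + 2 <= j ==> E j ** E k = E k ** E j"
 using ecomm[of j k] ecomm[of k j] by auto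

lemma letter_far:
 assumes "f \<in> letters" "h \<in> letters" "1 <= j" "1 <= k" "j < N" "k < N" "j + 2 <= k \<or> k + 2 <= j"
 shows "f j ** h k = h k ** f j"
 using letter_comm[OF _ letter_comm[OF _ E_far[OF assms(3-7)], symmetric]] letter_comm assms E_far
 by (metis (no_types, lifting) letter_closed letters(1))

lemma W_far:
 assumes "f \<in> letters" "h \<in> letters" "1 <= k" "k < N"
  "!!j. j \<in> set js ==> 1 <= j \<and> j < N \<and> (j + 2 <= k \<or> k + 2 <= j)"
 shows "W f js ** h k = h k ** W f js"
proof (rule W_comm[OF assms(1)])
 fix j assume "j \<in> set js"
 thus "E j ** h k = h k ** E j"
  using assms(5)[of j] by (intro letter_far[OF letters(1) assms(2) _ assms(3) _ assms(4)]) blast+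
qed (use assms in simp)

lemma W_W_far:
 assumes "f \<in> letters" "h \<in> letters"
  "!!j k. j \<in> set js ==> k \<in> set ks ==> 1 <= j \<and> j < N \<and> 1 <= k \<and> k < N \<and> (j + 2 <= k \<or> k + 2 <= j)"
 shows "W f js ** W h ks = W h ks ** W f js"
proof (rule W_comm[OF assms(1)])
 fix j assume j: "j \<in> set js"
 show "E j ** W h ks = W h ks ** E j"
 proof (cases "ks = []")
  case False
  then obtain k where "k \<in> set ks" by (cases ks) auto
  hence "1 <= j" "j < N" using assms(3)[OF j] by auto
  thus ?thesis by (intro W_far[symmetric]) (use assms j in auto)
 qed simp
qed (use assms in auto)

lemma tail: "a ** b = c ** d ==> a \<in> C ==> b \<in> C ==> c \<in> C ==> d \<in> C ==> x \<in> C ==> a ** b ** x = c ** d ** x"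
 by (metis assoc)

lemma u_letter: "f \<in> letters ==> u_gen ** f j = f (Suc j) ** u_gen"
 using ue[of j] by (auto simp: letters_def E_def[symmetric] g_mult simp del: of_nat_Suc)

lemma u_W: "f \<in> letters ==> u_gen ** W f js = W f (map Suc js) ** u_gen"
proof (induction js)
 case (Cons j js)
 have "u_gen ** f j ** W f js = f (Suc j) ** u_gen ** W f js"
  by (rule tail[OF u_letter]) (use Cons in auto)
 thus ?case using Cons by simp
qed simp

lemma W_inverse: "W g js ** W g' (rev js) = \<I>" "W g' js ** W g (rev js) = \<I>"
proof (induction js)
 case (Cons j js)
 { case 1
  have "W g (j # js) ** W g' (rev (j # js)) = g j ** (W g js ** W g' (rev js)) ** g' j" by (simp add: W_append)
  thus ?case using Cons(1) by (simp add: gg) }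
 { case 2
  have "W g' (j # js) ** W g (rev (j # js)) = g' j ** (W g' js ** W g (rev js)) ** g j" by (simp add: W_append)
  thus ?case using Cons(2) by (simp add: gg) }
qed simp_all

subsection \<open>Moving a cup through a bundle of strands\<close>

text \<open>The corner idempotent of level \<open>N - 2\<close>, at the last two strands.\<close>

definition cc :: tl_elem where "cc = sc (inverse m) (E (N - 1))"

lemma m_inverse [simp]: "m * inverse m = 1" "m * (inverse m * inverse m) = inverse m"
 using m0 by simp_all

lemma cc_closed [simp]: "cc \<in> C" by (simp add: cc_def)

lemma cc_idem: "cc ** cc = cc" "x \<in> C ==> cc ** cc ** x = cc ** x"
 using m0 by (simp_all add: cc_def ee tails)

lemma cc_W:
 assumes "f \<in> letters" "!!j. j \<in> set js ==> 1 <= j \<and> j + 3 <= N"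
 shows "cc ** W f js = W f js ** cc"
proof -
 have "W f js ** E (N - 1) = E (N - 1) ** W f js"
 proof (rule W_far)
  fix j assume "j \<in> set js"
  thus "1 <= j \<and> j < N \<and> (j + 2 <= N - 1 \<or> N - 1 + 2 <= j)" using assms(2)[of j] by linarith
 qed (use assms N in auto)
 thus ?thesis by (simp add: cc_def)
qed

context
 fixes a :: nat
 assumes a: "1 <= a" "a + 3 <= N"
begin

text \<open>The word X and its reverse. Here \<open>a\<close> is the number of strands of the first
  bundle, and \<open>a + 3 <= N\<close> leaves room for the extra pair of strands and a nonempty
  second bundle. \<open>ca\<close> is the idempotent with its arcs right after the first bundle;
  \<open>cup\<close> and \<open>cap\<close> connect it with the idempotent \<open>cc\<close> at the
  end.\<close>

definition cup where "cup = sc (inverse m) (W E [Suc a..<N])"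
definition cap where "cap = sc (inverse m) (W E (rev [Suc a..<N]))"
definition ca where "ca = sc (inverse m) (E (Suc a))"

lemma cup_closed [simp]: "cup \<in> C" "cap \<in> C" "ca \<in> C"
 by (simp_all add: cup_def cap_def ca_def)

lemma N3: "N >= 3" using a by simp

lemma Wup_split: "b <= c ==> f \<in> letters ==> W f [b..<Suc c] = W f [b..<c] ** f c"
 by (simp add: W_append)

lemma Wdown_split: "b <= c ==> f \<in> letters ==> W f (rev [b..<Suc c]) = f c ** W f (rev [b..<c])"
 by simp

lemma Wup_first: "b < c ==> f \<in> letters ==> W f [b..<c] = f b ** W f [Suc b..<c]"
 by (simp add: upt_conv_Cons)

lemma Wdown_first: "b < c ==> f \<in> letters ==> W f (rev [b..<c]) = W f (rev [Suc b..<c]) ** f b"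
 by (simp add: upt_conv_Cons W_append)

text \<open>The word collapses from the inside: the innermost square yields the single factor
  \<open>m\<close>, and every further pair of letters is absorbed by \<open>eee\<close>.\<close>

lemma down_up: "b <= c ==> W E (rev [b..<Suc c]) ** W E [b..<Suc c] = sc m (E c)"
proof (induction c rule: dec_induct)
 case base
 thus ?case by (simp add: ee)
next
 case (step c)
 have "W E (rev [b..<Suc (Suc c)]) ** W E [b..<Suc (Suc c)] = E (Suc c) ** (W E (rev [b..<Suc c]) ** W E [b..<Suc c]) ** E (Suc c)"
  using step.hyps by (simp add: Wup_split[of b "Suc c"] Wdown_split[of b "Suc c"] del: upt_Suc)
 also have "W E (rev [b..<Suc c]) ** W E [b..<Suc c] = sc m (E c)" by (rule step.IH)
 also have "E (Suc c) ** sc m (E c) ** E (Suc c) = sc m (E (Suc c))" by (simp add: eee[OF N3])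
 finally show ?case .
qed

lemma up_down: "b + k < N ==> W E [b..<Suc (b + k)] ** W E (rev [b..<Suc (b + k)]) = sc m (E b)"
proof (induction k arbitrary: b)
 case 0
 thus ?case by (simp add: ee)
next
 case (Suc k)
 have "W E [b..<Suc (b + Suc k)] ** W E (rev [b..<Suc (b + Suc k)]) =
  E b ** (W E [Suc b..<Suc (Suc b + k)] ** W E (rev [Suc b..<Suc (Suc b + k)])) ** E b"
  by (simp add: Wup_first[of b] Wdown_first[of b] del: upt_Suc)
 also have "W E [Suc b..<Suc (Suc b + k)] ** W E (rev [Suc b..<Suc (Suc b + k)]) = sc m (E (Suc b))"
  by (rule Suc.IH) (use Suc.prems in simp)
 also have "E b ** sc m (E (Suc b)) ** E b = sc m (E b)" by (simp add: eee[OF N3])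
 finally show ?case .
qed

lemma cup_cap: "cup ** cap = ca" "cap ** cup = cc"
proof -
 have n: "Suc (N - 1) = N" "Suc a + (N - 2 - a) = N - 1" using a by auto
 have "W E [Suc a..<N] ** W E (rev [Suc a..<N]) = sc m (E (Suc a))"
  using up_down[of "Suc a" "N - 2 - a"] a unfolding n by simp
 moreover have "W E (rev [Suc a..<N]) ** W E [Suc a..<N] = sc m (E (N - 1))"
  using down_up[of "Suc a" "N - 1"] a unfolding n by simp
 ultimately show "cup ** cap = ca" "cap ** cup = cc"
  using m0 by (simp_all add: cup_def cap_def ca_def cc_def)
qed

lemma cup_idem: "cup ** cc = cup" "ca ** cup = cup" "cc ** cap = cap" "cap ** ca = cap"
proof -
 have n: "W f [Suc a..<N] = W f [Suc a..<N - 1] ** f (N - 1)" "W f (rev [Suc a..<N]) = f (N - 1) ** W f (rev [Suc a..<N - 1])"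
  if "f \<in> letters" for f
  using Wup_split[of "Suc a" "N - 1" f] Wdown_split[of "Suc a" "N - 1" f] that a by simp_all
 show "cup ** cc = cup" "cc ** cap = cap"
  using m0 by (simp_all add: cup_def cap_def cc_def n ee tails)
 show "ca ** cup = cup" "cap ** ca = cap"
  using m0 a by (simp_all add: cup_def cap_def ca_def Wup_first[of "Suc a"] Wdown_first[of "Suc a"] ee tails)
qed

lemma cup_left: "1 <= j ==> j + 1 <= a ==> E j ** cup = cup ** E j"
 using W_far[of E E j "[Suc a..<N]"] a by (auto simp: cup_def)

text \<open>Strands of the second bundle change position by two when they pass the cup.
  Algebraically, \<open>E (a + 2)\<close> is cancelled between two copies of
  \<open>E (a + 3)\<close> and re-created between two copies of \<open>E (a + 1)\<close>.\<close>

lemma cup_right: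
 assumes "a + 4 <= N" shows "E (a + 3) ** cup = cup ** E (a + 1)"
proof -
 let ?R = "W E [a + 4..<N]"
 have up: "W E [Suc a..<N] = E (a + 1) ** E (a + 2) ** E (a + 3) ** ?R"
  using assms by (simp add: Wup_first[of "Suc a"] Wup_first[of "Suc (Suc a)"] Wup_first[of "Suc (Suc (Suc a))"] numeral_eq_Suc)
 have far: "E (a + 1) ** E (a + 3) = E (a + 3) ** E (a + 1)" by (rule E_far) (use assms in auto)
 have R: "?R ** E (Suc a) = E (Suc a) ** ?R" by (rule W_far) (use assms in auto)
 have "E (a + 3) ** E (a + 1) ** E (a + 2) ** E (a + 3) ** ?R = E (a + 1) ** E (a + 3) ** E (a + 2) ** E (a + 3) ** ?R"
  by (rule tail[OF far[symmetric]]) auto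
 also have "\<dots> = E (a + 1) ** E (a + 3) ** ?R"
  using tails(6)[of ?R "a + 2"] N3 by (simp add: numeral_eq_Suc)
 also have "\<dots> = E (a + 1) ** E (a + 2) ** E (a + 1) ** E (a + 3) ** ?R"
  using tails(5)[of "E (a + 3) ** ?R" "a + 1"] N3 by (simp add: numeral_eq_Suc)
 also have "\<dots> = E (a + 1) ** E (a + 2) ** E (a + 3) ** E (a + 1) ** ?R"
  using tail[OF far, of ?R] by simp
 finally show ?thesis by (simp add: cup_def up R)
qed

text \<open>Intertwining for the translation of the second bundle. Moving \<open>u\<close> through
  the cup shifts its letters by one, and the two additional crossings, at \<open>a + 1\<close> and
  \<open>a + 2\<close>, shift them back by \<open>braid_left\<close>.\<close>

lemma cup_u2:
 "(W g (rev [1..<a + 3]) ** u_gen) ** cup = cup ** (cc ** W g (rev [1..<a + 1])) ** sc m (cc ** u_gen ** cc)"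
proof -
 let ?G = "W g (rev [1..<a + 1])"
 have n: "[1..<a + 3] = [1..<a + 1] @ [a + 1, a + 2]" using a by (simp add: eval_nat_numeral)
 have G3: "W g (rev [1..<a + 3]) = g (a + 2) ** g (a + 1) ** ?G" unfolding n by (simp add: W_append)
 have up: "W E [Suc a..<N] = W E [Suc a..<N - 1] ** E (N - 1)"
  using Wup_split[of "Suc a" "N - 1" E] a by simp
 have uu: "u_gen ** W E [Suc a..<N] = W E [a + 2..<N] ** u_gen ** E (N - 1)"
 proof -
  have "u_gen ** W E [Suc a..<N - 1] = W E [a + 2..<N] ** u_gen"
   using u_W[of E "[Suc a..<N - 1]"] a by (simp add: map_Suc_upt)
  thus ?thesis unfolding up using tail[of u_gen "W E [Suc a..<N - 1]" "W E [a + 2..<N]" u_gen "E (N - 1)"] by simp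
 qed
 have G: "?G ** W E [a + 2..<N] = W E [a + 2..<N] ** ?G" by (rule W_W_far) (use a in auto)
 have b: "g (a + 2) ** g (a + 1) ** W E [a + 2..<N] = W E [Suc a..<N]"
 proof -
  let ?R = "W E [a + 3..<N]"
  have u1: "W E [a + 2..<N] = E (a + 2) ** ?R" using Wup_first[of "a + 2" N E] a by (simp add: numeral_eq_Suc)
  have u2: "W E [Suc a..<N] = E (a + 1) ** E (a + 2) ** ?R" using Wup_first[of "Suc a" N E] u1 a by (simp add: numeral_eq_Suc)
  have "g (a + 2) ** g (a + 1) ** E (a + 2) ** ?R = (g (a + 2) ** g (a + 1) ** E (a + 2)) ** ?R" by simp
  also have "\<dots> = (E (a + 1) ** E (a + 2)) ** ?R" using braid_left(1)[OF N3, of "a + 1"] by simp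
  finally show ?thesis unfolding u1 u2 by simp
 qed
 have "(W g (rev [1..<a + 3]) ** u_gen) ** W E [Suc a..<N] = g (a + 2) ** g (a + 1) ** (?G ** W E [a + 2..<N]) ** u_gen ** E (N - 1)"
  unfolding G3 by (simp add: uu)
 also have "\<dots> = (g (a + 2) ** g (a + 1) ** W E [a + 2..<N]) ** ?G ** u_gen ** E (N - 1)" unfolding G by simp
 also have "\<dots> = W E [Suc a..<N] ** ?G ** u_gen ** E (N - 1)" unfolding b ..
 finally have l: "(W g (rev [1..<a + 3]) ** u_gen) ** cup = cup ** ?G ** u_gen ** E (N - 1)" by (simp add: cup_def)
 have cG: "cc ** ?G = ?G ** cc" by (rule cc_W) (use a in auto)
 have "cup ** (cc ** ?G) ** sc m (cc ** u_gen ** cc) = sc m (cup ** (cc ** ?G) ** cc ** u_gen ** cc)" by simp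
 also have "\<dots> = sc m (cup ** (cc ** ?G) ** u_gen ** cc)" unfolding cG by (simp add: cc_idem)
 also have "\<dots> = sc m ((cup ** cc) ** ?G ** u_gen ** cc)" by simp
 also have "\<dots> = cup ** ?G ** u_gen ** E (N - 1)" unfolding cup_idem(1) using m0 by (simp add: cc_def)
 finally show ?thesis using l by simp
qed

text \<open>The crossings are absorbed into the cup one at a time: the outermost one commutes past
  the part already treated and then turns over by \<open>cross_left\<close>.
  \<open>cup_cross\<close> is the counterpart with the crossings on the right.\<close>

lemma cross_cup:
 assumes "a + 1 <= b" "b < N"
 shows "W g' (rev [a + 2..<Suc b]) ** W E [a + 1..<Suc b] = W g [a + 1..<b] ** E b"
 using assms
proof (induction b rule: dec_induct)
 case base
 thus ?case by simp
next
 case (step b)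
 have "W g' (rev [a + 2..<Suc (Suc b)]) ** W E [a + 1..<Suc (Suc b)] =
  g' (Suc b) ** (W g' (rev [a + 2..<Suc b]) ** W E [a + 1..<Suc b]) ** E (Suc b)"
  using step.hyps step.prems by (simp add: Wup_split[of "Suc a" "Suc b"] Wdown_split[of "Suc (Suc a)" "Suc b"] del: upt_Suc)
 also have "W g' (rev [a + 2..<Suc b]) ** W E [a + 1..<Suc b] = W g [a + 1..<b] ** E b" using step by simp
 also have "g' (Suc b) ** (W g [a + 1..<b] ** E b) ** E (Suc b) = g' (Suc b) ** W g [a + 1..<b] ** E b ** E (Suc b)" by simp
 also have "\<dots> = W g [a + 1..<b] ** g' (Suc b) ** E b ** E (Suc b)"
  by (rule tail, rule W_far[symmetric]) (use step a in auto)
 also have "\<dots> = W g [a + 1..<Suc b] ** E (Suc b)"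
  using step by (simp add: cross_left(1)[OF N3] Wup_split[of "Suc a" b] del: upt_Suc)
 finally show ?case .
qed

lemma cup_cross:
 assumes "a + 1 <= b" "b < N"
 shows "W E [a + 1..<Suc b] ** W g' (rev [a + 1..<b]) = E (a + 1) ** W g [a + 2..<Suc b]"
 using assms
proof (induction b rule: dec_induct)
 case base
 thus ?case by simp
next
 case (step b)
 let ?V = "W g' (rev [a + 1..<b])"
 have up: "W E [a + 1..<Suc b] = W E [a + 1..<b] ** E b" using Wup_split[of "a + 1" b E] step by simp
 have "W E [a + 1..<Suc (Suc b)] ** W g' (rev [a + 1..<Suc b]) = (W E [a + 1..<b] ** E b ** E (Suc b)) ** g' b ** ?V"
  using step.hyps step.prems by (simp add: Wup_split[of "Suc a" "Suc b"] Wup_split[of "Suc a" b] Wdown_split[of "Suc a" b] del: upt_Suc)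
 also have "\<dots> = W E [a + 1..<b] ** (E b ** E (Suc b) ** g' b) ** ?V" by simp
 also have "\<dots> = W E [a + 1..<b] ** E b ** g (Suc b) ** ?V" by (simp add: cross_left(2)[OF N3])
 also have "g (Suc b) ** ?V = ?V ** g (Suc b)" by (rule W_far[symmetric]) (use step a in auto)
 also have "W E [a + 1..<b] ** E b ** ?V ** g (Suc b) = (W E [a + 1..<Suc b] ** ?V) ** g (Suc b)" unfolding up by simp
 also have "\<dots> = (E (a + 1) ** W g [a + 2..<Suc b]) ** g (Suc b)" using step by simp
 also have "\<dots> = E (a + 1) ** W g [a + 2..<Suc (Suc b)]"
  using step by (simp add: Wup_split[of "Suc (Suc a)" "Suc b"] del: upt_Suc)
 finally show ?case .
qed

text \<open>Intertwining for the translation of the first bundle, which crosses everything to its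
  right. Both sides are brought to the common form
  \<open>ca ** W g [a + 2..<N] ** u_gen ** E (N - 1)\<close>, from the left by
  \<open>cross_cup\<close> and from the right by \<open>cup_cross\<close>.\<close>

lemma cup_u1:
 "sc m (ca ** (u_gen ** W g' (rev [a + 2..<N])) ** ca) ** cup =
 cup ** sc m (cc ** u_gen ** cc) ** (cc ** W g' (rev [a..<N - 2]))"
proof -
 have n: "Suc (N - 1) = N" using a by simp
 let ?V = "W g' (rev [a + 2..<N])" and ?U = "W g' (rev [a..<N - 2])" and ?G = "W g [a + 1..<N - 1]"
 have "sc m (ca ** (u_gen ** ?V) ** ca) ** cup = sc m (ca ** u_gen ** ?V ** (ca ** cup))" by simp
 also have "\<dots> = ca ** u_gen ** (?V ** W E [a + 1..<N])" unfolding cup_idem using m0 by (simp add: cup_def)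
 also have "\<dots> = ca ** (u_gen ** ?G) ** E (N - 1)" using cross_cup[of "N - 1"] a unfolding n by simp
 also have "u_gen ** ?G = W g [a + 2..<N] ** u_gen" using u_W[of g "[a + 1..<N - 1]"] a by (simp add: map_Suc_upt)
 finally have l: "sc m (ca ** (u_gen ** ?V) ** ca) ** cup = ca ** W g [a + 2..<N] ** u_gen ** E (N - 1)" by simp
 have cU: "cc ** ?U = ?U ** cc" by (rule cc_W) (use a in auto)
 have uU: "u_gen ** ?U = W g' (rev [a + 1..<N - 1]) ** u_gen"
 proof -
  have "map Suc (rev [a..<N - 2]) = rev [a + 1..<N - 1]" using a by (simp add: rev_map[symmetric] map_Suc_upt Suc_diff_Suc numeral_eq_Suc)
  thus ?thesis using u_W[of g' "rev [a..<N - 2]"] by simp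
 qed
 have "cup ** sc m (cc ** u_gen ** cc) ** (cc ** ?U) = sc m ((cup ** cc) ** u_gen ** (cc ** ?U))" by (simp add: cc_idem)
 also have "\<dots> = sc m (cup ** (u_gen ** ?U) ** cc)" unfolding cup_idem cU by simp
 also have "\<dots> = sc (inverse m) ((W E [a + 1..<N] ** W g' (rev [a + 1..<N - 1])) ** u_gen ** E (N - 1))"
  unfolding uU using m0 by (simp add: cup_def cc_def)
 also have "W E [a + 1..<N] ** W g' (rev [a + 1..<N - 1]) = E (a + 1) ** W g [a + 2..<N]"
  using cup_cross[of "N - 1"] a unfolding n by simp
 also have "sc (inverse m) ((E (a + 1) ** W g [a + 2..<N]) ** u_gen ** E (N - 1)) = ca ** W g [a + 2..<N] ** u_gen ** E (N - 1)"
  by (simp add: ca_def)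
 finally show ?thesis using l by simp
qed

lemma end_u2:
 "sc m (cc ** (W g (rev [1..<a + 1]) ** u_gen) ** cc) ** cc =
 cc ** (cc ** W g (rev [1..<a + 1])) ** sc m (cc ** u_gen ** cc)"
proof -
 let ?G = "W g (rev [1..<a + 1])"
 have cG: "cc ** ?G = ?G ** cc" by (rule cc_W) (use a in auto)
 have "cc ** (cc ** ?G) ** sc m (cc ** u_gen ** cc) = sc m ((cc ** ?G) ** cc ** u_gen ** cc)" by (simp add: cc_idem)
 also have "\<dots> = sc m ((cc ** ?G) ** u_gen ** cc)" unfolding cG by (simp add: cc_idem)
 finally show ?thesis by (simp add: cc_idem)
qed

text \<open>With the cup at the far end, the two additional crossings slide off it and leave
  \<open>E (N - 2)\<close>, which \<open>u\<close> carries to \<open>E (N - 1)\<close>: this is the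
  idempotent on the left of the right-hand side.\<close>

lemma end_u1:
 "(u_gen ** W g' (rev [a..<N])) ** cc = cc ** sc m (cc ** u_gen ** cc) ** (cc ** W g' (rev [a..<N - 2]))"
proof -
 let ?U = "W g' (rev [a..<N - 2])"
 have cU: "cc ** ?U = ?U ** cc" by (rule cc_W) (use a in auto)
 have n: "[a..<N] = [a..<N - 2] @ [N - 2, N - 1]"
 proof -
  have e: "Suc (Suc (N - 2)) = N" "Suc (N - 2) = N - 1" using a by auto
  have "[a..<Suc (Suc (N - 2))] = [a..<N - 2] @ [N - 2, Suc (N - 2)]" using a by simp
  thus ?thesis unfolding e(1) unfolding e(2) .
 qed
 have b: "g' (N - 1) ** g' (N - 2) ** E (N - 1) = E (N - 2) ** E (N - 1)"
 proof -
  have "N - 1 = Suc (N - 2)" using a by auto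
  thus ?thesis using braid_left(3)[OF N3, of "N - 2"] by simp
 qed
 have uE: "u_gen ** E (N - 2) = E (N - 1) ** u_gen"
 proof -
  have "N - 1 = Suc (N - 2)" using a by auto
  thus ?thesis using u_letter[of E "N - 2"] by simp
 qed
 have "(u_gen ** W g' (rev [a..<N])) ** cc = u_gen ** g' (N - 1) ** g' (N - 2) ** (?U ** cc)" unfolding n by (simp add: W_append)
 also have "\<dots> = sc (inverse m) (u_gen ** (g' (N - 1) ** g' (N - 2) ** E (N - 1)) ** ?U)" unfolding cU[symmetric] by (simp add: cc_def)
 also have "\<dots> = sc (inverse m) ((u_gen ** E (N - 2)) ** E (N - 1) ** ?U)" unfolding b by simp
 also have "\<dots> = sc m (cc ** u_gen ** cc ** ?U)" unfolding uE using m0 by (simp add: cc_def)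
 also have "\<dots> = cc ** sc m (cc ** u_gen ** cc) ** (cc ** ?U)" by (simp add: cc_idem)
 finally show ?thesis .
qed

end

end

section \<open>Finite generation over the image of the fusion map\<close>

inductive_set cspan :: "('d \<Rightarrow>\<^sub>0 complex) set => ('d \<Rightarrow>\<^sub>0 complex) set" for S where
 zero: "0 \<in> cspan S"
| add: "x \<in> cspan S ==> y \<in> S ==> x + sc c y \<in> cspan S"

lemma cspan_base: "x \<in> S ==> x \<in> cspan S"
 using cspan.add[OF cspan.zero, of x S 1] by simp

lemma cspan_add:
 assumes "x \<in> cspan S" "y \<in> cspan S" shows "x + y \<in> cspan S"
 using assms(2,1) by (induction y rule: cspan.induct) (auto intro: cspan.intros simp flip: add.assoc)

lemma cspan_sc: "x \<in> cspan S ==> sc c x \<in> cspan S"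
 by (induction x rule: cspan.induct) (auto intro: cspan.intros)

lemma cspan_diff: "x \<in> cspan S ==> y \<in> cspan S ==> x - y \<in> cspan S"
proof -
 assume "x \<in> cspan S" "y \<in> cspan S"
 hence "x + sc (- 1) y \<in> cspan S" by (intro cspan_add cspan_sc)
 moreover have "x + sc (- 1) y = x - y" by (rule poly_mapping_eqI) (simp add: lookup_add lookup_minus)
 ultimately show ?thesis by simp
qed

lemma cspan_linear:
 assumes "x \<in> cspan S" "f 0 = 0" "!!x y. f (x + y) = f x + f y" "!!c x. f (sc c x) = sc c (f x)"
  "!!x. x \<in> S ==> f x \<in> cspan T"
 shows "f x \<in> cspan T"
 using assms(1) by (induction x rule: cspan.induct) (auto simp: assms(2-4) intro!: cspan_add cspan_sc cspan.zero assms(5))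

lemma cspan_subset: "S \<subseteq> cspan T ==> cspan S \<subseteq> cspan T"
 using cspan_linear[of _ S "\<lambda>x. x" T] by auto

context tl_alg begin

lemma cspan_C: "S \<subseteq> C ==> cspan S \<subseteq> C"
proof
 fix x assume S: "S \<subseteq> C" and "x \<in> cspan S"
 from this(2) show "x \<in> C" by (induction x rule: cspan.induct) (use S in auto)
qed

lemma cspan_left:
 assumes "x \<in> cspan S" "!!y. y \<in> S ==> a ** y \<in> cspan T" shows "a ** x \<in> cspan T"
 by (rule cspan_linear[of x S "\<lambda>x. a ** x"]) (use assms in auto)

lemma cspan_right:
 assumes "x \<in> cspan S" "!!y. y \<in> S ==> y ** a \<in> cspan T" shows "x ** a \<in> cspan T"
 by (rule cspan_linear[of x S "\<lambda>x. x ** a"]) (use assms in auto)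

section \<open>The finite Temperley-Lieb algebras inside the affine one\<close>

text \<open>The unital algebra generated by \<open>E 1, ..., E k\<close>. Only left multiplication
  by a letter is built in, so an induction has to move just one letter; closure under products is
  \<open>H_mult\<close>.\<close>

inductive_set H :: "nat => tl_elem set" for k where
 one: "\<I> \<in> H k"
| left: "h \<in> H k ==> 1 <= j ==> j <= k ==> E j ** h \<in> H k"
| add: "x \<in> H k ==> y \<in> H k ==> x + y \<in> H k"
| scale: "x \<in> H k ==> sc c x \<in> H k"

lemma H_C: "x \<in> H k ==> x \<in> C"
 by (induction rule: H.induct) auto

lemma H_mult: "x \<in> H k ==> y \<in> H k ==> x ** y \<in> H k"
proof (induction rule: H.induct)
 case (left h j)
 thus ?case using H.left[of "h ** y" k j] by (simp add: H_C)
qed (auto intro: H.intros simp: H_C)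

lemma H_mono: "x \<in> H k ==> k <= l ==> x \<in> H l"
 by (induction rule: H.induct) (auto intro: H.intros)

lemma H_diff: "x \<in> H k ==> y \<in> H k ==> x - y \<in> H k"
proof -
 assume "x \<in> H k" "y \<in> H k"
 hence "x + sc (- 1) y \<in> H k" by (intro H.add H.scale)
 moreover have "x + sc (- 1) y = x - y" by (rule poly_mapping_eqI) (simp add: lookup_add lookup_minus)
 ultimately show ?thesis by simp
qed

lemma H_letter: "f \<in> letters ==> 1 <= j ==> j <= k ==> f j \<in> H k"
proof -
 assume f: "f \<in> letters" "1 <= j" "j <= k"
 have E: "E j \<in> H k" using H.left[OF H.one f(2,3)] by simp
 have "g j \<in> H k" "g' j \<in> H k" unfolding g_def g'_def by (intro H.scale H_diff H.one E)+
 thus ?thesis using E f by (auto simp: letters_def)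
qed

lemma H_W: "f \<in> letters ==> (!!j. j \<in> set js ==> 1 <= j \<and> j <= k) ==> W f js \<in> H k"
proof (induction js)
 case (Cons j js)
 thus ?case using H_mult[OF H_letter[of f j k] Cons.IH] by simp
qed (simp add: H.one)

text \<open>The tower of the algebras \<open>H k\<close>: \<open>H (k + 1)\<close> is spanned by \<open>H k\<close> and \<open>H k E\<^sub>k\<^sub>+\<^sub>1 H k\<close>, because
 compressing \<open>H k\<close> by \<open>E\<^sub>k\<^sub>+\<^sub>1\<close> gives nothing new.\<close>

definition tower :: "nat => tl_elem set" where
 "tower k = H k \<union> {a ** E (Suc k) ** b | a b. a \<in> H k \<and> b \<in> H k}"

definition compress :: "nat => bool" where
 "compress k \<longleftrightarrow> (\<forall>x\<in>H k. \<exists>y\<in>H k. E (Suc k) ** x ** E (Suc k) = y ** E (Suc k))"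

lemma H_tower:
 assumes "compress k" "x \<in> H (Suc k)" shows "x \<in> cspan (tower k)"
 using assms(2)
proof (induction rule: H.induct)
 case one
 thus ?case by (intro cspan_base) (auto simp: tower_def intro: H.one)
next
 case (left h j)
 have "E j ** y \<in> tower k" if "y \<in> tower k" for y
 proof (cases "j = Suc k")
  case True
  from that show ?thesis unfolding tower_def
  proof (elim UnE CollectE exE conjE)
   assume "y \<in> H k"
   hence "E j ** y = \<I> ** E (Suc k) ** y" using True by (simp add: H_C)
   thus "E j ** y \<in> H k \<union> {a ** E (Suc k) ** b |a b. a \<in> H k \<and> b \<in> H k}"
    using \<open>y \<in> H k\<close> H.one by blast
  next
   fix a b assume y: "y = a ** E (Suc k) ** b" "a \<in> H k" "b \<in> H k"
   obtain c where c: "c \<in> H k" "E (Suc k) ** a ** E (Suc k) = c ** E (Suc k)"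
    using assms(1) y by (auto simp: compress_def)
   have "E j ** y = (E (Suc k) ** a ** E (Suc k)) ** b" using y True by (simp add: H_C)
   also have "\<dots> = c ** E (Suc k) ** b" unfolding c(2) using c y by (simp add: H_C)
   finally show "E j ** y \<in> H k \<union> {a ** E (Suc k) ** b |a b. a \<in> H k \<and> b \<in> H k}" using c y by blast
  qed
 next
  case False
  hence j: "1 <= j" "j <= k" using left by auto
  from that show ?thesis unfolding tower_def
  proof (elim UnE CollectE exE conjE)
   fix a b assume y: "y = a ** E (Suc k) ** b" "a \<in> H k" "b \<in> H k"
   have "E j ** y = (E j ** a) ** E (Suc k) ** b" using y by (simp add: H_C)
   thus "E j ** y \<in> H k \<union> {a ** E (Suc k) ** b |a b. a \<in> H k \<and> b \<in> H k}" using H.left[OF y(2) j] y by blast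
  qed (use j in \<open>auto intro: H.left\<close>)
 qed
 thus ?case using left by (intro cspan_left[of h "tower k"]) (auto intro: cspan_base)
qed (auto intro: cspan_add cspan_sc)

lemma H_far: "x \<in> H k ==> k + 2 <= j ==> j < N ==> E j ** x = x ** E j"
proof (induction rule: H.induct)
 case (left h i)
 have "E j ** E i ** h = E i ** E j ** h"
  by (rule tail, rule E_far) (use left in \<open>auto simp: H_C\<close>)
 thus ?case using left by (simp add: H_C)
qed auto

text \<open>In the induction step \<open>H_tower\<close> reduces to elements \<open>a\<close> and
  \<open>a ** E (k + 1) ** b\<close> with \<open>a\<close>, \<open>b\<close> in \<open>H k\<close>.
  These commute with \<open>E (k + 2)\<close>, and then either the square of
  \<open>E (k + 2)\<close> gives \<open>m\<close>, or \<open>E (k + 1)\<close> is absorbed between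
  its two copies.\<close>

lemma compress_all: "Suc k < N ==> compress k"
proof (induction k)
 case 0
 show ?case unfolding compress_def
 proof
  fix x assume "x \<in> H 0"
  thus "\<exists>y\<in>H 0. E (Suc 0) ** x ** E (Suc 0) = y ** E (Suc 0)"
  proof (induction rule: H.induct)
   case one
   show ?case by (intro bexI[of _ "sc m \<I>"] H.scale H.one) (simp add: ee)
  next
   case (add x y)
   then obtain x' y' where "x' \<in> H 0" "y' \<in> H 0" "E (Suc 0) ** x ** E (Suc 0) = x' ** E (Suc 0)"
    "E (Suc 0) ** y ** E (Suc 0) = y' ** E (Suc 0)" by blast
   thus ?case by (intro bexI[of _ "x' + y'"] H.add) auto
  next
   case (scale x c)
   then obtain x' where "x' \<in> H 0" "E (Suc 0) ** x ** E (Suc 0) = x' ** E (Suc 0)" by blast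
   thus ?case by (intro bexI[of _ "sc c x'"] H.scale) auto
  qed auto
 qed
next
 case (Suc k)
 have N3: "N >= 3" using Suc by simp
 show ?case unfolding compress_def
 proof
  fix x assume "x \<in> H (Suc k)"
  hence "x \<in> cspan (tower k)" using Suc by (intro H_tower) auto
  thus "\<exists>y\<in>H (Suc k). E (Suc (Suc k)) ** x ** E (Suc (Suc k)) = y ** E (Suc (Suc k))"
  proof (induction rule: cspan.induct)
   case zero
   show ?case using H.scale[OF H.one, of 0] by (intro bexI[of _ 0]) auto
  next
   case (add x y c)
   have "\<exists>z\<in>H (Suc k). E (Suc (Suc k)) ** y ** E (Suc (Suc k)) = z ** E (Suc (Suc k))"
    using add(2) unfolding tower_def
   proof (elim UnE CollectE exE conjE)
    assume y: "y \<in> H k"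
    have "y ** E (Suc (Suc k)) = E (Suc (Suc k)) ** y" using H_far[OF y, of "Suc (Suc k)"] Suc by simp
    hence "E (Suc (Suc k)) ** y ** E (Suc (Suc k)) = sc m y ** E (Suc (Suc k))"
     using y by (simp add: tails H_C)
    thus ?thesis using H.scale[OF H_mono[OF y]] by (intro bexI[of _ "sc m y"]) auto
   next
    fix a b assume y: "y = a ** E (Suc k) ** b" "a \<in> H k" "b \<in> H k"
    have ab: "a ** E (Suc (Suc k)) = E (Suc (Suc k)) ** a" "b ** E (Suc (Suc k)) = E (Suc (Suc k)) ** b"
     using H_far[OF y(2), of "Suc (Suc k)"] H_far[OF y(3), of "Suc (Suc k)"] Suc by simp_all
    have "E (Suc (Suc k)) ** y ** E (Suc (Suc k)) = (E (Suc (Suc k)) ** a) ** E (Suc k) ** (b ** E (Suc (Suc k)))"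
     using y by (simp add: H_C)
    also have "\<dots> = a ** (E (Suc (Suc k)) ** E (Suc k) ** E (Suc (Suc k)) ** b)" unfolding ab(1)[symmetric] ab(2) using y by (simp add: H_C)
    also have "\<dots> = a ** (E (Suc (Suc k)) ** b)" using tails(6)[of b "Suc k"] N3 y by (simp add: H_C)
    also have "\<dots> = (a ** b) ** E (Suc (Suc k))" unfolding ab(2)[symmetric] using y by (simp add: H_C)
    finally show ?thesis using H_mono[OF H_mult[OF y(2,3)], of "Suc k"] by auto
   qed
   then obtain z where "z \<in> H (Suc k)" "E (Suc (Suc k)) ** y ** E (Suc (Suc k)) = z ** E (Suc (Suc k))" by blast
   moreover obtain w where "w \<in> H (Suc k)" "E (Suc (Suc k)) ** x ** E (Suc (Suc k)) = w ** E (Suc (Suc k))" using add by blast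
   ultimately show ?case by (intro bexI[of _ "w + sc c z"] H.add H.scale) auto
  qed
 qed
qed

lemma H_finite: "k < N ==> \<exists>S. finite S \<and> S \<subseteq> H k \<and> H k \<subseteq> cspan S"
proof (induction k)
 case 0
 have "x \<in> cspan {\<I>}" if "x \<in> H 0" for x
  using that by (induction rule: H.induct) (auto intro: cspan_base cspan_add cspan_sc)
 thus ?case by (intro exI[of _ "{\<I>}"]) (auto intro: H.one)
next
 case (Suc k)
 then obtain S where S: "finite S" "S \<subseteq> H k" "H k \<subseteq> cspan S" by auto
 define T where "T = S \<union> (\<lambda>(a, b). a ** E (Suc k) ** b) ` (S \<times> S)"
 have "tower k \<subseteq> cspan T"
 proof
  fix x assume "x \<in> tower k"
  thus "x \<in> cspan T" unfolding tower_def
  proof (elim UnE CollectE exE conjE)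
   assume "x \<in> H k"
   thus ?thesis using S cspan_subset[of S T] cspan_base[of _ T] by (auto simp: T_def)
  next
   fix a b assume x: "x = a ** E (Suc k) ** b" "a \<in> H k" "b \<in> H k"
   have "a' ** E (Suc k) ** b \<in> cspan T" if "a' \<in> S" for a'
   proof -
    have "(a' ** E (Suc k)) ** b \<in> cspan T"
    proof (rule cspan_left)
     show "b \<in> cspan S" using S x by auto
     fix y assume y: "y \<in> S"
     hence "(a' ** E (Suc k)) ** y = a' ** E (Suc k) ** y" using assoc[OF H_C _ H_C, of a' k "E (Suc k)" y k] that S by blast
     thus "(a' ** E (Suc k)) ** y \<in> cspan T" using that y by (auto simp: T_def intro!: cspan_base)
    qed
    thus ?thesis using assoc[OF H_C _ H_C, of a' k "E (Suc k)" b k] that S x by auto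
   qed
   thus ?thesis unfolding x(1) using S x by (intro cspan_right[of a S]) auto
  qed
 qed
 hence "H (Suc k) \<subseteq> cspan T"
  using H_tower[OF compress_all[OF Suc.prems]] cspan_subset by blast
 moreover have "T \<subseteq> H (Suc k)"
  using S H_mono[of _ k "Suc k"] H_letter[of E "Suc k" "Suc k"] by (auto simp: T_def intro!: H_mult)
 moreover have "finite T" using S by (simp add: T_def)
 ultimately show ?case by blast
qed

text \<open>The analogues in the affine Temperley-Lieb algebra of the Jucys-Murphy (or Bernstein) elements of the
 affine Hecke algebra.  They normalise \<open>H\<close> up to lower terms.\<close>

definition Y :: "nat => tl_elem" where "Y i = W g (rev [1..<i]) ** u_gen ** W g' (rev [i..<N])"
definition Y' :: "nat => tl_elem" where "Y' i = W g [i..<N] ** u_inv_gen ** W g' [1..<i]"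

lemma Y_closed [simp]: "Y i \<in> C" "Y' i \<in> C"
 by (simp_all add: Y_def Y'_def)

lemma W_inverse_tail:
 "x \<in> C ==> W g js ** W g' (rev js) ** x = x" "x \<in> C ==> W g' js ** W g (rev js) ** x = x"
 using W_inverse[of js] assoc[of "W g js" "W g' (rev js)" x] assoc[of "W g' js" "W g (rev js)" x] by simp_all

lemma Y_inverse: "Y i ** Y' i = \<I>" "Y' i ** Y i = \<I>"
 using W_inverse_tail(2)[of _ "rev [i..<N]"] W_inverse_tail(2)[of _ "[1..<i]"] W_inverse(1)[of "[i..<N]"] W_inverse(1)[of "rev [1..<i]"]
 by (simp_all add: Y_def Y'_def tails)

lemma gg_tail: "x \<in> C ==> g j ** g' j ** x = x" "x \<in> C ==> g' j ** g j ** x = x"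
 using gg[of j] assoc[of "g j" "g' j" x] assoc[of "g' j" "g j" x] by simp_all

text \<open>The recursion that obtains \<open>Y (i + 1)\<close> from \<open>Y i\<close> by
  multiplying with \<open>g i\<close> on both sides, and its inverse, written as a crossing passing
  from one side to the other.\<close>

lemma Y_step:
 assumes "1 <= i" "i < N"
 shows "Y i ** g i = g' i ** Y (Suc i)" "Y (Suc i) ** g' i = g i ** Y i"
  "Y' i ** g' i = g i ** Y' (Suc i)" "Y' (Suc i) ** g i = g' i ** Y' i"
proof -
 have "[i..<N] = i # [Suc i..<N]" using assms by (simp add: upt_conv_Cons)
 moreover have "[1..<Suc i] = [1..<i] @ [i]" using assms by simp
 ultimately show "Y i ** g i = g' i ** Y (Suc i)" "Y (Suc i) ** g' i = g i ** Y i"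
  "Y' i ** g' i = g i ** Y' (Suc i)" "Y' (Suc i) ** g i = g' i ** Y' i"
  by (simp_all add: Y_def Y'_def W_append gg gg_tail del: upt_Suc)
qed

text \<open>An arc crossing a staircase of crossings moves by one position. Only the two letters at
  \<open>j\<close> and \<open>j + 1\<close> matter: by the braid relations both sides contain
  \<open>E j ** E (j + 1)\<close> there.\<close>

lemma slide:
 assumes f: "f \<in> {g, g'}" and b: "1 <= b" "b <= j" "Suc j < c" "c <= N"
 shows "W f (rev [b..<c]) ** E (Suc j) = E j ** W f (rev [b..<c])"
proof -
 have N3: "N >= 3" using b by simp
 have fl: "f \<in> letters" using f by (auto simp: letters_def)
 have "[b..<c] = [b..<j] @ [j..<c]" using b upt_add_eq_append[of b j "c - j"] by simp
 also have "[j..<c] = j # Suc j # [Suc (Suc j)..<c]" using b by (simp add: upt_conv_Cons)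
 finally have s: "W f (rev [b..<c]) = W f (rev [Suc (Suc j)..<c]) ** f (Suc j) ** f j ** W f (rev [b..<j])"
  using fl by (simp add: W_append)
 have l: "W f (rev [b..<j]) ** E (Suc j) = E (Suc j) ** W f (rev [b..<j])"
  by (rule W_far) (use b fl in auto)
 have r: "W f (rev [Suc (Suc j)..<c]) ** E j = E j ** W f (rev [Suc (Suc j)..<c])"
  by (rule W_far) (use b fl in auto)
 have br: "f (Suc j) ** f j ** E (Suc j) = E j ** E (Suc j)" "E j ** f (Suc j) ** f j = E j ** E (Suc j)"
  using f braid_left[OF N3, of j] braid_right[OF N3, of j] by auto
 have "W f (rev [b..<c]) ** E (Suc j) = W f (rev [Suc (Suc j)..<c]) ** (f (Suc j) ** f j ** E (Suc j)) ** W f (rev [b..<j])"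
  unfolding s using fl l by simp
 also have "f (Suc j) ** f j ** E (Suc j) = E j ** f (Suc j) ** f j" by (simp only: br)
 also have "W f (rev [Suc (Suc j)..<c]) ** (E j ** f (Suc j) ** f j) ** W f (rev [b..<j]) =
  (W f (rev [Suc (Suc j)..<c]) ** E j) ** f (Suc j) ** f j ** W f (rev [b..<j])" using fl by simp
 also have "\<dots> = E j ** W f (rev [b..<c])" unfolding r s using fl by simp
 finally show ?thesis .
qed

text \<open>Strand \<open>i\<close> winds around the annulus past an arc it does not share. One half
  of the braid and the factor \<open>u\<close> each shift the arc by one position, in opposite
  directions.\<close>

lemma Y_comm:
 assumes j: "1 <= j" "j < N" "j ~= i" "Suc j ~= i" and i: "1 <= i" "i <= N"
 shows "Y i ** E j = E j ** Y i" "Y' i ** E j = E j ** Y' i"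
proof -
 let ?G = "W g (rev [1..<i])" and ?V = "W g' (rev [i..<N])"
 show Y: "Y i ** E j = E j ** Y i"
 proof (cases "i < j")
  case True
  then obtain k where k: "j = Suc k" "i <= k" by (cases j) auto
  have V: "?V ** E j = E k ** ?V" unfolding k(1) by (rule slide) (use k i j in auto)
  have u: "u_gen ** E k = E j ** u_gen" using u_letter[of E k] k by simp
  have G: "?G ** E j = E j ** ?G" by (rule W_far) (use k i j in auto)
  have "Y i ** E j = ?G ** u_gen ** (?V ** E j)" by (simp add: Y_def)
  also have "\<dots> = ?G ** (u_gen ** E k) ** ?V" unfolding V by simp
  also have "\<dots> = (?G ** E j) ** u_gen ** ?V" unfolding u by simp
  also have "\<dots> = E j ** Y i" unfolding G by (simp add: Y_def)
  finally show ?thesis .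
 next
  case False
  hence ji: "Suc j < i" using j by simp
  have V: "?V ** E j = E j ** ?V" by (rule W_far) (use ji i j in auto)
  have u: "u_gen ** E j = E (Suc j) ** u_gen" using u_letter[of E j] by simp
  have G: "?G ** E (Suc j) = E j ** ?G" by (rule slide) (use ji i j in auto)
  have "Y i ** E j = ?G ** u_gen ** (?V ** E j)" by (simp add: Y_def)
  also have "\<dots> = ?G ** (u_gen ** E j) ** ?V" unfolding V by simp
  also have "\<dots> = (?G ** E (Suc j)) ** u_gen ** ?V" unfolding u by simp
  also have "\<dots> = E j ** Y i" unfolding G by (simp add: Y_def)
  finally show ?thesis .
 qed
 have "Y' i ** E j = Y' i ** E j ** (Y i ** Y' i)" by (simp add: Y_inverse)
 also have "\<dots> = Y' i ** (E j ** Y i) ** Y' i" by simp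
 also have "\<dots> = (Y' i ** Y i) ** E j ** Y' i" unfolding Y[symmetric] by simp
 also have "\<dots> = E j ** Y' i" unfolding Y_inverse by simp
 finally show "Y' i ** E j = E j ** Y' i" .
qed

text \<open>The crossings in \<open>Y_step\<close> are expanded and the relation is solved for
  \<open>A ** E i\<close>. Terms without \<open>E i\<close> remain, so moving past
  \<open>E i\<close> is possible only up to a span.\<close>

lemma solve_cross:
 assumes "A \<in> C" "B \<in> C"
 shows "A ** g i = g' i ** B ==> A ** E i = sc (s\<^sup>2) A + B - sc (s\<^sup>2) (E i ** B)"
  "A ** g' i = g i ** B ==> A ** E i = sc (1 / s\<^sup>2) A + B - sc (1 / s\<^sup>2) (E i ** B)"
proof -
 have c: "x = s\<^sup>2 * y + z - s\<^sup>2 * w" if "\<i> * s * y - \<i> / s * x = \<i> * s * w - \<i> / s * z" for x y z w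
 proof -
  have "\<i> / s * x = \<i> / s * (s\<^sup>2 * y + z - s\<^sup>2 * w)" using that s0 by (simp add: field_simps power2_eq_square)
  moreover have "\<i> / s ~= 0" using s0 by simp
  ultimately show ?thesis using mult_cancel_left by blast
 qed
 have c': "x = 1 / s\<^sup>2 * y + z - 1 / s\<^sup>2 * w" if "\<i> * s * x - \<i> / s * y = \<i> * s * z - \<i> / s * w" for x y z w
 proof -
  have "\<i> * s * x = \<i> / s * y + (\<i> * s * z - \<i> / s * w)" using that by (simp add: algebra_simps)
  also have "\<dots> = \<i> * s * (1 / s\<^sup>2 * y + z - 1 / s\<^sup>2 * w)" using s0 by (simp add: field_simps power2_eq_square)
  finally have "\<i> * s * x = \<i> * s * (1 / s\<^sup>2 * y + z - 1 / s\<^sup>2 * w)" .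
  moreover have "\<i> * s ~= 0" using s0 by simp
  ultimately show ?thesis using mult_cancel_left by blast
 qed
 { assume a: "A ** g i = g' i ** B"
  show "A ** E i = sc (s\<^sup>2) A + B - sc (s\<^sup>2) (E i ** B)"
  proof (rule poly_mapping_eqI)
   fix k
   have "lookup (A ** g i) k = lookup (g' i ** B) k" using a by simp
   thus "lookup (A ** E i) k = lookup (sc (s\<^sup>2) A + B - sc (s\<^sup>2) (E i ** B)) k"
    unfolding g_mult(3)[OF assms(1)] g_mult(2)[OF assms(2)] lookup_minus lookup_add lookup_sc by (rule c)
  qed }
 { assume a: "A ** g' i = g i ** B"
  show "A ** E i = sc (1 / s\<^sup>2) A + B - sc (1 / s\<^sup>2) (E i ** B)"
  proof (rule poly_mapping_eqI)
   fix k
   have "lookup (A ** g' i) k = lookup (g i ** B) k" using a by simp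
   thus "lookup (A ** E i) k = lookup (sc (1 / s\<^sup>2) A + B - sc (1 / s\<^sup>2) (E i ** B)) k"
    unfolding g_mult(4)[OF assms(1)] g_mult(1)[OF assms(2)] lookup_minus lookup_add lookup_sc by (rule c')
  qed }
qed

text \<open>Stated for a family \<open>Z\<close> so that it covers both \<open>Y\<close> and its
  inverse: for these the roles of the two crossings in \<open>solve_cross\<close> are exchanged, but
  the spans are the same.\<close>

lemma cross_H:
 assumes Z: "!!i. Z i \<in> C"
  and comm: "!!i j. 1 <= j ==> j < N ==> j ~= i ==> Suc j ~= i ==> 1 <= i ==> i <= N ==> Z i ** E j = E j ** Z i"
  and c1: "!!i. 1 <= i ==> i < N ==> Z i ** E i \<in> cspan {Z i, Z (Suc i), E i ** Z (Suc i)}"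
  and c2: "!!i. 1 <= i ==> i < N ==> Z (Suc i) ** E i \<in> cspan {Z (Suc i), Z i, E i ** Z i}"
  and h: "h \<in> H (N - 1)" and i: "1 <= i" "i <= N"
 shows "Z i ** h \<in> cspan {h' ** Z j | h' j. h' \<in> H (N - 1) \<and> 1 <= j \<and> j <= N}" (is "_ \<in> cspan ?M")
 using h i
proof (induction arbitrary: i rule: H.induct)
 case one
 have "\<I> ** Z i \<in> ?M" using one H.one by blast
 thus ?case using cspan_base[of "\<I> ** Z i" ?M] Z by simp
next
 case (left h j)
 have j: "1 <= j" "j < N" using left N by auto
 have hC: "h \<in> C" using left H_C by blast
 have EM: "E j ** x \<in> cspan ?M" if "x \<in> cspan ?M" for x
 proof (rule cspan_left[OF that])
  fix y assume "y \<in> ?M"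
  then obtain h' k where y: "y = h' ** Z k" "h' \<in> H (N - 1)" "1 <= k" "k <= N" by blast
  hence "E j ** y = (E j ** h') ** Z k" using Z by (simp add: H_C)
  moreover have "E j ** h' \<in> H (N - 1)" using left y by (auto intro: H.left)
  ultimately show "E j ** y \<in> cspan ?M" using y by (intro cspan_base) blast
 qed
 have step: "(Z i ** E j) ** h \<in> cspan ?M" if c: "Z i ** E j \<in> cspan {Z i, Z k, E j ** Z k}" and k: "1 <= k" "k <= N" for k
 proof (rule cspan_right[OF c])
  fix y assume "y \<in> {Z i, Z k, E j ** Z k}"
  thus "y ** h \<in> cspan ?M" using left.IH[OF left.prems] left.IH[OF k] EM[OF left.IH[OF k]] Z hC by auto
 qed
 consider "i = j" | "i = Suc j" | "j ~= i" "Suc j ~= i" by blast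
 hence "(Z i ** E j) ** h \<in> cspan ?M"
 proof cases
  case 1
  thus ?thesis using step[of "Suc i"] c1[of i] j by simp
 next
  case 2
  thus ?thesis using step[of j] c2[of j] j by simp
 next
  case 3
  hence "(Z i ** E j) ** h = E j ** Z i ** h" using comm[of j i] j left Z hC by simp
  thus ?thesis using EM left.IH[OF left.prems] by simp
 qed
 thus ?case using Z hC by simp
qed (auto intro: cspan_add cspan_sc)

lemma Y_H:
 assumes "h \<in> H (N - 1)" "1 <= i" "i <= N"
 shows "Y i ** h \<in> cspan {h' ** Y j | h' j. h' \<in> H (N - 1) \<and> 1 <= j \<and> j <= N}"
  "Y' i ** h \<in> cspan {h' ** Y' j | h' j. h' \<in> H (N - 1) \<and> 1 <= j \<and> j <= N}"
proof -
 have sp: "sc a x + y - sc a z \<in> cspan {x, y, z}" for a x y and z :: tl_elem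
  by (intro cspan_add cspan_diff cspan_sc cspan_base) auto
 show "Y i ** h \<in> cspan {h' ** Y j | h' j. h' \<in> H (N - 1) \<and> 1 <= j \<and> j <= N}"
  by (rule cross_H) (use assms Y_comm solve_cross(1)[OF _ _ Y_step(1)] solve_cross(2)[OF _ _ Y_step(2)] in \<open>auto simp: sp\<close>)
 show "Y' i ** h \<in> cspan {h' ** Y' j | h' j. h' \<in> H (N - 1) \<and> 1 <= j \<and> j <= N}"
  by (rule cross_H) (use assms Y_comm solve_cross(2)[OF _ _ Y_step(3)] solve_cross(1)[OF _ _ Y_step(4)] in \<open>auto simp: sp\<close>)
qed

text \<open>The set of sums of products \<open>h ** r\<close> with \<open>h\<close> in
  \<open>H (N - 1)\<close> and \<open>r\<close> in \<open>R\<close> contains the unit and is stable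
  under left multiplication by \<open>u\<close>, its inverse and \<open>E 1\<close>, hence is
  everything. Stability under \<open>u\<close> holds because \<open>u\<close> is \<open>Y 1\<close>
  times crossings, and \<open>Y 1\<close> moves past \<open>H (N - 1)\<close> into
  \<open>R\<close>.\<close>

lemma finite_over_image:
 assumes n1: "1 <= n1" "n1 < N"
  and R: "R \<subseteq> C" "\<I> \<in> R" "!!x y. x \<in> R ==> y \<in> R ==> x ** y \<in> R" "!!x y. x \<in> R ==> y \<in> R ==> x + y \<in> R"
   "!!c x. x \<in> R ==> sc c x \<in> R"
  and ER: "!!j. 1 <= j ==> j < N ==> j ~= n1 ==> E j \<in> R"
  and U: "u_gen ** W g' (rev [n1..<N]) \<in> R" "W g (rev [1..<Suc n1]) ** u_gen \<in> R"
  and V: "V1 \<in> R" "V1 ** (u_gen ** W g' (rev [n1..<N])) = \<I>"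
   "V2 \<in> R" "V2 ** (W g (rev [1..<Suc n1]) ** u_gen) = \<I>"
 shows "\<exists>S. finite S \<and> S \<subseteq> C \<and> C \<subseteq> cspan {h ** r | h r. h \<in> S \<and> r \<in> R}"
proof -
 have RC: "x \<in> C" if "x \<in> R" for x using that R by auto
 have Rdiff: "x - y \<in> R" if "x \<in> R" "y \<in> R" for x y
 proof -
  have "x + sc (- 1) y \<in> R" by (rule R(4)[OF that(1) R(5)[OF that(2)]])
  moreover have "x + sc (- 1) y = x - y" by (rule poly_mapping_eqI) (simp add: lookup_add lookup_minus)
  ultimately show ?thesis by simp
 qed
 have lR: "f j \<in> R" if "f \<in> letters" "1 <= j" "j < N" "j ~= n1" for f j
 proof -
  have "g j \<in> R" "g' j \<in> R" unfolding g_def g'_def by (intro R(5) Rdiff R(2) ER that)+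
  thus ?thesis using that ER by (auto simp: letters_def)
 qed
 have WR: "W f js \<in> R" if "f \<in> letters" "!!j. j \<in> set js ==> 1 <= j \<and> j < N \<and> j ~= n1" for f js
  using that(2) by (induction js) (auto intro!: R(2,3) lR that(1))
 \<comment> \<open>\<open>V1\<close> is given only as a left inverse lying in \<open>R\<close>;
   multiplying by the explicit inverse identifies it. The same is done for
   \<open>V2\<close>.\<close>
 have V1: "V1 = W g [n1..<N] ** u_inv_gen"
 proof -
  have "V1 = V1 ** (u_gen ** W g' (rev [n1..<N])) ** W g [n1..<N] ** u_inv_gen"
   using W_inverse_tail(2)[of u_inv_gen "rev [n1..<N]"] RC V(1) by (simp add: uui)
  also have "\<dots> = (V1 ** (u_gen ** W g' (rev [n1..<N]))) ** W g [n1..<N] ** u_inv_gen" using RC V(1) by simp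
  finally show ?thesis unfolding V(2) by simp
 qed
 have V2: "V2 = u_inv_gen ** W g' [1..<Suc n1]"
 proof -
  have "V2 = V2 ** (W g (rev [1..<Suc n1]) ** u_gen) ** u_inv_gen ** W g' [1..<Suc n1]"
   using W_inverse(1)[of "rev [1..<Suc n1]"] RC V(3) by (simp add: tails del: upt_Suc)
  also have "\<dots> = (V2 ** (W g (rev [1..<Suc n1]) ** u_gen)) ** u_inv_gen ** W g' [1..<Suc n1]" using RC V(3) by (simp del: upt_Suc)
  finally show ?thesis unfolding V(4) by (simp del: upt_Suc)
 qed
 \<comment> \<open>For \<open>i <= n1\<close> the element \<open>Y i\<close> is the image of the
   first translation with crossings of index below \<open>n1\<close> around it; for larger
   \<open>i\<close> it is that of the second one with crossings of index above \<open>n1\<close>.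
   The crossing at \<open>n1\<close> itself, which mixes the bundles, never occurs.\<close>
 have YR: "Y i \<in> R \<and> Y' i \<in> R" if i: "1 <= i" "i <= N" for i
 proof (cases "i <= n1")
  case True
  have s: "[i..<N] = [i..<n1] @ [n1..<N]" using True n1 upt_add_eq_append[of i n1 "N - n1"] by simp
  have "Y i = W g (rev [1..<i]) ** (u_gen ** W g' (rev [n1..<N])) ** W g' (rev [i..<n1])"
   unfolding Y_def s by (simp add: W_append)
  moreover have "Y' i = W g [i..<n1] ** V1 ** W g' [1..<i]" unfolding Y'_def s V1 by (simp add: W_append)
  moreover have "W g (rev [1..<i]) \<in> R" "W g' (rev [i..<n1]) \<in> R" "W g [i..<n1] \<in> R" "W g' [1..<i] \<in> R"
   by (rule WR; use True i n1 in auto)+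
  ultimately show ?thesis using R(3)[OF _ R(3)[OF U(1)]] R(3)[OF _ R(3)[OF V(1)]] by metis
 next
  case False
  have s: "[1..<i] = [1..<Suc n1] @ [Suc n1..<i]" using False n1 upt_add_eq_append[of 1 "Suc n1" "i - Suc n1"] by simp
  have "Y i = W g (rev [Suc n1..<i]) ** (W g (rev [1..<Suc n1]) ** u_gen) ** W g' (rev [i..<N])"
   unfolding Y_def s by (simp add: W_append del: upt_Suc)
  moreover have "Y' i = W g [i..<N] ** V2 ** W g' [Suc n1..<i]" unfolding Y'_def s V2 by (simp add: W_append del: upt_Suc)
  moreover have "W g (rev [Suc n1..<i]) \<in> R" "W g' (rev [i..<N]) \<in> R" "W g [i..<N] \<in> R" "W g' [Suc n1..<i] \<in> R"
   by (rule WR; use False i n1 in auto)+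
  ultimately show ?thesis using R(3)[OF _ R(3)[OF U(2)]] R(3)[OF _ R(3)[OF V(3)]] by metis
 qed
 define B where "B = {h ** r | h r. h \<in> H (N - 1) \<and> r \<in> R}"
 have HB: "h ** x \<in> cspan B" if h: "h \<in> H (N - 1)" and x: "x \<in> cspan B" for h x
 proof (rule cspan_left[OF x])
  fix y assume "y \<in> B"
  then obtain h' r where y: "y = h' ** r" "h' \<in> H (N - 1)" "r \<in> R" by (auto simp: B_def)
  hence "h ** y = (h ** h') ** r" using h RC by (simp add: H_C)
  thus "h ** y \<in> cspan B" using H_mult[OF h y(2)] y(3) by (intro cspan_base) (auto simp: B_def)
 qed
 have ZB: "Z 1 ** x \<in> cspan B"
  if Z: "!!h. h \<in> H (N - 1) ==> Z 1 ** h \<in> cspan {h' ** Z j | h' j. h' \<in> H (N - 1) \<and> 1 <= j \<and> j <= N}"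
   "!!i. Z i \<in> C" "!!i. 1 <= i ==> i <= N ==> Z i \<in> R" and x: "x \<in> cspan B" for Z x
 proof (rule cspan_left[OF x])
  fix y assume "y \<in> B"
  then obtain h r where y: "y = h ** r" "h \<in> H (N - 1)" "r \<in> R" by (auto simp: B_def)
  have "(Z 1 ** h) ** r \<in> cspan B"
  proof (rule cspan_right[OF Z(1)[OF y(2)]])
   fix w assume "w \<in> {h' ** Z j | h' j. h' \<in> H (N - 1) \<and> 1 <= j \<and> j <= N}"
   then obtain h' j where w: "w = h' ** Z j" "h' \<in> H (N - 1)" "1 <= j" "j <= N" by blast
   hence "w ** r = h' ** (Z j ** r)" using y RC Z(2) by (simp add: H_C)
   moreover have "Z j ** r \<in> R" using Z(3) w y R(3) by blast
   ultimately show "w ** r \<in> cspan B" using w by (intro cspan_base) (auto simp: B_def)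
  qed
  thus "Z 1 ** y \<in> cspan B" using y RC Z(2) by (simp add: H_C)
 qed
 have BC: "cspan B \<subseteq> C" by (rule cspan_C) (auto simp: B_def H_C RC)
 have gen: "x ** y \<in> cspan B" if x: "x \<in> gen_alg m N" and y: "y \<in> cspan B" for x y
  using x y
 proof (induction arbitrary: y rule: gen_alg.induct)
  case one
  thus ?case using BC by (simp flip: \<I>_def add: subset_iff)
 next
  case u
  have yC: "y \<in> C" using u BC by blast
  \<comment> \<open>The crossings in \<open>Y 1\<close> are undone by the word
    \<open>W g [1..<N]\<close>, which lies in \<open>H (N - 1)\<close>.\<close>
  have u: "u_gen ** y = Y 1 ** (W g [1..<N] ** y)"
   using W_inverse_tail(2)[of y "rev [1..<N]"] yC by (simp add: Y_def)
  have "W g [1..<N] \<in> H (N - 1)" by (rule H_W) auto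
  thus ?case unfolding u using HB \<open>y \<in> cspan B\<close> Y_H(1) YR N by (intro ZB[of Y]) auto
 next
  case u_inv
  have yC: "y \<in> C" using u_inv BC by blast
  have u: "u_inv_gen ** y = W g' (rev [1..<N]) ** (Y' 1 ** y)"
   using W_inverse_tail(2)[of "u_inv_gen ** y" "rev [1..<N]"] yC by (simp add: Y'_def)
  have w: "W g' (rev [1..<N]) \<in> H (N - 1)" by (rule H_W) auto
  have "Y' 1 ** y \<in> cspan B" using u_inv Y_H(2) YR N by (intro ZB[of Y']) auto
  thus ?case unfolding u using HB w by blast
 next
  case e
  have "E 1 \<in> H (N - 1)" using H_letter[of E 1] N by simp
  thus ?case using HB e by (simp add: E_def)
 next
  case (mult x x')
  have "x \<in> C" "x' \<in> C" "y \<in> C" using mult TL_gen_alg[OF N1] BC by auto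
  hence "tl_mult m N x x' ** y = x ** (x' ** y)" using assoc[of x x' y] by (simp add: mul_def)
  thus ?case using mult by simp
 qed (auto intro: cspan_add cspan_sc)
 have IB: "\<I> \<in> cspan B"
  using H.one[of "N - 1"] R(2) by (intro cspan_base) (force simp: B_def)
 have CB: "C \<subseteq> cspan B"
 proof
  fix x assume "x \<in> C"
  thus "x \<in> cspan B" using gen[OF _ IB, of x] TL_gen_alg[OF N1] by simp
 qed
 obtain S where S: "finite S" "S \<subseteq> H (N - 1)" "H (N - 1) \<subseteq> cspan S" using H_finite[of "N - 1"] N by auto
 have "B \<subseteq> cspan {h ** r | h r. h \<in> S \<and> r \<in> R}"
 proof
  fix x assume "x \<in> B"
  then obtain h r where x: "x = h ** r" "h \<in> H (N - 1)" "r \<in> R" by (auto simp: B_def)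
  thus "x \<in> cspan {h ** r | h r. h \<in> S \<and> r \<in> R}"
   unfolding x(1) using S by (intro cspan_right[of h S]) (auto intro: cspan_base)
 qed
 hence "C \<subseteq> cspan {h ** r | h r. h \<in> S \<and> r \<in> R}" using CB cspan_subset by blast
 moreover have "S \<subseteq> C" using S H_C by blast
 ultimately show ?thesis using S(1) by blast
qed

end

section \<open>Balanced tensor products\<close>

definition add_hom :: "('v, 'p) ring_scheme => ('w, 'q) ring_scheme => ('v => 'w) => bool" where
 "add_hom V W f \<longleftrightarrow> (\<forall>x\<in>carrier V. f x \<in> carrier W) \<and>
  (\<forall>x\<in>carrier V. \<forall>y\<in>carrier V. f (x +[V] y) = f x +[W] f y)"

lemma add_homD:
 assumes "add_hom V W f" "x \<in> carrier V"
 shows "f x \<in> carrier W" "y \<in> carrier V ==> f (x +[V] y) = f x +[W] f y"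
 using assms by (auto simp: add_hom_def)

lemma add_hom_zero:
 assumes "abelian_group V" "abelian_group W" "add_hom V W f" shows "f \<zero>\<^bsub>V\<^esub> = \<zero>\<^bsub>W\<^esub>"
proof -
 interpret V: abelian_group V by fact
 interpret W: abelian_group W by fact
 have "f \<zero>\<^bsub>V\<^esub> \<in> carrier W" using assms(3) by (auto simp: add_hom_def)
 moreover have "f \<zero>\<^bsub>V\<^esub> = f \<zero>\<^bsub>V\<^esub> +[W] f \<zero>\<^bsub>V\<^esub>" using add_homD(2)[OF assms(3), of "\<zero>\<^bsub>V\<^esub>" "\<zero>\<^bsub>V\<^esub>"] by simp
 ultimately show ?thesis using W.add.r_cancel_one' by metis
qed

definition biadditive where
 "biadditive X Y W h \<longleftrightarrow> (\<forall>x\<in>carrier X. \<forall>y\<in>carrier Y. h x y \<in> carrier W) \<and>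
  (\<forall>x\<in>carrier X. \<forall>x'\<in>carrier X. \<forall>y\<in>carrier Y. h (x +[X] x') y = h x y +[W] h x' y) \<and>
  (\<forall>x\<in>carrier X. \<forall>y\<in>carrier Y. \<forall>y'\<in>carrier Y. h x (y +[Y] y') = h x y +[W] h x y')"

locale tensor =
 fixes X :: "('x, 'p) ring_scheme" and Y :: "('y, 'q) ring_scheme" and R :: "'r set"
  and ra :: "'x => 'r => 'x" and la :: "'r => 'y => 'y"
 assumes Xg: "abelian_group X" and Yg: "abelian_group Y"
  and ra: "!!x r. x \<in> carrier X ==> r \<in> R ==> ra x r \<in> carrier X"
  and la: "!!r y. r \<in> R ==> y \<in> carrier Y ==> la r y \<in> carrier Y"
begin

abbreviation "TM \<equiv> tensor_module X Y R ra la"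

interpretation X: abelian_group X by (rule Xg)
interpretation Y: abelian_group Y by (rule Yg)

definition F where "F = {z :: 'x \<times> 'y \<Rightarrow>\<^sub>0 int. keys z \<subseteq> carrier X \<times> carrier Y}"
definition K where "K = generate (free_Abelian_group (carrier X \<times> carrier Y)) (tensor_relators X Y R ra la)"
definition cls where "cls z = (\<lambda>k. k + z) ` K"
definition tens where "tens x y = cls (frag_of (x, y))"

lemma F_closed: "z \<in> F ==> z' \<in> F ==> z + z' \<in> F" "z \<in> F ==> - z \<in> F" "0 \<in> F"
 "z \<in> F ==> z' \<in> F ==> z - z' \<in> F" "x \<in> carrier X ==> y \<in> carrier Y ==> frag_of (x, y) \<in> F"
 using keys_add[of z z'] keys_diff[of z z'] by (auto simp: F_def)

lemma relators_F: "tensor_relators X Y R ra la \<subseteq> F"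
 unfolding tensor_relators_def by (auto intro!: F_closed simp: ra la)

lemma K_subgroup: "subgroup K (free_Abelian_group (carrier X \<times> carrier Y))"
 unfolding K_def by (rule group.generate_is_subgroup) (use relators_F in \<open>auto simp: F_def\<close>)

lemma K_closed: "k \<in> K ==> k \<in> F" "0 \<in> K" "k \<in> K ==> k' \<in> K ==> k + k' \<in> K" "k \<in> K ==> - k \<in> K"
 "k \<in> K ==> k' \<in> K ==> k - k' \<in> K"
proof -
 show F: "k \<in> F" if "k \<in> K" for k using subgroup.mem_carrier[OF K_subgroup that] by (simp add: F_def)
 show "0 \<in> K" using subgroup.one_closed[OF K_subgroup] by simp
 show add: "k + k' \<in> K" if "k \<in> K" "k' \<in> K" for k k' using subgroup.m_closed[OF K_subgroup that] by simp
 show m: "- k \<in> K" if "k \<in> K" for k using subgroup.m_inv_closed[OF K_subgroup that] F[OF that] by (simp add: F_def)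
 show "k - k' \<in> K" if "k \<in> K" "k' \<in> K" using add[OF that(1) m[OF that(2)]] by simp
qed

lemma relator_K: "z \<in> tensor_relators X Y R ra la ==> z \<in> K"
 unfolding K_def by (rule generate.incl)

lemma cls_eq: "cls z = cls z' \<longleftrightarrow> z - z' \<in> K"
proof
 assume "cls z = cls z'"
 moreover have "z \<in> cls z" using K_closed(2) by (auto simp: cls_def intro!: image_eqI[of _ _ 0])
 ultimately obtain k where "k \<in> K" "z = k + z'" by (auto simp: cls_def)
 thus "z - z' \<in> K" by simp
next
 have sub: "cls z \<subseteq> cls z'" if "z - z' \<in> K" for z z'
 proof
  fix w assume "w \<in> cls z"
  then obtain k where "k \<in> K" "w = k + z" by (auto simp: cls_def)
  hence "w = (k + (z - z')) + z'" "k + (z - z') \<in> K" using that K_closed by auto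
  thus "w \<in> cls z'" unfolding cls_def by (rule image_eqI)
 qed
 assume "z - z' \<in> K"
 moreover from K_closed(4)[OF this] have "z' - z \<in> K" by simp
 ultimately show "cls z = cls z'" using sub by blast
qed

lemma carrier_T: "carrier (TM act) = cls ` F"
proof -
 have "K #>\<^bsub>free_Abelian_group (carrier X \<times> carrier Y)\<^esub> z = cls z" for z
  by (auto simp: r_coset_def cls_def)
 hence "rcosets\<^bsub>free_Abelian_group (carrier X \<times> carrier Y)\<^esub> K = cls ` F"
  by (auto simp: RCOSETS_def F_def)
 thus ?thesis unfolding tensor_module_def Let_def K_def[symmetric] by (simp add: FactGroup_def)
qed

lemma zero_T: "\<zero>\<^bsub>TM act\<^esub> = cls 0"
 unfolding tensor_module_def Let_def K_def[symmetric] by (simp add: FactGroup_def cls_def)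

lemma add_T: "cls z +[TM act] cls z' = cls (z + z')"
proof -
 have "cls z +[TM act] cls z' = {a + b | a b. a \<in> cls z \<and> b \<in> cls z'}"
  unfolding tensor_module_def Let_def K_def[symmetric] by (auto simp: FactGroup_def set_mult_def)
 also have "\<dots> = cls (z + z')"
 proof (intro subset_antisym subsetI)
  fix w assume "w \<in> {a + b | a b. a \<in> cls z \<and> b \<in> cls z'}"
  then obtain k k' where "k \<in> K" "k' \<in> K" "w = (k + z) + (k' + z')" by (auto simp: cls_def)
  thus "w \<in> cls (z + z')" using K_closed(3) by (auto simp: cls_def intro!: image_eqI[of _ _ "k + k'"])
 next
  fix w assume "w \<in> cls (z + z')"
  then obtain k where k: "k \<in> K" "w = k + (z + z')" by (auto simp: cls_def)
  hence "w = (k + z) + (0 + z')" "k + z \<in> cls z" "0 + z' \<in> cls z'"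
   using K_closed(2) unfolding cls_def by (auto intro: imageI)
  thus "w \<in> {a + b | a b. a \<in> cls z \<and> b \<in> cls z'}" by blast
 qed
 finally show ?thesis .
qed

lemma abelian_group_T: "abelian_group (TM act)"
proof (rule abelian_groupI)
 fix x assume "x \<in> carrier (TM act)"
 then obtain z where "x = cls z" "z \<in> F" by (auto simp: carrier_T)
 thus "\<exists>y\<in>carrier (TM act). y +[TM act] x = \<zero>\<^bsub>TM act\<^esub>"
  by (intro bexI[of _ "cls (- z)"]) (auto simp: carrier_T add_T zero_T F_closed)
qed (auto simp: carrier_T add_T zero_T F_closed add_ac)

lemma tens_closed: "x \<in> carrier X ==> y \<in> carrier Y ==> tens x y \<in> carrier (TM act)"
 by (auto simp: tens_def carrier_T F_closed)

lemma tens_add_left: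
 "x \<in> carrier X ==> x' \<in> carrier X ==> y \<in> carrier Y ==>
  tens (x +[X] x') y = tens x y +[TM act] tens x' y"
 unfolding tens_def add_T cls_eq
 by (rule relator_K) (auto simp: tensor_relators_def algebra_simps)

lemma tens_add_right:
 "x \<in> carrier X ==> y \<in> carrier Y ==> y' \<in> carrier Y ==>
  tens x (y +[Y] y') = tens x y +[TM act] tens x y'"
 unfolding tens_def add_T cls_eq
 by (rule relator_K) (auto simp: tensor_relators_def algebra_simps)

lemma tens_balanced: "x \<in> carrier X ==> r \<in> R ==> y \<in> carrier Y ==> tens (ra x r) y = tens x (la r y)"
 unfolding tens_def cls_eq
 by (rule relator_K) (auto simp: tensor_relators_def)

lemma tens_zero: "y \<in> carrier Y ==> tens \<zero>\<^bsub>X\<^esub> y = cls 0"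
proof -
 assume y: "y \<in> carrier Y"
 interpret T: abelian_group "TM undefined" by (rule abelian_group_T)
 have "tens \<zero>\<^bsub>X\<^esub> y +[TM undefined] tens \<zero>\<^bsub>X\<^esub> y = tens \<zero>\<^bsub>X\<^esub> y"
  by (subst tens_add_left[symmetric]) (use y in simp_all)
 hence "tens \<zero>\<^bsub>X\<^esub> y = \<zero>\<^bsub>TM undefined\<^esub>"
  using T.add.r_cancel_one[OF tens_closed tens_closed, of "\<zero>\<^bsub>X\<^esub>" y "\<zero>\<^bsub>X\<^esub>" y] y X.zero_closed by blast
 thus ?thesis by (simp add: zero_T)
qed

lemma tens_minus: "x \<in> carrier X ==> y \<in> carrier Y ==> cls (- frag_of (x, y)) = tens (\<ominus>\<^bsub>X\<^esub> x) y"
proof -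
 assume xy: "x \<in> carrier X" "y \<in> carrier Y"
 have "tens (\<ominus>\<^bsub>X\<^esub> x +[X] x) y = cls (frag_of (\<ominus>\<^bsub>X\<^esub> x, y) + frag_of (x, y))"
  using xy tens_add_left[of "\<ominus>\<^bsub>X\<^esub> x" x y undefined] by (simp add: add_T tens_def)
 hence "cls 0 = cls (frag_of (\<ominus>\<^bsub>X\<^esub> x, y) + frag_of (x, y))" using xy tens_zero by (simp add: X.l_neg)
 hence "- (frag_of (\<ominus>\<^bsub>X\<^esub> x, y) + frag_of (x, y)) \<in> K" by (simp add: cls_eq)
 thus ?thesis by (simp add: tens_def cls_eq algebra_simps)
qed

lemma T_induct [consumes 1, case_names zero tens add]:
 assumes a: "a \<in> carrier (TM act)"
  and zero: "P \<zero>\<^bsub>TM act\<^esub>"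
  and tens: "!!x y. x \<in> carrier X ==> y \<in> carrier Y ==> P (tens x y)"
  and add: "!!a b. a \<in> carrier (TM act) ==> b \<in> carrier (TM act) ==>
   P a ==> P b ==> P (a +[TM act] b)"
 shows "P a"
proof -
 obtain z where z: "a = cls z" "z \<in> F" using a by (auto simp: carrier_T)
 have "z \<in> F \<and> P (cls z) \<and> P (cls (- z))"
 proof (rule frag_induction[of z "carrier X \<times> carrier Y" "\<lambda>z. z \<in> F \<and> P (cls z) \<and> P (cls (- z))"])
  show "keys z \<subseteq> carrier X \<times> carrier Y" using z by (simp add: F_def)
  show "0 \<in> F \<and> P (cls 0) \<and> P (cls (- 0))" using zero by (simp add: zero_T F_closed)
  show "frag_of p \<in> F \<and> P (cls (frag_of p)) \<and> P (cls (- frag_of p))" if "p \<in> carrier X \<times> carrier Y" for p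
   using that tens by (auto simp: F_closed tens_minus) (simp add: tens_def)
  fix u v assume u: "u \<in> F \<and> P (cls u) \<and> P (cls (- u))" and v: "v \<in> F \<and> P (cls v) \<and> P (cls (- v))"
  have "P (cls u +[TM act] cls (- v))" "P (cls v +[TM act] cls (- u))"
   using u v by (auto intro!: add simp: carrier_T F_closed)
  thus "u - v \<in> F \<and> P (cls (u - v)) \<and> P (cls (- (u - v)))" using u v by (simp add: add_T F_closed)
 qed
 thus ?thesis using z by simp
qed

lemma lift:
 assumes W: "abelian_group W" and h: "biadditive X Y W h"
  and bal: "!!x r y. x \<in> carrier X ==> r \<in> R ==> y \<in> carrier Y ==> h (ra x r) y = h x (la r y)"
 shows "\<exists>H. add_hom (TM act) W H \<and> (\<forall>x\<in>carrier X. \<forall>y\<in>carrier Y. H (tens x y) = h x y)"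
proof -
 interpret W: abelian_group W by fact
 let ?G = "add_monoid W"
 have cg: "comm_group ?G" by (rule W.a_comm_group)
 have img: "(\<lambda>p. h (fst p) (snd p)) ` (carrier X \<times> carrier Y) \<subseteq> carrier ?G" using h by (auto simp: biadditive_def)
 obtain h0 where h0: "h0 \<in> Group.hom (free_Abelian_group (carrier X \<times> carrier Y)) ?G"
  "!!p. p \<in> carrier X \<times> carrier Y ==> h0 (frag_of p) = h (fst p) (snd p)"
  by (rule comm_group.free_Abelian_group_universal[OF cg img]) blast
 have clo: "h0 z \<in> carrier W" if "z \<in> F" for z
  using h0(1) that by (auto simp: Group.hom_def F_def Pi_def)
 have add: "h0 (z + z') = h0 z +[W] h0 z'" if "z \<in> F" "z' \<in> F" for z z'
  using h0(1) that by (auto simp: Group.hom_def F_def)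
 have sub: "h0 (z - z') = h0 z \<ominus>\<^bsub>W\<^esub> h0 z'" if "z \<in> F" "z' \<in> F" for z z'
 proof -
  have "h0 z = h0 (z - z') +[W] h0 z'" using add[of "z - z'" z'] that by (simp add: F_closed)
  thus ?thesis using clo that F_closed(4)[OF that]
   by (simp add: a_minus_def W.a_assoc W.r_neg)
 qed
 have z0: "h0 0 = \<zero>\<^bsub>W\<^esub>" using sub[of 0 0] clo[of 0] F_closed(3) by (simp add: a_minus_def W.r_neg)
 have cancel: "p +[W] q \<ominus>\<^bsub>W\<^esub> p \<ominus>\<^bsub>W\<^esub> q = \<zero>\<^bsub>W\<^esub>" if pq: "p \<in> carrier W" "q \<in> carrier W" for p q
 proof -
  have "p +[W] q \<ominus>\<^bsub>W\<^esub> p = q" using pq W.a_comm[of p q] by (simp add: a_minus_def W.a_assoc W.r_neg)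
  thus ?thesis using pq by (simp add: a_minus_def W.r_neg)
 qed
 have rel: "h0 z = \<zero>\<^bsub>W\<^esub>" if "z \<in> tensor_relators X Y R ra la" for z
  using that unfolding tensor_relators_def
 proof (elim UnE CollectE exE conjE)
  fix x x' y assume "z = frag_of (x +[X] x', y) - frag_of (x, y) - frag_of (x', y)" "x \<in> carrier X" "x' \<in> carrier X" "y \<in> carrier Y"
  thus ?thesis using h by (simp add: sub F_closed h0(2) biadditive_def cancel)
 next
  fix x y y' assume "z = frag_of (x, y +[Y] y') - frag_of (x, y) - frag_of (x, y')" "x \<in> carrier X" "y \<in> carrier Y" "y' \<in> carrier Y"
  thus ?thesis using h by (simp add: sub F_closed h0(2) biadditive_def cancel)
 next
  fix x r y assume "z = frag_of (ra x r, y) - frag_of (x, la r y)" "x \<in> carrier X" "r \<in> R" "y \<in> carrier Y"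
  thus ?thesis using h by (simp add: sub F_closed h0(2) bal biadditive_def ra la a_minus_def W.r_neg)
 qed
 have K0: "h0 z = \<zero>\<^bsub>W\<^esub>" if "z \<in> K" for z
 proof -
  have "z \<in> F \<and> h0 z = \<zero>\<^bsub>W\<^esub>" using that unfolding K_def
  proof (induction rule: generate.induct)
   case (inv h)
   hence hF: "h \<in> F" using relators_F by blast
   have "h0 (0 - h) = \<zero>\<^bsub>W\<^esub>" using sub[OF F_closed(3) hF] rel[OF inv] z0 by (simp add: a_minus_def)
   thus ?case using hF F_closed(2)[OF hF] by (simp add: F_def)
  qed (use rel relators_F z0 F_closed add in auto)
  thus ?thesis by simp
 qed
 define H where "H c = h0 (SOME z. z \<in> F \<and> cls z = c)" for c
 have H: "H (cls z) = h0 z" if "z \<in> F" for z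
 proof -
  have s: "(SOME z'. z' \<in> F \<and> cls z' = cls z) \<in> F \<and> cls (SOME z'. z' \<in> F \<and> cls z' = cls z) = cls z"
   by (rule someI[of _ z]) (use that in simp)
  define w where "w = (SOME z'. z' \<in> F \<and> cls z' = cls z)"
  have w: "w \<in> F" "w - z \<in> K" using s by (auto simp: w_def cls_eq)
  have "h0 w = h0 (w - z) +[W] h0 z" using add[of "w - z" z] w that by (simp add: F_closed)
  thus ?thesis using K0[OF w(2)] clo that by (simp add: H_def w_def)
 qed
 show ?thesis
  by (intro exI[of _ H]) (auto simp: add_hom_def carrier_T add_T H F_closed clo add tens_def h0(2))
qed

text \<open>The action on cosets is defined by applying \<open>act\<close> to representatives and
  saturating with \<open>K\<close>. It is well defined as soon as \<open>act\<close> respects the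
  relators; the universal property then provides the additive map it must equal.\<close>

lemma smult_T:
 assumes act: "!!x y. x \<in> carrier X ==> y \<in> carrier Y ==> act a (x, y) \<in> F"
  and h: "biadditive X Y (TM act) (\<lambda>x y. cls (act a (x, y)))"
  and bal: "!!x r y. x \<in> carrier X ==> r \<in> R ==> y \<in> carrier Y ==> cls (act a (ra x r, y)) = cls (act a (x, la r y))"
 shows "add_hom (TM act) (TM act) (module.smult (TM act) a)"
  and "z \<in> F ==> a *[TM act] cls z = cls (frag_extend (act a) z)"
  and "x \<in> carrier X ==> y \<in> carrier Y ==> a *[TM act] tens x y = cls (act a (x, y))"
proof -
 let ?T = "TM act"
 obtain H where H: "add_hom ?T ?T H" "!!x y. x \<in> carrier X ==> y \<in> carrier Y ==> H (tens x y) = cls (act a (x, y))"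
  using lift[OF abelian_group_T h bal, of act] by blast
 have H0: "H (cls 0) = cls 0" using add_hom_zero[OF abelian_group_T abelian_group_T H(1)] by (simp add: zero_T)
 have Hadd: "H (cls (u + v)) = H (cls u) +[?T] H (cls v)" if "u \<in> F" "v \<in> F" for u v
  using H(1) that unfolding add_hom_def carrier_T add_T[symmetric, of _ _ act] by blast
 have ext: "frag_extend (act a) z \<in> F \<and> cls (frag_extend (act a) z) = H (cls z)" if "z \<in> F" for z
 proof -
  have "z \<in> F \<and> frag_extend (act a) z \<in> F \<and> cls (frag_extend (act a) z) = H (cls z)"
  proof (rule frag_induction[of z "carrier X \<times> carrier Y" "\<lambda>z. z \<in> F \<and> frag_extend (act a) z \<in> F \<and> cls (frag_extend (act a) z) = H (cls z)"])
   show "keys z \<subseteq> carrier X \<times> carrier Y" using that by (simp add: F_def)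
   show "0 \<in> F \<and> frag_extend (act a) 0 \<in> F \<and> cls (frag_extend (act a) 0) = H (cls 0)" by (simp add: F_closed H0)
   show "frag_of p \<in> F \<and> frag_extend (act a) (frag_of p) \<in> F \<and> cls (frag_extend (act a) (frag_of p)) = H (cls (frag_of p))"
    if "p \<in> carrier X \<times> carrier Y" for p
    using that act H(2) by (auto simp: F_closed tens_def)
   fix u v assume u: "u \<in> F \<and> frag_extend (act a) u \<in> F \<and> cls (frag_extend (act a) u) = H (cls u)"
    and v: "v \<in> F \<and> frag_extend (act a) v \<in> F \<and> cls (frag_extend (act a) v) = H (cls v)"
   let ?f = "frag_extend (act a)"
   have "H (cls u) = H (cls (u - v)) +[?T] H (cls v)" using Hadd[of "u - v" v] u v by (simp add: F_closed)
   moreover obtain w where w: "w \<in> F" "H (cls (u - v)) = cls w"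
    using H(1) F_closed(4)[of u v] u v unfolding add_hom_def carrier_T by blast
   ultimately have "cls (?f u) = cls (w + ?f v)" using u v by (simp add: add_T[symmetric, of _ _ act])
   hence "?f u - ?f v - w \<in> K" by (simp add: cls_eq algebra_simps)
   hence "cls (?f u - ?f v) = cls w" by (simp add: cls_eq)
   thus "u - v \<in> F \<and> ?f (u - v) \<in> F \<and> cls (?f (u - v)) = H (cls (u - v))"
    using u v w by (simp add: F_closed frag_extend_diff)
  qed
  thus ?thesis by simp
 qed
 have K: "frag_extend (act a) k \<in> K" if "k \<in> K" for k
 proof -
  have "cls k = cls 0" using that by (simp add: cls_eq)
  hence "cls (frag_extend (act a) k) = cls 0" using ext[OF K_closed(1)[OF that]] H0 by simp
  thus ?thesis by (simp add: cls_eq)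
 qed
 have sm: "a *[?T] cls z = cls (frag_extend (act a) z)" if "z \<in> F" for z
 proof -
  let ?f = "frag_extend (act a)"
  have "a *[?T] cls z = {k + w | k w. k \<in> K \<and> w \<in> ?f ` cls z}"
   unfolding tensor_module_def Let_def K_def[symmetric] by (auto simp: set_mult_def)
  also have "\<dots> = cls (?f z)"
  proof (intro subset_antisym subsetI)
   fix w assume "w \<in> {k + w | k w. k \<in> K \<and> w \<in> ?f ` cls z}"
   then obtain k k' where k: "k \<in> K" "k' \<in> K" "w = k + ?f (k' + z)" by (auto simp: cls_def)
   hence "w = (k + ?f k') + ?f z" "k + ?f k' \<in> K" using K K_closed by (auto simp: frag_extend_add)
   thus "w \<in> cls (?f z)" unfolding cls_def by blast
  next
   fix w assume "w \<in> cls (?f z)"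
   then obtain k where "k \<in> K" "w = k + ?f z" by (auto simp: cls_def)
   moreover have "z \<in> cls z" using K_closed(2) by (auto simp: cls_def intro!: image_eqI[of _ _ 0])
   ultimately show "w \<in> {k + w | k w. k \<in> K \<and> w \<in> ?f ` cls z}" by blast
  qed
  finally show ?thesis .
 qed
 hence smH: "a *[?T] c = H c" if "c \<in> carrier ?T" for c
  using that ext by (auto simp: carrier_T)
 show "add_hom ?T ?T (module.smult ?T a)"
 proof -
  interpret T: abelian_group ?T by (rule abelian_group_T)
  show ?thesis using H(1) unfolding add_hom_def by (auto simp: smH)
 qed
 show "z \<in> F ==> a *[?T] cls z = cls (frag_extend (act a) z)" by (rule sm)
 show "x \<in> carrier X ==> y \<in> carrier Y ==> a *[?T] tens x y = cls (act a (x, y))"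
  using smH[OF tens_closed] H(2) by simp
qed

lemma left_module_T:
 assumes A: "ring A"
  and hom: "!!a. a \<in> carrier A ==> add_hom (TM act) (TM act) (module.smult (TM act) a)"
  and add: "!!a b x y. a \<in> carrier A ==> b \<in> carrier A ==> x \<in> carrier X ==> y \<in> carrier Y ==>
   (a +[A] b) *[TM act] tens x y =
   a *[TM act] tens x y +[TM act] b *[TM act] tens x y"
  and mult: "!!a b x y. a \<in> carrier A ==> b \<in> carrier A ==> x \<in> carrier X ==> y \<in> carrier Y ==>
   (a **[A] b) *[TM act] tens x y =
   a *[TM act] (b *[TM act] tens x y)"
  and one: "!!x y. x \<in> carrier X ==> y \<in> carrier Y ==> \<one>\<^bsub>A\<^esub> *[TM act] tens x y = tens x y"
 shows "left_module A (TM act)"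
proof -
 let ?T = "TM act"
 interpret A: ring A by fact
 interpret T: abelian_group ?T by (rule abelian_group_T)
 have sm0: "a *[?T] \<zero>\<^bsub>?T\<^esub> = \<zero>\<^bsub>?T\<^esub>" if "a \<in> carrier A" for a
  by (rule add_hom_zero[OF abelian_group_T abelian_group_T hom[OF that]])
 note smc = add_homD(1)[OF hom] and sma = add_homD(2)[OF hom]
 show ?thesis
 proof
  fix a x y assume a: "a \<in> carrier A" and x: "x \<in> carrier ?T"
  show "a *[?T] x \<in> carrier ?T" by (rule smc[OF a x])
  show "y \<in> carrier ?T ==> a *[?T] (x +[?T] y) = a *[?T] x +[?T] a *[?T] y" by (rule sma[OF a x])
 next
  fix a b x assume a: "a \<in> carrier A" and b: "b \<in> carrier A" and x: "x \<in> carrier ?T"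
  show "(a +[A] b) *[?T] x = a *[?T] x +[?T] b *[?T] x"
   using x
  proof (induction rule: T_induct)
   case (add c d)
   thus ?case using a b
    by (simp add: sma smc) (metis (no_types, lifting) T.a_assoc T.a_lcomm T.a_closed smc)
  qed (use a b sm0 add in auto)
  show "(a **[A] b) *[?T] x = a *[?T] (b *[?T] x)"
   using x
  proof (induction rule: T_induct)
   case (add c d)
   thus ?case using a b by (simp add: sma smc)
  qed (use a b sm0 mult in auto)
 next
  fix x assume "x \<in> carrier ?T"
  thus "\<one>\<^bsub>A\<^esub> *[?T] x = x"
  proof (induction rule: T_induct)
   case (add c d)
   thus ?case by (simp add: sma)
  qed (use sm0 one in auto)
 qed
qed

end

section \<open>Induced modules\<close>

text \<open>Common to fusion, where \<open>X\<close> is the whole algebra, and globalization, where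
  \<open>X\<close> is the left ideal generated by an idempotent.\<close>

locale induced =
 fixes A :: "(complex, 'a) module" and X :: "'a set" and B :: "(complex, 'b) module" and f :: "'b => 'a"
  and V :: "('b, 'v) module"
 assumes A: "ring A" and XA: "X \<subseteq> carrier A" and Xg: "abelian_group (A\<lparr>carrier := X\<rparr>)"
  and AX: "!!a x. a \<in> carrier A ==> x \<in> X ==> a **[A] x \<in> X"
  and fA: "!!b. b \<in> carrier B ==> f b \<in> carrier A"
  and Xf: "!!x b. x \<in> X ==> b \<in> carrier B ==> x **[A] f b \<in> X"
  and V: "left_module B V"
begin

interpretation A: ring A by (rule A)
interpretation V: left_module B V by (rule V)

sublocale tensor "A\<lparr>carrier := X\<rparr>" V "carrier B" "\<lambda>x b. x **[A] f b" "module.smult V"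
 by (rule tensor.intro[OF Xg V.M.abelian_group_axioms]) (auto simp: Xf V.smult_closed)

abbreviation T where "T \<equiv> induced_module A X B f V"

lemma X_closed: "x \<in> X ==> x \<in> carrier A" "x \<in> X ==> x' \<in> X ==> x +[A] x' \<in> X"
 using XA abelian_monoid.a_closed[OF abelian_group.axioms(1)[OF Xg], of x x'] by auto

lemma T_facts:
 "abelian_group T" "x \<in> X ==> v \<in> carrier V ==> tens x v \<in> carrier T"
 "x \<in> X ==> x' \<in> X ==> v \<in> carrier V ==> tens (x +[A] x') v = tens x v +[T] tens x' v"
 "x \<in> X ==> v \<in> carrier V ==> v' \<in> carrier V ==> tens x (v +[V] v') = tens x v +[T] tens x v'"
 "x \<in> X ==> b \<in> carrier B ==> v \<in> carrier V ==> tens (x **[A] f b) v = tens x (b *[V] v)"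
 using abelian_group_T tens_closed tens_add_left tens_add_right tens_balanced
 by (simp_all add: induced_module_def)

lemma smult_tens:
 assumes a: "a \<in> carrier A"
 shows "add_hom T T (module.smult T a)" "x \<in> X ==> v \<in> carrier V ==> a *[T] tens x v = tens (a **[A] x) v"
proof -
 have ba: "biadditive (A\<lparr>carrier := X\<rparr>) V T (\<lambda>x v. tens (a **[A] x) v)"
  using a by (auto simp: biadditive_def T_facts AX A.r_distr X_closed)
 have bl: "tens (a **[A] (x **[A] f b)) v = tens (a **[A] x) (b *[V] v)" if "x \<in> X" "b \<in> carrier B" "v \<in> carrier V" for x b v
  using that a by (simp add: A.m_assoc[symmetric] X_closed fA T_facts AX)
 note s = smult_T[of "\<lambda>a (x, v). frag_of (a **[A] x, v)" a, folded induced_module_def, unfolded split_conv tens_def[symmetric]]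
 have F: "x \<in> carrier (A\<lparr>carrier := X\<rparr>) ==> v \<in> carrier V ==> frag_of (a **[A] x, v) \<in> F" for x v
  using a by (auto intro!: F_closed simp: AX)
 show "add_hom T T (module.smult T a)" by (rule s(1)[OF F ba]) (use bl in auto)
 show "x \<in> X ==> v \<in> carrier V ==> a *[T] tens x v = tens (a **[A] x) v" by (rule s(3)[OF F ba]) (use bl in auto)
qed

lemma left_module_induced: "left_module A T"
 unfolding induced_module_def
 by (rule left_module_T[OF A]; fold induced_module_def)
  (auto simp: smult_tens T_facts A.l_distr A.m_assoc AX X_closed)

lemma induced_induct [consumes 1, case_names zero tens add]:
 assumes "a \<in> carrier T" "P \<zero>\<^bsub>T\<^esub>" "!!x v. x \<in> X ==> v \<in> carrier V ==> P (tens x v)"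
  "!!a b. a \<in> carrier T ==> b \<in> carrier T ==> P a ==> P b ==> P (a +[T] b)"
 shows "P a"
 using T_induct[where act = "\<lambda>a (x, v). frag_of (a **[A] x, v)" and P = P and a = a] assms
 unfolding induced_module_def by simp

lemma induced_lift:
 assumes "abelian_group W" "biadditive (A\<lparr>carrier := X\<rparr>) V W h"
  "!!x b v. x \<in> X ==> b \<in> carrier B ==> v \<in> carrier V ==> h (x **[A] f b) v = h x (b *[V] v)"
 shows "\<exists>H. add_hom T W H \<and> (\<forall>x\<in>X. \<forall>v\<in>carrier V. H (tens x v) = h x v)"
 using lift[OF assms(1,2)] assms(3) unfolding induced_module_def by simp

end

section \<open>Outer tensor products and fusion\<close>

definition push :: "('a => 'b) => ('a \<Rightarrow>\<^sub>0 complex) => ('b \<Rightarrow>\<^sub>0 complex)" where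
 "push f x = (\<Sum>a\<in>keys x. single (f a) (lookup x a))"

lemma push_superset:
 "finite A ==> keys x \<subseteq> A ==> push f x = (\<Sum>a\<in>A. single (f a) (lookup x a))"
 unfolding push_def by (rule sum.mono_neutral_left) (auto simp: in_keys_iff)

lemma push_add [simp]: "push f (x + y) = push f x + push f y"
proof -
 have "push f z = (\<Sum>a\<in>keys x \<union> keys y \<union> keys (x + y). single (f a) (lookup z a))"
  if "z \<in> {x, y, x + y}" for z
  by (rule push_superset) (use that in auto)
 thus ?thesis by (simp add: lookup_add single_add sum.distrib)
qed

lemma push_simps [simp]: "push f 0 = 0" "push f (single a c) = single (f a) c"
 by (simp add: push_def) (subst push_superset[of "{a}"], auto)

lemma push_sc: "push f (sc c x) = sc c (push f x)"
proof -
 have "keys x \<subseteq> UNIV" by simp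
 thus ?thesis by (induction x rule: single_induct) auto
qed

lemma keys_push: "keys x \<subseteq> D ==> f ` D \<subseteq> D' ==> keys (push f x) \<subseteq> D'"
proof (induction x rule: single_induct)
 case (add x a c)
 have "keys (push f x) \<union> keys (single (f a) c) \<subseteq> D'"
  using add by (auto split: if_splits)
 from order_trans[OF keys_add this] show ?case by simp
qed simp

abbreviation in1 :: "tl_elem => tl2_elem" where "in1 \<equiv> push (\<lambda>d. (d, id_diagram))"
abbreviation in2 :: "tl_elem => tl2_elem" where "in2 \<equiv> push (\<lambda>d. (id_diagram, d))"

abbreviation tl2_mult :: "complex => nat => nat => tl2_elem => tl2_elem => tl2_elem" where
 "tl2_mult m N1 N2 \<equiv> conv (\<lambda>a b. loop_weight N1 m (fst a) (fst b) * loop_weight N2 m (snd a) (snd b))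
   (\<lambda>a b. (comp_diagram N1 (fst a) (fst b), comp_diagram N2 (snd a) (snd b)))"

lemma TL2_simps [simp]:
 "monoid.mult (TL2 m N1 N2) = tl2_mult m N1 N2"
 "monoid.one (TL2 m N1 N2) = single (id_diagram, id_diagram) 1"
 "ring.zero (TL2 m N1 N2) = 0" "ring.add (TL2 m N1 N2) = (+)" "module.smult (TL2 m N1 N2) = sc"
 by (simp_all add: TL2_def)

lemma carrier_TL2: "carrier (TL2 m N1 N2) = {x. keys x \<subseteq> AD N1 \<times> AD N2}"
 by (simp add: TL2_def)

lemma comp_id_id: "N >= 1 ==> comp_diagram N id_diagram id_diagram = id_diagram" "loop_weight N m id_diagram id_diagram = 1"
 by (simp_all add: diagrams_trans trans_comp loop_weight_def)

lemma push_mult: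
 assumes "!!a b. w' (f a) (f b) = w a b" "!!a b. op' (f a) (f b) = f (op a b)"
 shows "push f (conv w op x y) = conv w' op' (push f x) (push f y)"
proof -
 have U: "keys x \<subseteq> UNIV" "keys y \<subseteq> UNIV" by simp_all
 from U(1) show ?thesis
 proof (induction x rule: single_induct)
  case (add x a c)
  have "push f (conv w op (single a c) y) = conv w' op' (push f (single a c)) (push f y)"
   using U(2) by (induction y rule: single_induct) (simp_all add: assms)
  thus ?case using add by simp
 qed simp
qed

lemma in1_mult: "N2 >= 1 ==> in1 (tl_mult m N1 x y) = tl2_mult m N1 N2 (in1 x) (in1 y)"
 by (rule push_mult) (simp_all add: comp_id_id(1)[of N2] comp_id_id(2))

lemma in2_mult: "N1 >= 1 ==> in2 (tl_mult m N2 x y) = tl2_mult m N1 N2 (in2 x) (in2 y)"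
 by (rule push_mult) (simp_all add: comp_id_id(1)[of N1] comp_id_id(2))

locale tl_pair = tl_corners m \<phi> for m and \<phi> +
 fixes N1 N2 :: nat
 assumes N12: "N1 >= 1" "N2 >= 1"
begin

abbreviation "C2 \<equiv> carrier (TL2 m N1 N2)"

interpretation A: diagram_basis "AD N1" "loop_weight N1 m" "comp_diagram N1" id_diagram
 by (rule diagram_basis_TL[OF N12(1)])
interpretation B: diagram_basis "AD N2" "loop_weight N2 m" "comp_diagram N2" id_diagram
 by (rule diagram_basis_TL[OF N12(2)])

lemma in_closed: "x \<in> CT N1 ==> in1 x \<in> C2"
 "y \<in> CT N2 ==> in2 y \<in> C2"
 using keys_push[of x "AD N1" "\<lambda>d. (d, id_diagram)" "AD N1 \<times> AD N2"]
  keys_push[of y "AD N2" "\<lambda>d. (id_diagram, d)" "AD N1 \<times> AD N2"] A.d1 B.d1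
 by (auto simp: carrier_TL carrier_TL2 simp del: mem_Sigma_iff intro: SigmaI)

lemma in_comm:
 assumes "x \<in> CT N1" "y \<in> CT N2"
 shows "tl2_mult m N1 N2 (in1 x) (in2 y) = tl2_mult m N1 N2 (in2 y) (in1 x)"
 using assms(1)[unfolded carrier_TL mem_Collect_eq]
proof (induction x rule: single_induct)
 case (add x a c)
 have "tl2_mult m N1 N2 (in1 (single a c)) (in2 y) = tl2_mult m N1 N2 (in2 y) (in1 (single a c))"
  using assms(2)[unfolded carrier_TL mem_Collect_eq]
 proof (induction y rule: single_induct)
  case (add y b d)
  thus ?case using \<open>a \<in> AD N1\<close> by (simp add: A.op_unit B.op_unit A.w_unit B.w_unit mult_ac)
 qed simp
 thus ?case using add by simp
qed simp

lemma single_pair: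
 assumes "a \<in> AD N1" "b \<in> AD N2"
 shows "single (a, b) c = tl2_mult m N1 N2 (in1 (single a c)) (in2 (single b 1))"
 using assms by (simp add: A.op_unit B.op_unit A.w_unit B.w_unit)

lemma TL2_induct [consumes 1, case_names zero add]:
 assumes "t \<in> C2" "P 0"
  "!!t a b c. t \<in> C2 ==> P t ==> a \<in> AD N1 ==> b \<in> AD N2 ==>
   single (a, b) c \<in> C2 ==> P (t + single (a, b) c)"
 shows "P t"
 using assms(1)[unfolded carrier_TL2 mem_Collect_eq]
proof (induction t rule: single_induct)
 case (add x p c)
 thus ?case using assms(3)[of x "fst p" "snd p" c] by (auto simp: carrier_TL2 split: if_splits)
qed (rule assms(2))

end

lemma left_module_zero:
 assumes "left_module R M" "x \<in> carrier M" shows "\<zero>\<^bsub>R\<^esub> *[M] x = \<zero>\<^bsub>M\<^esub>"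
proof -
 interpret left_module R M by fact
 have "\<zero>\<^bsub>R\<^esub> *[M] x +[M] \<zero>\<^bsub>R\<^esub> *[M] x = \<zero>\<^bsub>R\<^esub> *[M] x"
  using smult_l_distr[OF R.zero_closed R.zero_closed assms(2)] by simp
 thus ?thesis using M.add.r_cancel_one[OF smult_closed smult_closed] assms(2) by blast
qed

locale outer = tl_pair m \<phi> N1 N2 for m \<phi> N1 N2 +
 fixes M1 :: "(tl_elem, 'v) module" and M2 :: "(tl_elem, 'w) module"
 assumes M1: "lmod N1 M1" and M2: "lmod N2 M2"
begin

interpretation A: diagram_basis "AD N1" "loop_weight N1 m" "comp_diagram N1" id_diagram
 by (rule diagram_basis_TL[OF N12(1)])
interpretation B: diagram_basis "AD N2" "loop_weight N2 m" "comp_diagram N2" id_diagram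
 by (rule diagram_basis_TL[OF N12(2)])
interpretation M1: left_module "TL m N1" M1 by (rule M1)
interpretation M2: left_module "TL m N2" M2 by (rule M2)

lemma id1: "single id_diagram c \<in> CT N1" "single id_diagram c \<in> CT N2"
 using A.d1 B.d1 by (auto simp: carrier_TL)

lemma single_closed: "a \<in> AD N1 ==> single a c \<in> CT N1"
 "b \<in> AD N2 ==> single b c \<in> CT N2"
 by (auto simp: carrier_TL)

lemma scale_eq: "scale (TL m N1) M1 c v = single id_diagram c *[M1] v"
 "scale (TL m N2) M2 c w = single id_diagram c *[M2] w"
 by (simp_all add: scale_def)

sublocale O: tensor M1 M2 "UNIV :: complex set" "\<lambda>v c. scale (TL m N1) M1 c v" "scale (TL m N2) M2"
 by (rule tensor.intro[OF M1.M.abelian_group_axioms M2.M.abelian_group_axioms])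
  (auto simp: scale_eq intro!: M1.smult_closed M2.smult_closed id1)

abbreviation T where "T \<equiv> outer_tensor m N1 N2 M1 M2"
abbreviation otens where "otens \<equiv> O.tens"

definition oact :: "tl2_elem => 'v \<times> 'w => ('v \<times> 'w \<Rightarrow>\<^sub>0 int)" where
 "oact t = (\<lambda>(v, w). \<Sum>(a, b)\<in>keys t.
     frag_of (single a (lookup t (a, b)) *[M1] v,
         single b 1 *[M2] w))"

lemma T_eq: "T = tensor_module M1 M2 (UNIV :: complex set) (\<lambda>v c. scale (TL m N1) M1 c v) (scale (TL m N2) M2) oact"
 unfolding outer_tensor_def oact_def by (rule refl)

lemma T_facts:
 "abelian_group T" "v \<in> carrier M1 ==> w \<in> carrier M2 ==> otens v w \<in> carrier T"
 "v \<in> carrier M1 ==> v' \<in> carrier M1 ==> w \<in> carrier M2 ==> otens (v +[M1] v') w = otens v w +[T] otens v' w"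
 "v \<in> carrier M1 ==> w \<in> carrier M2 ==> w' \<in> carrier M2 ==> otens v (w +[M2] w') = otens v w +[T] otens v w'"
 "v \<in> carrier M1 ==> w \<in> carrier M2 ==>
  otens (single id_diagram c *[M1] v) w = otens v (single id_diagram c *[M2] w)"
 using O.abelian_group_T O.tens_closed O.tens_add_left O.tens_add_right O.tens_balanced[of v c w]
 by (simp_all add: T_eq scale_eq)

lemma K_sum: "(!!i. i \<in> I ==> f i \<in> O.K) ==> sum f I \<in> O.K"
 by (induction I rule: infinite_finite_induct) (auto intro: O.K_closed)

lemma F_sum: "(!!i. i \<in> I ==> f i \<in> O.F) ==> sum f I \<in> O.F"
 by (induction I rule: infinite_finite_induct) (auto intro: O.F_closed)

lemma smult_single_comm:
 "a \<in> AD N1 ==> v \<in> carrier M1 ==>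
  single a z *[M1] (single id_diagram c *[M1] v) = single id_diagram c *[M1] (single a z *[M1] v)"
 "b \<in> AD N2 ==> w \<in> carrier M2 ==>
  single b z *[M2] (single id_diagram c *[M2] w) = single id_diagram c *[M2] (single b z *[M2] w)"
 using M1.smult_assoc[OF single_closed(1)[of a z] id1(1)[of c], of v] M1.smult_assoc[OF id1(1)[of c] single_closed(1)[of a z], of v]
  M2.smult_assoc[OF single_closed(2)[of b z] id1(2)[of c], of w] M2.smult_assoc[OF id1(2)[of c] single_closed(2)[of b z], of w]
 by (simp_all add: A.op_unit B.op_unit A.w_unit B.w_unit mult_ac)

lemma smult_split: "b \<in> AD N2 ==> w \<in> carrier M2 ==>
  single b c *[M2] w = single id_diagram c *[M2] (single b 1 *[M2] w)"
 "a \<in> AD N1 ==> v \<in> carrier M1 ==>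
  single a (c * d) *[M1] v = single id_diagram c *[M1] (single a d *[M1] v)"
 using M2.smult_assoc[OF id1(2)[of c] single_closed(2)[of b 1], of w] M1.smult_assoc[OF id1(1)[of c] single_closed(1)[of a d], of v]
 by (simp_all add: A.op_unit B.op_unit A.w_unit B.w_unit)

lemma smult_pm_add:
 "a \<in> AD N1 ==> v \<in> carrier M1 ==>
  single a (c + d) *[M1] v = single a c *[M1] v +[M1] single a d *[M1] v"
 using M1.smult_l_distr[OF single_closed(1)[of a c] single_closed(1)[of a d], of v] by (simp add: single_add)

definition og where
 "og t v w p = frag_of (single (fst p) (lookup t p) *[M1] v, single (snd p) 1 *[M2] w)"

lemma oact_og: "oact t (v, w) = (\<Sum>p\<in>keys t. og t v w p)"
 by (simp add: oact_def og_def case_prod_beta)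

lemma add_K:
 "v \<in> carrier M1 ==> v' \<in> carrier M1 ==> w \<in> carrier M2 ==>
  frag_of (v +[M1] v', w) - frag_of (v, w) - frag_of (v', w) \<in> O.K"
 "v \<in> carrier M1 ==> w \<in> carrier M2 ==> w' \<in> carrier M2 ==>
  frag_of (v, w +[M2] w') - frag_of (v, w) - frag_of (v, w') \<in> O.K"
 using O.tens_add_left[of v v' w oact] O.tens_add_right[of v w w' oact]
 unfolding O.tens_def O.add_T O.cls_eq diff_diff_eq by simp_all

text \<open>The action of a general \<open>t\<close> is a sum over its support; each module law is
  checked for one summand modulo the relators, and \<open>K_sum\<close> adds the summands.\<close>

lemma og:
 assumes p: "p \<in> AD N1 \<times> AD N2" and v: "v \<in> carrier M1" and w: "w \<in> carrier M2"
 shows "og t v w p \<in> O.F" "v' \<in> carrier M1 ==> og t (v +[M1] v') w p - og t v w p - og t v' w p \<in> O.K"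
  "w' \<in> carrier M2 ==> og t v (w +[M2] w') p - og t v w p - og t v w' p \<in> O.K"
  "og t (scale (TL m N1) M1 c v) w p - og t v (scale (TL m N2) M2 c w) p \<in> O.K"
  "og (t + t') v w p - og t v w p - og t' v w p \<in> O.K" "lookup t p = 0 ==> og t v w p \<in> O.K"
proof -
 have k: "fst p \<in> AD N1" "snd p \<in> AD N2" using p by auto
 note cl = M1.smult_closed[OF single_closed(1)[OF k(1)]] M2.smult_closed[OF single_closed(2)[OF k(2)]]
 show "og t v w p \<in> O.F" using v w by (auto simp: og_def intro!: O.F_closed cl)
 show "v' \<in> carrier M1 ==> og t (v +[M1] v') w p - og t v w p - og t v' w p \<in> O.K"
  "w' \<in> carrier M2 ==> og t v (w +[M2] w') p - og t v w p - og t v w' p \<in> O.K"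
  "og (t + t') v w p - og t v w p - og t' v w p \<in> O.K"
  using k v w by (simp_all add: og_def M1.smult_r_distr M2.smult_r_distr lookup_add smult_pm_add single_closed add_K cl)
 have "otens (single (fst p) (lookup t p) *[M1] scale (TL m N1) M1 c v) (single (snd p) 1 *[M2] w) =
   otens (single (fst p) (lookup t p) *[M1] v) (single (snd p) 1 *[M2] scale (TL m N2) M2 c w)"
  unfolding scale_eq(1)[of c v] scale_eq(2)[of c w] smult_single_comm(1)[OF k(1) v] smult_single_comm(2)[OF k(2) w]
  using v w by (intro T_facts(5) cl)
 thus "og t (scale (TL m N1) M1 c v) w p - og t v (scale (TL m N2) M2 c w) p \<in> O.K"
  unfolding og_def O.tens_def O.cls_eq .
 show "og t v w p \<in> O.K" if "lookup t p = 0"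
  using O.tens_zero[OF cl(2)[OF w]] left_module_zero[OF M1 v] that by (simp add: og_def O.tens_def O.cls_eq)
qed

lemma keys_TL2: "t \<in> C2 ==> p \<in> keys t ==> p \<in> AD N1 \<times> AD N2"
 by (auto simp: carrier_TL2 simp del: mem_Sigma_iff)

lemma oact_F:
 assumes t: "t \<in> C2" and "v \<in> carrier M1" "w \<in> carrier M2"
 shows "oact t (v, w) \<in> O.F"
 unfolding oact_og by (rule F_sum, rule og(1)) (use assms keys_TL2 in auto)

text \<open>Supports are not additive in \<open>t\<close>. Summing over a common larger set repairs
  this, the additional summands being tensors with a zero factor.\<close>

lemma oact_superset:
 assumes S: "finite S" "keys t \<subseteq> S" "S \<subseteq> AD N1 \<times> AD N2"
  and v: "v \<in> carrier M1" "w \<in> carrier M2"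
 shows "O.cls (oact t (v, w)) = O.cls (\<Sum>p\<in>S. og t v w p)"
proof -
 have "(\<Sum>p\<in>S - keys t. og t v w p) \<in> O.K"
  using S(3) v by (intro K_sum og(6)) (auto simp: in_keys_iff)
 moreover have "(\<Sum>p\<in>S. og t v w p) = oact t (v, w) + (\<Sum>p\<in>S - keys t. og t v w p)"
  using sum.subset_diff[OF S(2,1), of "og t v w"] by (simp add: oact_og add.commute)
 ultimately show ?thesis by (subst eq_commute) (simp add: O.cls_eq)
qed

lemma oact_biadditive:
 assumes t: "t \<in> C2"
 shows "biadditive M1 M2 T (\<lambda>v w. O.cls (oact t (v, w)))"
proof -
 have "O.cls (oact t (v +[M1] v', w)) = O.cls (oact t (v, w)) +[T] O.cls (oact t (v', w))"
  if v: "v \<in> carrier M1" "v' \<in> carrier M1" "w \<in> carrier M2" for v v' w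
  unfolding T_eq O.add_T O.cls_eq diff_diff_eq[symmetric] oact_og sum_subtractf[symmetric]
  by (rule K_sum, rule og(2)) (use v keys_TL2[OF t] in auto)
 moreover have "O.cls (oact t (v, w +[M2] w')) = O.cls (oact t (v, w)) +[T] O.cls (oact t (v, w'))"
  if v: "v \<in> carrier M1" "w \<in> carrier M2" "w' \<in> carrier M2" for v w w'
  unfolding T_eq O.add_T O.cls_eq diff_diff_eq[symmetric] oact_og sum_subtractf[symmetric]
  by (rule K_sum, rule og(3)) (use v keys_TL2[OF t] in auto)
 moreover have "O.cls (oact t (v, w)) \<in> carrier T" if "v \<in> carrier M1" "w \<in> carrier M2" for v w
  unfolding T_eq O.carrier_T using oact_F[OF t that] by blast
 ultimately show ?thesis by (simp add: biadditive_def)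
qed

lemma oact_balanced:
 assumes t: "t \<in> C2" and v: "v \<in> carrier M1" "w \<in> carrier M2"
 shows "O.cls (oact t (scale (TL m N1) M1 c v, w)) = O.cls (oact t (v, scale (TL m N2) M2 c w))"
 unfolding O.cls_eq oact_og sum_subtractf[symmetric]
 by (rule K_sum, rule og(4)) (use v keys_TL2[OF t] in auto)

lemma osmult:
 assumes t: "t \<in> C2"
 shows "add_hom T T (module.smult T t)"
  "v \<in> carrier M1 ==> w \<in> carrier M2 ==> t *[T] otens v w = O.cls (oact t (v, w))"
 using O.smult_T[of oact t, folded T_eq, OF oact_F[OF t] oact_biadditive[OF t] oact_balanced[OF t]] by auto

lemma osmult_add:
 assumes t: "t \<in> C2" "t' \<in> C2" and v: "v \<in> carrier M1" "w \<in> carrier M2"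
 shows "(t + t') *[T] otens v w = t *[T] otens v w +[T] t' *[T] otens v w"
proof -
 define S where "S = keys t \<union> keys t'"
 have tt: "t + t' \<in> C2" using t keys_add[of t t'] by (auto simp: carrier_TL2)
 have S: "finite S" "S \<subseteq> AD N1 \<times> AD N2" using t by (auto simp: S_def carrier_TL2)
 have k: "keys t \<subseteq> S" "keys t' \<subseteq> S" "keys (t + t') \<subseteq> S"
  using keys_add[of t t'] by (auto simp: S_def)
 note sup = oact_superset[OF S(1) _ S(2) v]
 show ?thesis
  unfolding osmult(2)[OF t(1) v] osmult(2)[OF t(2) v] osmult(2)[OF tt v] sup[OF k(1)] sup[OF k(2)] sup[OF k(3)]
  unfolding T_eq O.add_T O.cls_eq diff_diff_eq[symmetric] sum_subtractf[symmetric]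
  by (rule K_sum, rule og(5)) (use S v in auto)
qed

lemma osmult_single:
 assumes ab: "a \<in> AD N1" "b \<in> AD N2" and v: "v \<in> carrier M1" "w \<in> carrier M2"
 shows "single (a, b) c *[T] otens v w = otens (single a c *[M1] v) (single b 1 *[M2] w)"
proof -
 have t: "single (a, b) c \<in> C2" using ab by (auto simp: carrier_TL2)
 have "O.cls (oact (single (a, b) c) (v, w)) = O.cls (\<Sum>p\<in>{(a, b)}. og (single (a, b) c) v w p)"
  by (rule oact_superset) (use ab v in auto)
 thus ?thesis using osmult(2)[OF t v] by (simp add: O.tens_def og_def)
qed

lemma outer_induct [consumes 1, case_names zero tens add]:
 assumes "a \<in> carrier T" "P \<zero>\<^bsub>T\<^esub>" "!!v w. v \<in> carrier M1 ==> w \<in> carrier M2 ==> P (otens v w)"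
  "!!a b. a \<in> carrier T ==> b \<in> carrier T ==> P a ==> P b ==> P (a +[T] b)"
 shows "P a"
 using O.T_induct[where act = oact and P = P and a = a] assms unfolding T_eq by blast

lemma left_module_outer: "left_module (TL2 m N1 N2) T"
proof -
 have R: "ring (TL2 m N1 N2)" by (rule ring_TL2[OF N12])
 interpret R: ring "TL2 m N1 N2" by (rule R)
 interpret Tg: abelian_group T by (rule T_facts(1))
 have sc: "t *[T] x \<in> carrier T" if "t \<in> C2" "x \<in> carrier T" for t x
  using osmult(1)[OF that(1)] that(2) by (auto simp: add_hom_def)
 have sa: "t *[T] (x +[T] y) = t *[T] x +[T] t *[T] y" if "t \<in> C2" "x \<in> carrier T" "y \<in> carrier T" for t x y
  using osmult(1)[OF that(1)] that(2,3) by (auto simp: add_hom_def)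
 have z: "t *[T] \<zero>\<^bsub>T\<^esub> = \<zero>\<^bsub>T\<^esub>" if "t \<in> C2" for t
  by (rule add_hom_zero[OF T_facts(1) T_facts(1) osmult(1)[OF that]])
 have tadd: "(t + t') *[T] x = t *[T] x +[T] t' *[T] x"
  if t: "t \<in> C2" "t' \<in> C2" and x: "x \<in> carrier T" for t t' x
  using x
 proof (induction rule: outer_induct)
  case (add y y')
  have tt: "t + t' \<in> C2" using t keys_add[of t t'] by (auto simp: carrier_TL2)
  show ?case using add t tt by (simp add: sa) (metis (no_types, lifting) Tg.a_assoc Tg.a_lcomm Tg.a_closed sc)
 next
  case zero
  have tt: "t + t' \<in> C2" using t keys_add[of t t'] by (auto simp: carrier_TL2)
  thus ?case using t by (simp add: z)
 qed (use t osmult_add in auto)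
 have zl: "0 *[T] otens v w = \<zero>\<^bsub>T\<^esub>" if "v \<in> carrier M1" "w \<in> carrier M2" for v w
 proof -
  have "(0::tl2_elem) \<in> C2" by (simp add: carrier_TL2)
  thus ?thesis using osmult(2)[of 0 v w] that by (simp add: oact_def T_eq O.zero_T)
 qed
 have mult: "tl2_mult m N1 N2 t t' *[T] otens v w = t *[T] (t' *[T] otens v w)"
  if t: "t \<in> C2" and t': "t' \<in> C2" and v: "v \<in> carrier M1" "w \<in> carrier M2" for t t' v w
  using t'
 proof (induction t' rule: TL2_induct)
  case zero
  show ?case using t v by (simp add: zl z)
 next
  case (add t' a' b' c')
  have m1: "tl2_mult m N1 N2 t (single (a', b') c') *[T] otens v w = t *[T] (single (a', b') c' *[T] otens v w)"
   using t
  proof (induction t rule: TL2_induct)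
   case zero
   have "otens (single a' c' *[M1] v) (single b' 1 *[M2] w) \<in> carrier T"
    using add v by (intro T_facts M1.smult_closed M2.smult_closed single_closed)
   thus ?case using add v by (simp add: zl osmult_single M1.smult_closed M2.smult_closed single_closed)
  next
   case (add t a b c)
   note ab = \<open>a \<in> AD N1\<close> \<open>b \<in> AD N2\<close> \<open>a' \<in> AD N1\<close> \<open>b' \<in> AD N2\<close>
   let ?v = "single a' c' *[M1] v" and ?w = "single b' 1 *[M2] w"
   have vw: "?v \<in> carrier M1" "?w \<in> carrier M2" using ab v by (auto intro!: M1.smult_closed M2.smult_closed single_closed)
   let ?a = "comp_diagram N1 a a'" and ?b = "comp_diagram N2 b b'"
   let ?p = "loop_weight N1 m a a'" and ?q = "loop_weight N2 m b b'"
   have cl: "?a \<in> AD N1" "?b \<in> AD N2" using A.op_closed B.op_closed ab by auto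
   have "single a c *[M1] ?v = single ?a (?p * c * c') *[M1] v"
    using M1.smult_assoc[OF single_closed(1)[OF ab(1), of c] single_closed(1)[OF ab(3), of c'] v(1)] by simp
   moreover have "single b 1 *[M2] ?w = single ?b ?q *[M2] w"
    using M2.smult_assoc[OF single_closed(2)[OF ab(2), of 1] single_closed(2)[OF ab(4), of 1] v(2)] by simp
   \<comment> \<open>A coefficient acts on the first factor. The loop weight \<open>?q\<close>
     arising in the second factor is therefore split off as a scalar and moved across the tensor
     sign.\<close>
   ultimately have "single (a, b) c *[T] (single (a', b') c' *[T] otens v w) =
    otens (single ?a (?p * c * c') *[M1] v) (single id_diagram ?q *[M2] (single ?b 1 *[M2] w))"
    using ab v vw cl by (simp add: osmult_single smult_split(1)[of ?b w ?q])
   also have "\<dots> = otens (single ?a (?q * (?p * c * c')) *[M1] v) (single ?b 1 *[M2] w)"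
    using cl v by (simp add: smult_split(2)[of ?a v ?q] T_facts M1.smult_closed M2.smult_closed single_closed)
   also have "\<dots> = tl2_mult m N1 N2 (single (a, b) c) (single (a', b') c') *[T] otens v w"
    using cl v by (simp add: osmult_single mult_ac)
   finally have s: "tl2_mult m N1 N2 (single (a, b) c) (single (a', b') c') *[T] otens v w =
    single (a, b) c *[T] (single (a', b') c' *[T] otens v w)" by simp
   have s': "single (a', b') c' *[T] otens v w \<in> carrier T"
    using vw ab v by (simp add: osmult_single T_facts)
   have e: "conv w' op (x + y) z = conv w' op x z + conv w' op y z" for w' op and x y z :: tl2_elem by simp
   show ?case
    unfolding e
   proof (subst osmult_add)
    have "single (a', b') c' \<in> C2" by fact
    thus "tl2_mult m N1 N2 t (single (a', b') c') \<in> C2"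
     "tl2_mult m N1 N2 (single (a, b) c) (single (a', b') c') \<in> C2"
     using R.m_closed[of t] R.m_closed[of "single (a, b) c"] add.hyps by (simp_all del: conv_single)
    show "tl2_mult m N1 N2 t (single (a', b') c') *[T] otens v w +[T]
      tl2_mult m N1 N2 (single (a, b) c) (single (a', b') c') *[T] otens v w =
      (t + single (a, b) c) *[T] (single (a', b') c' *[T] otens v w)"
     unfolding s add.IH by (rule tadd[symmetric]) (use add.hyps s' in auto)
   qed (rule v)+
  qed
  have e: "conv w' op x (y + z) = conv w' op x y + conv w' op x z" for w' op and x y z :: tl2_elem by simp
  have tc: "t' *[T] otens v w \<in> carrier T" "single (a', b') c' *[T] otens v w \<in> carrier T"
   using add v sc T_facts by auto
  show ?case
   unfolding e
  proof (subst osmult_add)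
   show "tl2_mult m N1 N2 t t' \<in> C2"
    "tl2_mult m N1 N2 t (single (a', b') c') \<in> C2"
    using R.m_closed[OF t] add.hyps by simp_all
   show "tl2_mult m N1 N2 t t' *[T] otens v w +[T]
     tl2_mult m N1 N2 t (single (a', b') c') *[T] otens v w =
     t *[T] ((t' + single (a', b') c') *[T] otens v w)"
    unfolding m1 add.IH osmult_add[OF add.hyps(1,4) v] by (rule sa[symmetric, OF t tc])
  qed (rule v)+
 qed
 show ?thesis
  unfolding T_eq
 proof (rule O.left_module_T[OF R]; fold T_eq)
  fix t assume "t \<in> C2"
  thus "add_hom T T (module.smult T t)" by (rule osmult)
 next
  fix v w assume v: "v \<in> carrier M1" "w \<in> carrier M2"
  have "single (id_diagram, id_diagram) 1 *[T] otens v w =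
   otens (single id_diagram 1 *[M1] v) (single id_diagram 1 *[M2] w)"
   by (rule osmult_single[OF A.d1 B.d1 v])
  thus "\<one>\<^bsub>TL2 m N1 N2\<^esub> *[T] otens v w = otens v w"
   using M1.smult_one[OF v(1)] M2.smult_one[OF v(2)] by simp
 qed (use osmult_add mult in auto)
qed

lemma in1_smult:
 assumes x: "x \<in> CT N1" and v: "v \<in> carrier M1" "w \<in> carrier M2"
 shows "in1 x *[T] otens v w = otens (x *[M1] v) w"
proof -
 interpret L: left_module "TL2 m N1 N2" T by (rule left_module_outer)
 show ?thesis using x[unfolded carrier_TL mem_Collect_eq]
 proof (induction x rule: single_induct)
  case zero
  have "0 *[M1] v = \<zero>\<^bsub>M1\<^esub>" using left_module_zero[OF M1 v(1)] by simp
  thus ?case using left_module_zero[OF left_module_outer T_facts(2)[OF v]] O.tens_zero[OF v(2)] by (simp add: T_eq O.zero_T)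
 next
  case (add x a c)
  have x: "x \<in> CT N1" using add by (simp add: carrier_TL)
  have "single (a, id_diagram) c *[T] otens v w = otens (single a c *[M1] v) w"
   using osmult_single[OF add(2) B.d1 v] M2.smult_one[OF v(2)] by simp
  moreover have "single (a, id_diagram) c \<in> C2" using add B.d1 by (auto simp: carrier_TL2)
  ultimately show ?case using add x v in_closed(1)[OF x] single_closed(1)[of a c]
    M1.smult_l_distr[of x "single a c" v]
   by (simp add: osmult_add T_facts M1.smult_closed)
 qed
qed

lemma in2_smult:
 assumes y: "y \<in> CT N2" and v: "v \<in> carrier M1" "w \<in> carrier M2"
 shows "in2 y *[T] otens v w = otens v (y *[M2] w)"
proof -
 interpret L: left_module "TL2 m N1 N2" T by (rule left_module_outer)
 show ?thesis using y[unfolded carrier_TL mem_Collect_eq]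
 proof (induction y rule: single_induct)
  case zero
  have "otens v \<zero>\<^bsub>M2\<^esub> +[T] otens v \<zero>\<^bsub>M2\<^esub> = otens v \<zero>\<^bsub>M2\<^esub>" using T_facts(4)[of v "\<zero>\<^bsub>M2\<^esub>" "\<zero>\<^bsub>M2\<^esub>"] v by simp
  hence "otens v \<zero>\<^bsub>M2\<^esub> = \<zero>\<^bsub>T\<^esub>" using L.M.add.r_cancel_one[OF T_facts(2) T_facts(2)] v M2.M.zero_closed by blast
  moreover have "0 *[M2] w = \<zero>\<^bsub>M2\<^esub>" using left_module_zero[OF M2 v(2)] by simp
  ultimately show ?case using left_module_zero[OF left_module_outer T_facts(2)[OF v]] by simp
 next
  case (add y b c)
  have y: "y \<in> CT N2" using add by (simp add: carrier_TL)
  have "single (id_diagram, b) c *[T] otens v w = otens v (single b c *[M2] w)"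
   using osmult_single[OF A.d1 add(2) v] add(2) v
   by (simp add: smult_split(1)[of b w c] T_facts M2.smult_closed single_closed)
  moreover have "single (id_diagram, b) c \<in> C2" using add A.d1 by (auto simp: carrier_TL2)
  ultimately show ?case using add y v in_closed(2)[OF y] single_closed(2)[of b c]
    M2.smult_l_distr[of y "single b c" w]
   by (simp add: osmult_add T_facts M2.smult_closed)
 qed
qed

lemma outer_lift:
 assumes "abelian_group W" "biadditive M1 M2 W h"
  "!!v c w. v \<in> carrier M1 ==> w \<in> carrier M2 ==> h (single id_diagram c *[M1] v) w = h v (single id_diagram c *[M2] w)"
 shows "\<exists>H. add_hom T W H \<and> (\<forall>v\<in>carrier M1. \<forall>w\<in>carrier M2. H (otens v w) = h v w)"
 unfolding T_eq by (rule O.lift[OF assms(1,2)]) (use assms(3) in \<open>simp add: scale_eq\<close>)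

end

section \<open>Universal properties of fusion and globalization\<close>

definition lin :: "(complex, 'a) module => ('a, 'v) module => ('a, 'w) module => ('v => 'w) => bool" where
 "lin A V W F \<longleftrightarrow> add_hom V W F \<and> (\<forall>a\<in>carrier A. \<forall>v\<in>carrier V. F (a *[V] v) = a *[W] F v)"

text \<open>Generation is phrased as an induction principle: \<open>U\<close> is closed under
  addition and contains all multiples of \<open>S\<close>, without being a submodule. This form is
  both easy to use and easy to verify from the induction rules of tensor products.\<close>

definition generates :: "(complex, 'a) module => ('a, 'v) module => 'v set => bool" where
 "generates A V S \<longleftrightarrow> S \<subseteq> carrier V \<and> (\<forall>U. \<zero>\<^bsub>V\<^esub> \<in> U \<and> (\<forall>x\<in>U \<inter> carrier V. \<forall>y\<in>U \<inter> carrier V. x +[V] y \<in> U) \<and>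
  (\<forall>a\<in>carrier A. \<forall>s\<in>S. a *[V] s \<in> U) --> carrier V \<subseteq> U)"

lemma generates_induct [consumes 2, case_names zero add act]:
 assumes "generates A V S" "x \<in> carrier V" "P \<zero>\<^bsub>V\<^esub>"
  "!!x y. x \<in> carrier V ==> y \<in> carrier V ==> P x ==> P y ==> P (x +[V] y)"
  "!!a s. a \<in> carrier A ==> s \<in> S ==> P (a *[V] s)"
 shows "P x"
proof -
 have "carrier V \<subseteq> {x. P x}"
  using assms(1)[unfolded generates_def, THEN conjunct2, rule_format, of "{x. P x}"] assms(3-5) by blast
 thus ?thesis using assms(2) by blast
qed

lemma linD:
 assumes "lin A V W F" "v \<in> carrier V"
 shows "F v \<in> carrier W" "w \<in> carrier V ==> F (v +[V] w) = F v +[W] F w"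
  "a \<in> carrier A ==> F (a *[V] v) = a *[W] F v"
 using assms by (auto simp: lin_def add_hom_def)

lemma smult_zero:
 assumes "left_module A V" "a \<in> carrier A" shows "a *[V] \<zero>\<^bsub>V\<^esub> = \<zero>\<^bsub>V\<^esub>"
proof -
 interpret left_module A V by fact
 show ?thesis
  by (rule add_hom_zero[of V V]) (use assms(2) in \<open>auto simp: add_hom_def smult_closed smult_r_distr M.abelian_group_axioms\<close>)
qed

context induced begin

lemma induced_lin:
 assumes W: "left_module A W" and h: "biadditive (A\<lparr>carrier := X\<rparr>) V W h"
  "!!x b v. x \<in> X ==> b \<in> carrier B ==> v \<in> carrier V ==> h (x **[A] f b) v = h x (b *[V] v)"
  "!!a x v. a \<in> carrier A ==> x \<in> X ==> v \<in> carrier V ==> h (a **[A] x) v = a *[W] h x v"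
 shows "\<exists>H. lin A T W H \<and> (\<forall>x\<in>X. \<forall>v\<in>carrier V. H (tens x v) = h x v)"
proof -
 interpret W: left_module A W by (rule W)
 obtain H where H: "add_hom T W H" "!!x v. x \<in> X ==> v \<in> carrier V ==> H (tens x v) = h x v"
  using induced_lift[OF W.M.abelian_group_axioms h(1,2)] by blast
 have "H (a *[T] t) = a *[W] H t" if a: "a \<in> carrier A" and t: "t \<in> carrier T" for a t
  using t
 proof (induction rule: induced_induct)
  case zero
  show ?case using add_hom_zero[OF T_facts(1) W.M.abelian_group_axioms H(1)]
   by (simp add: smult_zero[OF left_module_induced a] smult_zero[OF W a])
 next
  case (tens x v)
  thus ?case using a by (simp add: smult_tens(2) H(2) AX h(3) del: mem_Collect_eq)
 next
  case (add x y)
  note s = add_homD[OF smult_tens(1)[OF a]]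
  have "H (a *[T] (x +[T] y)) = H (a *[T] x) +[W] H (a *[T] y)"
   unfolding s(2)[OF add(1,2)] by (rule add_homD(2)[OF H(1) s(1)[OF add(1)] s(1)[OF add(2)]])
  thus ?case
   unfolding add_homD(2)[OF H(1) add(1,2)] using add a add_homD(1)[OF H(1)] by (simp add: W.smult_r_distr)
 qed
 thus ?thesis using H by (intro exI[of _ H]) (simp add: lin_def)
qed

end

lemma lin_zero: "left_module A V ==> left_module B W ==> lin C V W F ==> F \<zero>\<^bsub>V\<^esub> = \<zero>\<^bsub>W\<^esub>"
 by (rule add_hom_zero) (auto simp: lin_def left_module_def)

lemma lin_unique:
 assumes "left_module A V" "left_module A W" "lin A V W F" "lin A V W G" "generates A V S"
  "!!s. s \<in> S ==> F s = G s" "x \<in> carrier V"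
 shows "F x = G x"
proof -
 have S: "S \<subseteq> carrier V" using assms(5) by (simp add: generates_def)
 from assms(5,7) show ?thesis
  by (induction rule: generates_induct)
   (use S assms(6) in \<open>auto simp: lin_zero[OF assms(1-3)] lin_zero[OF assms(1,2,4)] linD[OF assms(3)] linD[OF assms(4)] subsetD\<close>)
qed

lemma lin_comp: "lin A U V F ==> lin A V W G ==> lin A U W (\<lambda>x. G (F x))"
 by (auto simp: lin_def add_hom_def)

lemma lin_id: "lin A V V (\<lambda>x. x)"
 by (auto simp: lin_def add_hom_def)

lemma module_iso_lin: "module_iso A V W \<longleftrightarrow> (\<exists>F. bij_betw F (carrier V) (carrier W) \<and> lin A V W F)"
 unfolding module_iso_def lin_def add_hom_def by (rule iff_exI) (auto dest: bij_betwE)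

lemma lin_inv:
 assumes V: "left_module A V" and F: "bij_betw F (carrier V) (carrier W)" "lin A V W F"
 shows "lin A W V (inv_into (carrier V) F)"
proof -
 interpret left_module A V by (rule V)
 let ?G = "inv_into (carrier V) F"
 have G: "?G w \<in> carrier V" "F (?G w) = w" if "w \<in> carrier W" for w
  using bij_betw_apply[OF bij_betw_inv_into[OF F(1)] that] bij_betw_inv_into_right[OF F(1) that] by auto
 have inj: "?G (F v) = v" if "v \<in> carrier V" for v using bij_betw_inv_into_left[OF F(1) that] .
 have "?G (x +[W] y) = ?G x +[V] ?G y" if "x \<in> carrier W" "y \<in> carrier W" for x y
  using inj[of "?G x +[V] ?G y"] linD(2)[OF F(2), of "?G x" "?G y"] G that by simp
 moreover have "?G (a *[W] x) = a *[V] ?G x" if "a \<in> carrier A" "x \<in> carrier W" for a x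
  using inj[of "a *[V] ?G x"] linD(3)[OF F(2), of "?G x" a] G that by (simp add: smult_closed)
 ultimately show ?thesis using G by (auto simp: lin_def add_hom_def)
qed

lemma module_iso_refl: "module_iso A V V"
 unfolding module_iso_lin using lin_id[of A V] bij_betw_id[of "carrier V"] by (auto simp: id_def)

lemma module_iso_sym: "left_module A V ==> module_iso A V W ==> module_iso A W V"
 unfolding module_iso_lin using lin_inv bij_betw_inv_into by blast

lemma module_iso_trans: "module_iso A U V ==> module_iso A V W ==> module_iso A U W"
 unfolding module_iso_lin using lin_comp bij_betw_trans[unfolded comp_def] by blast

lemma module_iso_generators:
 assumes V: "left_module A V" and W: "left_module A W" and F: "lin A V W F" and G: "lin A W V G"
  and S: "generates A V S" "!!s. s \<in> S ==> G (F s) = s" and S': "generates A W S'" "!!s. s \<in> S' ==> F (G s) = s"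
 shows "module_iso A V W"
proof -
 have "G (F x) = x" if "x \<in> carrier V" for x by (rule lin_unique[OF V V lin_comp[OF F G] lin_id S that])
 moreover have "F (G x) = x" if "x \<in> carrier W" for x by (rule lin_unique[OF W W lin_comp[OF G F] lin_id S' that])
 ultimately have "bij_betw F (carrier V) (carrier W)"
  by (intro bij_betw_byWitness[where f' = G]) (auto simp: linD[OF F] linD[OF G])
 thus ?thesis using F unfolding module_iso_lin by blast
qed

section \<open>Universal properties of fusion and globalization, stated for abstract
  algebras\<close>

definition nhom :: "(complex, 'a) module => (complex, 'b) module => ('a => 'b) => bool" where
 "nhom R A f \<longleftrightarrow> (\<forall>x\<in>carrier R. f x \<in> carrier A \<and> (\<forall>y\<in>carrier R. f (x +[R] y) = f x +[A] f y \<and> f (x **[R] y) = f x **[A] f y))"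

lemma nhomD:
 assumes "nhom R A f" "x \<in> carrier R"
 shows "f x \<in> carrier A" "y \<in> carrier R ==> f (x +[R] y) = f x +[A] f y" "y \<in> carrier R ==> f (x **[R] y) = f x **[A] f y"
 using assms by (auto simp: nhom_def)

text \<open>Restriction of scalars along a homomorphism that need not preserve the unit: only the image of the
 idempotent \<open>f 1\<close> is kept.\<close>

definition pullback :: "(complex, 'a) module => ('a => 'a) => ('a, 'w) module => ('a, 'w) module" where
 "pullback R f W = W\<lparr>carrier := {w \<in> carrier W. f \<one>\<^bsub>R\<^esub> *[W] w = w}, module.smult := \<lambda>r. module.smult W (f r)\<rparr>"

lemma pullback_simps [simp]:
 "w \<in> carrier (pullback R f W) \<longleftrightarrow> w \<in> carrier W \<and> f \<one>\<^bsub>R\<^esub> *[W] w = w"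
 "r *[pullback R f W] w = f r *[W] w" "v +[pullback R f W] w = v +[W] w" "\<zero>\<^bsub>pullback R f W\<^esub> = \<zero>\<^bsub>W\<^esub>"
 by (auto simp: pullback_def)

lemma left_module_pullback:
 assumes R: "ring R" and W: "left_module A W" and f: "nhom R A f"
 shows "left_module R (pullback R f W)"
proof -
 interpret R: ring R by fact
 interpret W: left_module A W by fact
 note f1 = nhomD(1)[OF f R.one_closed]
 have ff: "f x *[W] (f y *[W] w) = f (x **[R] y) *[W] w" if "x \<in> carrier R" "y \<in> carrier R" "w \<in> carrier W" for x y w
  using that by (simp add: nhomD[OF f] W.smult_assoc)
 show ?thesis
 proof (intro left_module.intro R left_module_axioms.intro abelian_groupI)
  fix w assume w: "w \<in> carrier (pullback R f W)"
  have "f \<one>\<^bsub>R\<^esub> *[W] (\<ominus>\<^bsub>W\<^esub> w) +[W] w = f \<one>\<^bsub>R\<^esub> *[W] (\<ominus>\<^bsub>W\<^esub> w +[W] w)"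
   using W.smult_r_distr[OF f1, of "\<ominus>\<^bsub>W\<^esub> w" w] w by simp
  also have "\<dots> = \<zero>\<^bsub>W\<^esub>" using w by (simp add: W.M.l_neg smult_zero[OF W f1])
  finally have "f \<one>\<^bsub>R\<^esub> *[W] (\<ominus>\<^bsub>W\<^esub> w) = \<ominus>\<^bsub>W\<^esub> w" using w by (intro W.M.minus_equality[symmetric]) (auto simp: f1 W.smult_closed)
  thus "\<exists>v\<in>carrier (pullback R f W). v +[pullback R f W] w = \<zero>\<^bsub>pullback R f W\<^esub>"
   using w by (intro bexI[of _ "\<ominus>\<^bsub>W\<^esub> w"]) (auto simp: W.M.l_neg)
 qed (auto simp: f1 W.smult_closed W.smult_l_distr W.smult_r_distr nhomD(1,2)[OF f] ff W.M.a_ac smult_zero[OF W f1])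
qed

text \<open>Reduces generation by the whole image of \<open>F\<close> to generation by the image of
  a generating set of \<open>F\<close>; the scalars of \<open>A\<close> are absorbed into those of
  \<open>B\<close> through \<open>p\<close>.\<close>

lemma span_image:
 assumes F: "left_module A F" "generates A F S" and G: "left_module B G" and p: "nhom A B p" and \<gamma>: "add_hom F G \<gamma>"
  "!!r x. r \<in> carrier A ==> x \<in> carrier F ==> \<gamma> (r *[F] x) = p r *[G] \<gamma> x"
  and U: "\<zero>\<^bsub>G\<^esub> \<in> U \<and> (\<forall>x\<in>U \<inter> carrier G. \<forall>y\<in>U \<inter> carrier G. x +[G] y \<in> U)"
   "!!a s. a \<in> carrier B ==> s \<in> S ==> a *[G] \<gamma> s \<in> U"
  and x: "x \<in> carrier F" "t \<in> carrier B"
 shows "t *[G] \<gamma> x \<in> U"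
proof -
 interpret F: left_module A F by (rule F)
 interpret G: left_module B G by (rule G)
 note \<gamma>D = add_homD[OF \<gamma>(1)]
 have "\<forall>t\<in>carrier B. t *[G] \<gamma> x \<in> U"
  using F(2) x(1)
 proof (induction rule: generates_induct)
  case zero
  have "\<gamma> \<zero>\<^bsub>F\<^esub> = \<zero>\<^bsub>G\<^esub>" by (rule add_hom_zero[OF F.M.abelian_group_axioms G.M.abelian_group_axioms \<gamma>(1)])
  thus ?case using U by (simp add: smult_zero[OF G])
 next
  case (add x y)
  thus ?case using U(1) by (simp add: \<gamma>D G.smult_r_distr G.smult_closed)
 next
  case (act r s)
  hence s: "s \<in> carrier F" using F(2) by (auto simp: generates_def)
  have "t *[G] \<gamma> (r *[F] s) = (t **[B] p r) *[G] \<gamma> s" if "t \<in> carrier B" for t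
   using act s that nhomD(1)[OF p] by (simp add: \<gamma>(2) \<gamma>D G.smult_assoc)
  thus ?case using U(2) act nhomD(1)[OF p] by simp
 qed
 thus ?thesis using x(2) by blast
qed

text \<open>The maps that a fusion classifies: biadditive and compatible with each of the two
  embedded algebras separately, so that the tensor product algebra disappears from the later
  arguments. The property of being a fusion is split into \<open>fus_mod\<close>, which concerns
  \<open>T\<close> alone, and \<open>fus_lift\<close>, which concerns one target \<open>W\<close> of
  a given type.\<close>

definition fus_map where
 "fus_map R1 f1 M1 R2 f2 M2 W \<beta> \<longleftrightarrow> biadditive M1 M2 W \<beta> \<and>
  (\<forall>a\<in>carrier M1. \<forall>b\<in>carrier M2. (\<forall>r\<in>carrier R1. f1 r *[W] \<beta> a b = \<beta> (r *[M1] a) b) \<and>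
    (\<forall>r\<in>carrier R2. f2 r *[W] \<beta> a b = \<beta> a (r *[M2] b)))"

definition fus_mod where
 "fus_mod A R1 f1 M1 R2 f2 M2 T \<beta> \<longleftrightarrow> left_module A T \<and> fus_map R1 f1 M1 R2 f2 M2 T \<beta> \<and>
  generates A T {\<beta> a b | a b. a \<in> carrier M1 \<and> b \<in> carrier M2}"

definition fus_lift where
 "fus_lift A R1 f1 M1 R2 f2 M2 T \<beta> W \<longleftrightarrow>
  (\<forall>h. fus_map R1 f1 M1 R2 f2 M2 W h --> (\<exists>F. lin A T W F \<and> (\<forall>a\<in>carrier M1. \<forall>b\<in>carrier M2. F (\<beta> a b) = h a b)))"

definition glob_mod where
 "glob_mod A R \<phi> V G \<gamma> \<longleftrightarrow> left_module A G \<and> lin R V (pullback R \<phi> G) \<gamma> \<and> generates A G (\<gamma> ` carrier V)"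

definition glob_lift where
 "glob_lift A R \<phi> V G \<gamma> W \<longleftrightarrow>
  (\<forall>h. lin R V (pullback R \<phi> W) h --> (\<exists>F. lin A G W F \<and> (\<forall>v\<in>carrier V. F (\<gamma> v) = h v)))"

lemma fus_mapD:
 assumes "fus_map R1 f1 M1 R2 f2 M2 W \<beta>" "a \<in> carrier M1" "b \<in> carrier M2"
 shows "\<beta> a b \<in> carrier W" "a' \<in> carrier M1 ==> \<beta> (a +[M1] a') b = \<beta> a b +[W] \<beta> a' b"
  "b' \<in> carrier M2 ==> \<beta> a (b +[M2] b') = \<beta> a b +[W] \<beta> a b'"
  "r \<in> carrier R1 ==> f1 r *[W] \<beta> a b = \<beta> (r *[M1] a) b" "r' \<in> carrier R2 ==> f2 r' *[W] \<beta> a b = \<beta> a (r' *[M2] b)"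
 using assms by (auto simp: fus_map_def biadditive_def)

lemma fus_map_swap: "fus_map R1 f1 M1 R2 f2 M2 W \<beta> \<longleftrightarrow> fus_map R2 f2 M2 R1 f1 M1 W (\<lambda>b a. \<beta> a b)"
 by (auto simp: fus_map_def biadditive_def)

lemma fus_mod_swap: "fus_mod A R1 f1 M1 R2 f2 M2 T \<beta> ==> fus_mod A R2 f2 M2 R1 f1 M1 T (\<lambda>b a. \<beta> a b)"
proof -
 have "{\<beta> a b | a b. a \<in> carrier M1 \<and> b \<in> carrier M2} = {\<beta> a b | b a. b \<in> carrier M2 \<and> a \<in> carrier M1}" by blast
 thus "fus_mod A R1 f1 M1 R2 f2 M2 T \<beta> ==> ?thesis"
  using fus_map_swap[of R1 f1 M1 R2 f2 M2 T \<beta>] by (simp add: fus_mod_def)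
qed

lemma fus_lift_swap: "fus_lift A R1 f1 M1 R2 f2 M2 T \<beta> W ==> fus_lift A R2 f2 M2 R1 f1 M1 T (\<lambda>b a. \<beta> a b) W"
 unfolding fus_lift_def
proof (intro allI impI)
 fix h assume l: "\<forall>h. fus_map R1 f1 M1 R2 f2 M2 W h --> (\<exists>F. lin A T W F \<and> (\<forall>a\<in>carrier M1. \<forall>b\<in>carrier M2. F (\<beta> a b) = h a b))"
  and h: "fus_map R2 f2 M2 R1 f1 M1 W h"
 have "fus_map R1 f1 M1 R2 f2 M2 W (\<lambda>a b. h b a)" using h by (subst fus_map_swap)
 thus "\<exists>F. lin A T W F \<and> (\<forall>b\<in>carrier M2. \<forall>a\<in>carrier M1. F (\<beta> a b) = h b a)" using l by blast
qed

lemma fus_cong: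
 assumes M: "left_module R1 M1" "left_module R2 M2" "module_iso R1 M1 M1'" "module_iso R2 M2 M2'"
  and T: "fus_mod A R1 f1 M1 R2 f2 M2 T \<beta>" "fus_lift A R1 f1 M1 R2 f2 M2 T \<beta> T'"
  and T': "fus_mod A R1 f1 M1' R2 f2 M2' T' \<beta>'" "fus_lift A R1 f1 M1' R2 f2 M2' T' \<beta>' T"
 shows "module_iso A T T'"
proof -
 obtain p1 where p1: "bij_betw p1 (carrier M1) (carrier M1')" "lin R1 M1 M1' p1" using M(3) unfolding module_iso_lin by blast
 obtain p2 where p2: "bij_betw p2 (carrier M2) (carrier M2')" "lin R2 M2 M2' p2" using M(4) unfolding module_iso_lin by blast
 define i1 i2 where "i1 = inv_into (carrier M1) p1" and "i2 = inv_into (carrier M2) p2"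
 have i: "lin R1 M1' M1 i1" "lin R2 M2' M2 i2" using lin_inv[OF M(1) p1] lin_inv[OF M(2) p2] by (simp_all add: i1_def i2_def)
 have inv: "a \<in> carrier M1 ==> i1 (p1 a) = a" "b \<in> carrier M2 ==> i2 (p2 b) = b"
  "a' \<in> carrier M1' ==> p1 (i1 a') = a'" "b' \<in> carrier M2' ==> p2 (i2 b') = b'" for a b a' b'
  using bij_betw_inv_into_left[OF p1(1)] bij_betw_inv_into_left[OF p2(1)] bij_betw_inv_into_right[OF p1(1)] bij_betw_inv_into_right[OF p2(1)]
  by (simp_all add: i1_def i2_def)
 have m: "fus_map R1 f1 M1 R2 f2 M2 T \<beta>" "fus_map R1 f1 M1' R2 f2 M2' T' \<beta>'" using T(1) T'(1) by (simp_all add: fus_mod_def)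
 have "fus_map R1 f1 M1 R2 f2 M2 T' (\<lambda>a b. \<beta>' (p1 a) (p2 b))"
  unfolding fus_map_def biadditive_def by (simp add: fus_mapD[OF m(2)] linD[OF p1(2)] linD[OF p2(2)])
 then obtain F where F: "lin A T T' F" "!!a b. a \<in> carrier M1 ==> b \<in> carrier M2 ==> F (\<beta> a b) = \<beta>' (p1 a) (p2 b)"
  using T(2) unfolding fus_lift_def by blast
 have "fus_map R1 f1 M1' R2 f2 M2' T (\<lambda>a b. \<beta> (i1 a) (i2 b))"
  unfolding fus_map_def biadditive_def by (simp add: fus_mapD[OF m(1)] linD[OF i(1)] linD[OF i(2)])
 then obtain G where G: "lin A T' T G" "!!a b. a \<in> carrier M1' ==> b \<in> carrier M2' ==> G (\<beta>' a b) = \<beta> (i1 a) (i2 b)"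
  using T'(2) unfolding fus_lift_def by blast
 show ?thesis
  by (rule module_iso_generators[OF _ _ F(1) G(1)])
   (use T(1) T'(1) in \<open>auto simp: fus_mod_def F(2) G(2) linD[OF i(1)] linD[OF i(2)] linD[OF p1(2)] linD[OF p2(2)] inv\<close>)
qed

lemma glob_cong:
 assumes M: "left_module R M" "module_iso R M M'"
  and G: "glob_mod A R \<phi> M G \<gamma>" "glob_lift A R \<phi> M G \<gamma> G'"
  and G': "glob_mod A R \<phi> M' G' \<gamma>'" "glob_lift A R \<phi> M' G' \<gamma>' G"
 shows "module_iso A G G'"
proof -
 obtain p where p: "bij_betw p (carrier M) (carrier M')" "lin R M M' p" using M(2) unfolding module_iso_lin by blast
 define i where "i = inv_into (carrier M) p"
 have i: "lin R M' M i" using lin_inv[OF M(1) p] by (simp add: i_def)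
 have inv: "a \<in> carrier M ==> i (p a) = a" "a' \<in> carrier M' ==> p (i a') = a'" for a a'
  using bij_betw_inv_into_left[OF p(1)] bij_betw_inv_into_right[OF p(1)] by (simp_all add: i_def)
 have m: "lin R M (pullback R \<phi> G) \<gamma>" "lin R M' (pullback R \<phi> G') \<gamma>'" using G(1) G'(1) by (simp_all add: glob_mod_def)
 obtain F where F: "lin A G G' F" "!!a. a \<in> carrier M ==> F (\<gamma> a) = \<gamma>' (p a)"
  using G(2) lin_comp[OF p(2) m(2)] unfolding glob_lift_def by blast
 obtain H where H: "lin A G' G H" "!!a. a \<in> carrier M' ==> H (\<gamma>' a) = \<gamma> (i a)"
  using G'(2) lin_comp[OF i m(1)] unfolding glob_lift_def by blast
 show ?thesis
  by (rule module_iso_generators[OF _ _ F(1) H(1)])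
   (use G(1) G'(1) in \<open>auto simp: glob_mod_def F(2) H(2) linD[OF i] linD[OF p(2)] inv\<close>)
qed

text \<open>A module is recovered from its globalization as the image of the corner idempotent.\<close>

lemma glob_reflect:
 assumes A: "ring A" and R: "ring R" and \<phi>: "nhom R A \<phi>"
  and corner: "!!x. x \<in> carrier A ==> \<phi> \<one>\<^bsub>R\<^esub> **[A] x **[A] \<phi> \<one>\<^bsub>R\<^esub> \<in> \<phi> ` carrier R"
  and M: "left_module R M" "left_module R M'"
  and G: "glob_mod A R \<phi> M G \<gamma>" "inj_on \<gamma> (carrier M)" and G': "glob_mod A R \<phi> M' G' \<gamma>'" "inj_on \<gamma>' (carrier M')"
  and iso: "module_iso A G G'"
 shows "module_iso R M M'"
proof -
 interpret R: ring R by fact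
 have c: "\<phi> \<one>\<^bsub>R\<^esub> \<in> carrier A" using nhomD(1)[OF \<phi>] by simp
 have bij: "bij_betw \<gamma> (carrier M) (carrier (pullback R \<phi> G))" and l: "lin R M (pullback R \<phi> G) \<gamma>"
  if M: "left_module R M" and G: "glob_mod A R \<phi> M G \<gamma>" "inj_on \<gamma> (carrier M)" for M :: "('a, 'z) module" and G :: "('a, 'y) module" and \<gamma>
 proof -
  interpret M: left_module R M by (rule M)
  have Gm: "left_module A G" and gen: "generates A G (\<gamma> ` carrier M)" using G by (simp_all add: glob_mod_def)
  interpret Gm: left_module A G by (rule Gm)
  show l: "lin R M (pullback R \<phi> G) \<gamma>" using G by (simp add: glob_mod_def)
  \<comment> \<open>The idempotent sends \<open>G\<close> into the copy of \<open>M\<close>: on a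
    multiple of a generator, the element between the two idempotents lies in the corner, hence comes
    from \<open>R\<close>.\<close>
  have "\<phi> \<one>\<^bsub>R\<^esub> *[G] x \<in> \<gamma> ` carrier M" if "x \<in> carrier G" for x
   using gen that
  proof (induction rule: generates_induct)
   case zero
   have "\<gamma> \<zero>\<^bsub>M\<^esub> = \<zero>\<^bsub>G\<^esub>" using lin_zero[OF M left_module_pullback[OF R Gm \<phi>] l] by simp
   thus ?case using smult_zero[OF Gm c] M.M.zero_closed by (metis imageI)
  next
   case (add x y)
   then obtain v w where "v \<in> carrier M" "w \<in> carrier M" "\<phi> \<one>\<^bsub>R\<^esub> *[G] x = \<gamma> v" "\<phi> \<one>\<^bsub>R\<^esub> *[G] y = \<gamma> w" by blast
   thus ?case using add linD(2)[OF l, of v w] c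
    by (auto simp: Gm.smult_r_distr intro!: image_eqI[of _ _ "v +[M] w"])
  next
   case (act a s)
   then obtain v where v: "v \<in> carrier M" "s = \<gamma> v" by blast
   obtain r where r: "r \<in> carrier R" "\<phi> \<one>\<^bsub>R\<^esub> **[A] a **[A] \<phi> \<one>\<^bsub>R\<^esub> = \<phi> r" using corner[OF act(1)] by blast
   have g: "\<gamma> v \<in> carrier G" "\<phi> \<one>\<^bsub>R\<^esub> *[G] \<gamma> v = \<gamma> v" using linD(1)[OF l v(1)] by auto
   have "\<phi> \<one>\<^bsub>R\<^esub> *[G] (a *[G] s) = \<phi> r *[G] \<gamma> v"
    using g c act(1) by (simp add: v(2) r(2)[symmetric] Gm.smult_assoc)
   also have "\<dots> = \<gamma> (r *[M] v)" using linD(3)[OF l v(1) r(1)] by simp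
   finally show ?case using v r by (auto simp: M.smult_closed)
  qed
  hence "carrier (pullback R \<phi> G) \<subseteq> \<gamma> ` carrier M" by (auto simp: subset_iff) metis
  thus "bij_betw \<gamma> (carrier M) (carrier (pullback R \<phi> G))" using G(2) linD(1)[OF l] unfolding bij_betw_def by blast
 qed
 have 1: "module_iso R M (pullback R \<phi> G)" using bij[OF M(1) G] l[OF M(1) G] unfolding module_iso_lin by blast
 have 2: "module_iso R M' (pullback R \<phi> G')" using bij[OF M(2) G'] l[OF M(2) G'] unfolding module_iso_lin by blast
 obtain F where F: "bij_betw F (carrier G) (carrier G')" "lin A G G' F" using iso unfolding module_iso_lin by blast
 have Gm: "left_module A G" using G by (simp add: glob_mod_def)
 interpret Gm: left_module A G by (rule Gm)
 have lF: "lin R (pullback R \<phi> G) (pullback R \<phi> G') F"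
  unfolding lin_def add_hom_def by (auto simp: linD[OF F(2)] nhomD[OF \<phi>]) (metis linD(3)[OF F(2)] c)
 have "w \<in> F ` carrier (pullback R \<phi> G)" if w: "w \<in> carrier (pullback R \<phi> G')" for w
 proof -
  obtain v where v: "v \<in> carrier G" "w = F v" using F(1) w by (auto simp: bij_betw_def)
  have "F (\<phi> \<one>\<^bsub>R\<^esub> *[G] v) = F v" using linD(3)[OF F(2) v(1) c] v w by simp
  hence "\<phi> \<one>\<^bsub>R\<^esub> *[G] v = v" using F(1) v c by (auto simp: bij_betw_def inj_on_def Gm.smult_closed)
  thus ?thesis using v by auto
 qed
 hence "bij_betw F (carrier (pullback R \<phi> G)) (carrier (pullback R \<phi> G'))"
  using F(1) linD(1)[OF lF] unfolding bij_betw_def by (auto simp: inj_on_def)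
 hence "module_iso R (pullback R \<phi> G) (pullback R \<phi> G')" using lF unfolding module_iso_lin by blast
 from module_iso_trans[OF 1 module_iso_trans[OF this module_iso_sym[OF M(2) 2]]] show ?thesis .
qed

section \<open>Fusion commutes with globalization\<close>

text \<open>The elements \<open>X\<close> and \<open>Y\<close> are mutually inverse equivalences between the idempotents \<open>\<phi> 1\<close> and \<open>f1' (\<phi>1 1)\<close>,
 and \<open>X\<close> intertwines the two ways of mapping the small algebras into the big one.\<close>

locale fusion_glob =
 fixes A A' R1 R1' R2 :: "(complex, 'a) module" and f1 f2 f1' f2' \<phi>1 \<phi> :: "'a => 'a" and X Y :: 'a
  and M1 :: "('a, 'v) module" and M2 :: "('a, 'w) module" and G1 :: "('a, 'g) module" and \<gamma>1
  and F :: "('a, 'f) module" and \<beta> and T :: "('a, 't) module" and \<beta>' and G :: "('a, 'h) module" and \<gamma>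
 assumes rings: "ring A" "ring A'" "ring R1" "ring R1'" "ring R2"
  and homs: "nhom R1 A f1" "nhom R2 A f2" "nhom R1' A' f1'" "nhom R2 A' f2'" "nhom R1 R1' \<phi>1" "nhom A A' \<phi>"
  and f1'_one: "f1' \<one>\<^bsub>R1'\<^esub> = \<one>\<^bsub>A'\<^esub>"
  and comm: "!!x y. x \<in> carrier R1' ==> y \<in> carrier R2 ==> f1' x **[A'] f2' y = f2' y **[A'] f1' x"
  and XY: "X \<in> carrier A'" "Y \<in> carrier A'" "X **[A'] Y = f1' (\<phi>1 \<one>\<^bsub>R1\<^esub>)" "Y **[A'] X = \<phi> \<one>\<^bsub>A\<^esub>"
   "f1' (\<phi>1 \<one>\<^bsub>R1\<^esub>) **[A'] X = X" "\<phi> \<one>\<^bsub>A\<^esub> **[A'] Y = Y"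
  and X1: "!!r. r \<in> carrier R1 ==> f1' (\<phi>1 r) **[A'] X = X **[A'] \<phi> (f1 r)"
  and X2: "!!r. r \<in> carrier R2 ==> f2' r **[A'] X = X **[A'] \<phi> (f2 r)"
  and M: "left_module R1 M1" "left_module R2 M2"
  and G1: "glob_mod R1' R1 \<phi>1 M1 G1 \<gamma>1" "glob_lift R1' R1 \<phi>1 M1 G1 \<gamma>1 (pullback R1' f1' G)"
  and F: "fus_mod A R1 f1 M1 R2 f2 M2 F \<beta>" "fus_lift A R1 f1 M1 R2 f2 M2 F \<beta> (pullback A \<phi> T)"
  and T: "fus_mod A' R1' f1' G1 R2 f2' M2 T \<beta>'" "fus_lift A' R1' f1' G1 R2 f2' M2 T \<beta>' G"
  and G: "glob_mod A' A \<phi> F G \<gamma>" "glob_lift A' A \<phi> F G \<gamma> T"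
begin

interpretation A: ring A by (rule rings)
interpretation A': ring A' by (rule rings)
interpretation R1: ring R1 by (rule rings)
interpretation R1': ring R1' by (rule rings)
interpretation R2: ring R2 by (rule rings)
interpretation M1: left_module R1 M1 by (rule M)
interpretation M2: left_module R2 M2 by (rule M)

lemma parts: "left_module R1' G1" "left_module A F" "left_module A' T" "left_module A' G"
 "lin R1 M1 (pullback R1 \<phi>1 G1) \<gamma>1" "lin A F (pullback A \<phi> G) \<gamma>"
 "fus_map R1 f1 M1 R2 f2 M2 F \<beta>" "fus_map R1' f1' G1 R2 f2' M2 T \<beta>'"
 "generates R1' G1 (\<gamma>1 ` carrier M1)" "generates A' G (\<gamma> ` carrier F)"
 "generates A F {\<beta> a b | a b. a \<in> carrier M1 \<and> b \<in> carrier M2}"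
 "generates A' T {\<beta>' a b | a b. a \<in> carrier G1 \<and> b \<in> carrier M2}"
 using G1 F T G by (simp_all add: glob_mod_def fus_mod_def)

interpretation G1: left_module R1' G1 by (rule parts)
interpretation F: left_module A F by (rule parts)
interpretation T: left_module A' T by (rule parts)
interpretation G: left_module A' G by (rule parts)

lemmas hom_closed = nhomD(1)[OF homs(1)] nhomD(1)[OF homs(2)] nhomD(1)[OF homs(3)] nhomD(1)[OF homs(4)] nhomD(1)[OF homs(5)] nhomD(1)[OF homs(6)]

lemma \<gamma>1: "a \<in> carrier M1 ==> \<gamma>1 a \<in> carrier G1" "a \<in> carrier M1 ==> a' \<in> carrier M1 ==> \<gamma>1 (a +[M1] a') = \<gamma>1 a +[G1] \<gamma>1 a'"
 "a \<in> carrier M1 ==> r \<in> carrier R1 ==> \<phi>1 r *[G1] \<gamma>1 a = \<gamma>1 (r *[M1] a)"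
 using linD[OF parts(5), of a] by auto

lemma \<gamma>: "x \<in> carrier F ==> \<gamma> x \<in> carrier G" "x \<in> carrier F ==> y \<in> carrier F ==> \<gamma> (x +[F] y) = \<gamma> x +[G] \<gamma> y"
 "x \<in> carrier F ==> r \<in> carrier A ==> \<phi> r *[G] \<gamma> x = \<gamma> (r *[F] x)"
 using linD[OF parts(6), of x] by auto

lemmas \<beta> = fus_mapD[OF parts(7)] and \<beta>' = fus_mapD[OF parts(8)]

text \<open>Obtained by multiplying the intertwining relations of \<open>X\<close> with
  \<open>Y\<close> on both sides. For \<open>R2\<close> an idempotent remains on the right, because
  the image of \<open>f2'\<close> does not lie in the corner.\<close>

lemma Y1: "r \<in> carrier R1 ==> \<phi> (f1 r) **[A'] Y = Y **[A'] f1' (\<phi>1 r)"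
 and Y2: "r' \<in> carrier R2 ==> \<phi> (f2 r') **[A'] Y = Y **[A'] f2' r' **[A'] f1' (\<phi>1 \<one>\<^bsub>R1\<^esub>)"
proof -
 have gen: "\<phi> z **[A'] Y = Y **[A'] x **[A'] f1' (\<phi>1 \<one>\<^bsub>R1\<^esub>)"
  if "x **[A'] X = X **[A'] \<phi> z" "x \<in> carrier A'" "z \<in> carrier A" for x z
 proof -
  have z: "\<phi> z \<in> carrier A'" "\<phi> \<one>\<^bsub>A\<^esub> **[A'] \<phi> z = \<phi> z"
   using that nhomD(3)[OF homs(6) A.one_closed that(3)] by (simp_all add: hom_closed)
  have "Y **[A'] x **[A'] (X **[A'] Y) = Y **[A'] (x **[A'] X) **[A'] Y" using that(2) XY(1,2) by (simp add: A'.m_assoc)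
  also have "\<dots> = (Y **[A'] X) **[A'] \<phi> z **[A'] Y" unfolding that(1) using z XY(1,2) by (simp add: A'.m_assoc)
  finally show ?thesis using z by (simp add: XY)
 qed
 show "r \<in> carrier R1 ==> \<phi> (f1 r) **[A'] Y = Y **[A'] f1' (\<phi>1 r)"
 proof -
  assume r: "r \<in> carrier R1"
  have "f1' (\<phi>1 r) **[A'] f1' (\<phi>1 \<one>\<^bsub>R1\<^esub>) = f1' (\<phi>1 r)"
   using r nhomD(3)[OF homs(5) r R1.one_closed] nhomD(3)[OF homs(3), of "\<phi>1 r" "\<phi>1 \<one>\<^bsub>R1\<^esub>"] by (simp add: hom_closed)
  thus ?thesis using gen[OF X1[OF r]] r XY(2) by (simp add: hom_closed A'.m_assoc)
 qed
 show "r' \<in> carrier R2 ==> \<phi> (f2 r') **[A'] Y = Y **[A'] f2' r' **[A'] f1' (\<phi>1 \<one>\<^bsub>R1\<^esub>)"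
  using gen[OF X2] by (simp add: hom_closed)
qed

lemma act: "x \<in> carrier A' ==> y \<in> carrier A' ==> w \<in> carrier G ==> x *[G] (y *[G] w) = (x **[A'] y) *[G] w"
 "x \<in> carrier A' ==> y \<in> carrier A' ==> w' \<in> carrier T ==> x *[T] (y *[T] w') = (x **[A'] y) *[T] w'"
 by (simp_all add: G.smult_assoc T.smult_assoc)

text \<open>For fixed \<open>b\<close> the map sending \<open>a\<close> to \<open>X\<close> times
  \<gamma>(\<beta> a b) extends from \<open>M1\<close> to its globalization \<open>G1\<close>. The
  extensions \<open>K b\<close> then form a bilinear family to which the universal property of the
  fusion applies.\<close>

lemma forward: "\<exists>H. lin A' T G H \<and> (\<forall>a\<in>carrier M1. \<forall>b\<in>carrier M2. H (\<beta>' (\<gamma>1 a) b) = X *[G] \<gamma> (\<beta> a b))"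
proof -
 let ?P = "pullback R1' f1' G"
 have P: "left_module R1' ?P" by (rule left_module_pullback[OF rings(4) parts(4) homs(3)])
 have one: "f1' \<one>\<^bsub>R1'\<^esub> *[G] w = w" if "w \<in> carrier G" for w using that by (simp add: f1'_one G.smult_one)
 have h: "lin R1 M1 (pullback R1 \<phi>1 ?P) (\<lambda>a. X *[G] \<gamma> (\<beta> a b))" if b: "b \<in> carrier M2" for b
  unfolding lin_def add_hom_def
  using b by (simp add: \<beta> \<gamma> XY G.smult_closed G.smult_r_distr one M1.smult_closed act hom_closed X1)
   (simp add: act(1)[symmetric] XY(1) \<beta> \<gamma> hom_closed one G.smult_closed)
 define K where "K b = (SOME K. lin R1' G1 ?P K \<and> (\<forall>a\<in>carrier M1. K (\<gamma>1 a) = X *[G] \<gamma> (\<beta> a b)))" for b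
 have K: "lin R1' G1 ?P (K b)" "!!a. a \<in> carrier M1 ==> K b (\<gamma>1 a) = X *[G] \<gamma> (\<beta> a b)" if "b \<in> carrier M2" for b
 proof -
  have "\<exists>K. lin R1' G1 ?P K \<and> (\<forall>a\<in>carrier M1. K (\<gamma>1 a) = X *[G] \<gamma> (\<beta> a b))"
   using G1(2)[unfolded glob_lift_def, rule_format, OF h[OF that]] by blast
  from someI_ex[OF this] show "lin R1' G1 ?P (K b)" "!!a. a \<in> carrier M1 ==> K b (\<gamma>1 a) = X *[G] \<gamma> (\<beta> a b)"
   unfolding K_def by auto
 qed
 have Kc: "K b x \<in> carrier G" if "b \<in> carrier M2" "x \<in> carrier G1" for b x using linD(1)[OF K(1)] that by auto
 have Kadd: "K b (x +[G1] y) = K b x +[G] K b y" if "b \<in> carrier M2" "x \<in> carrier G1" "y \<in> carrier G1" for b x y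
  using linD(2)[OF K(1)] that by simp
 have Kact: "K b (r *[G1] x) = f1' r *[G] K b x" if "b \<in> carrier M2" "x \<in> carrier G1" "r \<in> carrier R1'" for b x r
  using linD(3)[OF K(1)] that by simp
 \<comment> \<open>Dependence on \<open>b\<close> is not visible from the choice of
   \<open>K b\<close>. Both sides are linear in \<open>x\<close> and agree on the generators from
   \<open>M1\<close>, so they agree by uniqueness of extensions.\<close>
 have "K (b +[M2] b') x = K b x +[G] K b' x" if b: "b \<in> carrier M2" "b' \<in> carrier M2" and x: "x \<in> carrier G1" for b b' x
 proof (rule lin_unique[OF parts(1) P _ _ parts(9) _ x])
  show "lin R1' G1 ?P (K (b +[M2] b'))" using b by (intro K) auto
  show "lin R1' G1 ?P (\<lambda>x. K b x +[G] K b' x)"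
   using b by (simp add: lin_def add_hom_def Kadd Kact Kc one G.M.a_ac hom_closed G.smult_r_distr G1.smult_closed G.smult_closed)
  fix s assume "s \<in> \<gamma>1 ` carrier M1"
  thus "K (b +[M2] b') s = K b s +[G] K b' s" using b by (auto simp: K(2) \<beta> \<gamma> G.smult_r_distr XY)
 qed
 moreover have "f2' r *[G] K b x = K (r *[M2] b) x" if b: "b \<in> carrier M2" and x: "x \<in> carrier G1" and r: "r \<in> carrier R2" for b x r
 proof (rule lin_unique[OF parts(1) P _ _ parts(9) _ x])
  show "lin R1' G1 ?P (K (r *[M2] b))" using b r by (intro K) (auto simp: M2.smult_closed)
  show "lin R1' G1 ?P (\<lambda>x. f2' r *[G] K b x)"
   using b r by (simp add: lin_def add_hom_def Kadd Kact Kc one hom_closed G.smult_r_distr G1.smult_closed G.smult_closed act comm f1'_one G.smult_one)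
  fix s assume "s \<in> \<gamma>1 ` carrier M1"
  then obtain a where a: "a \<in> carrier M1" "s = \<gamma>1 a" by blast
  have "f2' r *[G] (X *[G] \<gamma> (\<beta> a b)) = X *[G] (\<phi> (f2 r) *[G] \<gamma> (\<beta> a b))"
   using a b r G.smult_assoc[of X "\<phi> (f2 r)" "\<gamma> (\<beta> a b)"] G.smult_assoc[of "f2' r" X "\<gamma> (\<beta> a b)"]
   by (simp add: hom_closed XY \<beta>(1) \<gamma>(1) X2)
  thus "f2' r *[G] K b s = K (r *[M2] b) s" using a b r by (simp add: K(2) \<gamma> \<beta> hom_closed M2.smult_closed)
 qed
 ultimately have "fus_map R1' f1' G1 R2 f2' M2 G (\<lambda>x b. K b x)"
  unfolding fus_map_def biadditive_def by (simp add: Kc Kadd Kact)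
 then obtain H where H: "lin A' T G H" "\<forall>x\<in>carrier G1. \<forall>b\<in>carrier M2. H (\<beta>' x b) = K b x"
  using T(2) unfolding fus_lift_def by blast
 thus ?thesis by (intro exI[of _ H]) (simp add: \<gamma>1 K)
qed

text \<open>The universal properties are used in the opposite order: first the one of the small
  fusion, then the one of its globalization.\<close>

lemma backward: "\<exists>H. lin A' G T H \<and> (\<forall>a\<in>carrier M1. \<forall>b\<in>carrier M2. H (\<gamma> (\<beta> a b)) = Y *[T] \<beta>' (\<gamma>1 a) b)"
proof -
 let ?P = "pullback A \<phi> T"
 have 2: "(Y **[A'] f2' r **[A'] f1' (\<phi>1 \<one>\<^bsub>R1\<^esub>)) *[T] \<beta>' (\<gamma>1 a) b = Y *[T] \<beta>' (\<gamma>1 a) (r *[M2] b)"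
  if "a \<in> carrier M1" "b \<in> carrier M2" "r \<in> carrier R2" for a b r
  using that by (simp add: T.smult_assoc \<beta>' \<gamma>1 hom_closed XY(1,2) M1.smult_one)
 have 1: "(Y **[A'] f1' (\<phi>1 r)) *[T] \<beta>' (\<gamma>1 a) b = Y *[T] \<beta>' (\<gamma>1 (r *[M1] a)) b"
  if "a \<in> carrier M1" "b \<in> carrier M2" "r \<in> carrier R1" for a b r
  using that by (simp add: T.smult_assoc \<beta>' \<gamma>1 hom_closed XY(1,2))
 have "fus_map R1 f1 M1 R2 f2 M2 ?P (\<lambda>a b. Y *[T] \<beta>' (\<gamma>1 a) b)"
  unfolding fus_map_def biadditive_def
  by (simp add: \<beta>' \<gamma>1 act hom_closed XY T.smult_closed T.smult_r_distr Y1 Y2 1 2)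
 then obtain H where H: "lin A F ?P H" "\<forall>a\<in>carrier M1. \<forall>b\<in>carrier M2. H (\<beta> a b) = Y *[T] \<beta>' (\<gamma>1 a) b"
  using F(2) unfolding fus_lift_def by blast
 obtain H' where H': "lin A' G T H'" "\<forall>x\<in>carrier F. H' (\<gamma> x) = H x" using G(2)[unfolded glob_lift_def, rule_format, OF H(1)] by blast
 thus ?thesis using H by (intro exI[of _ H']) (simp add: \<beta>)
qed

lemma generates_G: "generates A' G {\<gamma> (\<beta> a b) | a b. a \<in> carrier M1 \<and> b \<in> carrier M2}" (is "generates _ _ ?S")
 unfolding generates_def
proof (intro conjI allI impI)
 show "?S \<subseteq> carrier G" by (auto simp: \<beta> \<gamma>)
 fix U assume U: "\<zero>\<^bsub>G\<^esub> \<in> U \<and> (\<forall>x\<in>U \<inter> carrier G. \<forall>y\<in>U \<inter> carrier G. x +[G] y \<in> U) \<and> (\<forall>a\<in>carrier A'. \<forall>s\<in>?S. a *[G] s \<in> U)"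
 have \<gamma>h: "add_hom F G \<gamma>" by (simp add: add_hom_def \<gamma>)
 have in_U: "t *[G] \<gamma> x \<in> U" if "x \<in> carrier F" "t \<in> carrier A'" for x t
  by (rule span_image[OF parts(2,11,4) homs(6) \<gamma>h _ _ _ that]) (simp add: \<gamma>(3), use U in \<open>blast+\<close>)
 show "carrier G \<subseteq> U"
 proof
  fix x assume "x \<in> carrier G"
  with parts(10) have "x \<in> carrier G \<and> x \<in> U"
   by (induction rule: generates_induct) (use U in_U in \<open>auto simp: \<gamma> G.smult_closed\<close>)
  thus "x \<in> U" ..
 qed
qed

lemma generates_T: "generates A' T {\<beta>' (\<gamma>1 a) b | a b. a \<in> carrier M1 \<and> b \<in> carrier M2}" (is "generates _ _ ?S")
 unfolding generates_def
proof (intro conjI allI impI)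
 show "?S \<subseteq> carrier T" by (auto simp: \<beta>' \<gamma>1)
 fix U assume U: "\<zero>\<^bsub>T\<^esub> \<in> U \<and> (\<forall>x\<in>U \<inter> carrier T. \<forall>y\<in>U \<inter> carrier T. x +[T] y \<in> U) \<and> (\<forall>a\<in>carrier A'. \<forall>s\<in>?S. a *[T] s \<in> U)"
 have \<beta>h: "add_hom G1 T (\<lambda>x. \<beta>' x b)" if "b \<in> carrier M2" for b using that by (simp add: add_hom_def \<beta>')
 have in_U: "t *[T] \<beta>' x b \<in> U" if "x \<in> carrier G1" "t \<in> carrier A'" "b \<in> carrier M2" for x t b
  by (rule span_image[OF parts(1,9,3) homs(3) \<beta>h[OF that(3)] _ _ _ that(1,2)]) (simp add: \<beta>'(4) that(3), use U that(3) in \<open>blast+\<close>)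
 show "carrier T \<subseteq> U"
 proof
  fix x assume "x \<in> carrier T"
  with parts(12) have "x \<in> carrier T \<and> x \<in> U"
   by (induction rule: generates_induct) (use U in_U in \<open>auto simp: \<beta>' T.smult_closed\<close>)
  thus "x \<in> U" ..
 qed
qed

text \<open>On generators the two composites multiply by \<open>X\<close> times \<open>Y\<close> and
  by \<open>Y\<close> times \<open>X\<close>. These are the two idempotents, each of which fixes the
  generators on its own side.\<close>

theorem fusion_glob_iso: "module_iso A' T G"
proof -
 obtain H where H: "lin A' T G H" "!!a b. a \<in> carrier M1 ==> b \<in> carrier M2 ==> H (\<beta>' (\<gamma>1 a) b) = X *[G] \<gamma> (\<beta> a b)"
  using forward by blast
 obtain K where K: "lin A' G T K" "!!a b. a \<in> carrier M1 ==> b \<in> carrier M2 ==> K (\<gamma> (\<beta> a b)) = Y *[T] \<beta>' (\<gamma>1 a) b"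
  using backward by blast
 have "K (H (\<beta>' (\<gamma>1 a) b)) = \<beta>' (\<gamma>1 a) b" if "a \<in> carrier M1" "b \<in> carrier M2" for a b
  using that linD(3)[OF K(1), of "\<gamma> (\<beta> a b)" X]
  by (simp add: H K act XY(1-3) \<beta> \<gamma> \<beta>' \<gamma>1 hom_closed M1.smult_one)
 moreover have "H (K (\<gamma> (\<beta> a b))) = \<gamma> (\<beta> a b)" if "a \<in> carrier M1" "b \<in> carrier M2" for a b
  using that linD(3)[OF H(1), of "\<beta>' (\<gamma>1 a) b" Y]
  by (simp add: H K act XY(1,2,4) \<beta> \<gamma> \<beta>' \<gamma>1 hom_closed F.smult_one)
 ultimately show ?thesis
  by (intro module_iso_generators[OF parts(3,4) H(1) K(1) generates_T _ generates_G]) auto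
qed

end

section \<open>Finite-dimensional modules\<close>

abbreviation cst :: "complex => tl_elem" where "cst \<equiv> single id_diagram"

text \<open>An inductive form of the linear span, better suited to following spans through maps than
  the finite sums in \<open>fin_dim\<close>; \<open>fin_dim_iff\<close> connects the two.\<close>

inductive_set mspan :: "(tl_elem, 'v) module => 'v set => 'v set" for M S where
 zero: "\<zero>\<^bsub>M\<^esub> \<in> mspan M S"
| add: "x \<in> mspan M S ==> s \<in> S ==> x +[M] cst c *[M] s \<in> mspan M S"

lemma scale_TL: "scale (TL m K) M c v = cst c *[M] v"
 by (simp add: scale_def)

lemma carrier_sc: "x \<in> carrier (TL m K) ==> sc c x \<in> carrier (TL m K)"
 using order_trans[OF keys_sc] by (simp add: carrier_TL)

locale TL_module =
 fixes m :: complex and K :: nat and M :: "(tl_elem, 'v) module"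
 assumes TL_module: "left_module (TL m K) M"
begin

sublocale left_module "TL m K" M by (rule TL_module)

lemma cst_closed [simp]: "cst c \<in> carrier (TL m K)"
 using R.one_closed by (auto simp: carrier_TL)

lemma cst_smult:
 assumes "v \<in> carrier M"
 shows "cst c *[M] v \<in> carrier M" "cst 0 *[M] v = \<zero>\<^bsub>M\<^esub>" "cst 1 *[M] v = v"
  "cst (c + d) *[M] v = cst c *[M] v +[M] cst d *[M] v"
  "w \<in> carrier M ==> cst c *[M] (v +[M] w) = cst c *[M] v +[M] cst c *[M] w"
 using assms smult_closed[OF cst_closed assms] left_module_zero[OF TL_module assms] smult_one[OF assms]
  smult_l_distr[OF cst_closed cst_closed assms, of c d] smult_r_distr[OF cst_closed assms, of w c]
 by (simp_all add: single_add)

lemma sc_smult: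
 assumes "x \<in> carrier (TL m K)" "v \<in> carrier M"
 shows "sc c x *[M] v = cst c *[M] (x *[M] v)" "x *[M] (cst c *[M] v) = cst c *[M] (x *[M] v)"
proof -
 have e: "sc c (cst 1) = cst c" by simp
 have "tl_mult m K (cst c) x = sc c x" "tl_mult m K x (cst c) = sc c x"
  using conv_sc(1)[of "loop_weight K m" "comp_diagram K" c "cst 1" x] conv_sc(2)[of "loop_weight K m" "comp_diagram K" x c "cst 1"]
   R.l_one[OF assms(1)] R.r_one[OF assms(1)] unfolding e by simp_all
 thus "sc c x *[M] v = cst c *[M] (x *[M] v)" "x *[M] (cst c *[M] v) = cst c *[M] (x *[M] v)"
  using smult_assoc[OF cst_closed assms, of c] smult_assoc[OF assms(1) cst_closed assms(2), of c] by simp_all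
qed

lemma mspan_closed: "S \<subseteq> carrier M ==> x \<in> mspan M S ==> x \<in> carrier M"
 by (rotate_tac, induction rule: mspan.induct) (auto simp: cst_smult)

lemma mspan_add:
 assumes "S \<subseteq> carrier M" "x \<in> mspan M S" "y \<in> mspan M S" shows "x +[M] y \<in> mspan M S"
 using assms(3)
proof (induction rule: mspan.induct)
 case zero
 thus ?case using assms mspan_closed by auto
next
 case (add y s c)
 have "x +[M] (y +[M] cst c *[M] s) = (x +[M] y) +[M] cst c *[M] s"
  using add assms mspan_closed[OF assms(1)] by (auto simp: M.a_assoc cst_smult subsetD)
 thus ?case using add by (simp add: mspan.add)
qed

lemma mspan_base: "S \<subseteq> carrier M ==> s \<in> S ==> cst c *[M] s \<in> mspan M S"
 using mspan.add[OF mspan.zero, of s S M c] cst_smult(1)[of s c] by auto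

lemma mspan_cst:
 assumes "S \<subseteq> carrier M" "x \<in> mspan M S" shows "cst d *[M] x \<in> mspan M S"
 using assms(2)
proof (induction rule: mspan.induct)
 case zero
 thus ?case by (simp add: smult_zero[OF TL_module] mspan.zero)
next
 case (add x s c)
 have s: "s \<in> carrier M" using add assms by blast
 have "cst d *[M] (cst c *[M] s) = cst (d * c) *[M] s" using sc_smult(1)[OF cst_closed s, of d c] by simp
 thus ?case using add s mspan_closed[OF assms(1) add(1)] by (simp add: cst_smult mspan.add)
qed

lemma fin_dim_iff: "fin_dim (TL m K) M \<longleftrightarrow> (\<exists>S. finite S \<and> S \<subseteq> carrier M \<and> carrier M \<subseteq> mspan M S)"
proof
 assume "fin_dim (TL m K) M"
 then obtain S where S: "finite S" "S \<subseteq> carrier M" "!!v. v \<in> carrier M ==> \<exists>c. v = (\<Oplus>\<^bsub>M\<^esub>s\<in>S. cst (c s) *[M] s)"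
  unfolding fin_dim_def scale_TL by blast
 have "(\<Oplus>\<^bsub>M\<^esub>s\<in>S'. cst (c s) *[M] s) \<in> mspan M S" if "S' \<subseteq> S" for c S'
  using finite_subset[OF that S(1)] that
 proof (induction S' rule: finite_induct)
  case (insert s F)
  hence "s \<in> carrier M" "F \<subseteq> carrier M" using S by auto
  moreover from this have "(\<Oplus>\<^bsub>M\<^esub>s\<in>insert s F. cst (c s) *[M] s) = cst (c s) *[M] s +[M] (\<Oplus>\<^bsub>M\<^esub>s\<in>F. cst (c s) *[M] s)"
   using insert by (intro M.finsum_insert) (auto simp: cst_smult subsetD)
  ultimately show ?case using insert mspan_add[OF S(2) mspan_base[OF S(2)]] by auto
 qed (simp add: mspan.zero)
 hence sp: "(\<Oplus>\<^bsub>M\<^esub>s\<in>S. cst (c s) *[M] s) \<in> mspan M S" for c by blast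
 have "v \<in> mspan M S" if "v \<in> carrier M" for v
 proof -
  from S(3)[OF that] obtain c where "v = (\<Oplus>\<^bsub>M\<^esub>s\<in>S. cst (c s) *[M] s)" by blast
  thus ?thesis using sp[of c] by simp
 qed
 thus "\<exists>S. finite S \<and> S \<subseteq> carrier M \<and> carrier M \<subseteq> mspan M S" using S by blast
next
 assume "\<exists>S. finite S \<and> S \<subseteq> carrier M \<and> carrier M \<subseteq> mspan M S"
 then obtain S where S: "finite S" "S \<subseteq> carrier M" "carrier M \<subseteq> mspan M S" by blast
 have fs: "(\<lambda>s. cst (c s) *[M] s) \<in> S \<rightarrow> carrier M" for c using S(2) by (auto simp: cst_smult)
 have "\<exists>c. v = (\<Oplus>\<^bsub>M\<^esub>s\<in>S. cst (c s) *[M] s)" if "v \<in> mspan M S" for v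
  using that
 proof (induction rule: mspan.induct)
  case zero
  have "(\<Oplus>\<^bsub>M\<^esub>s\<in>S. cst 0 *[M] s) = (\<Oplus>\<^bsub>M\<^esub>s\<in>S. \<zero>\<^bsub>M\<^esub>)"
   using S(2) by (intro M.finsum_cong' refl cst_smult(2)) auto
  thus ?case by (intro exI[of _ "\<lambda>_. 0"]) (simp only: M.finsum_zero)
 next
  case (add x t d)
  then obtain c where c: "x = (\<Oplus>\<^bsub>M\<^esub>s\<in>S. cst (c s) *[M] s)" by blast
  have t: "t \<in> carrier M" using add S by auto
  have 1: "(\<Oplus>\<^bsub>M\<^esub>s\<in>S - {t}. cst ((c(t := c t + d)) s) *[M] s) = (\<Oplus>\<^bsub>M\<^esub>s\<in>S - {t}. cst (c s) *[M] s)"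
   by (rule M.finsum_cong') (use fs in auto)
  have split: "(\<Oplus>\<^bsub>M\<^esub>s\<in>S. cst (b s) *[M] s) = cst (b t) *[M] t +[M] (\<Oplus>\<^bsub>M\<^esub>s\<in>S - {t}. cst (b s) *[M] s)" for b
   using M.finsum_insert[of "S - {t}" t "\<lambda>s. cst (b s) *[M] s"] fs[of b] S(1) add(2) t cst_smult(1)[OF t] by (auto simp: insert_absorb)
  have cl: "(\<Oplus>\<^bsub>M\<^esub>s\<in>S - {t}. cst (c s) *[M] s) \<in> carrier M" using fs by (intro M.finsum_closed) auto
  have "x +[M] cst d *[M] t = (\<Oplus>\<^bsub>M\<^esub>s\<in>S. cst ((c(t := c t + d)) s) *[M] s)"
   unfolding c split[of c] split[of "c(t := c t + d)"] 1 using t cl by (simp add: cst_smult M.a_ac)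
  thus ?case by blast
 qed
 thus "fin_dim (TL m K) M" using S unfolding fin_dim_def scale_TL by blast
qed

lemma mspan_trans:
 assumes "S' \<subseteq> carrier M" "x \<in> mspan M S" "S \<subseteq> mspan M S'" shows "x \<in> mspan M S'"
 using assms(2)
 by (induction rule: mspan.induct) (use assms mspan_cst[OF assms(1)] in \<open>auto intro!: mspan_add[OF assms(1)] mspan.zero\<close>)

lemma cspan_smult:
 assumes v: "v \<in> carrier M" and B: "B \<subseteq> carrier M" and y: "y \<in> cspan Z"
  and Z: "!!z. z \<in> Z ==> z \<in> carrier (TL m K) \<and> z *[M] v \<in> mspan M B"
 shows "y \<in> carrier (TL m K) \<and> y *[M] v \<in> mspan M B"
 using y
proof (induction rule: cspan.induct)
 case zero
 thus ?case using left_module_zero[OF TL_module v] R.zero_closed by (simp add: mspan.zero)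
next
 case (add x y c)
 have "y \<in> carrier (TL m K)" "y *[M] v \<in> mspan M B" using Z[OF add(2)] by auto
 hence "sc c y \<in> carrier (TL m K)" "sc c y *[M] v \<in> mspan M B"
  using carrier_sc sc_smult(1)[OF _ v] mspan_cst[OF B] by auto
 thus ?case using add mspan_add[OF B] smult_l_distr[of x "sc c y" v] R.a_closed[of x "sc c y"] v by simp
qed

lemma mspan_image:
 assumes "S \<subseteq> carrier M" "x \<in> mspan M S" "left_module (TL m L) M'" "add_hom M M' f"
  "!!c v. v \<in> carrier M ==> f (cst c *[M] v) = cst c *[M'] f v"
 shows "f x \<in> mspan M' (f ` S)"
 using assms(2)
proof (induction rule: mspan.induct)
 case zero
 show ?case using add_hom_zero[OF M.abelian_group_axioms _ assms(4)] assms(3) by (simp add: left_module_def mspan.zero)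
next
 case (add x s c)
 have "s \<in> carrier M" "x \<in> carrier M" using add assms(1) mspan_closed by auto
 thus ?case using add by (simp add: add_homD(2)[OF assms(4)] cst_smult assms(5) mspan.add)
qed

end

lemma fin_dim_iso:
 assumes M: "left_module (TL m K) M" "left_module (TL m K) M'" and iso: "module_iso (TL m K) M M'" and fin: "fin_dim (TL m K) M"
 shows "fin_dim (TL m K) M'"
proof -
 interpret M: TL_module m K M by (rule TL_module.intro) (rule M)
 interpret M': TL_module m K M' by (rule TL_module.intro) (rule M)
 obtain F where F: "bij_betw F (carrier M) (carrier M')" "lin (TL m K) M M' F" using iso unfolding module_iso_lin by blast
 obtain S where S: "finite S" "S \<subseteq> carrier M" "carrier M \<subseteq> mspan M S" using fin M.fin_dim_iff by blast
 have "F ` carrier M \<subseteq> mspan M' (F ` S)"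
  using M.mspan_image[OF S(2) _ M(2), of _ F] F(2) S(3) by (auto simp: lin_def)
 thus ?thesis
  unfolding M'.fin_dim_iff using S F(1) by (intro exI[of _ "F ` S"]) (auto simp: bij_betw_imp_surj_on linD[OF F(2)] subsetD)
qed

definition transport :: "('v => 'w) => ('a, 'v) module => ('a, 'w) module" where
 "transport f M = (let g = inv_into (carrier M) f in
  \<lparr>carrier = f ` carrier M, monoid.mult = undefined, monoid.one = undefined, ring.zero = f \<zero>\<^bsub>M\<^esub>,
   ring.add = \<lambda>x y. f (g x +[M] g y), module.smult = \<lambda>a x. f (a *[M] g x)\<rparr>)"

lemma transport:
 assumes M: "left_module A M" and f: "inj_on f (carrier M)"
 shows "left_module A (transport f M)" "module_iso A M (transport f M)"
proof -
 interpret left_module A M by (rule M)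
 have s: "carrier (transport f M) = f ` carrier M" "\<zero>\<^bsub>transport f M\<^esub> = f \<zero>\<^bsub>M\<^esub>"
  "v \<in> carrier M ==> w \<in> carrier M ==> f v +[transport f M] f w = f (v +[M] w)"
  "v \<in> carrier M ==> a *[transport f M] f v = f (a *[M] v)" for v w a
  using f by (simp_all add: transport_def Let_def)
 show "left_module A (transport f M)"
 proof (intro left_module.intro R.ring_axioms left_module_axioms.intro abelian_groupI)
  fix x assume "x \<in> carrier (transport f M)"
  then obtain v where "v \<in> carrier M" "x = f v" by (auto simp: s)
  thus "\<exists>y\<in>carrier (transport f M). y +[transport f M] x = \<zero>\<^bsub>transport f M\<^esub>"
   by (intro bexI[of _ "f (\<ominus>\<^bsub>M\<^esub> v)"]) (auto simp: s M.l_neg)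
 qed (auto simp: s smult_closed smult_l_distr smult_r_distr smult_assoc smult_one M.a_ac)
 have "lin A M (transport f M) f" by (auto simp: lin_def add_hom_def s)
 thus "module_iso A M (transport f M)" unfolding module_iso_lin using f by (intro exI[of _ f]) (simp add: bij_betw_def s)
qed

text \<open>Coefficients with respect to a finite spanning set are chosen for every vector. They
  determine the vector, so this is an injection into \<open>std_vec\<close>; it is in general not
  linear, and the module structure is carried along it by \<open>transport\<close>.\<close>

lemma std_vec_representative:
 fixes M :: "(tl_elem, 'v) module"
 assumes M: "M \<in> TL_Mod m K"
 shows "\<exists>P :: (tl_elem, std_vec) module. P \<in> TL_Mod m K \<and> module_iso (TL m K) M P"
proof -
 interpret TL_module m K M by (rule TL_module.intro) (use M in \<open>simp add: TL_Mod_def\<close>)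
 obtain S where S: "finite S" "S \<subseteq> carrier M" "!!v. v \<in> carrier M ==> \<exists>c. v = (\<Oplus>\<^bsub>M\<^esub>s\<in>S. cst (c s) *[M] s)"
  using M unfolding TL_Mod_def fin_dim_def scale_TL by blast
 define cf where "cf v = (SOME c. v = (\<Oplus>\<^bsub>M\<^esub>s\<in>S. cst (c s) *[M] s))" for v
 have cf: "v = (\<Oplus>\<^bsub>M\<^esub>s\<in>S. cst (cf v s) *[M] s)" if "v \<in> carrier M" for v
  unfolding cf_def by (rule someI_ex[OF S(3)[OF that]])
 obtain idx :: "'v => nat" where idx: "inj_on idx S" using finite_imp_inj_to_nat_seg[OF S(1)] by blast
 define \<iota> :: "'v => std_vec" where "\<iota> v = (\<lambda>i. if i \<in> idx ` S then cf v (inv_into S idx i) else 0)" for v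
 have "inj_on \<iota> (carrier M)"
 proof (rule inj_onI)
  fix v w assume v: "v \<in> carrier M" "w \<in> carrier M" "\<iota> v = \<iota> w"
  have e: "cf v s = cf w s" if "s \<in> S" for s using fun_cong[OF v(3), of "idx s"] that idx by (simp add: \<iota>_def)
  have "v = (\<Oplus>\<^bsub>M\<^esub>s\<in>S. cst (cf v s) *[M] s)" by (rule cf[OF v(1)])
  also have "\<dots> = (\<Oplus>\<^bsub>M\<^esub>s\<in>S. cst (cf w s) *[M] s)"
   by (rule M.finsum_cong') (use e S(2) in \<open>auto simp: cst_smult subsetD\<close>)
  also have "\<dots> = w" by (rule cf[OF v(2), symmetric])
  finally show "v = w" .
 qed
 note t = transport[OF TL_module this]
 show ?thesis using t fin_dim_iso[OF TL_module t] M by (auto simp: TL_Mod_def)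
qed

text \<open>The left ideal of the idempotent is spanned by \<open>D\<close> over the image of
  \<phi>. Scalars from that image are absorbed by \<open>V\<close>, so the elements \<open>d\<close>
  applied to \<gamma> of a finite spanning set of \<open>V\<close> span \<open>G\<close>.\<close>

lemma fin_dim_glob:
 assumes V: "left_module (TL m K) V" "fin_dim (TL m K) V" and G: "glob_mod (TL m L) (TL m K) \<phi> V G \<gamma>"
  and \<phi>: "nhom (TL m K) (TL m L) \<phi>" "!!c x. x \<in> carrier (TL m K) ==> \<phi> (sc c x) = sc c (\<phi> x)"
  and D: "finite D" "D \<subseteq> carrier (TL m L)"
  "!!x. x \<in> carrier (TL m L) ==> tl_mult m L x (\<phi> (cst 1)) \<in> cspan {tl_mult m L d (\<phi> r) | d r. d \<in> D \<and> r \<in> carrier (TL m K)}"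
 shows "fin_dim (TL m L) G"
proof -
 have Gm: "left_module (TL m L) G" and l: "lin (TL m K) V (pullback (TL m K) \<phi> G) \<gamma>"
  and gen: "generates (TL m L) G (\<gamma> ` carrier V)" using G by (simp_all add: glob_mod_def)
 interpret V: TL_module m K V by (rule TL_module.intro) (rule V)
 interpret G: TL_module m L G by (rule TL_module.intro) (rule Gm)
 have \<gamma>: "v \<in> carrier V ==> \<gamma> v \<in> carrier G" "v \<in> carrier V ==> w \<in> carrier V ==> \<gamma> (v +[V] w) = \<gamma> v +[G] \<gamma> w"
  "v \<in> carrier V ==> r \<in> carrier (TL m K) ==> \<gamma> (r *[V] v) = \<phi> r *[G] \<gamma> v"
  "v \<in> carrier V ==> \<phi> (cst 1) *[G] \<gamma> v = \<gamma> v" for v w r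
  using linD[OF l, of v] by auto
 have cl: "\<phi> r \<in> carrier (TL m L)" if "r \<in> carrier (TL m K)" for r using nhomD(1)[OF \<phi>(1) that] .
 obtain S where S: "finite S" "S \<subseteq> carrier V" "carrier V \<subseteq> mspan V S" using V(2) V.fin_dim_iff by blast
 define B where "B = (\<lambda>(d, s). d *[G] \<gamma> s) ` (D \<times> S)"
 have B: "B \<subseteq> carrier G" using D(2) S(2) by (auto simp: B_def \<gamma> subsetD intro!: G.smult_closed)
 have \<gamma>c: "\<gamma> (cst c *[V] v) = cst c *[G] \<gamma> v" if v: "v \<in> carrier V" for c v
  using \<phi>(2)[OF V.cst_closed, of c 1] G.sc_smult(1)[OF cl[OF V.cst_closed[of 1]] \<gamma>(1)[OF v], of c] v by (simp add: \<gamma>)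
 have d: "d *[G] \<gamma> v \<in> mspan G B" if "d \<in> D" "v \<in> carrier V" for d v
 proof -
  have dc: "d \<in> carrier (TL m L)" using that D by auto
  have "d *[G] \<gamma> v \<in> mspan G ((\<lambda>v. d *[G] \<gamma> v) ` S)"
   by (rule V.mspan_image[OF S(2) _ Gm]) (use that S dc in \<open>auto simp: add_hom_def \<gamma>(1,2) \<gamma>c G.smult_closed G.smult_r_distr G.sc_smult(2)\<close>)
  moreover have "(\<lambda>v. d *[G] \<gamma> v) ` S \<subseteq> B" using that by (auto simp: B_def)
  ultimately show ?thesis using G.mspan_trans[OF B] G.mspan_base[OF B, of _ 1] G.cst_smult(3) B by (metis (no_types, lifting) subset_iff)
 qed
 have "y \<in> carrier (TL m L) \<and> y *[G] \<gamma> v \<in> mspan G B" if y: "y \<in> cspan {tl_mult m L d (\<phi> r) | d r. d \<in> D \<and> r \<in> carrier (TL m K)}" and v: "v \<in> carrier V" for y v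
 proof (rule G.cspan_smult[OF \<gamma>(1)[OF v] B y])
  fix z assume "z \<in> {tl_mult m L d (\<phi> r) | d r. d \<in> D \<and> r \<in> carrier (TL m K)}"
  then obtain d' r where z: "z = tl_mult m L d' (\<phi> r)" "d' \<in> D" "r \<in> carrier (TL m K)" by blast
  have "z *[G] \<gamma> v = d' *[G] \<gamma> (r *[V] v)"
   using G.smult_assoc[of d' "\<phi> r" "\<gamma> v"] z v D(2) cl by (auto simp: \<gamma>)
  thus "z \<in> carrier (TL m L) \<and> z *[G] \<gamma> v \<in> mspan G B"
   using d z v G.R.m_closed[of d' "\<phi> r"] D(2) cl by (auto simp: V.smult_closed)
 qed
 note span = this
 have "x \<in> mspan G B" if "x \<in> carrier G" for x
  using gen that
 proof (induction rule: generates_induct)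
  case (act a s)
  then obtain v where v: "v \<in> carrier V" "s = \<gamma> v" by blast
  have "a *[G] s = tl_mult m L a (\<phi> (cst 1)) *[G] \<gamma> v"
   using G.smult_assoc[OF act(1) cl[OF V.cst_closed[of 1]] \<gamma>(1)[OF v(1)]] v by (simp add: \<gamma>)
  thus ?case using span[OF D(3)[OF act(1)] v(1)] by simp
 qed (auto simp: mspan.zero intro: G.mspan_add[OF B])
 thus ?thesis unfolding G.fin_dim_iff using B D(1) S(1) by (intro exI[of _ B]) (auto simp: B_def)
qed

lemma fin_dim_fus:
 assumes M: "left_module (TL m K) M1" "fin_dim (TL m K) M1" "left_module (TL m L) M2" "fin_dim (TL m L) M2"
  and T: "fus_mod (TL m N) (TL m K) f1 M1 (TL m L) f2 M2 T \<beta>"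
  and f: "nhom (TL m K) (TL m N) f1" "nhom (TL m L) (TL m N) f2" "!!c. f1 (cst c) = cst c" "!!c. f2 (cst c) = cst c"
  and D: "finite D" "D \<subseteq> carrier (TL m N)"
  "!!x. x \<in> carrier (TL m N) ==> x \<in> cspan {tl_mult m N d (tl_mult m N (f1 a) (f2 b)) | d a b. d \<in> D \<and> a \<in> carrier (TL m K) \<and> b \<in> carrier (TL m L)}"
 shows "fin_dim (TL m N) T"
proof -
 have Tm: "left_module (TL m N) T" and bm: "fus_map (TL m K) f1 M1 (TL m L) f2 M2 T \<beta>"
  and gen: "generates (TL m N) T {\<beta> a b | a b. a \<in> carrier M1 \<and> b \<in> carrier M2}" using T by (simp_all add: fus_mod_def)
 interpret M1: TL_module m K M1 by (rule TL_module.intro) (rule M)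
 interpret M2: TL_module m L M2 by (rule TL_module.intro) (rule M)
 interpret T: TL_module m N T by (rule TL_module.intro) (rule Tm)
 note \<beta> = fus_mapD[OF bm]
 have cl: "a \<in> carrier (TL m K) ==> f1 a \<in> carrier (TL m N)" "b \<in> carrier (TL m L) ==> f2 b \<in> carrier (TL m N)" for a b
  using nhomD(1)[OF f(1)] nhomD(1)[OF f(2)] by auto
 have \<beta>c: "\<beta> (cst c *[M1] v) w = cst c *[T] \<beta> v w" "\<beta> v (cst c *[M2] w) = cst c *[T] \<beta> v w"
  if "v \<in> carrier M1" "w \<in> carrier M2" for c v w
  using \<beta>(4)[OF that M1.cst_closed[of c]] \<beta>(5)[OF that M2.cst_closed[of c]] by (simp_all add: f)
 obtain S1 where S1: "finite S1" "S1 \<subseteq> carrier M1" "carrier M1 \<subseteq> mspan M1 S1" using M(2) M1.fin_dim_iff by blast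
 obtain S2 where S2: "finite S2" "S2 \<subseteq> carrier M2" "carrier M2 \<subseteq> mspan M2 S2" using M(4) M2.fin_dim_iff by blast
 define B where "B = (\<lambda>(d, s, t). d *[T] \<beta> s t) ` (D \<times> S1 \<times> S2)"
 have B: "B \<subseteq> carrier T" using D(2) S1(2) S2(2) by (auto simp: B_def \<beta>(1) subsetD intro!: T.smult_closed)
 have d: "d *[T] \<beta> v w \<in> mspan T B" if dD: "d \<in> D" and v: "v \<in> carrier M1" and w: "w \<in> carrier M2" for d v w
 proof -
  have dc: "d \<in> carrier (TL m N)" using dD D by auto
  have BB: "B \<subseteq> mspan T B" using T.mspan_base[OF B, of _ 1] T.cst_smult(3) B by (metis subset_iff)
  have h2: "d *[T] \<beta> s w \<in> mspan T B" if s: "s \<in> S1" for s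
  proof -
   have "s \<in> carrier M1" "w \<in> mspan M2 S2" using s w S1 S2 by auto
   hence "d *[T] \<beta> s w \<in> mspan T ((\<lambda>w. d *[T] \<beta> s w) ` S2)"
    by (intro M2.mspan_image[OF S2(2) _ Tm]) (use dc in \<open>auto simp: add_hom_def \<beta>(1,3) \<beta>c T.smult_closed T.smult_r_distr T.sc_smult(2)\<close>)
   moreover have "(\<lambda>w. d *[T] \<beta> s w) ` S2 \<subseteq> B" unfolding B_def using dD s by (auto intro!: image_eqI[of _ _ "(d, s, _)"])
   ultimately show ?thesis using T.mspan_trans[OF B _ order_trans[OF _ BB]] by blast
  qed
  have "v \<in> mspan M1 S1" using v S1 by auto
  hence "d *[T] \<beta> v w \<in> mspan T ((\<lambda>v. d *[T] \<beta> v w) ` S1)"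
   by (intro M1.mspan_image[OF S1(2) _ Tm]) (use dc w in \<open>auto simp: add_hom_def \<beta>(1,2) \<beta>c T.smult_closed T.smult_r_distr T.sc_smult(2)\<close>)
  thus ?thesis by (rule T.mspan_trans[OF B]) (use h2 in auto)
 qed
 have "y \<in> carrier (TL m N) \<and> y *[T] \<beta> v w \<in> mspan T B"
  if y: "y \<in> cspan {tl_mult m N d (tl_mult m N (f1 a) (f2 b)) | d a b. d \<in> D \<and> a \<in> carrier (TL m K) \<and> b \<in> carrier (TL m L)}"
   and v: "v \<in> carrier M1" and w: "w \<in> carrier M2" for y v w
 proof (rule T.cspan_smult[OF \<beta>(1)[OF v w] B y])
  fix z assume "z \<in> {tl_mult m N d (tl_mult m N (f1 a) (f2 b)) | d a b. d \<in> D \<and> a \<in> carrier (TL m K) \<and> b \<in> carrier (TL m L)}"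
  then obtain d' a b where z: "z = tl_mult m N d' (tl_mult m N (f1 a) (f2 b))" "d' \<in> D" "a \<in> carrier (TL m K)" "b \<in> carrier (TL m L)" by blast
  have d'c: "d' \<in> carrier (TL m N)" using z D(2) by auto
  have ab: "tl_mult m N (f1 a) (f2 b) \<in> carrier (TL m N)" using T.R.m_closed[of "f1 a" "f2 b"] z cl by auto
  have "z *[T] \<beta> v w = d' *[T] \<beta> (a *[M1] v) (b *[M2] w)"
   using T.smult_assoc[OF d'c ab \<beta>(1)[OF v w]] T.smult_assoc[of "f1 a" "f2 b" "\<beta> v w"] z v w cl by (simp add: \<beta> M2.smult_closed)
  thus "z \<in> carrier (TL m N) \<and> z *[T] \<beta> v w \<in> mspan T B"
   using d z v w T.R.m_closed[OF d'c ab] by (simp add: M1.smult_closed M2.smult_closed)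
 qed
 note span = this
 have "x \<in> mspan T B" if "x \<in> carrier T" for x
  using gen that
  by (induction rule: generates_induct) (use span[OF D(3)] in \<open>auto simp: mspan.zero intro: T.mspan_add[OF B]\<close>)
 thus ?thesis unfolding T.fin_dim_iff using B D(1) S1(1) S2(1) by (intro exI[of _ B]) (auto simp: B_def)
qed

section \<open>The universal properties hold\<close>

locale corner_module =
 fixes A R :: "(complex, 'a) module" and \<phi> :: "'a => 'a" and V :: "('a, 'v) module"
 assumes A: "ring A" and R: "ring R" and \<phi>: "nhom R A \<phi>" and V: "left_module R V"
  and bij: "bij_betw \<phi> (carrier R) {\<phi> \<one>\<^bsub>R\<^esub> **[A] x **[A] \<phi> \<one>\<^bsub>R\<^esub> | x. x \<in> carrier A}"
begin

interpretation A: ring A by (rule A)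
interpretation R: ring R by (rule R)
interpretation V: left_module R V by (rule V)

abbreviation c where "c \<equiv> \<phi> \<one>\<^bsub>R\<^esub>"
abbreviation X where "X \<equiv> {x **[A] c | x. x \<in> carrier A}"

lemma c_closed: "c \<in> carrier A" using nhomD(1)[OF \<phi>] by simp

lemma c_\<phi>: "r \<in> carrier R ==> c **[A] \<phi> r = \<phi> r" "r \<in> carrier R ==> \<phi> r **[A] c = \<phi> r"
 using nhomD(3)[OF \<phi> R.one_closed, of r] nhomD(3)[OF \<phi> _ R.one_closed, of r] by simp_all

lemma in_X: "x \<in> X \<longleftrightarrow> x \<in> carrier A \<and> x **[A] c = x"
proof
 assume "x \<in> X"
 thus "x \<in> carrier A \<and> x **[A] c = x" using c_\<phi>(1)[OF R.one_closed] by (auto simp: c_closed A.m_assoc)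
next
 assume "x \<in> carrier A \<and> x **[A] c = x"
 hence "x = x **[A] c" "x \<in> carrier A" by simp_all
 thus "x \<in> X" by blast
qed

sublocale induced A X R \<phi> V
proof (rule induced.intro[OF A])
 show "X \<subseteq> carrier A" by (auto simp: c_closed)
 show "abelian_group (A\<lparr>carrier := X\<rparr>)"
 proof (rule abelian_groupI)
  fix x assume "x \<in> carrier (A\<lparr>carrier := X\<rparr>)"
  hence x: "x \<in> carrier A" "x **[A] c = x" by (simp_all add: in_X del: mem_Collect_eq)
  have "\<ominus>\<^bsub>A\<^esub> x \<in> X" unfolding in_X using x by (simp add: A.l_minus c_closed)
  thus "\<exists>y\<in>carrier (A\<lparr>carrier := X\<rparr>). y +[A\<lparr>carrier := X\<rparr>] x = \<zero>\<^bsub>A\<lparr>carrier := X\<rparr>\<^esub>"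
   using x by (intro bexI[of _ "\<ominus>\<^bsub>A\<^esub> x"]) (simp_all add: A.l_neg)
 qed (simp_all add: in_X A.l_distr c_closed A.a_ac del: mem_Collect_eq)
 show "a **[A] x \<in> X" if "a \<in> carrier A" "x \<in> X" for a x
  using that by (simp add: in_X A.m_assoc c_closed del: mem_Collect_eq)
 show "x **[A] \<phi> b \<in> X" if "x \<in> X" "b \<in> carrier R" for x b
  using that by (simp add: in_X A.m_assoc c_closed nhomD(1)[OF \<phi>] c_\<phi> del: mem_Collect_eq)
qed (auto simp: nhomD(1)[OF \<phi>] V)

definition \<gamma> where "\<gamma> v = tens c v"

lemma c_X: "c \<in> X" unfolding in_X by (simp add: c_closed c_\<phi>)

lemma smult_\<gamma>: "a \<in> carrier A ==> v \<in> carrier V ==> a *[T] \<gamma> v = tens (a **[A] c) v"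
 using smult_tens(2)[OF _ c_X] by (simp add: \<gamma>_def)

lemma glob_mod: "glob_mod A R \<phi> V T \<gamma>"
proof -
 have "\<phi> r *[T] \<gamma> v = \<gamma> (r *[V] v)" if "r \<in> carrier R" "v \<in> carrier V" for r v
  using that T_facts(5)[OF c_X that] by (simp add: smult_\<gamma> c_\<phi> nhomD(1)[OF \<phi>]) (simp add: \<gamma>_def)
 moreover have "\<gamma> v \<in> carrier T" "c *[T] \<gamma> v = \<gamma> v" if "v \<in> carrier V" for v
  using that T_facts(2)[OF c_X that] by (simp_all add: smult_\<gamma> c_closed c_\<phi>) (simp_all add: \<gamma>_def)
 ultimately have "lin R V (pullback R \<phi> T) \<gamma>"
  using T_facts(4)[OF c_X] by (simp add: lin_def add_hom_def) (simp add: \<gamma>_def)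
 moreover have "generates A T (\<gamma> ` carrier V)"
  unfolding generates_def
 proof (intro conjI allI impI subsetI)
  fix y assume "y \<in> \<gamma> ` carrier V" thus "y \<in> carrier T" using T_facts(2)[OF c_X] by (auto simp: \<gamma>_def)
 next
  fix U y assume U: "\<zero>\<^bsub>T\<^esub> \<in> U \<and> (\<forall>x\<in>U \<inter> carrier T. \<forall>y\<in>U \<inter> carrier T. x +[T] y \<in> U) \<and>
   (\<forall>a\<in>carrier A. \<forall>s\<in>\<gamma> ` carrier V. a *[T] s \<in> U)" and y: "y \<in> carrier T"
  from y show "y \<in> U"
  proof (induction rule: induced_induct)
   case (tens x v)
   have x: "x \<in> carrier A" "x **[A] c = x" using tens(1) unfolding in_X by auto
   have "x *[T] \<gamma> v \<in> U" using U x(1) tens(2) by blast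
   thus ?case unfolding smult_\<gamma>[OF x(1) tens(2)] x(2) .
  qed (use U in auto)
 qed
 ultimately show ?thesis by (simp add: glob_mod_def left_module_induced)
qed

lemma glob_lift:
 assumes W: "left_module A W" shows "glob_lift A R \<phi> V T \<gamma> W"
 unfolding glob_lift_def
proof (intro allI impI)
 fix h assume h: "lin R V (pullback R \<phi> W) h"
 interpret W: left_module A W by (rule W)
 have hc: "v \<in> carrier V ==> h v \<in> carrier W" "v \<in> carrier V ==> c *[W] h v = h v"
  "v \<in> carrier V ==> w \<in> carrier V ==> h (v +[V] w) = h v +[W] h w"
  "v \<in> carrier V ==> r \<in> carrier R ==> h (r *[V] v) = \<phi> r *[W] h v" for v w r
  using linD[OF h, of v] by auto
 have "\<exists>H. lin A T W H \<and> (\<forall>x\<in>X. \<forall>v\<in>carrier V. H (tens x v) = x *[W] h v)"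
 proof (rule induced_lin[OF W])
  show "biadditive (A\<lparr>carrier := X\<rparr>) V W (\<lambda>x v. x *[W] h v)"
   unfolding biadditive_def using X_closed(1)
   by (simp add: hc W.smult_closed W.smult_l_distr W.smult_r_distr del: mem_Collect_eq)
  show "(x **[A] \<phi> b) *[W] h v = x *[W] h (b *[V] v)" if "x \<in> X" "b \<in> carrier R" "v \<in> carrier V" for x b v
   using that X_closed(1)[OF that(1)] by (simp add: hc W.smult_assoc nhomD(1)[OF \<phi>])
  show "(a **[A] x) *[W] h v = a *[W] (x *[W] h v)" if "a \<in> carrier A" "x \<in> X" "v \<in> carrier V" for a x v
   by (rule W.smult_assoc[OF that(1) X_closed(1)[OF that(2)] hc(1)[OF that(3)]])
 qed
 then obtain H where H: "lin A T W H" "!!x v. x \<in> X ==> v \<in> carrier V ==> H (tens x v) = x *[W] h v" by blast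
 hence "lin A T W H" by simp
 moreover have "\<forall>v\<in>carrier V. H (\<gamma> v) = h v" by (simp add: \<gamma>_def H(2)[OF c_X] hc)
 ultimately show "\<exists>F. lin A T W F \<and> (\<forall>v\<in>carrier V. F (\<gamma> v) = h v)" by blast
qed

text \<open>A left inverse is obtained by lifting. For \<open>x\<close> in the left ideal the
  product \<open>c x\<close> lies in the corner, so it comes from a unique element of
  \<open>R\<close>, which acts on \<open>v\<close>; at \<open>x = c\<close> this element is the
  unit.\<close>

lemma inj_\<gamma>: "inj_on \<gamma> (carrier V)"
proof -
 define \<psi> where "\<psi> = inv_into (carrier R) \<phi>"
 have \<psi>: "\<psi> (\<phi> r) = r" if "r \<in> carrier R" for r using bij_betw_inv_into_left[OF bij that] by (simp add: \<psi>_def)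
 have im: "\<exists>r\<in>carrier R. c **[A] x = \<phi> r" if x: "x \<in> X" for x
 proof -
  have "x \<in> carrier A" "x **[A] c = x" using x unfolding in_X by auto
  hence "c **[A] x = c **[A] x **[A] c" by (simp add: A.m_assoc c_closed)
  hence "c **[A] x \<in> \<phi> ` carrier R" using \<open>x \<in> carrier A\<close> bij_betw_imp_surj_on[OF bij] by blast
  thus ?thesis by blast
 qed
 have "\<exists>H. add_hom T V H \<and> (\<forall>x\<in>X. \<forall>v\<in>carrier V. H (tens x v) = \<psi> (c **[A] x) *[V] v)"
 proof (rule induced_lift[OF V.M.abelian_group_axioms])
  have 1: "\<psi> (c **[A] x) \<in> carrier R" if "x \<in> X" for x using im[OF that] \<psi> by auto
  have "\<psi> (c **[A] (x +[A] y)) = \<psi> (c **[A] x) +[R] \<psi> (c **[A] y)" if xy: "x \<in> X" "y \<in> X" for x y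
  proof -
   obtain r s where r: "r \<in> carrier R" "c **[A] x = \<phi> r" "s \<in> carrier R" "c **[A] y = \<phi> s" using im[OF xy(1)] im[OF xy(2)] by blast
   hence "c **[A] (x +[A] y) = \<phi> (r +[R] s)" using X_closed(1)[OF xy(1)] X_closed(1)[OF xy(2)] by (simp add: A.r_distr c_closed nhomD[OF \<phi>])
   thus ?thesis using r \<psi> by simp
  qed
  thus "biadditive (A\<lparr>carrier := X\<rparr>) V V (\<lambda>x v. \<psi> (c **[A] x) *[V] v)"
   unfolding biadditive_def using 1 by (simp add: V.smult_closed V.smult_l_distr V.smult_r_distr del: mem_Collect_eq)
  show "\<psi> (c **[A] (x **[A] \<phi> b)) *[V] v = \<psi> (c **[A] x) *[V] (b *[V] v)"
   if x: "x \<in> X" and b: "b \<in> carrier R" and v: "v \<in> carrier V" for x b v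
  proof -
   obtain r where r: "r \<in> carrier R" "c **[A] x = \<phi> r" using im[OF x] by blast
   have "c **[A] (x **[A] \<phi> b) = \<phi> (r **[R] b)"
    using X_closed(1)[OF x] b r by (simp add: A.m_assoc[symmetric] c_closed nhomD[OF \<phi>])
   thus ?thesis using r b v \<psi> by (simp add: V.smult_assoc)
  qed
 qed
 then obtain H where "!!v. v \<in> carrier V ==> H (\<gamma> v) = \<psi> (c **[A] c) *[V] v" using c_X unfolding \<gamma>_def by blast
 hence "H (\<gamma> v) = v" if "v \<in> carrier V" for v using that by (simp add: c_\<phi> \<psi> V.smult_one)
 thus ?thesis by (rule inj_on_inverseI)
qed

end

locale fusion_alg = tl_pair m \<phi> N1 N2 for m \<phi> N1 N2 +
 fixes \<epsilon> :: "tl2_elem => tl_elem"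
 assumes \<epsilon>: "alg_hom (TL2 m N1 N2) (TL m (N1 + N2)) \<epsilon>"
begin

abbreviation A where "A \<equiv> TL m (N1 + N2)"

lemma ring_A: "ring A" by (rule ring_TL) (use N12 in simp)

interpretation R2: ring "TL2 m N1 N2" by (rule ring_TL2[OF N12])

lemma \<epsilon>_closed: "t \<in> C2 ==> \<epsilon> t \<in> carrier A"
 by (rule alg_hom_simps(5)[OF \<epsilon>])

lemma nhoms: "nhom (TL m N1) A (\<lambda>x. \<epsilon> (in1 x))" "nhom (TL m N2) A (\<lambda>x. \<epsilon> (in2 x))"
 unfolding nhom_def using alg_hom_simps[OF \<epsilon> in_closed(1) in_closed(1)] alg_hom_simps[OF \<epsilon> in_closed(2) in_closed(2)]
  in_closed alg_hom_simps(5)[OF \<epsilon>]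
 by (auto simp: in1_mult[OF N12(2)] in2_mult[OF N12(1)])

lemma \<epsilon>_comm: "x \<in> CT N1 ==> y \<in> CT N2 ==> \<epsilon> (in1 x) **[A] \<epsilon> (in2 y) = \<epsilon> (in2 y) **[A] \<epsilon> (in1 x)"
 using alg_hom_simps(1)[OF \<epsilon> in_closed(1) in_closed(2), of x y] alg_hom_simps(1)[OF \<epsilon> in_closed(2) in_closed(1), of y x] in_comm[of x y]
 by simp

lemma \<epsilon>_scale: "x \<in> CT N1 ==> \<epsilon> (in1 (sc c x)) = sc c (\<epsilon> (in1 x))" "y \<in> CT N2 ==> \<epsilon> (in2 (sc c y)) = sc c (\<epsilon> (in2 y))"
 using alg_hom_simps(3)[OF \<epsilon> in_closed(1) in_closed(1), of x x] alg_hom_simps(3)[OF \<epsilon> in_closed(2) in_closed(2), of y y]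
 by (simp_all add: push_sc)

lemma \<epsilon>_one: "\<epsilon> (single (id_diagram, id_diagram) c) = cst c"
proof -
 have "\<epsilon> (sc c (single (id_diagram, id_diagram) 1)) = sc c (cst 1)"
  using alg_hom_simps(3)[OF \<epsilon> R2.one_closed R2.one_closed, of c] alg_hom_simps(4)[OF \<epsilon> R2.one_closed R2.one_closed] by (simp del: sc_single)
 thus ?thesis by simp
qed

end

locale fusion_module = outer m \<phi> N1 N2 M1 M2 + fusion_alg m \<phi> N1 N2 \<epsilon>
 for m \<phi> N1 N2 and M1 :: "(tl_elem, 'v) module" and M2 :: "(tl_elem, 'w) module" and \<epsilon>
begin

interpretation A: ring A by (rule ring_A)
interpretation M1: left_module "TL m N1" M1 by (rule M1)
interpretation M2: left_module "TL m N2" M2 by (rule M2)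
interpretation L: left_module "TL2 m N1 N2" T by (rule left_module_outer)

sublocale I: induced A "carrier A" "TL2 m N1 N2" \<epsilon> T
 by (rule induced.intro[OF ring_A])
  (use A.abelian_group_axioms in \<open>auto simp: \<epsilon>_closed left_module_outer simp del: TL_simps TL2_simps\<close>)

definition ft where "ft t x = I.tens t x"

lemma ft:
 "t \<in> carrier A ==> x \<in> carrier T ==> ft t x \<in> carrier I.T"
 "t \<in> carrier A ==> t' \<in> carrier A ==> x \<in> carrier T ==> ft (t +[A] t') x = ft t x +[I.T] ft t' x"
 "t \<in> carrier A ==> x \<in> carrier T ==> x' \<in> carrier T ==> ft t (x +[T] x') = ft t x +[I.T] ft t x'"
 "t \<in> carrier A ==> b \<in> carrier (TL2 m N1 N2) ==> x \<in> carrier T ==> ft (t **[A] \<epsilon> b) x = ft t (b *[T] x)"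
 "a \<in> carrier A ==> t \<in> carrier A ==> x \<in> carrier T ==> a *[I.T] ft t x = ft (a **[A] t) x"
 unfolding ft_def by (fact I.T_facts I.smult_tens(2))+

lemmas ft_induct = I.induced_induct[folded ft_def, consumes 1, case_names zero gen add]

definition \<beta> where "\<beta> v w = ft \<one>\<^bsub>A\<^esub> (otens v w)"

lemma smult_tens_one: "t \<in> carrier A ==> o' \<in> carrier T ==> t *[I.T] ft \<one>\<^bsub>A\<^esub> o' = ft t o'"
 using ft(5)[of t "\<one>\<^bsub>A\<^esub>" o'] A.one_closed A.r_one[of t] by (simp del: TL_simps)

lemma \<epsilon>_tens: "z \<in> carrier (TL2 m N1 N2) ==> o' \<in> carrier T ==> \<epsilon> z *[I.T] ft \<one>\<^bsub>A\<^esub> o' = ft \<one>\<^bsub>A\<^esub> (z *[T] o')"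
 using ft(4)[of "\<one>\<^bsub>A\<^esub>" z o'] smult_tens_one[of "\<epsilon> z" o'] A.one_closed A.l_one[of "\<epsilon> z"] by (simp add: \<epsilon>_closed del: TL_simps)

lemma fus_map_\<beta>: "fus_map (TL m N1) (\<lambda>x. \<epsilon> (in1 x)) M1 (TL m N2) (\<lambda>x. \<epsilon> (in2 x)) M2 I.T \<beta>"
 unfolding fus_map_def biadditive_def \<beta>_def
 by (simp add: ft(1,3) T_facts \<epsilon>_tens in_closed in1_smult in2_smult A.one_closed del: TL_simps)

lemma tens_zero: "t \<in> carrier A ==> ft t \<zero>\<^bsub>T\<^esub> = \<zero>\<^bsub>I.T\<^esub>"
 by (rule add_hom_zero[OF T_facts(1) I.T_facts(1), of "ft t"]) (auto simp: add_hom_def ft(1,3))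

lemma fus_mod: "fus_mod A (TL m N1) (\<lambda>x. \<epsilon> (in1 x)) M1 (TL m N2) (\<lambda>x. \<epsilon> (in2 x)) M2 I.T \<beta>"
proof -
 have "generates A I.T {\<beta> a b | a b. a \<in> carrier M1 \<and> b \<in> carrier M2}"
  unfolding generates_def
 proof (intro conjI allI impI subsetI)
  fix y assume "y \<in> {\<beta> a b | a b. a \<in> carrier M1 \<and> b \<in> carrier M2}"
  thus "y \<in> carrier I.T" using fus_mapD(1)[OF fus_map_\<beta>] by auto
 next
  fix U y assume U: "\<zero>\<^bsub>I.T\<^esub> \<in> U \<and> (\<forall>x\<in>U \<inter> carrier I.T. \<forall>y\<in>U \<inter> carrier I.T. x +[I.T] y \<in> U) \<and>
   (\<forall>a\<in>carrier A. \<forall>s\<in>{\<beta> a b | a b. a \<in> carrier M1 \<and> b \<in> carrier M2}. a *[I.T] s \<in> U)" and y: "y \<in> carrier I.T"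
  have t: "ft t o' \<in> U" if t: "t \<in> carrier A" and "o' \<in> carrier T" for t o'
   using that(2)
  proof (induction rule: outer_induct)
   case zero
   thus ?case using U t by (simp add: tens_zero del: TL_simps)
  next
   case (tens v w)
   hence "t *[I.T] \<beta> v w \<in> U" using U t by blast
   thus ?case using tens t by (simp add: \<beta>_def smult_tens_one T_facts del: TL_simps)
  next
   case (add a b)
   thus ?case using U t by (simp add: ft del: TL_simps)
  qed
  from y show "y \<in> U" by (induction rule: ft_induct) (use U t in auto)
 qed
 thus ?thesis using fus_map_\<beta> by (simp add: fus_mod_def I.left_module_induced)
qed

text \<open>The map is lifted twice, to the tensor product over the complex numbers and then to the
  induced module. In between, compatibility with all of \<epsilon> is recovered from the two
  factors, as each basis element is a product of one from each factor.\<close>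

lemma fus_lift:
 assumes W: "left_module A W"
 shows "fus_lift A (TL m N1) (\<lambda>x. \<epsilon> (in1 x)) M1 (TL m N2) (\<lambda>x. \<epsilon> (in2 x)) M2 I.T \<beta> W"
 unfolding fus_lift_def
proof (intro allI impI)
 fix h assume h: "fus_map (TL m N1) (\<lambda>x. \<epsilon> (in1 x)) M1 (TL m N2) (\<lambda>x. \<epsilon> (in2 x)) M2 W h"
 interpret W: left_module A W by (rule W)
 note hD = fus_mapD[OF h]
 have "\<exists>H. add_hom T W H \<and> (\<forall>v\<in>carrier M1. \<forall>w\<in>carrier M2. H (otens v w) = h v w)"
 proof (rule outer_lift[OF W.M.abelian_group_axioms])
  show "biadditive M1 M2 W h" using h by (simp add: fus_map_def)
  show "h (single id_diagram c *[M1] v) w = h v (single id_diagram c *[M2] w)"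
   if "v \<in> carrier M1" "w \<in> carrier M2" for v c w
   using hD(4)[OF that id1(1)[of c]] hD(5)[OF that id1(2)[of c]] by simp
 qed
 then obtain h0 where h0: "add_hom T W h0" "!!v w. v \<in> carrier M1 ==> w \<in> carrier M2 ==> h0 (otens v w) = h v w" by blast
 note h0D = add_homD[OF h0(1)]
 have h00: "h0 \<zero>\<^bsub>T\<^esub> = \<zero>\<^bsub>W\<^esub>" by (rule add_hom_zero[OF T_facts(1) W.M.abelian_group_axioms h0(1)])
 have \<epsilon>z: "\<epsilon> z *[W] h0 (otens v w) = h0 (z *[T] otens v w)"
  if z: "z \<in> carrier (TL2 m N1 N2)" and v: "v \<in> carrier M1" "w \<in> carrier M2" for z v w
  using z
 proof (induction z rule: TL2_induct)
  case zero
  have "\<epsilon> 0 +[A] \<epsilon> 0 = \<epsilon> 0" using alg_hom_simps(2)[OF \<epsilon> L.R.zero_closed L.R.zero_closed] by simp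
  hence "\<epsilon> 0 = \<zero>\<^bsub>A\<^esub>" by simp
  thus ?case using left_module_zero[OF W hD(1)[OF v]] left_module_zero[OF left_module_outer T_facts(2)[OF v]] v
   by (simp add: h0(2) h00)
 next
  case (add t a b c)
  let ?x = "single a c" and ?y = "single b 1"
  have cl: "?x \<in> CT N1" "?y \<in> CT N2" by (intro single_closed add)+
  note inc = in_closed(1)[OF cl(1)] in_closed(2)[OF cl(2)]
  have s: "single (a, b) c = in1 ?x **[TL2 m N1 N2] in2 ?y" using single_pair add by simp
  have w: "?y *[M2] w \<in> carrier M2" by (rule M2.smult_closed[OF cl(2) v(2)])
  have "\<epsilon> (single (a, b) c) *[W] h v w = h (?x *[M1] v) (?y *[M2] w)"
   unfolding s alg_hom_simps(1)[OF \<epsilon> inc] W.smult_assoc[OF \<epsilon>_closed[OF inc(1)] \<epsilon>_closed[OF inc(2)] hD(1)[OF v]]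
   by (simp only: hD(5)[OF v cl(2)] hD(4)[OF v(1) w cl(1)])
  moreover have "single (a, b) c *[T] otens v w = otens (?x *[M1] v) (?y *[M2] w)"
   by (rule osmult_single[OF add.hyps(2,3) v])
  moreover have "\<epsilon> (t + single (a, b) c) = \<epsilon> t +[A] \<epsilon> (single (a, b) c)"
   using alg_hom_simps(2)[OF \<epsilon> add.hyps(1,4)] by simp
  moreover have "(t + single (a, b) c) *[T] otens v w = t *[T] otens v w +[T] single (a, b) c *[T] otens v w"
   by (rule osmult_add[OF add.hyps(1,4) v])
  ultimately show ?case
   using add v w cl W.smult_l_distr[OF \<epsilon>_closed[OF add.hyps(1)] \<epsilon>_closed[OF add.hyps(4)] hD(1)[OF v]]
   by (simp add: h0(2) h0D L.smult_closed T_facts M1.smult_closed del: TL_simps)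
 qed
 have \<epsilon>o: "\<epsilon> z *[W] h0 o' = h0 (z *[T] o')" if z: "z \<in> carrier (TL2 m N1 N2)" and o': "o' \<in> carrier T" for z o'
  using o'
 proof (induction rule: outer_induct)
  case zero
  show ?case by (simp add: h00 smult_zero[OF W \<epsilon>_closed[OF z]] smult_zero[OF left_module_outer z])
 next
  case (add a b)
  thus ?case using z by (simp add: h0D L.smult_closed L.smult_r_distr W.smult_r_distr \<epsilon>_closed)
 qed (rule \<epsilon>z[OF z])
 have "\<exists>H. lin A I.T W H \<and> (\<forall>x\<in>carrier A. \<forall>v\<in>carrier T. H (ft x v) = x *[W] h0 v)"
 proof (rule I.induced_lin[OF W, folded ft_def])
  show "biadditive (A\<lparr>carrier := carrier A\<rparr>) T W (\<lambda>x v. x *[W] h0 v)"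
   unfolding biadditive_def by (simp add: h0D W.smult_closed W.smult_l_distr W.smult_r_distr del: TL_simps)
  show "(x **[A] \<epsilon> b) *[W] h0 v = x *[W] h0 (b *[T] v)"
   if "x \<in> carrier A" "b \<in> carrier (TL2 m N1 N2)" "v \<in> carrier T" for x b v
   using that by (simp add: W.smult_assoc \<epsilon>_closed h0D \<epsilon>o del: TL_simps)
  show "(a **[A] x) *[W] h0 v = a *[W] (x *[W] h0 v)" if "a \<in> carrier A" "x \<in> carrier A" "v \<in> carrier T" for a x v
   by (rule W.smult_assoc[OF that(1,2) h0D(1)[OF that(3)]])
 qed
 then obtain H where H: "lin A I.T W H" "!!x v. x \<in> carrier A ==> v \<in> carrier T ==> H (ft x v) = x *[W] h0 v" by blast
 hence "lin A I.T W H" by simp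
 moreover have "H (\<beta> a b) = h a b" if "a \<in> carrier M1" "b \<in> carrier M2" for a b
  using that H(2)[OF A.one_closed T_facts(2)[OF that]] W.smult_one[OF hD(1)[OF that]] by (simp add: \<beta>_def h0(2) del: TL_simps)
 ultimately show "\<exists>F. lin A I.T W F \<and> (\<forall>a\<in>carrier M1. \<forall>b\<in>carrier M2. F (\<beta> a b) = h a b)" by blast
qed

end

section \<open>Intertwining elements\<close>

abbreviation rot :: "int => tl_elem" where "rot k \<equiv> single (tdiag k) 1"

context tl_corners begin

text \<open>The map \<phi> is an isomorphism onto the corner, whose unit is the idempotent; into the
  whole algebra it is a homomorphism that sends the unit to that idempotent.\<close>

lemma \<phi>_facts:
 assumes K: "K >= 1"
 shows "nhom (TL m K) (TL m (K + 2)) (\<phi> K)" "\<phi> K (cst 1) = corner_idem m K"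
  "x \<in> carrier (TL m K) ==> \<phi> K (sc c x) = sc c (\<phi> K x)"
  "bij_betw (\<phi> K) (carrier (TL m K)) {tl_mult m (K + 2) (tl_mult m (K + 2) (corner_idem m K) x) (corner_idem m K) | x. x \<in> carrier (TL m (K + 2))}"
  "\<phi> K u_gen = sc m (tl_mult m (K + 2) (tl_mult m (K + 2) (corner_idem m K) u_gen) (corner_idem m K))"
  "j \<in> {1..<K} ==> \<phi> K (e_gen K (int j)) = tl_mult m (K + 2) (corner_idem m K) (e_gen (K + 2) (int j))"
proof -
 have iso: "alg_hom (TL m K) (corner_algebra m K) (\<phi> K)" "bij_betw (\<phi> K) (carrier (TL m K)) (carrier (corner_algebra m K))"
  using \<phi>[OF K] by (simp_all add: corner_iso_def Let_def alg_iso_def)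
 have car: "carrier (corner_algebra m K) = {tl_mult m (K + 2) (tl_mult m (K + 2) (corner_idem m K) x) (corner_idem m K) | x. x \<in> carrier (TL m (K + 2))}"
  by (simp add: corner_algebra_def Let_def)
 interpret S: ring "TL m K" by (rule ring_TL[OF K])
 interpret B: ring "TL m (K + 2)" by (rule ring_TL) simp
 have c: "corner_idem m K \<in> carrier (TL m (K + 2))" by (auto simp: corner_idem_eq carrier_TL affine_e)
 have sub: "carrier (corner_algebra m K) \<subseteq> carrier (TL m (K + 2))"
  unfolding car using B.m_closed[OF B.m_closed[OF c] c] by auto
 note H = alg_hom_simps[OF iso(1), simplified]
 show "nhom (TL m K) (TL m (K + 2)) (\<phi> K)" unfolding nhom_def using H sub by auto
 show "\<phi> K (cst 1) = corner_idem m K" using H(4)[OF S.one_closed S.one_closed] by simp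
 show "x \<in> carrier (TL m K) ==> \<phi> K (sc c x) = sc c (\<phi> K x)" using H(3)[of x x c] by simp
 show "bij_betw (\<phi> K) (carrier (TL m K)) {tl_mult m (K + 2) (tl_mult m (K + 2) (corner_idem m K) x) (corner_idem m K) | x. x \<in> carrier (TL m (K + 2))}"
  using iso(2) unfolding car .
 show "\<phi> K u_gen = sc m (tl_mult m (K + 2) (tl_mult m (K + 2) (corner_idem m K) u_gen) (corner_idem m K))"
  "j \<in> {1..<K} ==> \<phi> K (e_gen K (int j)) = tl_mult m (K + 2) (corner_idem m K) (e_gen (K + 2) (int j))"
  using \<phi>[OF K] by (simp_all add: corner_iso_def Let_def)
qed

end

lemma nhom_comp: "nhom R A f ==> nhom A B g ==> nhom R B (\<lambda>x. g (f x))"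
 by (auto simp: nhom_def)

context tl_alg begin

text \<open>The relation is stable under sums, scalars and products, so generators suffice. For the
  inverse of \<open>u\<close> it follows from the one for \<open>u\<close> by multiplying with the
  images of the inverse on both sides.\<close>

lemma intertwine:
 assumes K: "K >= 1" and F: "nhom (TL m K) (TL m N) F" "!!c x. x \<in> CT K ==> F (sc c x) = sc c (F x)"
  and F': "nhom (TL m K) (TL m N) F'" "!!c x. x \<in> CT K ==> F' (sc c x) = sc c (F' x)"
  and X: "X \<in> C" "F (cst 1) ** X = X" "X ** F' (cst 1) = X"
  and u: "F u_gen ** X = X ** F' u_gen" and e: "K >= 2 ==> F (e_gen K 1) ** X = X ** F' (e_gen K 1)"
  and x: "x \<in> CT K"
 shows "F x ** X = X ** F' x"
proof -
 have mem: "x \<in> CT K" if "x \<in> gen_alg m K" for x using that TL_gen_alg[OF K] by simp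
 note FD = nhomD[OF F(1) mem, simplified mult_TL] and FE = nhomD[OF F'(1) mem, simplified mult_TL]
 note un = gen_alg.one[of m K] and uu = gen_alg.u[of m K] and ui = gen_alg.u_inv[of m K]
 have inv: "tl_mult m K u_gen u_inv_gen = cst 1" "tl_mult m K u_inv_gen u_gen = cst 1"
  using K by (simp_all add: u_gen_def u_inv_gen_def diagrams_trans trans_comp)
 have unit: "tl_mult m K (cst 1) (cst 1) = cst 1"
  using K by (simp add: diagrams_trans trans_comp)
 from x have "x \<in> gen_alg m K" by (simp add: TL_gen_alg[OF K])
 thus ?thesis
 proof (induction rule: gen_alg.induct)
  case one
  show ?case using X by simp
 next
  case u_inv
  have "F u_inv_gen ** X = F u_inv_gen ** X ** F' (cst 1)" by (simp add: X)
  also have "\<dots> = F u_inv_gen ** (X ** F' u_gen) ** F' u_inv_gen"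
   using FE(3)[OF uu mem[OF ui]] inv X FD(1)[OF ui] FE(1)[OF uu] FE(1)[OF ui] by simp
  also have "\<dots> = (F u_inv_gen ** F u_gen) ** X ** F' u_inv_gen"
   unfolding u[symmetric] using X FD(1)[OF ui] FD(1)[OF uu] FE(1)[OF ui] by simp
  also have "F u_inv_gen ** F u_gen = F (cst 1)" using FD(3)[OF ui mem[OF uu]] inv by simp
  also have "F (cst 1) ** X ** F' u_inv_gen = (F (cst 1) ** X) ** F' u_inv_gen"
   by (rule assoc[symmetric, OF FD(1)[OF un] X(1) FE(1)[OF ui]])
  finally show ?case by (simp add: X)
 next
  case (add x y)
  thus ?case using FD(2)[OF add(1) mem[OF add(2)]] FE(2)[OF add(1) mem[OF add(2)]] by simp
 next
  case (scale x c)
  thus ?case using F(2) F'(2) mem by simp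
 next
  case (mult x y)
  note c = FD(1)[OF mult(1)] FD(1)[OF mult(2)] FE(1)[OF mult(1)] FE(1)[OF mult(2)] X(1)
  have "(F x ** F y) ** X = F x ** (X ** F' y)" using c mult by simp
  also have "\<dots> = (F x ** X) ** F' y" using c by simp
  also have "\<dots> = X ** F' x ** F' y" unfolding mult.IH(1) using c by simp
  finally show ?case using FD(3)[OF mult(1) mem[OF mult(2)]] FE(3)[OF mult(1) mem[OF mult(2)]] by simp
 qed (use u e in auto)
qed

text \<open>After multiplication by \<open>cc\<close> every diagram has an arc between neighbours on
  its outer boundary, even if it was a rotation. Rotating this arc to position \<open>N - 1\<close>
  splits off a copy of \<open>cc\<close> on the left.\<close>

lemma corner_span:
 assumes "x \<in> C"
 shows "x ** cc \<in> cspan {rot (int i) ** cc ** y ** cc | i y. i < N \<and> y \<in> C}" (is "_ \<in> cspan ?S")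
 using assms[unfolded carrier_TL mem_Collect_eq]
proof (induction x rule: single_induct)
 case zero
 show ?case by (simp add: cspan.zero)
next
 case (add x d c)
 define eI where "eI j = single (e_diagram N j) (1::complex)" for j
 have cl: "eI j \<in> C" "rot k \<in> C" "single d c \<in> C" for j k
  using affine_e[OF N] affine_trans[OF N1] add by (auto simp: carrier_TL eI_def)
 have E: "E (N - 1) = eI (int N - 1)" using N by (simp add: E_def e_gen_def eI_def of_nat_diff)
 have absorb: "eI j ** single (sg, l) c = sc m (single (sg, l) c)"
  if "per N sg" "sg (Outer j) = Outer (j + 1)" for j sg l c
  using comp_e_absorb_left[OF N that]
  by (simp add: mul_def eI_def e_diagram_pairing comp_diagram_def loop_weight_def)
 have comm: "rot k ** eI j = eI (j - k) ** rot k" for j k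
  using trans_e[OF N] by (simp add: mul_def eI_def loop_weight_tdiag[OF N1])
 obtain sg l where d: "d = (sg, l)" by (cases d)
 have "\<exists>j. eI j ** single d c ** cc = sc m (single d c ** cc)"
 proof -
  have aff: "(sg, l) \<in> AD N" using add d by simp
  hence per: "per N sg" by (simp add: affine_diagrams_def)
  show ?thesis
  proof (cases rule: diagram_cases[OF N1 aff])
   case (1 k)
   let ?j = "int N - 1 - k"
   have sd: "single d c = sc c (rot k)" using 1 d by simp
   have rc: "rot k ** cc = sc (inverse m) (eI ?j ** rot k)" using comm[of k "int N - 1"] by (simp add: cc_def E[simplified])
   have "e_pairing N ?j (Outer ?j) = Outer (?j + 1)" by (simp add: strip_def swap_def)
   hence "eI ?j ** eI ?j = sc m (eI ?j)" using absorb[OF periodic_e[OF N], of ?j ?j 0 1] unfolding eI_def e_diagram_pairing by blast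
   hence "(eI ?j ** eI ?j) ** rot k = sc m (eI ?j ** rot k)" by (simp only: mul_linear)
   hence "eI ?j ** eI ?j ** rot k = sc m (eI ?j ** rot k)" using cl by (simp only: assoc)
   hence "eI ?j ** rot k ** cc = sc m (rot k ** cc)" by (simp add: rc m0)
   hence "eI ?j ** single d c ** cc = sc m (single d c ** cc)"
    unfolding sd mul_linear by (simp only: sc_simps(3) mult.commute)
   thus ?thesis by blast
  next
   case (2 a b)
   have "(eI a ** single d c) ** cc = sc m (single d c ** cc)"
    unfolding d absorb[OF per 2(1)] by (simp only: mul_linear)
   thus ?thesis using cl by (intro exI[of _ a]) (simp add: cc_def)
  qed
 qed
 then obtain j where j: "eI j ** single d c ** cc = sc m (single d c ** cc)" by blast
 \<comment> \<open>The element \<open>e_j\<close> depends on \<open>j\<close> only modulo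
   \<open>N\<close>, so the rotation can be taken from \<open>N\<close> fixed ones. This keeps the
   spanning set finite.\<close>
 define i where "i = nat ((int N - 1 - j) mod int N)"
 have iN: "i < N" "int i = (int N - 1 - j) mod int N" using N by (simp_all add: i_def nat_less_iff)
 have md: "(p - (int N - 1 - int i)) mod int N = (p - j) mod int N" for p
 proof -
  have "(p - (int N - 1 - int i)) mod int N = (p - (int N - 1) + (int N - 1 - j) mod int N) mod int N" by (simp add: iN(2) algebra_simps)
  also have "\<dots> = (p - (int N - 1) + (int N - 1 - j)) mod int N" by (rule mod_add_right_eq)
  finally show ?thesis by (simp add: algebra_simps)
 qed
 have ej: "eI j = eI (int N - 1 - int i)" by (simp only: eI_def e_diagram_def md)
 have rr: "rot (int i) ** rot (- int i) = \<I>" by (simp add: mul_def \<I>_def trans_comp[OF N1] loop_weight_tdiag[OF N1] diagrams_trans)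
 let ?x = "single d c ** cc"
 have xC: "?x \<in> C" "cc \<in> C" using cl by (simp_all add: cc_def)
 have "?x = sc (inverse m) (eI j ** ?x)" unfolding j using m0 by simp
 also have "eI j ** ?x = eI j ** (rot (int i) ** rot (- int i)) ** ?x" using cl xC by (simp add: rr)
 also have "\<dots> = (eI j ** rot (int i)) ** rot (- int i) ** ?x" using cl xC by simp
 also have "\<dots> = (rot (int i) ** E (N - 1)) ** rot (- int i) ** ?x" unfolding ej E comm ..
 also have "sc (inverse m) \<dots> = rot (int i) ** cc ** (rot (- int i) ** single d c) ** cc"
  using cl xC(2) by (simp add: cc_def)
 finally have "?x \<in> ?S" using iN(1) cl by blast
 hence "?x \<in> cspan ?S" by (rule cspan_base)
 thus ?case using add by (simp add: cspan_add)
qed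

lemma corner_idem_cc: assumes "N = n + 2" shows "corner_idem m n = cc"
proof -
 have "int (N - 1) = int n + 1" using assms by simp
 thus ?thesis unfolding corner_idem_def cc_def E_def assms[symmetric] by simp
qed

text \<open>Each letter is sent to \<open>cc\<close> times the letter with the same index. As the
  indices are below \<open>n\<close>, all letters commute with \<open>cc\<close>, and the copies of
  \<open>cc\<close> merge into one.\<close>

lemma \<phi>_prod:
 assumes n: "N = n + 2" "n >= 2" and js: "set js \<subseteq> {1..<n}" and f: "f \<in> letters"
  and h: "!!j. j \<in> {1..<n} ==> h j \<in> CT n \<and> \<phi> n (h j) = cc ** f j"
 shows "alg_prod (TL m n) (map h js) \<in> CT n \<and> \<phi> n (alg_prod (TL m n) (map h js)) = cc ** W f js"
 using js
proof (induction js)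
 case Nil
 interpret S: ring "TL m n" by (rule ring_TL) (use n in simp)
 show ?case using \<phi>_facts(2)[of n] n(2) S.one_closed corner_idem_cc[OF n(1)] by (simp add: alg_prod_def cc_def)
next
 case (Cons j js)
 interpret S: ring "TL m n" by (rule ring_TL) (use n in simp)
 have \<phi>n: "nhom (TL m n) (TL m N) (\<phi> n)" using \<phi>_facts(1)[of n] n by simp
 have "set js \<subseteq> {1..<n}" "j \<in> {1..<n}" using Cons.prems by auto
 note IH = Cons.IH[OF this(1)] and hj = h[OF this(2)]
 have c: "cc \<in> C" "W f js \<in> C" "f j \<in> C" using f by (auto simp: cc_def letters_def)
 have "cc ** W f [j] = W f [j] ** cc" by (rule cc_W[OF f]) (use \<open>j \<in> {1..<n}\<close> n in auto)
 hence jc: "cc ** f j = f j ** cc" using c by simp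
 have p: "alg_prod (TL m n) (map h (j # js)) = h j **[TL m n] alg_prod (TL m n) (map h js)" by (simp add: alg_prod_def)
 have "\<phi> n (h j **[TL m n] alg_prod (TL m n) (map h js)) = (cc ** f j) ** cc ** W f js"
  using nhomD(3)[OF \<phi>n, of "h j" "alg_prod (TL m n) (map h js)"] IH hj unfolding mult_TL by simp
 also have "\<dots> = (cc ** f j) ** W f js"
  unfolding jc using c by (simp add: cc_idem)
 finally show ?case using S.m_closed[of "h j" "alg_prod (TL m n) (map h js)"] IH hj c unfolding p by simp
qed

lemma \<phi>_W:
 assumes n: "N = n + 2" "n >= 2" and js: "set js \<subseteq> {1..<n}"
 shows "\<phi> n (alg_prod (TL m n) (map (g_elem m s n) js)) = cc ** W g js" "alg_prod (TL m n) (map (g_elem m s n) js) \<in> CT n"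
  "\<phi> n (alg_prod (TL m n) (map (g_inv_elem m s n) js)) = cc ** W g' js" "alg_prod (TL m n) (map (g_inv_elem m s n) js) \<in> CT n"
proof -
 interpret S: tl_alg m \<phi> n s by (intro tl_alg.intro tl_corners_axioms tl_alg_axioms.intro n s0 ms)
 have n1: "n >= 1" using n by simp
 note P = \<phi>_facts[OF n1]
 note ci = corner_idem_cc[OF n(1)]
 have lin: "\<phi> n (sc a (sc b S.\<I> - sc c (S.E j))) = cc ** sc a (sc b \<I> - sc c (E j))" if j: "j \<in> {1..<n}" for a b c j
 proof -
  have e: "sc a (sc b S.\<I> - sc c (S.E j)) = sc (a * b) S.\<I> + sc (- (a * c)) (S.E j)"
   by (rule poly_mapping_eqI) (simp add: lookup_add lookup_minus algebra_simps)
  have neg: "sc (- x) y = - sc x y" for x and y :: tl_elem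
   by (rule poly_mapping_eqI) (simp add: lookup_minus)
  have "\<phi> n (S.E j) = cc ** E j" unfolding S.E_def using P(6)[OF j, folded n(1), unfolded ci, folded mul_def E_def] .
  moreover have "\<phi> n S.\<I> = cc" using P(2) by (simp add: S.\<I>_def ci)
  moreover have "\<phi> n (sc (a * b) S.\<I> + sc (- (a * c)) (S.E j)) = \<phi> n (sc (a * b) S.\<I>) + \<phi> n (sc (- (a * c)) (S.E j))"
   using nhomD(2)[OF P(1), of "sc (a * b) S.\<I>" "sc (- (a * c)) (S.E j)"] S.C_closed by simp
  moreover have "cc \<in> C" by (simp add: cc_def)
  ultimately have \<phi>e: "\<phi> n (sc (a * b) S.\<I> + sc (- (a * c)) (S.E j)) = sc (a * b) cc + sc (- (a * c)) (cc ** E j)"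
   using P(3) S.C_closed by simp
  show ?thesis unfolding e \<phi>e by (simp add: neg)
 qed
 have l: "g \<in> letters" "g' \<in> letters" by (simp_all add: letters_def)
 have "g_elem m s n j \<in> CT n \<and> \<phi> n (g_elem m s n j) = cc ** g j"
  "g_inv_elem m s n j \<in> CT n \<and> \<phi> n (g_inv_elem m s n j) = cc ** g' j" if "j \<in> {1..<n}" for j
  unfolding S.g_elem_eq g_def g'_def S.g_def S.g'_def
  using lin[OF that, of \<i> s "inverse s"] lin[OF that, of "- \<i>" "inverse s" s] S.g_closed[of j, unfolded S.g_def S.g'_def] by blast+
 thus "\<phi> n (alg_prod (TL m n) (map (g_elem m s n) js)) = cc ** W g js" "alg_prod (TL m n) (map (g_elem m s n) js) \<in> CT n"
  "\<phi> n (alg_prod (TL m n) (map (g_inv_elem m s n) js)) = cc ** W g' js" "alg_prod (TL m n) (map (g_inv_elem m s n) js) \<in> CT n"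
  using \<phi>_prod[OF n js l(1), of "g_elem m s n"] \<phi>_prod[OF n js l(2), of "g_inv_elem m s n"] by auto
qed

end

section \<open>Fusion and globalization of Temperley-Lieb modules\<close>

locale fusion_setup = tl_corners m \<phi> for m and \<phi> +
 fixes s :: complex and \<epsilon> :: "nat => nat => tl2_elem => tl_elem"
 assumes s0: "s ~= 0" and ms: "m = s\<^sup>2 + inverse (s\<^sup>2)"
  and \<epsilon>: "!!K L. K >= 1 ==> L >= 1 ==> fusion_map m s K L (\<epsilon> K L)"
begin

abbreviation "glo \<equiv> globalize m \<phi>"
abbreviation "fus \<equiv> fusion m \<epsilon>"
abbreviation "ig \<equiv> iterated_glob m \<phi>"

lemma tl_alg: "N >= 2 ==> tl_alg m \<phi> N s"
 by (intro tl_alg.intro tl_corners_axioms tl_alg_axioms.intro s0 ms)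

lemma corner_module:
 assumes K: "K >= 1" and V: "lmod K V"
 shows "corner_module (TL m (K + 2)) (TL m K) (\<phi> K) V"
 by (rule corner_module.intro) (use \<phi>_facts[OF K] V ring_TL K in auto)

lemma globalize_eq:
 assumes K: "K >= 1"
 shows "glo K V = induced_module (TL m (K + 2)) {x **[TL m (K + 2)] \<phi> K \<one>\<^bsub>TL m K\<^esub> | x. x \<in> CT (K + 2)} (TL m K) (\<phi> K) V"
 using \<phi>_facts(2)[OF K] by (simp add: globalize_def)

abbreviation gam where "gam K V \<equiv> corner_module.\<gamma> (TL m (K + 2)) (TL m K) (\<phi> K) V"

lemma globalize:
 assumes K: "K >= 1" and V: "lmod K V"
 shows "glob_mod (TL m (K + 2)) (TL m K) (\<phi> K) V (glo K V) (gam K V)"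
  "lmod (K + 2) W ==> glob_lift (TL m (K + 2)) (TL m K) (\<phi> K) V (glo K V) (gam K V) W"
  "inj_on (gam K V) (carrier V)" "lmod (K + 2) (glo K V)"
proof -
 interpret corner_module "TL m (K + 2)" "TL m K" "\<phi> K" V by (rule corner_module[OF K V])
 show 1: "glob_mod (TL m (K + 2)) (TL m K) (\<phi> K) V (glo K V) (gam K V)"
  unfolding globalize_eq[OF K] by (rule glob_mod)
 show "lmod (K + 2) W ==> glob_lift (TL m (K + 2)) (TL m K) (\<phi> K) V (glo K V) (gam K V) W"
  unfolding globalize_eq[OF K] by (rule glob_lift)
 show "inj_on (gam K V) (carrier V)" by (rule inj_\<gamma>)
 show "lmod (K + 2) (glo K V)" using 1 by (simp add: glob_mod_def)
qed

lemma globalize_cong: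
 assumes "K >= 1" "lmod K V" "lmod K V'" "miso K V V'"
 shows "miso (K + 2) (glo K V) (glo K V')"
 by (rule glob_cong[OF assms(2,4) globalize(1)[OF assms(1,2)] globalize(2)[OF assms(1,2)] globalize(1)[OF assms(1,3)] globalize(2)[OF assms(1,3)]])
  (rule globalize(4)[OF assms(1,3)], rule globalize(4)[OF assms(1,2)])

lemma globalize_reflect:
 assumes K: "K >= 1" and V: "lmod K V" "lmod K V'"
  and iso: "miso (K + 2) (glo K V) (glo K V')"
 shows "miso K V V'"
proof (rule glob_reflect[OF _ _ \<phi>_facts(1)[OF K] _ V globalize(1)[OF K V(1)] globalize(3)[OF K V(1)] globalize(1)[OF K V(2)] globalize(3)[OF K V(2)] iso])
 show "\<phi> K \<one>\<^bsub>TL m K\<^esub> **[TL m (K + 2)] x **[TL m (K + 2)] \<phi> K \<one>\<^bsub>TL m K\<^esub> \<in> \<phi> K ` CT K"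
  if "x \<in> CT (K + 2)" for x
  using bij_betw_imp_surj_on[OF \<phi>_facts(4)[OF K]] that by (auto simp: \<phi>_facts(2)[OF K])
qed (use ring_TL K in auto)

lemma globalize_TL_Mod:
 assumes K: "K >= 1" and V: "V \<in> TL_Mod m K"
 shows "glo K V \<in> TL_Mod m (K + 2)"
proof -
 interpret t: tl_alg m \<phi> "K + 2" s by (rule tl_alg) simp
 have Vm: "lmod K V" "fin_dim (TL m K) V" using V by (simp_all add: TL_Mod_def)
 note cc = t.corner_idem_cc[OF refl]
 define D where "D = (\<lambda>i. t.mul (rot (int i)) t.cc) ` {..<K + 2}"
 note ccC = t.cc_closed
 have rC: "rot k \<in> t.C" for k using affine_trans[of "K + 2"] by (auto simp: carrier_TL)
 have "fin_dim (TL m (K + 2)) (glo K V)"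
 proof (rule fin_dim_glob[OF Vm globalize(1)[OF K Vm(1)] \<phi>_facts(1,3)[OF K]])
  show "finite D" by (simp add: D_def)
  show "D \<subseteq> CT (K + 2)" unfolding D_def by (intro image_subsetI t.C_closed(1) rC ccC)
  fix x assume "x \<in> CT (K + 2)"
  hence "t.mul x t.cc \<in> cspan {t.mul (rot (int i)) (t.mul t.cc (t.mul y t.cc)) | i y. i < K + 2 \<and> y \<in> t.C}"
   by (rule t.corner_span)
  moreover have "{t.mul (rot (int i)) (t.mul t.cc (t.mul y t.cc)) | i y. i < K + 2 \<and> y \<in> t.C} \<subseteq>
   {t.mul d (\<phi> K r) | d r. d \<in> D \<and> r \<in> CT K}"
  proof
   fix z assume "z \<in> {t.mul (rot (int i)) (t.mul t.cc (t.mul y t.cc)) | i y. i < K + 2 \<and> y \<in> t.C}"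
   then obtain i y where z: "z = t.mul (rot (int i)) (t.mul t.cc (t.mul y t.cc))" "i < K + 2" "y \<in> t.C" by blast
   have "t.mul (t.mul t.cc y) t.cc \<in> \<phi> K ` CT K"
    unfolding bij_betw_imp_surj_on[OF \<phi>_facts(4)[OF K]] t.mul_def cc[symmetric] using z(3) by blast
   then obtain r where r: "r \<in> CT K" "t.mul t.cc (t.mul y t.cc) = \<phi> K r"
    unfolding t.assoc[OF ccC z(3) ccC] by blast
   have "z = t.mul (t.mul (rot (int i)) t.cc) (\<phi> K r)"
    unfolding z(1) r(2)[symmetric] t.assoc[OF rC ccC t.C_closed(1)[OF ccC t.C_closed(1)[OF z(3) ccC]]]
     t.cc_idem(2)[OF t.C_closed(1)[OF z(3) ccC]] ..
   thus "z \<in> {t.mul d (\<phi> K r) | d r. d \<in> D \<and> r \<in> CT K}" using z r by (auto simp: D_def)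
  qed
  ultimately show "tl_mult m (K + 2) x (\<phi> K (cst 1)) \<in> cspan {tl_mult m (K + 2) d (\<phi> K r) | d r. d \<in> D \<and> r \<in> CT K}"
   using cspan_subset[of _ "{t.mul d (\<phi> K r) | d r. d \<in> D \<and> r \<in> CT K}"] cspan_base
   unfolding \<phi>_facts(2)[OF K] cc t.mul_def by blast
 qed
 thus ?thesis using globalize(4)[OF K Vm(1)] by (simp add: TL_Mod_def)
qed

lemma fusion_alg:
 assumes K: "K >= 1" "L >= 1" shows "fusion_alg m \<phi> K L (\<epsilon> K L)"
proof -
 have "alg_hom (TL2 m K L) (TL m (K + L)) (\<epsilon> K L)" using \<epsilon>[OF K] by (simp add: fusion_map_def Let_def)
 thus ?thesis by (intro fusion_alg.intro tl_pair.intro tl_corners_axioms tl_pair_axioms.intro fusion_alg_axioms.intro K)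
qed

lemma fusion_module:
 assumes "K >= 1" "L >= 1" "lmod K M1" "lmod L M2"
 shows "fusion_module m \<phi> K L M1 M2 (\<epsilon> K L)"
 by (intro fusion_module.intro outer.intro tl_pair.intro tl_corners_axioms tl_pair_axioms.intro outer_axioms.intro fusion_alg assms)

abbreviation bet where "bet K L M1 M2 \<equiv> fusion_module.\<beta> m K L M1 M2 (\<epsilon> K L)"
abbreviation f1 where "f1 K L \<equiv> \<lambda>x. \<epsilon> K L (in1 x)"
abbreviation f2 where "f2 K L \<equiv> \<lambda>x. \<epsilon> K L (in2 x)"

lemma fusion:
 assumes K: "K >= 1" "L >= 1" and M: "lmod K M1" "lmod L M2"
 shows "fus_mod (TL m (K + L)) (TL m K) (f1 K L) M1 (TL m L) (f2 K L) M2 (fus K M1 L M2) (bet K L M1 M2)"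
  "lmod (K + L) W ==>
   fus_lift (TL m (K + L)) (TL m K) (f1 K L) M1 (TL m L) (f2 K L) M2 (fus K M1 L M2) (bet K L M1 M2) W"
  "lmod (K + L) (fus K M1 L M2)"
proof -
 interpret fusion_module m \<phi> K L M1 M2 "\<epsilon> K L" by (rule fusion_module[OF K M])
 show 1: "fus_mod (TL m (K + L)) (TL m K) (f1 K L) M1 (TL m L) (f2 K L) M2 (fus K M1 L M2) (bet K L M1 M2)"
  unfolding fusion_def by (rule fus_mod)
 show "lmod (K + L) W ==>
   fus_lift (TL m (K + L)) (TL m K) (f1 K L) M1 (TL m L) (f2 K L) M2 (fus K M1 L M2) (bet K L M1 M2) W"
  unfolding fusion_def by (rule fus_lift)
 show "lmod (K + L) (fus K M1 L M2)" using 1 by (simp add: fus_mod_def)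
qed

lemma fusion_cong:
 assumes K: "K >= 1" "L >= 1" and M: "lmod K M1" "lmod L M2" "lmod K M1'" "lmod L M2'"
  and iso: "miso K M1 M1'" "miso L M2 M2'"
 shows "miso (K + L) (fus K M1 L M2) (fus K M1' L M2')"
 by (rule fus_cong[OF M(1,2) iso fusion(1)[OF K M(1,2)] fusion(2)[OF K M(1,2)] fusion(1)[OF K M(3,4)] fusion(2)[OF K M(3,4)]])
  (rule fusion(3)[OF K M(3,4)], rule fusion(3)[OF K M(1,2)])


lemma \<epsilon>_facts:
 assumes K: "K >= 1" "L >= 1"
 shows "nhom (TL m K) (TL m (K + L)) (f1 K L)" "nhom (TL m L) (TL m (K + L)) (f2 K L)"
  "x \<in> CT K ==> f1 K L (sc c x) = sc c (f1 K L x)" "y \<in> CT L ==> f2 K L (sc c y) = sc c (f2 K L y)"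
  "f1 K L (cst c) = cst c" "f2 K L (cst c) = cst c"
  "x \<in> CT K ==> y \<in> CT L ==> tl_mult m (K + L) (f1 K L x) (f2 K L y) = tl_mult m (K + L) (f2 K L y) (f1 K L x)"
  "j \<in> {1..<K} ==> f1 K L (e_gen K (int j)) = e_gen (K + L) (int j)"
  "j \<in> {1..<L} ==> f2 K L (e_gen L (int j)) = e_gen (K + L) (int (K + j))"
  "f1 K L u_gen = tl_mult m (K + L) u_gen (alg_prod (TL m (K + L)) (map (g_inv_elem m s (K + L)) (rev [K..<K + L])))"
  "f2 K L u_gen = tl_mult m (K + L) (alg_prod (TL m (K + L)) (map (g_elem m s (K + L)) (rev [1..<K + 1]))) u_gen"
proof -
 note fm = \<epsilon>[OF K]
 interpret fusion_alg m \<phi> K L "\<epsilon> K L" by (rule fusion_alg[OF K])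
 show "nhom (TL m K) (TL m (K + L)) (f1 K L)" "nhom (TL m L) (TL m (K + L)) (f2 K L)" by (rule nhoms)+
 show "x \<in> CT K ==> f1 K L (sc c x) = sc c (f1 K L x)" "y \<in> CT L ==> f2 K L (sc c y) = sc c (f2 K L y)"
  by (rule \<epsilon>_scale; assumption)+
 show "f1 K L (cst c) = cst c" "f2 K L (cst c) = cst c" by (simp_all add: \<epsilon>_one)
 show "x \<in> CT K ==> y \<in> CT L ==> tl_mult m (K + L) (f1 K L x) (f2 K L y) = tl_mult m (K + L) (f2 K L y) (f1 K L x)"
  using \<epsilon>_comm[of x y] by simp
 show "j \<in> {1..<K} ==> f1 K L (e_gen K (int j)) = e_gen (K + L) (int j)"
  "j \<in> {1..<L} ==> f2 K L (e_gen L (int j)) = e_gen (K + L) (int (K + j))"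
  "f1 K L u_gen = tl_mult m (K + L) u_gen (alg_prod (TL m (K + L)) (map (g_inv_elem m s (K + L)) (rev [K..<K + L])))"
  "f2 K L u_gen = tl_mult m (K + L) (alg_prod (TL m (K + L)) (map (g_elem m s (K + L)) (rev [1..<K + 1]))) u_gen"
  using fm by (simp_all add: fusion_map_def Let_def in_fst_def in_snd_def e_gen_def u_gen_def)
qed

text \<open>\<open>finite_over_image\<close> is applied to the image of \<epsilon>, the images of
  the inverse translations serving as \<open>V1\<close> and \<open>V2\<close>. Elements of the image
  are then expanded into products of one element from each factor, the form in which they act on the
  generators of the fusion.\<close>

lemma fusion_TL_Mod:
 assumes K: "K >= 1" "L >= 1" and M: "M1 \<in> TL_Mod m K" "M2 \<in> TL_Mod m L"
 shows "fus K M1 L M2 \<in> TL_Mod m (K + L)"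
proof -
 interpret fusion_alg m \<phi> K L "\<epsilon> K L" by (rule fusion_alg[OF K])
 interpret t: tl_alg m \<phi> "K + L" s by (rule tl_alg) (use K in simp)
 interpret R1: ring "TL m K" by (rule ring_TL[OF K(1)])
 interpret R2: ring "TL m L" by (rule ring_TL[OF K(2)])
 interpret R: ring "TL2 m K L" by (rule ring_TL2[OF K])
 have m: "lmod K M1" "fin_dim (TL m K) M1" "lmod L M2" "fin_dim (TL m L) M2"
  using M by (simp_all add: TL_Mod_def)
 note e = \<epsilon>_facts[OF K]
 note H = alg_hom_simps[OF local.\<epsilon>]
 define Rg where "Rg = \<epsilon> K L ` carrier (TL2 m K L)"
 have in1R: "f1 K L x \<in> Rg" if "x \<in> CT K" for x using in_closed(1)[OF that] by (auto simp: Rg_def)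
 have in2R: "f2 K L x \<in> Rg" if "x \<in> CT L" for x using in_closed(2)[OF that] by (auto simp: Rg_def)
 have gens: "u_gen \<in> CT n" "u_inv_gen \<in> CT n" "tl_mult m n u_inv_gen u_gen = cst 1" if "n >= 1" for n
  using that affine_trans[of n] by (auto simp: carrier_TL u_gen_def u_inv_gen_def diagrams_trans trans_comp)
 have eg: "e_gen n j \<in> CT n" if "n >= 2" for n j using affine_e[OF that] by (auto simp: carrier_TL e_gen_def)
 have "\<exists>S. finite S \<and> S \<subseteq> t.C \<and> t.C \<subseteq> cspan {t.mul h r | h r. h \<in> S \<and> r \<in> Rg}"
 proof (rule t.finite_over_image)
  show "1 <= K" "K < K + L" using K by auto
  show "Rg \<subseteq> t.C" using \<epsilon>_closed by (auto simp: Rg_def)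
  show "t.\<I> \<in> Rg" using \<epsilon>_one[of 1] R.one_closed unfolding Rg_def t.\<I>_def by force
  show "t.mul x y \<in> Rg" "x + y \<in> Rg" if xy: "x \<in> Rg" "y \<in> Rg" for x y
  proof -
   obtain a b where ab: "x = \<epsilon> K L a" "y = \<epsilon> K L b" "a \<in> carrier (TL2 m K L)" "b \<in> carrier (TL2 m K L)" using xy by (auto simp: Rg_def)
   show "t.mul x y \<in> Rg" "x + y \<in> Rg"
    using H(1,2)[OF ab(3,4)] imageI[OF R.m_closed[OF ab(3,4)], of "\<epsilon> K L"] imageI[OF R.a_closed[OF ab(3,4)], of "\<epsilon> K L"]
    by (simp_all add: Rg_def ab(1,2) t.mul_def)
  qed
  show "sc c x \<in> Rg" if x: "x \<in> Rg" for c x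
  proof -
   obtain a where a: "x = \<epsilon> K L a" "a \<in> carrier (TL2 m K L)" using x by (auto simp: Rg_def)
   have "sc c a \<in> carrier (TL2 m K L)" using order_trans[OF keys_sc] a(2) by (simp add: carrier_TL2)
   thus ?thesis using H(3)[OF a(2,2), of c] imageI[of "sc c a" _ "\<epsilon> K L"] by (simp add: Rg_def a(1))
  qed
  show "t.E j \<in> Rg" if "1 <= j" "j < K + L" "j ~= K" for j
  proof (cases "j < K")
   case True
   thus ?thesis using that e(8)[of j] in1R[OF eg[of K "int j"]] by (simp add: t.E_def)
  next
   case False
   hence j: "j - K \<in> {1..<L}" "K + (j - K) = j" "L >= 2" using that by auto
   show ?thesis using e(9)[OF j(1)] in2R[OF eg[OF j(3), of "int (j - K)"]] by (simp only: t.E_def j(2))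
  qed
  have u: "t.mul u_gen (t.W t.g' (rev [K..<K + L])) = f1 K L u_gen" "t.mul (t.W t.g (rev [1..<Suc K])) u_gen = f2 K L u_gen"
   using e(10,11) by (simp_all add: t.W_def t.mul_def t.g_elem_eq[abs_def])
  show "t.mul u_gen (t.W t.g' (rev [K..<K + L])) \<in> Rg" "t.mul (t.W t.g (rev [1..<Suc K])) u_gen \<in> Rg"
   unfolding u using in1R in2R gens K by auto
  show "f1 K L u_inv_gen \<in> Rg" "f2 K L u_inv_gen \<in> Rg" using in1R in2R gens K by auto
  show "t.mul (f1 K L u_inv_gen) (t.mul u_gen (t.W t.g' (rev [K..<K + L]))) = t.\<I>"
   unfolding u using nhomD(3)[OF e(1) gens(2)[OF K(1)] gens(1)[OF K(1)]] gens(3)[OF K(1)] e(5)[of 1] by (simp add: t.mul_def t.\<I>_def)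
  show "t.mul (f2 K L u_inv_gen) (t.mul (t.W t.g (rev [1..<Suc K])) u_gen) = t.\<I>"
   unfolding u using nhomD(3)[OF e(2) gens(2)[OF K(2)] gens(1)[OF K(2)]] gens(3)[OF K(2)] e(6)[of 1] by (simp add: t.mul_def t.\<I>_def)
 qed
 then obtain D where D: "finite D" "D \<subseteq> t.C" "t.C \<subseteq> cspan {t.mul h r | h r. h \<in> D \<and> r \<in> Rg}" by blast
 let ?S = "{t.mul d (t.mul (f1 K L a) (f2 K L b)) | d a b. d \<in> D \<and> a \<in> CT K \<and> b \<in> CT L}"
 have "t.mul h (\<epsilon> K L z) \<in> cspan ?S" if h: "h \<in> D" and z: "z \<in> carrier (TL2 m K L)" for h z
  using z
 proof (induction z rule: TL2_induct)
  case zero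
  have "\<epsilon> K L 0 = 0" using H(2)[OF R.zero_closed R.zero_closed] by simp
  thus ?case by (simp add: cspan.zero)
 next
  case (add z a b c)
  let ?a = "single a c" and ?b = "single b (1::complex)"
  have cl: "?a \<in> CT K" "?b \<in> CT L" using add by (auto simp: carrier_TL)
  have "\<epsilon> K L (single (a, b) c) = t.mul (f1 K L ?a) (f2 K L ?b)"
   using H(1)[OF in_closed(1)[OF cl(1)] in_closed(2)[OF cl(2)]] single_pair[OF add.hyps(2,3), of c] by (simp add: t.mul_def)
  moreover have "t.mul h (t.mul (f1 K L ?a) (f2 K L ?b)) \<in> cspan ?S" using h cl by (intro cspan_base) blast
  ultimately show ?case using H(2)[OF add.hyps(1,4)] add.IH by (simp add: cspan_add)
 qed
 hence "{t.mul h r | h r. h \<in> D \<and> r \<in> Rg} \<subseteq> cspan ?S" by (auto simp: Rg_def)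
 hence "x \<in> cspan ?S" if "x \<in> CT (K + L)" for x using cspan_subset D(3) that by blast
 hence "fin_dim (TL m (K + L)) (fus K M1 L M2)"
  unfolding t.mul_def by (rule fin_dim_fus[OF m fusion(1)[OF K m(1,3)] e(1,2,5,6) D(1,2)])
 thus ?thesis using fusion(3)[OF K m(1,3)] by (simp add: TL_Mod_def)
qed

end

section \<open>Globalizing one argument of a fusion\<close>

locale fusion_pair = fusion_setup m \<phi> s \<epsilon> for m \<phi> s \<epsilon> +
 fixes K L N :: nat
 assumes KL: "K >= 1" "L >= 1" and N: "N = K + L + 2"
begin

sublocale t: tl_alg m \<phi> N s by (rule tl_alg) (simp add: N)

lemma a: "1 <= K" "K + 3 <= N" and n: "K + L >= 1" "K + L >= 2" and N2: "N - 2 = K + L"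
 using KL by (simp_all add: N)

lemmas q = \<phi>_facts[OF n(1), folded N]
lemmas f = \<epsilon>_facts[OF KL]
lemmas cc = t.corner_idem_cc[OF N]

lemma gens: "j >= 1 ==> u_gen \<in> CT j" "j >= 2 ==> e_gen j i \<in> CT j"
 "j >= 1 ==> cst 1 \<in> CT j"
 using affine_trans[of j] affine_e[of j] id_affine[of j] by (auto simp: carrier_TL u_gen_def diagrams_trans(2) e_gen_def)

abbreviation h1 where "h1 \<equiv> \<lambda>x. \<phi> (K + L) (f1 K L x)"
abbreviation h2 where "h2 \<equiv> \<lambda>x. \<phi> (K + L) (f2 K L x)"

lemma h_lin: "nhom (TL m K) (TL m N) h1" "nhom (TL m L) (TL m N) h2"
 "x \<in> CT K ==> h1 (sc c x) = sc c (h1 x)" "y \<in> CT L ==> h2 (sc c y) = sc c (h2 y)"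
 "h1 (cst 1) = t.cc" "h2 (cst 1) = t.cc"
proof -
 show "nhom (TL m K) (TL m N) h1" "nhom (TL m L) (TL m N) h2" by (rule nhom_comp[OF f(1) q(1)] nhom_comp[OF f(2) q(1)])+
 show "x \<in> CT K ==> h1 (sc c x) = sc c (h1 x)" "y \<in> CT L ==> h2 (sc c y) = sc c (h2 y)"
  using nhomD(1)[OF f(1)] nhomD(1)[OF f(2)] by (simp_all add: f q)
 show "h1 (cst 1) = t.cc" "h2 (cst 1) = t.cc" unfolding f(5,6) q(2) cc by (rule refl)+
qed

text \<open>The images of the small generators in the large algebra, arranged exactly as they occur
  on the right of the sliding lemmas \<open>cup_u1\<close>, \<open>cup_u2\<close>,
  \<open>end_u1\<close> and \<open>end_u2\<close>.\<close>

lemma h_gens: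
 "h1 u_gen = t.mul (sc m (t.mul t.cc (t.mul u_gen t.cc))) (t.mul t.cc (t.W t.g' (rev [K..<N - 2])))"
 "h2 u_gen = t.mul (t.mul t.cc (t.W t.g (rev [1..<K + 1]))) (sc m (t.mul t.cc (t.mul u_gen t.cc)))"
 "K >= 2 ==> h1 (e_gen K 1) = t.mul t.cc (t.E 1)" "L >= 2 ==> h2 (e_gen L 1) = t.mul t.cc (t.E (K + 1))"
proof -
 have W: "set (rev [K..<K + L]) \<subseteq> {1..<K + L}" "set (rev [1..<K + 1]) \<subseteq> {1..<K + L}" using KL by auto
 note w1 = t.\<phi>_W(3,4)[OF N n(2) W(1)] and w2 = t.\<phi>_W(1,2)[OF N n(2) W(2)]
 have u: "\<phi> (K + L) u_gen = sc m (t.mul t.cc (t.mul u_gen t.cc))"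
  using q(5) t.assoc[of t.cc u_gen t.cc] t.C_closed by (simp add: cc t.mul_def)
 show "h1 u_gen = t.mul (sc m (t.mul t.cc (t.mul u_gen t.cc))) (t.mul t.cc (t.W t.g' (rev [K..<N - 2])))"
  unfolding f(10) N2 unfolding u[symmetric] w1(1)[symmetric] unfolding t.mul_def using nhomD(3)[OF q(1) gens(1)[OF n(1)] w1(2)] by simp
 show "h2 u_gen = t.mul (t.mul t.cc (t.W t.g (rev [1..<K + 1]))) (sc m (t.mul t.cc (t.mul u_gen t.cc)))"
  unfolding f(11) unfolding u[symmetric] w2(1)[symmetric] unfolding t.mul_def using nhomD(3)[OF q(1) w2(2) gens(1)[OF n(1)]] by simp
 show "h1 (e_gen K 1) = t.mul t.cc (t.E 1)" if "K >= 2"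
  using f(8)[of 1] q(6)[of 1] that KL by (simp add: cc t.mul_def t.E_def)
 show "h2 (e_gen L 1) = t.mul t.cc (t.E (K + 1))" if "L >= 2"
  using f(9)[of 1] q(6)[of "K + 1"] that KL by (simp add: cc t.mul_def t.E_def)
qed

text \<open>The two intertwining conditions of \<open>fusion_glob\<close> reduce by
  \<open>intertwine\<close> to \<open>u\<close> and \<open>e_1\<close> of each factor. For the first
  factor these are \<open>cup_u1\<close> and \<open>cup_left\<close>, for the second
  \<open>cup_u2\<close> and \<open>cup_right\<close>.\<close>

lemma fusion_globalize_left:
 assumes M: "lmod K M1" "lmod L M2"
 shows "miso N (fus (K + 2) (glo K M1) L M2) (glo (K + L) (fus K M1 L M2))"
proof -
 define P where "P = K + 2"
 have PL: "P + L = N" and P: "P >= 1" "P >= 2" by (simp_all add: P_def N)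
 note p = \<phi>_facts[OF KL(1), folded P_def] and b = \<epsilon>_facts[OF P(1) KL(2), unfolded PL]
 define X Y where "X = t.cup K" and "Y = t.cap K"
 have X: "X \<in> t.C" "Y \<in> t.C" "t.ca K \<in> t.C" unfolding X_def Y_def by (rule t.cup_closed[OF a])+
 have XY: "t.mul X Y = t.ca K" "t.mul Y X = t.cc" "t.mul (t.ca K) X = X" "t.mul t.cc Y = Y" "t.mul X t.cc = X"
  by (simp_all add: X_def Y_def t.cup_cap[OF a] t.cup_idem[OF a])
 have ci: "corner_idem m K = sc (inverse m) (e_gen P (int (K + 1)))" by (simp add: corner_idem_def P_def add.commute)
 have cor: "corner_idem m K \<in> CT P" unfolding ci by (rule carrier_sc[OF gens(2)[OF P(2)]])
 have ca: "f1 P L (corner_idem m K) = t.ca K"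
  unfolding ci b(3)[OF gens(2)[OF P(2)]] using b(8)[of "K + 1"] by (simp add: P_def t.ca_def[OF a] t.E_def)
 have fu: "f1 P L (\<phi> K u_gen) = sc m (t.mul (t.ca K) (t.mul (t.mul u_gen (t.W t.g' (rev [K + 2..<N]))) (t.ca K)))"
 proof -
  interpret S: ring "TL m P" by (rule ring_TL[OF P(1)])
  note uP = gens(1)[OF P(1)]
  have c: "tl_mult m P (corner_idem m K) u_gen \<in> CT P" using S.m_closed[OF cor uP] by simp
  have c': "tl_mult m P (tl_mult m P (corner_idem m K) u_gen) (corner_idem m K) \<in> CT P" using S.m_closed[OF c cor] by simp
  have fuC: "f1 P L u_gen \<in> t.C" by (rule nhomD(1)[OF b(1) uP])
  have "f1 P L (\<phi> K u_gen) = sc m (t.mul (t.mul (t.ca K) (f1 P L u_gen)) (t.ca K))"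
   unfolding p(5) b(3)[OF c'] using nhomD(3)[OF b(1) c cor] nhomD(3)[OF b(1) cor uP] ca by (simp add: t.mul_def)
  moreover have "f1 P L u_gen = t.mul u_gen (t.W t.g' (rev [K + 2..<N]))"
   using b(10) by (simp add: t.W_def t.mul_def t.g_elem_eq[abs_def] P_def)
  ultimately show ?thesis using X fuC by simp
 qed
 have X1: "f1 P L (\<phi> K r) **[TL m N] X = X **[TL m N] h1 r" if "r \<in> CT K" for r
  unfolding t.mult_TL
 proof (rule t.intertwine[OF KL(1) nhom_comp[OF p(1) b(1)] _ h_lin(1,3) X(1) _ _ _ _ that])
  show "f1 P L (\<phi> K (sc c x)) = sc c (f1 P L (\<phi> K x))" if "x \<in> CT K" for c x
   using that nhomD(1)[OF p(1) that] by (simp add: p(3) b(3))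
  show "t.mul (f1 P L (\<phi> K (cst 1))) X = X" "t.mul X (h1 (cst 1)) = X" by (simp_all only: p(2) ca h_lin XY)
  show "t.mul (f1 P L (\<phi> K u_gen)) X = t.mul X (h1 u_gen)" unfolding fu h_gens X_def by (rule t.cup_u1[OF a])
  assume K2: "K >= 2"
  have "f1 P L (\<phi> K (e_gen K 1)) = t.mul (t.ca K) (t.E 1)"
   using p(6)[of 1] b(8)[of 1] K2 nhomD(3)[OF b(1) cor gens(2)[OF P(2), of 1]] ca by (simp add: t.mul_def t.E_def P_def)
  moreover have "t.mul (t.E 1) X = t.mul X (t.E 1)" unfolding X_def by (rule t.cup_left[OF a]) (use K2 in auto)
  moreover have "t.mul (t.mul (t.ca K) (t.E 1)) X = t.mul (t.ca K) (t.mul (t.E 1) X)" "t.mul X (t.mul t.cc (t.E 1)) = t.mul (t.mul X t.cc) (t.E 1)"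
   "t.mul (t.ca K) (t.mul X (t.E 1)) = t.mul (t.mul (t.ca K) X) (t.E 1)"
   using X t.cc_closed t.C_closed by simp_all
  ultimately show "t.mul (f1 P L (\<phi> K (e_gen K 1))) X = t.mul X (h1 (e_gen K 1))" by (simp only: h_gens(3)[OF K2] XY)
 qed
 have X2: "f2 P L r **[TL m N] X = X **[TL m N] h2 r" if "r \<in> CT L" for r
  unfolding t.mult_TL
 proof (rule t.intertwine[OF KL(2) b(2) _ h_lin(2,4) X(1) _ _ _ _ that])
  show "f2 P L (sc c x) = sc c (f2 P L x)" if "x \<in> CT L" for c x by (rule b(4)[OF that])
  show "t.mul (f2 P L (cst 1)) X = X" using b(6)[of 1] X by (simp add: t.\<I>_def[symmetric])
  show "t.mul X (h2 (cst 1)) = X" by (simp only: h_lin XY)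
  \<comment> \<open>The enlarged first bundle has \<open>K + 2\<close> strands, so its crossings
    with the second translation run up to index \<open>K + 2\<close>, as in
    \<open>cup_u2\<close>.\<close>
  have "P + 1 = K + 3" by (simp add: P_def)
  hence "f2 P L u_gen = t.mul (t.W t.g (rev [1..<K + 3])) u_gen"
   using b(11) by (simp only: t.W_def t.mul_def t.g_elem_eq[abs_def])
  thus "t.mul (f2 P L u_gen) X = t.mul X (h2 u_gen)" unfolding h_gens X_def using t.cup_u2[OF a] by (simp only:)
  assume L2: "L >= 2"
  have "f2 P L (e_gen L 1) = t.E (K + 3)" using b(9)[of 1] L2 by (simp add: t.E_def P_def add.commute)
  moreover have "t.mul (t.E (K + 3)) X = t.mul X (t.E (K + 1))" unfolding X_def by (rule t.cup_right[OF a]) (use L2 in \<open>simp add: N\<close>)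
  moreover have "t.mul X (t.mul t.cc (t.E (K + 1))) = t.mul (t.mul X t.cc) (t.E (K + 1))"
   using X t.cc_closed t.C_closed by simp
  ultimately show "t.mul (f2 P L (e_gen L 1)) X = t.mul X (h2 (e_gen L 1))" by (simp only: h_gens(4)[OF L2] XY)
 qed
 note G1 = globalize[OF KL(1) M(1), folded P_def]
 note F = fusion[OF KL M]
 note T = fusion[OF P(1) KL(2) G1(4) M(2), unfolded PL]
 note G = globalize[OF n(1) F(3), folded N]
 note R = ring_TL[OF n(1)] ring_TL[OF t.N1] ring_TL[OF KL(1)] ring_TL[OF P(1)] ring_TL[OF KL(2)]
 let ?g1 = "corner_module.\<gamma> (TL m P) (TL m K) (\<phi> K) M1"
 let ?g = "corner_module.\<gamma> (TL m N) (TL m (K + L)) (\<phi> (K + L)) (fus K M1 L M2)"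
 have "fusion_glob (TL m (K + L)) (TL m N) (TL m K) (TL m P) (TL m L) (f1 K L) (f2 K L) (f1 P L) (f2 P L) (\<phi> K) (\<phi> (K + L)) X Y
  M1 M2 (glo K M1) ?g1 (fus K M1 L M2) (bet K L M1 M2)
  (fus P (glo K M1) L M2) (bet P L (glo K M1) M2)
  (glo (K + L) (fus K M1 L M2)) ?g"
 proof (rule fusion_glob.intro)
  show "f1 P L \<one>\<^bsub>TL m P\<^esub> = \<one>\<^bsub>TL m N\<^esub>" using b(5)[of 1] by simp
  show "f1 P L x **[TL m N] f2 P L y = f2 P L y **[TL m N] f1 P L x" if "x \<in> CT P" "y \<in> CT L" for x y
   using b(7)[OF that] by simp
  show "X **[TL m N] Y = f1 P L (\<phi> K \<one>\<^bsub>TL m K\<^esub>)" "Y **[TL m N] X = \<phi> (K + L) \<one>\<^bsub>TL m (K + L)\<^esub>"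
   "f1 P L (\<phi> K \<one>\<^bsub>TL m K\<^esub>) **[TL m N] X = X" "\<phi> (K + L) \<one>\<^bsub>TL m (K + L)\<^esub> **[TL m N] Y = Y"
   unfolding t.mult_TL TL_simps(2) p(2) q(2) ca cc by (rule XY)+
  show "glob_lift (TL m P) (TL m K) (\<phi> K) M1 (glo K M1) ?g1
   (pullback (TL m P) (f1 P L) (glo (K + L) (fus K M1 L M2)))"
   by (rule G1(2)[OF left_module_pullback[OF R(4) G(4) b(1)]])
  show "fus_lift (TL m (K + L)) (TL m K) (f1 K L) M1 (TL m L) (f2 K L) M2 (fus K M1 L M2) (bet K L M1 M2)
   (pullback (TL m (K + L)) (\<phi> (K + L)) (fus P (glo K M1) L M2))"
   by (rule F(2)[OF left_module_pullback[OF R(1) T(3) q(1)]])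
 qed (fact R f(1,2) b(1,2) p(1) q(1) X(1,2) X1 X2 M G1(1) F(1) T(1) T(2)[OF G(4)] G(1) G(2)[OF T(3)])+
 from fusion_glob.fusion_glob_iso[OF this] show ?thesis unfolding P_def .
qed

text \<open>\<open>fusion_glob\<close> globalizes its first argument, so it is applied with the two
  factors exchanged. Both idempotents are \<open>cc\<close>, which therefore serves as
  \<open>X\<close> and as \<open>Y\<close>; intertwining still involves crossings and is supplied by
  \<open>end_u1\<close> and \<open>end_u2\<close>.\<close>

lemma fusion_globalize_right:
 assumes M: "lmod K M1" "lmod L M2"
 shows "miso N (fus K M1 (L + 2) (glo L M2)) (glo (K + L) (fus K M1 L M2))"
proof -
 define P where "P = L + 2"
 have PL: "K + P = N" and P: "P >= 1" "P >= 2" by (simp_all add: P_def N)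
 note p = \<phi>_facts[OF KL(2), folded P_def] and b = \<epsilon>_facts[OF KL(1) P(1), unfolded PL]
 note X = t.cc_closed
 have El: "t.E \<in> t.letters" by (simp add: t.letters_def)
 have ci: "corner_idem m L = sc (inverse m) (e_gen P (int (L + 1)))" by (simp add: corner_idem_def P_def add.commute)
 have cor: "corner_idem m L \<in> CT P" unfolding ci by (rule carrier_sc[OF gens(2)[OF P(2)]])
 have ca: "f2 K P (corner_idem m L) = t.cc"
 proof -
  have "L + 1 \<in> {1..<P}" "K + (L + 1) = N - 1" by (simp_all add: P_def N)
  thus ?thesis unfolding ci b(4)[OF gens(2)[OF P(2)]] t.cc_def t.E_def by (simp only: b(9))
 qed
 have fu: "f2 K P (\<phi> L u_gen) = sc m (t.mul t.cc (t.mul (t.mul (t.W t.g (rev [1..<K + 1])) u_gen) t.cc))"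
 proof -
  interpret S: ring "TL m P" by (rule ring_TL[OF P(1)])
  note uP = gens(1)[OF P(1)]
  have c: "tl_mult m P (corner_idem m L) u_gen \<in> CT P" using S.m_closed[OF cor uP] by simp
  have c': "tl_mult m P (tl_mult m P (corner_idem m L) u_gen) (corner_idem m L) \<in> CT P" using S.m_closed[OF c cor] by simp
  have fuC: "f2 K P u_gen \<in> t.C" by (rule nhomD(1)[OF b(2) uP])
  have "f2 K P (\<phi> L u_gen) = sc m (t.mul (t.mul t.cc (f2 K P u_gen)) t.cc)"
   unfolding p(5) b(4)[OF c'] using nhomD(3)[OF b(2) c cor] nhomD(3)[OF b(2) cor uP] ca by (simp add: t.mul_def)
  moreover have "f2 K P u_gen = t.mul (t.W t.g (rev [1..<K + 1])) u_gen"
   using b(11) by (simp add: t.W_def t.mul_def t.g_elem_eq[abs_def])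
  ultimately show ?thesis using X fuC by simp
 qed
 have X1: "f2 K P (\<phi> L r) **[TL m N] t.cc = t.cc **[TL m N] h2 r" if "r \<in> CT L" for r
  unfolding t.mult_TL
 proof (rule t.intertwine[OF KL(2) nhom_comp[OF p(1) b(2)] _ h_lin(2,4) X _ _ _ _ that])
  show "f2 K P (\<phi> L (sc c x)) = sc c (f2 K P (\<phi> L x))" if "x \<in> CT L" for c x
   using that nhomD(1)[OF p(1) that] by (simp add: p(3) b(4))
  show "t.mul (f2 K P (\<phi> L (cst 1))) t.cc = t.cc" "t.mul t.cc (h2 (cst 1)) = t.cc" by (simp_all only: p(2) ca h_lin t.cc_idem)
  show "t.mul (f2 K P (\<phi> L u_gen)) t.cc = t.mul t.cc (h2 u_gen)" unfolding fu h_gens by (rule t.end_u2[OF a])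
  assume L2: "L >= 2"
  have fe: "f2 K P (\<phi> L (e_gen L 1)) = t.mul t.cc (t.E (K + 1))"
   using p(6)[of 1] b(9)[of 1] L2 nhomD(3)[OF b(2) cor gens(2)[OF P(2), of 1]] ca by (simp add: t.mul_def t.E_def P_def)
  have "t.mul t.cc (t.W t.E [K + 1]) = t.mul (t.W t.E [K + 1]) t.cc"
   by (rule t.cc_W[OF El]) (use L2 N in simp)
  hence Ecc: "t.mul (t.E (K + 1)) t.cc = t.mul t.cc (t.E (K + 1))" by (simp add: t.C_closed(8))
  show "t.mul (f2 K P (\<phi> L (e_gen L 1))) t.cc = t.mul t.cc (h2 (e_gen L 1))"
   unfolding fe h_gens(4)[OF L2] t.assoc[OF X t.C_closed(8) X] Ecc ..
 qed
 have X2: "f1 K P r **[TL m N] t.cc = t.cc **[TL m N] h1 r" if "r \<in> CT K" for r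
  unfolding t.mult_TL
 proof (rule t.intertwine[OF KL(1) b(1) _ h_lin(1,3) X _ _ _ _ that])
  show "f1 K P (sc c x) = sc c (f1 K P x)" if "x \<in> CT K" for c x by (rule b(3)[OF that])
  show "t.mul (f1 K P (cst 1)) t.cc = t.cc" using b(5)[of 1] X by (simp add: t.\<I>_def[symmetric])
  show "t.mul t.cc (h1 (cst 1)) = t.cc" by (simp only: h_lin t.cc_idem)
  have "f1 K P u_gen = t.mul u_gen (t.W t.g' (rev [K..<N]))"
   using b(10) by (simp add: t.W_def t.mul_def t.g_elem_eq[abs_def])
  thus "t.mul (f1 K P u_gen) t.cc = t.mul t.cc (h1 u_gen)" unfolding h_gens using t.end_u1[OF a] by (simp only:)
  assume K2: "K >= 2"
  have fe: "f1 K P (e_gen K 1) = t.E 1" using b(8)[of 1] K2 by (simp add: t.E_def)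
  have "t.mul t.cc (t.W t.E [1]) = t.mul (t.W t.E [1]) t.cc"
   by (rule t.cc_W[OF El]) (use K2 KL N in simp)
  hence "t.mul (t.E 1) t.cc = t.mul t.cc (t.E 1)" by (simp add: t.C_closed(8))
  thus "t.mul (f1 K P (e_gen K 1)) t.cc = t.mul t.cc (h1 (e_gen K 1))"
   unfolding fe h_gens(3)[OF K2] t.cc_idem(2)[OF t.C_closed(8)] .
 qed
 note G1 = globalize[OF KL(2) M(2), folded P_def]
 note F = fusion[OF KL M]
 note T = fusion[OF KL(1) P(1) M(1) G1(4), unfolded PL]
 note G = globalize[OF n(1) F(3), folded N]
 note R = ring_TL[OF n(1)] ring_TL[OF t.N1] ring_TL[OF KL(1)] ring_TL[OF P(1)] ring_TL[OF KL(2)]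
 let ?g1 = "corner_module.\<gamma> (TL m P) (TL m L) (\<phi> L) M2"
 let ?g = "corner_module.\<gamma> (TL m N) (TL m (K + L)) (\<phi> (K + L)) (fus K M1 L M2)"
 have "fusion_glob (TL m (K + L)) (TL m N) (TL m L) (TL m P) (TL m K) (f2 K L) (f1 K L) (f2 K P) (f1 K P) (\<phi> L) (\<phi> (K + L)) t.cc t.cc
  M2 M1 (glo L M2) ?g1 (fus K M1 L M2) (\<lambda>b a. bet K L M1 M2 a b)
  (fus K M1 P (glo L M2)) (\<lambda>b a. bet K P M1 (glo L M2) a b)
  (glo (K + L) (fus K M1 L M2)) ?g"
 proof (rule fusion_glob.intro)
  show "f2 K P \<one>\<^bsub>TL m P\<^esub> = \<one>\<^bsub>TL m N\<^esub>" using b(6)[of 1] by simp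
  show "f2 K P x **[TL m N] f1 K P y = f1 K P y **[TL m N] f2 K P x" if "x \<in> CT P" "y \<in> CT K" for x y
   using b(7)[OF that(2,1)] by simp
  show "t.cc **[TL m N] t.cc = f2 K P (\<phi> L \<one>\<^bsub>TL m L\<^esub>)" "t.cc **[TL m N] t.cc = \<phi> (K + L) \<one>\<^bsub>TL m (K + L)\<^esub>"
   "f2 K P (\<phi> L \<one>\<^bsub>TL m L\<^esub>) **[TL m N] t.cc = t.cc" "\<phi> (K + L) \<one>\<^bsub>TL m (K + L)\<^esub> **[TL m N] t.cc = t.cc"
   unfolding t.mult_TL TL_simps(2) p(2) q(2) ca cc by (rule t.cc_idem)+
  show "glob_lift (TL m P) (TL m L) (\<phi> L) M2 (glo L M2) ?g1
   (pullback (TL m P) (f2 K P) (glo (K + L) (fus K M1 L M2)))"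
   by (rule G1(2)[OF left_module_pullback[OF R(4) G(4) b(2)]])
  show "fus_lift (TL m (K + L)) (TL m L) (f2 K L) M2 (TL m K) (f1 K L) M1 (fus K M1 L M2) (\<lambda>b a. bet K L M1 M2 a b)
   (pullback (TL m (K + L)) (\<phi> (K + L)) (fus K M1 P (glo L M2)))"
   by (rule fus_lift_swap[OF F(2)[OF left_module_pullback[OF R(1) T(3) q(1)]]])
 qed (fact R f(1,2) b(1,2) p(1) q(1) X X1 X2 M G1(1) fus_mod_swap[OF F(1)] fus_mod_swap[OF T(1)] fus_lift_swap[OF T(2)[OF G(4)]] G(1) G(2)[OF T(3)])+
 from fusion_glob.fusion_glob_iso[OF this] show ?thesis unfolding P_def .
qed

end

section \<open>The direct limit\<close>

context fusion_setup begin

lemma TL_ModD: "M \<in> TL_Mod m K ==> lmod K M"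
 by (simp add: TL_Mod_def)

lemma ig_TL_Mod: "ig K M L P ==> P \<in> TL_Mod m L \<and> K <= L"
 by (induction rule: iterated_glob.induct) auto

lemma ig_iso:
 assumes "ig K M L P" "miso L P P'" "P' \<in> TL_Mod m L"
 shows "ig K M L P'"
 using assms
proof (cases rule: iterated_glob.cases)
 case base
 have "ig K M K P'" by (rule iterated_glob.base[OF _ module_iso_trans[OF base(3)]]) (use assms(2,3) base(1) in auto)
 thus ?thesis by (simp only: base(1))
next
 case (step L0 P0)
 thus ?thesis using assms iterated_glob.step[OF step(2) _ module_iso_trans[OF step(4)]] by auto
qed

lemma ig_trans:
 assumes "ig L P L' Q" "ig K M L P"
 shows "ig K M L' Q"
 using assms(1)
proof (induction rule: iterated_glob.induct)
 case (base Q)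
 thus ?case using ig_iso[OF assms(2)] by auto
qed (rule iterated_glob.step)

lemma ig_refl: "M \<in> TL_Mod m K ==> ig K M K M"
 by (rule iterated_glob.base[OF _ module_iso_refl])

lemma ig_extend:
 assumes K: "K >= 1" and P: "P \<in> TL_Mod m K"
 shows "\<exists>Q. ig K P (K + 2 * k) Q"
proof (induction k)
 case 0
 thus ?case using ig_refl[OF P] by auto
next
 case (Suc k)
 then obtain Q where Q: "ig K P (K + 2 * k) Q" by blast
 have "glo (K + 2 * k) Q \<in> TL_Mod m (K + 2 * k + 2)"
  by (rule globalize_TL_Mod) (use ig_TL_Mod[OF Q] K in auto)
 from std_vec_representative[OF this] obtain R :: "(tl_elem, std_vec) module"
  where "R \<in> TL_Mod m (K + 2 * k + 2)" "miso (K + 2 * k + 2) (glo (K + 2 * k) Q) R" by blast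
 from iterated_glob.step[OF Q this] show ?case by (intro exI[of _ R]) (simp add: add.commute)
qed

text \<open>Every step of \<open>iterated_glob\<close> leaves its result free up to isomorphism;
  functoriality of globalization on isomorphisms keeps two such chains isomorphic level by
  level.\<close>

lemma ig_unique:
 assumes K: "K >= 1" and "ig K M L P" "ig K M L P'" and M: "lmod K M"
 shows "miso L P P'"
 using assms(2,3)
proof (induction arbitrary: P' rule: iterated_glob.induct)
 case (base P)
 from base(3) show ?case
 proof (cases rule: iterated_glob.cases)
  case base
  thus ?thesis using module_iso_trans[OF module_iso_sym[OF M \<open>miso K M P\<close>]] by blast
 next
  case (step L0 P0)
  thus ?thesis using ig_TL_Mod[OF step(2)] by simp
 qed
next
 case (step L P Q)
 note hyp = step
 from step(5) show ?case
 proof (cases rule: iterated_glob.cases)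
  case base
  thus ?thesis using ig_TL_Mod[OF hyp(1)] by simp
 next
  case (step L0 P0)
  have L0: "L0 = L" using step by simp
  have L: "L >= 1" using ig_TL_Mod[OF hyp(1)] K by simp
  have P: "lmod L P" "lmod L P0"
   using ig_TL_Mod[OF hyp(1)] ig_TL_Mod[OF step(2)] L0 by (auto dest: TL_ModD)
  have "miso L P P0" using hyp(4) step(2) L0 by simp
  from globalize_cong[OF L P this]
  have "miso (L + 2) (glo L P) P'" using step(4) L0 module_iso_trans by auto
  thus ?thesis by (rule module_iso_trans[OF module_iso_sym[OF globalize(4)[OF L P(1)] hyp(3)]])
 qed
qed

text \<open>The two chains are descended in parallel, each globalization step being undone by
  \<open>globalize_reflect\<close>. Comparison of levels rules out chains of different
  length.\<close>

lemma ig_reflect: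
 assumes K: "K >= 1" and "ig K M L P" "ig K M' L P'" "miso L P P'"
  and M: "lmod K M" "lmod K M'"
 shows "miso K M M'"
 using assms(2-4)
proof (induction arbitrary: P' rule: iterated_glob.induct)
 case (base P)
 from base(3) show ?case
 proof (cases rule: iterated_glob.cases)
  case base
  thus ?thesis
   using module_iso_trans[OF module_iso_trans[OF \<open>miso K M P\<close> \<open>miso K P P'\<close>] module_iso_sym[OF M(2)]] by blast
 next
  case (step L0 P0)
  thus ?thesis using ig_TL_Mod[OF step(2)] by simp
 qed
next
 case (step L P Q)
 note hyp = step
 from step(5) show ?case
 proof (cases rule: iterated_glob.cases)
  case base
  thus ?thesis using ig_TL_Mod[OF hyp(1)] by simp
 next
  case (step L0 P0)
  have L0: "L0 = L" using step by simp
  have L: "L >= 1" using ig_TL_Mod[OF hyp(1)] K by simp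
  have P: "lmod L P" "lmod L P0"
   using ig_TL_Mod[OF hyp(1)] ig_TL_Mod[OF step(2)] L0 by (auto dest: TL_ModD)
  have "miso (L + 2) (glo L P0) P'" using step L0 by simp
  from module_iso_trans[OF module_iso_trans[OF hyp(3,6)] module_iso_sym[OF globalize(4)[OF L P(2)] this]]
  have "miso L P P0" by (rule globalize_reflect[OF L P])
  thus ?thesis using hyp(4) step(2) L0 by simp
 qed
qed

lemma level_modulesI: "K >= 1 ==> M \<in> TL_Mod m K ==> (K, M) \<in> level_modules m"
 by (simp add: level_modules_def)

text \<open>Equivalence with a common module may be witnessed at two different levels. Their
  difference is even, so both can be pushed to the maximum, where uniqueness of the iterated
  globalization of \<open>M0\<close> identifies the results.\<close>

lemma common_level:
 assumes "ig K0 M0 L Z" "ig K P L Z" "ig K0 M0 L' Z'" "ig K' P' L' Z'"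
  and K0: "K0 >= 1" "M0 \<in> TL_Mod m K0"
 shows "\<exists>D Q. ig K P D Q \<and> ig K' P' D Q"
proof -
 have par: "even L \<longleftrightarrow> even K0" if "ig K0 M0 L Z" for L Z
  using that by (induction rule: iterated_glob.induct) auto
 have Z: "L >= 1" "Z \<in> TL_Mod m L" "L' >= 1" "Z' \<in> TL_Mod m L'"
  using ig_TL_Mod[OF assms(1)] ig_TL_Mod[OF assms(3)] K0 by auto
 define D where "D = max L L'"
 have "even (D - L)" "even (D - L')" using par[OF assms(1)] par[OF assms(3)] by (auto simp: D_def max_def)
 then obtain i j where ij: "D = L + 2 * i" "D = L' + 2 * j"
  by (metis D_def dvd_def le_add_diff_inverse max.cobounded1 max.cobounded2)
 obtain Y where Y: "ig L Z D Y" using ig_extend[OF Z(1,2), of i] ij by auto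
 obtain Y' where Y': "ig L' Z' D Y'" using ig_extend[OF Z(3,4), of j] ij by auto
 have "miso D Y' Y"
  by (rule ig_unique[OF K0(1) ig_trans[OF Y' assms(3)] ig_trans[OF Y assms(1)] TL_ModD[OF K0(2)]])
 from ig_iso[OF ig_trans[OF Y' assms(4)] this]
 have "ig K' P' D Y" using ig_TL_Mod[OF Y] by simp
 thus ?thesis using ig_trans[OF Y assms(2)] by blast
qed

text \<open>Here \<Phi> stands for fusion with one argument held fixed at level \<open>L\<close>.
  Abstracting it lets the same induction treat both arguments, given that \<Phi> commutes with a
  single globalization.\<close>

lemma ig_transfer:
 fixes \<Phi> :: "nat => (tl_elem, std_vec) module => (tl_elem, 'x) module"
 assumes K: "K >= 1" and "ig K P D Q"
  and mod: "!!D Q. D >= 1 ==> lmod D Q ==> lmod (D + L) (\<Phi> D Q)"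
  and cong: "!!Q. Q \<in> TL_Mod m K ==> miso K P Q ==> miso (K + L) (\<Phi> K Q) (\<Phi> K P)"
  and step: "!!D Q Q'. D >= 1 ==> lmod D Q ==> lmod (D + 2) Q' ==> miso (D + 2) (glo D Q) Q' ==>
   miso (D + L + 2) (\<Phi> (D + 2) Q') (glo (D + L) (\<Phi> D Q))"
  and F: "ig n F (K + L) F'" "miso (K + L) (\<Phi> K P) F'"
 shows "\<exists>R. ig n F (D + L) R \<and> miso (D + L) (\<Phi> D Q) R"
 using assms(2)
proof (induction rule: iterated_glob.induct)
 case (base Q)
 thus ?case using F cong module_iso_trans by blast
next
 case (step D Q Q')
 then obtain R where R: "ig n F (D + L) R" "miso (D + L) (\<Phi> D Q) R" by blast
 have D: "D >= 1" "D + L >= 1" and Q: "lmod D Q" using ig_TL_Mod[OF step(1)] K by (auto dest: TL_ModD)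
 note Rm = ig_TL_Mod[OF R(1), THEN conjunct1]
 obtain R' :: "(tl_elem, std_vec) module" where R': "R' \<in> TL_Mod m (D + L + 2)" "miso (D + L + 2) (glo (D + L) R) R'"
  using std_vec_representative[OF globalize_TL_Mod[OF D(2) Rm]] by blast
 have e: "D + 2 + L = D + L + 2" by simp
 have "miso (D + L + 2) (\<Phi> (D + 2) Q') R'"
  by (rule module_iso_trans[OF assms(5)[OF D(1) Q TL_ModD[OF step(2)] step(3)]
   module_iso_trans[OF globalize_cong[OF D(2) mod[OF D(1) Q] TL_ModD[OF Rm] R(2)] R'(2)]])
 thus ?case using iterated_glob.step[OF R(1) R'] unfolding e by blast
qed

text \<open>The arguments are globalized one after the other, the second while the first is already
  at its final level \<open>D\<close>.\<close>

lemma ig_fusion: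
 assumes K: "K >= 1" "L >= 1" and P: "P \<in> TL_Mod m K" "P' \<in> TL_Mod m L"
  and Q: "ig K P D Q" "ig L P' D' Q'"
  and F: "F \<in> TL_Mod m (K + L)" "miso (K + L) (fus K P L P') F"
 shows "\<exists>R. ig (K + L) F (D + D') R \<and> miso (D + D') (fus D Q D' Q') R"
proof -
 note P1 = TL_ModD[OF P(1)] and P2 = TL_ModD[OF P(2)]
 have pair: "fusion_pair m \<phi> s \<epsilon> a b (a + b + 2)" if "a >= 1" "b >= 1" for a b
  by (intro fusion_pair.intro fusion_setup_axioms fusion_pair_axioms.intro that refl)
 have "\<exists>R. ig (K + L) F (D + L) R \<and> miso (D + L) (fus D Q L P') R"
 proof (rule ig_transfer[where \<Phi> = "\<lambda>a V. fus a V L P'", OF K(1) Q(1) _ _ _ ig_refl[OF F(1)] F(2)])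
  show "miso (K + L) (fus K V L P') (fus K P L P')" if "V \<in> TL_Mod m K" "miso K P V" for V
   by (rule fusion_cong[OF K TL_ModD[OF that(1)] P2 P1 P2 module_iso_sym[OF P1 that(2)] module_iso_refl])
  fix a :: nat and V V' :: "(tl_elem, std_vec) module"
  assume a: "a >= 1" and V: "lmod a V"
  show "lmod (a + L) (fus a V L P')" by (rule fusion(3)[OF a K(2) V P2])
  assume V': "lmod (a + 2) V'" "miso (a + 2) (glo a V) V'"
  note G = globalize(4)[OF a V]
  have a2: "a + 2 >= 1" "a + 2 + L = a + L + 2" by simp_all
  show "miso (a + L + 2) (fus (a + 2) V' L P') (glo (a + L) (fus a V L P'))"
   by (rule module_iso_trans[OF fusion_cong[OF a2(1) K(2) V'(1) P2 G P2 module_iso_sym[OF G V'(2)] module_iso_refl, unfolded a2(2)]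
    fusion_pair.fusion_globalize_left[OF pair[OF a K(2)] V P2]])
 qed
 then obtain R where R: "ig (K + L) F (L + D) R" "miso (L + D) (fus D Q L P') R" by (auto simp: add.commute)
 have D: "D >= 1" "lmod D Q" using ig_TL_Mod[OF Q(1)] K by (auto dest: TL_ModD)
 have "\<exists>R. ig (K + L) F (D' + D) R \<and> miso (D' + D) (fus D Q D' Q') R"
 proof (rule ig_transfer[where \<Phi> = "\<lambda>a V. fus D Q a V", OF K(2) Q(2) _ _ _ R])
  show "miso (L + D) (fus D Q L V) (fus D Q L P')" if "V \<in> TL_Mod m L" "miso L P' V" for V
   by (rule fusion_cong[OF D(1) K(2) D(2) TL_ModD[OF that(1)] D(2) P2 module_iso_refl module_iso_sym[OF P2 that(2)], unfolded add.commute[of D]])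
  fix a :: nat and V V' :: "(tl_elem, std_vec) module"
  assume a: "a >= 1" and V: "lmod a V"
  show "lmod (a + D) (fus D Q a V)" using fusion(3)[OF D(1) a D(2) V] by (simp only: add.commute)
  assume V': "lmod (a + 2) V'" "miso (a + 2) (glo a V) V'"
  note G = globalize(4)[OF a V]
  have a2: "a + 2 >= 1" "D + (a + 2) = D + a + 2" by simp_all
  show "miso (a + D + 2) (fus D Q (a + 2) V') (glo (a + D) (fus D Q a V))"
   unfolding add.commute[of a D]
   by (rule module_iso_trans[OF fusion_cong[OF D(1) a2(1) D(2) V'(1) D(2) G module_iso_refl module_iso_sym[OF G V'(2)], unfolded a2(2)]
    fusion_pair.fusion_globalize_right[OF pair[OF D(1) a] D(2) V]])
 qed
 thus ?thesis by (simp only: add.commute)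
qed

lemma representatives:
 assumes X: "X \<in> C_infinity m \<phi>" and K: "K >= 1" "K' >= 1" and par: "even K \<longleftrightarrow> even K'"
  and r: "represents m X K A" "represents m X K' A'"
 shows "\<exists>P P' D Q. P \<in> TL_Mod m K \<and> P' \<in> TL_Mod m K' \<and> miso K P A \<and> module_iso (TL m K') P' A' \<and>
  ig K P D Q \<and> ig K' P' D Q"
proof -
 define c where "c = (if odd K then fst X else snd X)"
 obtain P where P: "(K, P) \<in> c" "miso K P A" using r(1) by (auto simp: represents_def c_def)
 obtain P' where P': "(K', P') \<in> c" "module_iso (TL m K') P' A'" using r(2) par by (auto simp: represents_def c_def)
 have "\<exists>x\<in>level_modules m. c = limit_rel m \<phi> `` {x}"
  using X by (auto simp: C_infinity_def odd_limit_def even_limit_def c_def quotient_def)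
 then obtain K0 M0 where M0: "(K0, M0) \<in> level_modules m" "c = limit_rel m \<phi> `` {(K0, M0)}" by auto
 have "((K0, M0), (K, P)) \<in> limit_rel m \<phi>" "((K0, M0), (K', P')) \<in> limit_rel m \<phi>" using P(1) P'(1) M0(2) by auto
 then obtain L Z L' Z' where Z: "ig K0 M0 L Z" "ig K P L Z"
   "ig K0 M0 L' Z'" "ig K' P' L' Z'" and m: "P \<in> TL_Mod m K" "P' \<in> TL_Mod m K'"
  by (auto simp: limit_rel_def level_modules_def)
 have "K0 >= 1" "M0 \<in> TL_Mod m K0" using M0(1) by (auto simp: level_modules_def)
 from common_level[OF Z this] m P(2) P'(2) show ?thesis by blast
qed

text \<open>Common globalizations of the arguments at levels \<open>D\<close> and \<open>E\<close>
  show that both fusions globalize to the same module at level \<open>D + E\<close>. If they start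
  at the same level, \<open>ig_reflect\<close> descends from there to an isomorphism.\<close>

theorem fusion_limit:
 assumes X: "X \<in> C_infinity m \<phi>" "Y \<in> C_infinity m \<phi>"
  and K: "K >= 1" "K' >= 1" "even K \<longleftrightarrow> even K'" and L: "L >= 1" "L' >= 1" "even L \<longleftrightarrow> even L'"
  and A: "represents m X K A" "represents m X K' A'" and B: "represents m Y L B" "represents m Y L' B'"
 shows "\<exists>Z\<in>C_infinity m \<phi>. represents m Z (K + L) (fus K A L B) \<and> represents m Z (K' + L') (fus K' A' L' B')"
  and "K + L = K' + L' ==> miso (K + L) (fus K A L B) (fus K' A' L' B')"
proof -
 obtain P P' D Q where P: "P \<in> TL_Mod m K" "P' \<in> TL_Mod m K'" "miso K P A" "module_iso (TL m K') P' A'"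
  and Q: "ig K P D Q" "ig K' P' D Q"
  using representatives[OF X(1) K A] by blast
 obtain S S' E T where S: "S \<in> TL_Mod m L" "S' \<in> TL_Mod m L'" "miso L S B" "module_iso (TL m L') S' B'"
  and T: "ig L S E T" "ig L' S' E T"
  using representatives[OF X(2) L B] by blast
 have M: "A \<in> TL_Mod m K" "A' \<in> TL_Mod m K'" "B \<in> TL_Mod m L" "B' \<in> TL_Mod m L'"
  using A B by (simp_all add: represents_def)
 have FM: "fus K A L B \<in> TL_Mod m (K + L)" "fus K' A' L' B' \<in> TL_Mod m (K' + L')"
  using fusion_TL_Mod K L M by auto
 obtain F :: "(tl_elem, std_vec) module" where F: "F \<in> TL_Mod m (K + L)" "miso (K + L) (fus K A L B) F"
  using std_vec_representative[OF FM(1)] by blast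
 obtain F' :: "(tl_elem, std_vec) module" where F': "F' \<in> TL_Mod m (K' + L')" "miso (K' + L') (fus K' A' L' B') F'"
  using std_vec_representative[OF FM(2)] by blast
 have "miso (K + L) (fus K P L S) F"
  by (rule module_iso_trans[OF fusion_cong[OF K(1) L(1) TL_ModD[OF P(1)] TL_ModD[OF S(1)] TL_ModD[OF M(1)] TL_ModD[OF M(3)] P(3) S(3)] F(2)])
 from ig_fusion[OF K(1) L(1) P(1) S(1) Q(1) T(1) F(1) this]
 obtain R where R: "ig (K + L) F (D + E) R" "miso (D + E) (fus D Q E T) R" by blast
 have "miso (K' + L') (fus K' P' L' S') F'"
  by (rule module_iso_trans[OF fusion_cong[OF K(2) L(2) TL_ModD[OF P(2)] TL_ModD[OF S(2)] TL_ModD[OF M(2)] TL_ModD[OF M(4)] P(4) S(4)] F'(2)])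
 from ig_fusion[OF K(2) L(2) P(2) S(2) Q(2) T(2) F'(1) this]
 obtain R' where R': "ig (K' + L') F' (D + E) R'" "miso (D + E) (fus D Q E T) R'" by blast
 have DE: "D >= 1" "E >= 1" "lmod D Q" "lmod E T"
  using ig_TL_Mod[OF Q(1)] ig_TL_Mod[OF T(1)] K L by (auto dest: TL_ModD)
 have RR: "miso (D + E) R' R"
  by (rule module_iso_trans[OF module_iso_sym[OF fusion(3)[OF DE] R'(2)] R(2)])
 have R'': "ig (K' + L') F' (D + E) R"
  by (rule ig_iso[OF R'(1) RR]) (use ig_TL_Mod[OF R(1)] in simp)
 define c where "c = limit_rel m \<phi> `` {(K + L, F)}"
 have lv: "(K + L, F) \<in> level_modules m" "(K' + L', F') \<in> level_modules m" using F(1) F'(1) K L by (auto intro!: level_modulesI)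
 have c: "(K + L, F) \<in> c" "(K' + L', F') \<in> c" using R(1) R'' lv by (auto simp: c_def limit_rel_def)
 have par: "odd (K' + L') \<longleftrightarrow> odd (K + L)" using K(3) L(3) by simp
 have iso: "miso (K + L) F (fus K A L B)" "miso (K' + L') F' (fus K' A' L' B')"
  using module_iso_sym[OF TL_ModD[OF FM(1)] F(2)] module_iso_sym[OF TL_ModD[OF FM(2)] F'(2)] by auto
 \<comment> \<open>The class of the fusion is placed in the component selected by the parity of its
   level; the other component is supplied by \<open>X\<close>.\<close>
 define Z where "Z = (if odd (K + L) then (c, snd X) else (fst X, c))"
 have "Z \<in> C_infinity m \<phi>"
  using X(1) lv(1) by (auto simp: Z_def c_def C_infinity_def odd_limit_def even_limit_def intro!: quotientI)
 moreover have "represents m Z (K + L) (fus K A L B)"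
  unfolding represents_def using FM(1) c(1) iso(1) by (auto simp: Z_def)
 moreover have "represents m Z (K' + L') (fus K' A' L' B')"
  unfolding represents_def par using FM(2) c(2) iso(2) by (auto simp: Z_def)
 ultimately show "\<exists>Z\<in>C_infinity m \<phi>. represents m Z (K + L) (fus K A L B) \<and> represents m Z (K' + L') (fus K' A' L' B')"
  by blast
 show "miso (K + L) (fus K A L B) (fus K' A' L' B')" if e: "K + L = K' + L'"
 proof -
  have "miso (K + L) F F'"
   by (rule ig_reflect[OF _ R(1) R''[folded e] module_iso_refl TL_ModD[OF F(1)] TL_ModD[OF F'(1)[folded e]]]) (use K in simp)
  thus ?thesis using module_iso_trans[OF F(2) module_iso_trans[OF _ iso(2)[folded e]]] by blast
 qed
qed

end

theorem proposition6p7p1: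
  fixes q s m :: complex
    and \<epsilon> :: "nat \<Rightarrow> nat \<Rightarrow> tl2_elem \<Rightarrow> tl_elem"
    and \<phi> :: "nat \<Rightarrow> tl_elem \<Rightarrow> tl_elem"
    and M1 M2 :: "level_module set \<times> level_module set"
    and N1 N1' N2 N2' :: nat
    and n k :: int
    and A :: "(tl_elem, 'a) module" and A' :: "(tl_elem, 'b) module"
    and B :: "(tl_elem, 'c) module" and B' :: "(tl_elem, 'd) module"
  assumes "q \<noteq> 0" and "s ^ 2 = q" and "m = q + inverse q" and "m \<noteq> 0"
    and "\<And>K L. K \<ge> 1 \<Longrightarrow> L \<ge> 1 \<Longrightarrow> fusion_map m s K L (\<epsilon> K L)"
    and "\<And>K. K \<ge> 1 \<Longrightarrow> corner_iso m K (\<phi> K)"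
    and "M1 \<in> C_infinity m \<phi>" and "M2 \<in> C_infinity m \<phi>"
    and "N1 \<ge> 1" and "N1' \<ge> 1" and "int N1' = int N1 + 2 * n"
    and "N2 \<ge> 1" and "N2' \<ge> 1" and "int N2' = int N2 + 2 * k"
    and "represents m M1 N1 A" and "represents m M1 N1' A'"
    and "represents m M2 N2 B" and "represents m M2 N2' B'"
  shows "(\<exists>Z\<in>C_infinity m \<phi>.
            represents m Z (N1 + N2) (fusion m \<epsilon> N1 A N2 B) \<and>
            represents m Z (N1' + N2') (fusion m \<epsilon> N1' A' N2' B')) \<and>
         (k = - n \<longrightarrow>
            module_iso (TL m (N1 + N2)) (fusion m \<epsilon> N1 A N2 B) (fusion m \<epsilon> N1' A' N2' B'))"
proof -
 interpret fusion_setup m \<phi> s \<epsilon>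
  by (intro fusion_setup.intro tl_corners.intro fusion_setup_axioms.intro) (use assms(1-6) in auto)
 \<comment> \<open>Levels of representatives of one object differ by an even number, so both lie in
   the same component of the direct sum.\<close>
 have "even (int N1') \<longleftrightarrow> even (int N1)" "even (int N2') \<longleftrightarrow> even (int N2)" unfolding assms(11,14) by simp_all
 hence par: "even N1 \<longleftrightarrow> even N1'" "even N2 \<longleftrightarrow> even N2'" by simp_all
 note L = fusion_limit[OF assms(7,8,9,10) par(1) assms(12,13) par(2) assms(15-18)]
 have "N1 + N2 = N1' + N2'" if "k = - n" using that assms(11,14) by linarith
 thus ?thesis using L by blast
qed

end
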